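(* Assume the standing assumptions and condition (B), with the $B_\ell$ defined for $y_0$ in an open set containing the ball $B_R=B(x_0,R)$, $0<R\le1$, and assume $[\delta]_1<\infty$ and $[\delta]_{1+\rho}<\infty$ for some $\rho>0$. Let $u_\varepsilon$ be a weak solution of $-\mathrm{div}(A^\varepsilon\nabla u_\varepsilon)=f$ in $B_R$ with $f\in L^p(B_R)$, $p>d$. Suppose there is $N\ge1$ such that $$\Big(\frac{\varepsilon_{k+1}}{\varepsilon_k}\Big)^N\le\frac{\varepsilon_{i+1}}{\varepsilon_i}\quad\text{for all }k>i\ge0.$$ Then there is $\nu>0$, depending only on $d,\mu,p,\rho,N,[\delta]_0,[\delta]_1$, such that if $\varepsilon_1\le\nu$ then $$\|\nabla u_\varepsilon\|_{L^\infty(B_{R/2})}\le C\Big\{\Big(\fint_{B_R}|\nabla u_\varepsilon|^2\Big)^{1/2}+R\Big(\fint_{B_R}|f|^p\Big)^{1/p}\Big\},$$ where $B_{R/2}=B(x_0,R/2)$ and $C$ depends only on $d,\mu,p,[\delta]_0,\rho,[\delta]_{1+\rho}$.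
   Context: Setting. For each integer $\ell\ge0$ let $B_\ell=B_\ell(y_0,y_1,\dots,y_\ell)$ be a continuous real $d\times d$ matrix-valued function of $y_0$ in an open set $\Omega_0\subseteq\mathbb{R}^d$ and $y_1,\dots,y_\ell\in\mathbb{R}^d$, and $A_n=\sum_{\ell=0}^nB_\ell$. Standing assumptions: (ellipticity) there is $\mu>0$ with $\xi\cdot A_n\xi\ge\mu|\xi|^2$ for all $n$, all arguments, all $\xi$; (boundedness) $\sum_\ell\|B_\ell\|_{L^\infty}\le\mu^{-1}$; (periodicity) $A_n$ is invariant under $(y_1,\dots,y_n)\mapsto(y_1+z_1,\dots,y_n+z_n)$, $z_i\in\mathbb{Z}^d$. Scales $1=\varepsilon_0>\varepsilon_1>\varepsilon_2>\cdots>0$, $\varepsilon_n\to0$; $A_n^\varepsilon(x)=A_n(x,x/\varepsilon_1,\dots,x/\varepsilon_n)$, $A^\varepsilon=\lim_nA^\varepsilon_n$ uniformly. Condition (B): there is $\delta=(\delta_0,\delta_1,\dots)$, $\delta_\ell\ge0$, with $\max\{\|B_\ell\|_{L^\infty},\max_{0\le j\le\ell}\|\nabla_{y_j}B_\ell\|_{L^\infty}\}\le\delta_\ell$ and $[\delta]_0:=\sum_{\ell\ge0}\delta_\ell<\infty$; for $\alpha>0$, $[\delta]_\alpha:=\sum_{\ell\ge1}\ell^\alpha\delta_\ell$. *)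

theory Defs
  imports "HOL-Analysis.Analysis"
begin

definition pdiff :: "'n::finite \<Rightarrow> (real^'n \<Rightarrow> real) \<Rightarrow> real^'n \<Rightarrow> real" where
  "pdiff k \<phi> x = frechet_derivative \<phi> (at x) (axis k 1)"

definition grad :: "(real^'n::finite \<Rightarrow> real) \<Rightarrow> real^'n \<Rightarrow> real^'n" where
  "grad \<phi> x = (\<chi> k. pdiff k \<phi> x)"

fun Ck :: "nat \<Rightarrow> (real^'n::finite \<Rightarrow> real) \<Rightarrow> bool" where
  "Ck 0 \<phi> = continuous_on UNIV \<phi>"
| "Ck (Suc n) \<phi> = ((\<forall>x. \<phi> differentiable (at x)) \<and> Ck 0 \<phi> \<and> (\<forall>k. Ck n (pdiff k \<phi>)))"

definition smooth :: "(real^'n::finite \<Rightarrow> real) \<Rightarrow> bool" where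
  "smooth \<phi> \<longleftrightarrow> (\<forall>n. Ck n \<phi>)"

definition test_fun :: "(real^'n::finite) set \<Rightarrow> (real^'n \<Rightarrow> real) \<Rightarrow> bool" where
  "test_fun U \<phi> \<longleftrightarrow> smooth \<phi> \<and> compact (closure {x. \<phi> x \<noteq> 0}) \<and> closure {x. \<phi> x \<noteq> 0} \<subseteq> U"

definition H1_weak_grad :: "(real^'n::finite) set \<Rightarrow> (real^'n \<Rightarrow> real) \<Rightarrow> (real^'n \<Rightarrow> real^'n) \<Rightarrow> bool" where
  "H1_weak_grad U u g \<longleftrightarrow>
     set_borel_measurable lborel U u \<and> set_borel_measurable lborel U g \<and>
     set_integrable lborel U (\<lambda>x. (u x)\<^sup>2) \<and>
     set_integrable lborel U (\<lambda>x. (norm (g x))\<^sup>2) \<and>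
     (\<forall>\<phi> k. test_fun U \<phi> \<longrightarrow>
        (LINT x:U|lborel. u x * pdiff k \<phi> x) = - (LINT x:U|lborel. g x $ k * \<phi> x))"

definition weak_solution :: "(real^'n::finite) set \<Rightarrow> (real^'n \<Rightarrow> real^'n^'n) \<Rightarrow> (real^'n \<Rightarrow> real)
    \<Rightarrow> (real^'n \<Rightarrow> real) \<Rightarrow> (real^'n \<Rightarrow> real^'n) \<Rightarrow> bool" where
  "weak_solution U A f u g \<longleftrightarrow> H1_weak_grad U u g \<and>
     (\<forall>\<phi>. test_fun U \<phi> \<longrightarrow>
        (LINT x:U|lborel. (A x *v g x) \<bullet> grad \<phi> x) = (LINT x:U|lborel. f x * \<phi> x))"

text \<open>B l Y is B_l(y_0,...,y_l) with y_i = Y i; it must depend only on Y 0, ..., Y l.\<close>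

definition A_n :: "(nat \<Rightarrow> (nat \<Rightarrow> real^'n::finite) \<Rightarrow> real^'n^'n) \<Rightarrow> nat \<Rightarrow> (nat \<Rightarrow> real^'n) \<Rightarrow> real^'n^'n" where
  "A_n B n Y = (\<Sum>l\<le>n. B l Y)"

definition Linf :: "(real^'n::finite) set \<Rightarrow> ((nat \<Rightarrow> real^'n) \<Rightarrow> real^'n^'n) \<Rightarrow> real" where
  "Linf \<Omega>0 F = (SUP Y\<in>{Y. Y 0 \<in> \<Omega>0}. norm (F Y))"

definition standing_assumptions ::
  "(real^'n::finite) set \<Rightarrow> (nat \<Rightarrow> (nat \<Rightarrow> real^'n) \<Rightarrow> real^'n^'n) \<Rightarrow> real \<Rightarrow> bool" where
  "standing_assumptions \<Omega>0 B \<mu> \<longleftrightarrow>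
     open \<Omega>0 \<and> \<mu> > 0 \<and>
     (\<forall>l Y Y'. (\<forall>i\<le>l. Y i = Y' i) \<longrightarrow> B l Y = B l Y') \<and>
     (\<forall>l. continuous_on {Y. Y 0 \<in> \<Omega>0} (B l)) \<and>
     (\<forall>n Y \<xi>. Y 0 \<in> \<Omega>0 \<longrightarrow> \<xi> \<bullet> (A_n B n Y *v \<xi>) \<ge> \<mu> * (norm \<xi>)\<^sup>2) \<and>
     summable (\<lambda>l. Linf \<Omega>0 (B l)) \<and> (\<Sum>l. Linf \<Omega>0 (B l)) \<le> inverse \<mu> \<and>
     (\<forall>n Y z. Y 0 \<in> \<Omega>0 \<longrightarrow> z 0 = 0 \<longrightarrow> (\<forall>i k. z i $ k \<in> \<int>) \<longrightarrow>
        A_n B n (\<lambda>i. Y i + z i) = A_n B n Y)"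

text \<open>Condition (B): |B_l| \<le> delta_l and |grad_{y_j} B_l| \<le> delta_l in L-infinity (j \<le> l),
  the gradient bound expressed as the equivalent Lipschitz bound along segments
  inside the domain; and sum delta_l < infinity.\<close>
definition condition_B ::
  "(real^'n::finite) set \<Rightarrow> (nat \<Rightarrow> (nat \<Rightarrow> real^'n) \<Rightarrow> real^'n^'n) \<Rightarrow> (nat \<Rightarrow> real) \<Rightarrow> bool" where
  "condition_B \<Omega>0 B \<delta> \<longleftrightarrow>
     (\<forall>l. \<delta> l \<ge> 0) \<and> summable \<delta> \<and>
     (\<forall>l Y. Y 0 \<in> \<Omega>0 \<longrightarrow> norm (B l Y) \<le> \<delta> l) \<and>
     (\<forall>l j Y y. j \<le> l \<longrightarrow> Y 0 \<in> \<Omega>0 \<longrightarrow> (j = 0 \<longrightarrow> closed_segment (Y 0) y \<subseteq> \<Omega>0) \<longrightarrow>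
        norm (B l (Y(j := y)) - B l Y) \<le> \<delta> l * dist y (Y j))"

definition delta0 :: "(nat \<Rightarrow> real) \<Rightarrow> real" where
  "delta0 \<delta> = (\<Sum>l. \<delta> l)"

definition delta_norm :: "real \<Rightarrow> (nat \<Rightarrow> real) \<Rightarrow> real" where
  "delta_norm \<alpha> \<delta> = (\<Sum>l. (if l = 0 then 0 else real l powr \<alpha>) * \<delta> l)"

definition scales :: "(nat \<Rightarrow> real) \<Rightarrow> bool" where
  "scales \<epsilon> \<longleftrightarrow> \<epsilon> 0 = 1 \<and> (\<forall>n. \<epsilon> n > 0) \<and> (\<forall>n. \<epsilon> (Suc n) < \<epsilon> n) \<and> \<epsilon> \<longlonglongrightarrow> 0"

definition A_eps :: "(nat \<Rightarrow> (nat \<Rightarrow> real^'n::finite) \<Rightarrow> real^'n^'n) \<Rightarrow> (nat \<Rightarrow> real) \<Rightarrow> real^'n \<Rightarrow> real^'n^'n" where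
  "A_eps B \<epsilon> x = lim (\<lambda>n. A_n B n (\<lambda>i. inverse (\<epsilon> i) *\<^sub>R x))"

definition avg :: "(real^'n::finite) set \<Rightarrow> (real^'n \<Rightarrow> real) \<Rightarrow> real" where
  "avg U h = (LINT x:U|lborel. h x) / measure lborel U"

end

theory Submission
  imports Defs "HOL-Analysis.Analysis"
begin

text \<open>The proof avoids homogenization theory. A shift \<open>h\<close> moves the coefficient \<open>A_eps\<close> by at most a modulus that is
  small whenever \<open>h\<close> is nearly a common period of the scales above the one under consideration, so differences of
  a solution along such shifts are again almost solutions and gain regularity from the Caccioppoli inequality, exactly
  as derivatives do for constant coefficients. Iterated differences of order up to \<open>d\<close> control the averages of the
  squared gradient from one ball to a concentric smaller one up to a factor \<open>1 + a\<^sub>i\<close>; summing the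
  \<open>a\<^sub>i\<close> over all scales costs a logarithm of each ratio \<open>\<epsilon> (k + 1) / \<epsilon> k\<close>, which the separation hypothesis absorbs
  once \<open>\<epsilon> 1\<close> is small. Weak solutions are reduced to smooth approximate ones by mollification, the commutator of
  mollification and coefficient being an error that vanishes in the limit.\<close>

section \<open>Ball energies and iterated differences\<close>

text \<open>A bound with a fixed constant per scale is useless, since infinitely many scales are
  crossed. This rules out arbitrary shifts: at a radius between \<epsilon> (k + 1) and \<epsilon> k
  they may move the coefficient by twice the tail of \<delta> beyond k, an amount that is the same
  at every dyadic radius in between. Almost periods lie within a multiple of \<epsilon> (k + 1) of
  every short vector and move it by amounts that can be summed over all radii. So two normalized
  bounds are propagated. The one for all shifts only has to stay bounded, because it enters through
  the ratio of the spacing of almost periods to the radius and when the level changes; the one for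
  almost periods has to be summable. The order \<open>d\<close> comes from the volume: lengthening
  each of \<open>d\<close> shifts by a factor \<open>n\<close> gains about n^(-2) per shift, hence
  n^(-2 d), while shrinking the ball by 1 / (2 n) leaves a share of order n^(-d) of its volume. At
  lower orders one lengthened shift suffices, provided that the difference of the next order is
  small; weights \<beta>^j arrange that.\<close>

definition ball_energy :: "'a::euclidean_space => real => ('a => 'b::real_normed_vector) => real" where
 "ball_energy c r f = (LINT x:cball c r|lborel. (norm (f x))^2)"

definition diff_op :: "'a::real_vector => ('a => 'b::real_vector) => 'a => 'b" where
 "diff_op h f = (\<lambda>x. f (x + h) - f x)"

fun diff_ops :: "'a::real_vector list => ('a => 'b::real_vector) => 'a => 'b" where
 "diff_ops [] f = f"
| "diff_ops (h # H) f = diff_op h (diff_ops H f)"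

definition len_sum :: "'a::real_normed_vector list => real" where
 "len_sum H = (\<Sum>h\<leftarrow>H. norm h)"

lemma len_sum_simps [simp]: "len_sum [] = 0" "len_sum (h # H) = norm h + len_sum H"
 by (auto simp: len_sum_def)

lemma len_sum_nonneg [simp]: "0 <= len_sum H"
 by (induction H) auto

lemma len_sum_le: "(!!h. h \<in> set H ==> norm h <= b) ==> len_sum H <= real (length H) * b"
 by (induction H) (force simp: algebra_simps)+

lemma set_integrable_cball:
 fixes f :: "'a::euclidean_space => 'b::{banach, second_countable_topology}"
 assumes "continuous_on UNIV f"
 shows "set_integrable lborel (cball c r) f" unfolding set_integrable_def
 by (rule borel_integrable_compact[OF compact_cball]) (rule continuous_on_subset[OF assms], simp)

lemma cont_norm_sq: "continuous_on UNIV f ==> continuous_on UNIV (\<lambda>x. (norm (f x))^2)"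
 for f :: "'a::topological_space => 'b::real_normed_vector" by (intro continuous_intros)

lemma cont_shift: "continuous_on UNIV f ==> continuous_on UNIV (\<lambda>x. f (x + h))"
 for f :: "'a::real_normed_vector => 'b::topological_space"
 by (rule continuous_on_compose2[of UNIV f]) (auto intro!: continuous_intros)

lemma cont_diff_op: "continuous_on UNIV f ==> continuous_on UNIV (diff_op h f)"
 for f :: "'a::real_normed_vector => 'b::real_normed_vector"
 unfolding diff_op_def by (intro continuous_intros cont_shift)

lemma cont_diff_ops: "continuous_on UNIV f ==> continuous_on UNIV (diff_ops H f)"
 for f :: "'a::real_normed_vector => 'b::real_normed_vector" by (induction H) (auto intro: cont_diff_op)

lemma diff_op_commute: "diff_op h (diff_op k f) = diff_op k (diff_op h f)"
 by (auto simp: diff_op_def algebra_simps)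

lemma diff_op_diff_ops: "diff_op h (diff_ops H f) = diff_ops H (diff_op h f)"
 by (induction H) (auto simp: diff_op_commute[of h])

text \<open>Difference operators commute, so any slot can be brought to the front;
  \<open>enlarge_all\<close> relies on this to treat the slots one after the other.\<close>

lemma diff_ops_mid: "diff_ops (S @ h # T) f = diff_ops (h # S @ T) f"
 by (induction S) (auto simp: diff_op_commute)

context
 fixes c :: "'a::euclidean_space"
begin

lemma ball_energy_nonneg [simp]: "0 <= ball_energy c r f"
 unfolding ball_energy_def set_lebesgue_integral_def by (intro integral_nonneg_AE) auto

lemma ball_energy_le_compare:
 fixes g :: "'a => real"
 assumes "continuous_on UNIV f" "continuous_on UNIV g"
  and "!!x. x \<in> cball c r ==> (norm (f x))^2 <= g x"
 shows "ball_energy c r f <= (LINT x:cball c r|lborel. g x)" unfolding ball_energy_def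
 by (intro set_integral_mono set_integrable_cball cont_norm_sq assms)

lemma ball_energy_mono_fun:
 assumes "continuous_on UNIV f" "continuous_on UNIV g"
  and "!!x. x \<in> cball c r ==> norm (f x) <= norm (g x)"
 shows "ball_energy c r f <= ball_energy c r g" unfolding ball_energy_def
 by (intro set_integral_mono set_integrable_cball cont_norm_sq assms power_mono) auto

lemma ball_energy_cmul: "ball_energy c r (\<lambda>x. a *\<^sub>R f x) = a^2 * ball_energy c r f"
 unfolding ball_energy_def by (simp add: power_mult_distrib)

lemma ball_energy_mono_set:
 assumes "continuous_on UNIV f" "cball a s \<subseteq> cball c r"
 shows "ball_energy a s f <= ball_energy c r f" unfolding ball_energy_def set_lebesgue_integral_def
proof (rule integral_mono)
 show "integrable lborel (\<lambda>x. indicat_real (cball a s) x *\<^sub>R (norm (f x))\<^sup>2)"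
  "integrable lborel (\<lambda>x. indicat_real (cball c r) x *\<^sub>R (norm (f x))\<^sup>2)"
  using set_integrable_cball[OF cont_norm_sq[OF assms(1)]] by (auto simp: set_integrable_def)
qed (use assms(2) in \<open>auto simp: indicator_def\<close>)

lemma ball_energy_mono:
 assumes "continuous_on UNIV f" "s <= r"
 shows "ball_energy c s f <= ball_energy c r f" by (rule ball_energy_mono_set) (use assms in auto)

lemma ball_energy_shift_eq:
 assumes "continuous_on UNIV f"
 shows "ball_energy c r (\<lambda>x. f (x + h)) = ball_energy (c + h) r f"
proof -
 have [measurable]: "f \<in> borel_measurable borel" using assms by (rule borel_measurable_continuous_onI)
 have m: "(\<lambda>x. indicator (cball (c + h) r) x *\<^sub>R (norm (f x))\<^sup>2) \<in> borel_measurable borel"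
  by (intro borel_measurable_scaleR borel_measurable_indicator borel_measurable_continuous_onI
    cont_norm_sq assms) auto
 have "ball_energy (c + h) r f = (\<integral>x. indicator (cball (c + h) r) x *\<^sub>R (norm (f x))\<^sup>2 \<partial>lborel)"
  by (simp add: ball_energy_def set_lebesgue_integral_def)
 also have "... = (\<integral>x. indicator (cball (c + h) r) (h + x) *\<^sub>R (norm (f (h + x)))\<^sup>2 \<partial>lborel)"
  by (subst lborel_distr_plus[symmetric, of h], subst integral_distr)
   (use m in \<open>auto simp: lborel_distr_plus\<close>)
 finally show ?thesis by (simp add: ball_energy_def set_lebesgue_integral_def indicator_def dist_norm algebra_simps)
qed

lemma ball_energy_shift:
 assumes "continuous_on UNIV f" "norm h + s <= r"
 shows "ball_energy c s (\<lambda>x. f (x + h)) <= ball_energy c r f"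
proof -
 have "cball (c + h) s \<subseteq> cball c r"
 proof
  fix x assume "x \<in> cball (c + h) s"
  then show "x \<in> cball c r" using dist_triangle[of c x "c + h"] assms(2) by (simp add: dist_norm)
 qed
 then show ?thesis by (simp add: ball_energy_shift_eq assms(1) ball_energy_mono_set)
qed

lemma ball_energy_add:
 assumes "continuous_on UNIV f" "continuous_on UNIV g"
 shows "ball_energy c r (\<lambda>x. f x + g x) <= 2 * ball_energy c r f + 2 * ball_energy c r g"
proof -
 have le: "(norm (f x + g x))^2 <= 2 * (norm (f x))^2 + 2 * (norm (g x))^2" for x
 proof -
  have "(norm (f x + g x))^2 <= (norm (f x) + norm (g x))^2" by (intro power_mono norm_triangle_ineq) auto
  moreover have "0 <= (norm (f x) - norm (g x))^2" by simp
  ultimately show ?thesis by (simp add: power2_eq_square algebra_simps)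
 qed
 have "ball_energy c r (\<lambda>x. f x + g x)
   <= (LINT x:cball c r|lborel. 2 * (norm (f x))^2 + 2 * (norm (g x))^2)"
  by (rule ball_energy_le_compare) (use le in \<open>auto intro!: continuous_intros assms\<close>)
 also have "... = 2 * ball_energy c r f + 2 * ball_energy c r g" unfolding ball_energy_def
  by (subst set_integral_add) (auto intro!: set_integrable_cball continuous_intros assms)
 finally show ?thesis .
qed

lemma ball_energy_diff:
 assumes "continuous_on UNIV f" "continuous_on UNIV g"
 shows "ball_energy c r (\<lambda>x. f x - g x) <= 2 * ball_energy c r f + 2 * ball_energy c r g"
 using ball_energy_add[OF assms(1), of "\<lambda>x. - g x" r] assms(2) by (auto simp: continuous_on_minus ball_energy_def)

lemma ball_energy_diff_op:
 assumes "continuous_on UNIV f" "norm h + s <= r"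
 shows "ball_energy c s (diff_op h f) <= 4 * ball_energy c r f"
proof -
 have "ball_energy c s (diff_op h f) <= 2 * ball_energy c s (\<lambda>x. f (x + h)) + 2 * ball_energy c s f"
  unfolding diff_op_def by (intro ball_energy_diff cont_shift assms)
 moreover have "ball_energy c s f <= ball_energy c r f"
  using assms by (intro ball_energy_mono) (auto intro: order_trans[OF _ assms(2)])
 moreover have "ball_energy c s (\<lambda>x. f (x + h)) <= ball_energy c r f" by (rule ball_energy_shift) (use assms in auto)
 ultimately show ?thesis by simp
qed

text \<open>Each difference costs a factor 4 and an enlargement of the ball by the length of its
  shift, so \<open>len_sum\<close> is what has to fit between the two radii.\<close>

lemma ball_energy_diff_ops:
 assumes "continuous_on UNIV f" "len_sum H + s <= r"
 shows "ball_energy c s (diff_ops H f) <= 4 ^ length H * ball_energy c r f" using assms(2)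
proof (induction H arbitrary: s)
 case Nil
 then show ?case using assms(1) by (auto intro: ball_energy_mono)
next
 case (Cons h H)
 have "ball_energy c s (diff_ops (h # H) f) <= 4 * ball_energy c (norm h + s) (diff_ops H f)"
  by (auto intro!: ball_energy_diff_op cont_diff_ops assms)
 also have "... <= 4 * (4 ^ length H * ball_energy c r f)" using Cons by (intro mult_left_mono Cons.IH) auto
 finally show ?case by simp
qed

lemma ball_energy_sum:
 assumes "!!i. i < n ==> continuous_on UNIV (f i)"
 shows "ball_energy c r (\<lambda>x. \<Sum>i<n. f i x) <= real n * (\<Sum>i<n. ball_energy c r (f i))"
proof -
 have "(norm (\<Sum>i<n. f i x))^2 <= real n * (\<Sum>i<n. (norm (f i x))^2)" for x
 proof -
  have "(norm (\<Sum>i<n. f i x))^2 <= (\<Sum>i<n. norm (f i x))^2" by (intro power_mono norm_sum) auto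
  also have "... <= real n * (\<Sum>i<n. (norm (f i x))^2)"
   using Cauchy_Schwarz_ineq_sum[of "\<lambda>_. 1" "\<lambda>i. norm (f i x)" "{..<n}"] by simp
  finally show ?thesis .
 qed
 then have "ball_energy c r (\<lambda>x. \<Sum>i<n. f i x) <= (LINT x:cball c r|lborel. real n * (\<Sum>i<n. (norm (f i x))^2))"
  by (intro ball_energy_le_compare) (auto intro!: continuous_intros assms)
 also have "... = real n * (\<Sum>i<n. ball_energy c r (f i))"
 proof -
  have "(LINT x:cball c r|lborel. (\<Sum>i<n. (norm (f i x))^2)) = (\<Sum>i<n. ball_energy c r (f i))"
   unfolding ball_energy_def set_lebesgue_integral_def scaleR_sum_right by (rule Bochner_Integration.integral_sum)
    (use set_integrable_cball[OF cont_norm_sq] assms in \<open>auto simp: set_integrable_def\<close>)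
  then show ?thesis by simp
 qed
 finally show ?thesis .
qed

end

section \<open>Integrals of derivatives of compactly supported functions\<close>

lemma has_derivative_imp_continuous_UNIV:
 assumes "!!x. (f has_derivative f' x) (at x)"
 shows "continuous_on UNIV f" by (meson assms continuous_at_imp_continuous_on has_derivative_continuous)

text \<open>Difference quotients of \<open>X\<close> have integral zero by translation invariance
  and converge to \<open>X'\<close>. The mean value theorem bounds them by a multiple of the
  indicator of a slightly larger ball, so dominated convergence applies. One direction at a time is
  all that the integration by parts below uses.\<close>

lemma integral_directional_derivative_eq_0:
 fixes X X' :: "'a::euclidean_space => real"
 assumes contX: "continuous_on UNIV X" and contX': "continuous_on UNIV X'"
  and supp: "!!x. x \<notin> cball c r ==> X x = 0"
  and der: "!!x. ((\<lambda>t. X (x + t *\<^sub>R e)) has_real_derivative X' x) (at 0)"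
 shows "integral\<^sup>L lborel X' = 0"
proof -
 have supp': "X' x = 0" if "x \<notin> cball c r" for x
 proof -
  have "eventually (\<lambda>t. x + t *\<^sub>R e \<in> - cball c r) (at 0)"
   by (rule topological_tendstoD[where l = "x + 0 *\<^sub>R e"]) (use that in \<open>auto intro!: tendsto_eq_intros simp del: mem_cball\<close>)
  then have ev: "eventually (\<lambda>t. X (x + t *\<^sub>R e) = 0) (at 0)" by (rule eventually_mono) (use supp in auto)
  have "((\<lambda>t. X (x + t *\<^sub>R e)) has_real_derivative 0) (at 0)" using ev supp[OF that]
   by (subst DERIV_cong_ev[of 0 0 _ "\<lambda>_. 0" 0 0]) (auto simp: eventually_nhds_conv_at)
  with der[of x] show ?thesis using DERIV_unique by blast
 qed
 obtain B where B: "!!x. x \<in> cball c r ==> \<bar>X' x\<bar> <= B"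
  using compact_imp_bounded[OF compact_continuous_image[OF continuous_on_subset[OF contX'] compact_cball, of c r]]
  unfolding bounded_iff by (auto simp del: mem_cball)
 define B' where "B' = max B 0"
 have B': "\<bar>X' x\<bar> <= B'" for x using B[of x] supp'[of x] by (cases "x \<in> cball c r") (auto simp: B'_def)
 have der_t: "((\<lambda>t. X (x + t *\<^sub>R e)) has_real_derivative X' (x + t *\<^sub>R e)) (at t)" for x t
  using DERIV_shift[of "\<lambda>t. X (x + t *\<^sub>R e)" "X' (x + t *\<^sub>R e)" 0 t] der[of "x + t *\<^sub>R e"] by (simp add: algebra_simps)
 define Q where "Q n x = real (Suc n) * (X (x + (1 / real (Suc n)) *\<^sub>R e) - X x)" for n x
 have [measurable]: "X \<in> borel_measurable borel" "X' \<in> borel_measurable borel"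
  using contX contX' by (auto intro: borel_measurable_continuous_onI)
 have Qm: "Q n \<in> borel_measurable lborel" for n unfolding Q_def by measurable
 have Xint: "integrable lborel X"
 proof -
  have "set_integrable lborel (cball c r) X" by (rule set_integrable_cball[OF contX])
  moreover have "(\<lambda>x. indicat_real (cball c r) x *\<^sub>R X x) = X" using supp by (force simp: indicator_def)
  ultimately show ?thesis by (simp add: set_integrable_def)
 qed
 have shift: "integrable lborel (\<lambda>x. X (x + h))" "(\<integral>x. X (x + h) \<partial>lborel) = integral\<^sup>L lborel X" for h
 proof -
  have "integrable (distr lborel borel ((+) h)) X" by (simp add: lborel_distr_plus Xint)
  then show "integrable lborel (\<lambda>x. X (x + h))" by (subst (asm) integrable_distr_eq) (auto simp: add.commute)
  show "(\<integral>x. X (x + h) \<partial>lborel) = integral\<^sup>L lborel X"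
   by (subst (2) lborel_distr_plus[symmetric, of h], subst integral_distr) (auto simp: add.commute)
 qed
 have Q0: "integral\<^sup>L lborel (Q n) = 0" for n unfolding Q_def by (simp add: shift Xint)
 have lim: "(\<lambda>n. Q n x) \<longlonglongrightarrow> X' x" for x
 proof -
  have "((\<lambda>h. (X (x + h *\<^sub>R e) - X x) / h) \<longlongrightarrow> X' x) (at 0)" using der[of x] by (simp add: DERIV_def)
  moreover have "filterlim (\<lambda>n. 1 / real (Suc n)) (at 0) sequentially"
   unfolding filterlim_at using LIMSEQ_Suc[OF lim_1_over_n] by auto
  ultimately have "(\<lambda>n. (X (x + (1 / real (Suc n)) *\<^sub>R e) - X x) / (1 / real (Suc n))) \<longlonglongrightarrow> X' x"
   by (rule filterlim_compose)
  then show ?thesis by (simp add: Q_def mult.commute)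
 qed
 have bound: "norm (Q n x) <= B' * indicat_real (cball c (r + norm e)) x" for n x
 proof (cases "x \<in> cball c (r + norm e)")
  case True
  obtain t where t: "X (x + (1 / real (Suc n)) *\<^sub>R e) - X (x + 0 *\<^sub>R e) = (1 / real (Suc n) - 0) * X' (x + t *\<^sub>R e)"
   using MVT2[of 0 "1 / real (Suc n)" "\<lambda>t. X (x + t *\<^sub>R e)" "\<lambda>t. X' (x + t *\<^sub>R e)"] der_t by auto
  then have "Q n x = X' (x + t *\<^sub>R e)" by (simp add: Q_def)
  then show ?thesis using True B' by simp
 next
  case False
  have "x \<notin> cball c r" using False norm_ge_zero[of e] unfolding mem_cball by linarith
  moreover have "x + (1 / real (Suc n)) *\<^sub>R e \<notin> cball c r"
  proof
   assume "x + (1 / real (Suc n)) *\<^sub>R e \<in> cball c r"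
   moreover have "norm ((1 / real (Suc n)) *\<^sub>R e) <= norm e" by (simp add: divide_le_eq distrib_left)
   moreover have "dist c x <= dist c (x + (1 / real (Suc n)) *\<^sub>R e) + norm ((1 / real (Suc n)) *\<^sub>R e)"
    using dist_triangle[of c x "x + (1 / real (Suc n)) *\<^sub>R e"] by (simp add: dist_norm)
   ultimately show False using False by simp
  qed
  ultimately show ?thesis using supp by (simp add: Q_def B'_def)
 qed
 have "(\<lambda>n. integral\<^sup>L lborel (Q n)) \<longlonglongrightarrow> integral\<^sup>L lborel X'"
  by (rule integral_dominated_convergence[where w = "\<lambda>x. B' * indicat_real (cball c (r + norm e)) x"])
   (use Qm lim bound set_integrable_cball[of "\<lambda>_. 1::real" c "r + norm e"] in \<open>auto simp: set_integrable_def\<close>)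
 then show ?thesis using LIMSEQ_unique Q0 by (simp add: LIMSEQ_const_iff)
qed

section \<open>Cut-off and integration by parts\<close>

definition grad_pair :: "('a::euclidean_space => real) => ('a => 'a) => bool" where
 "grad_pair v G \<longleftrightarrow> continuous_on UNIV G \<and> (\<forall>x. (v has_derivative (\<lambda>h. G x \<bullet> h)) (at x))"

text \<open>The sign makes \<open>f\<close> the right-hand side of -div F = f. Continuity is asked
  of the diagonal partial derivatives, those that form the divergence.\<close>

definition div_pair :: "(real^'n::finite => real^'n) => (real^'n => real) => bool" where
 "div_pair F f \<longleftrightarrow> (\<exists>F'. (\<forall>x. (F has_derivative F' x) (at x)) \<and>
   (\<forall>i. continuous_on UNIV (\<lambda>x. F' x (axis i 1) $ i)) \<and> (\<forall>x. f x = - (\<Sum>i\<in>UNIV. F' x (axis i 1) $ i)))"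

lemma grad_pair_cont: "grad_pair v G ==> continuous_on UNIV v" "grad_pair v G ==> continuous_on UNIV G"
 unfolding grad_pair_def by (auto intro: has_derivative_imp_continuous_UNIV)

lemma has_derivative_shift:
 assumes "!!x. (f has_derivative f' x) (at x)"
 shows "((\<lambda>x. f (x + h)) has_derivative f' (x + h)) (at x)"
proof -
 have "((\<lambda>x. x + h) has_derivative (\<lambda>x. x)) (at x)" by (auto intro!: derivative_eq_intros)
 from has_derivative_compose[OF this assms] show ?thesis by simp
qed

lemma grad_pair_diff_op: "grad_pair v G ==> grad_pair (diff_op h v) (diff_op h G)"
proof -
 assume *: "grad_pair v G"
 have "((\<lambda>x. v (x + h) - v x) has_derivative (\<lambda>k. (G (x + h) - G x) \<bullet> k)) (at x)" for x unfolding inner_diff_left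
  by (intro has_derivative_diff has_derivative_shift[of v "\<lambda>x h. G x \<bullet> h"])
   (use * in \<open>auto simp: grad_pair_def\<close>)
 then show ?thesis using * cont_diff_op[of G h] by (simp add: grad_pair_def diff_op_def)
qed

lemma grad_pair_diff_ops: "grad_pair v G ==> grad_pair (diff_ops H v) (diff_ops H G)"
 by (induction H) (auto intro: grad_pair_diff_op)

lemma div_pair_cont: 
 assumes "div_pair F f" shows "continuous_on UNIV F" "continuous_on UNIV f"
proof -
 obtain F' where F': "!!x. (F has_derivative F' x) (at x)"
  "!!i. continuous_on UNIV (\<lambda>x. F' x (axis i 1) $ i)" "!!x. f x = - (\<Sum>i\<in>UNIV. F' x (axis i 1) $ i)"
  using assms unfolding div_pair_def by blast
 show "continuous_on UNIV F" using F'(1) by (rule has_derivative_imp_continuous_UNIV)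
 have "f = (\<lambda>x. - (\<Sum>i\<in>UNIV. F' x (axis i 1) $ i))" using F'(3) by auto
 then show "continuous_on UNIV f" using F'(2) by (simp add: continuous_on_minus continuous_on_sum)
qed

lemma div_pair_diff_op:
 assumes "div_pair F f" shows "div_pair (diff_op h F) (diff_op h f)"
proof -
 obtain F' where F': "!!x. (F has_derivative F' x) (at x)"
  "!!i. continuous_on UNIV (\<lambda>x. F' x (axis i 1) $ i)" "!!x. f x = - (\<Sum>i\<in>UNIV. F' x (axis i 1) $ i)"
  using assms unfolding div_pair_def by blast
 show ?thesis unfolding div_pair_def
 proof (intro exI[of _ "\<lambda>x k. F' (x + h) k - F' x k"] conjI allI)
  show "(diff_op h F has_derivative (\<lambda>k. F' (x + h) k - F' x k)) (at x)" for x
   unfolding diff_op_def by (intro has_derivative_diff has_derivative_shift F')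
  show "continuous_on UNIV (\<lambda>x. (F' (x + h) (axis i 1) - F' x (axis i 1)) $ i)" for i
   using F'(2)[of i] cont_shift[OF F'(2)[of i], of h] by (auto intro!: continuous_intros)
 qed (simp add: diff_op_def F'(3) sum_subtractf)
qed

lemma div_pair_diff_ops: "div_pair F f ==> div_pair (diff_ops H F) (diff_ops H f)"
 by (induction H) (auto intro: div_pair_diff_op)

text \<open>The weak form of -div F = f tested with \<open>z\<close>: the vanishing of integrated
  directional derivatives, applied to \<open>z\<close> times each component of \<open>F\<close> and
  summed.\<close>

lemma integral_div_eq_0:
 fixes F :: "real^'n::finite => real^'n"
 assumes F: "!!x. (F has_derivative F' x) (at x)" "!!i. continuous_on UNIV (\<lambda>x. F' x (axis i 1) $ i)"
  and z: "!!x. (z has_derivative (\<lambda>h. Z x \<bullet> h)) (at x)" "continuous_on UNIV Z"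
  and supp: "!!x. x \<notin> cball c r ==> z x = 0" "!!x. x \<notin> cball c r ==> Z x = 0"
 shows "(LINT x:cball c r|lborel. Z x \<bullet> F x + z x * (\<Sum>i\<in>UNIV. F' x (axis i 1) $ i)) = 0"
proof -
 have contz: "continuous_on UNIV z" using z(1) by (rule has_derivative_imp_continuous_UNIV)
 have contF: "continuous_on UNIV F" using F(1) by (rule has_derivative_imp_continuous_UNIV)
 define X' where "X' i x = Z x $ i * F x $ i + z x * F' x (axis i 1) $ i" for i x
 have cont': "continuous_on UNIV (X' i)" for i unfolding X'_def by (intro continuous_intros contz contF F z)
 have int0: "integral\<^sup>L lborel (X' i) = 0" for i
 proof (rule integral_directional_derivative_eq_0[where X = "\<lambda>x. z x * F x $ i" and e = "axis i 1" and c = c and r = r])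
  show "continuous_on UNIV (\<lambda>x. z x * F x $ i)" by (intro continuous_intros contz contF)
  show "((\<lambda>t. z (x + t *\<^sub>R axis i 1) * F (x + t *\<^sub>R axis i 1) $ i) has_real_derivative X' i x) (at 0)" for x
  proof -
   have line: "((\<lambda>t. x + t *\<^sub>R axis i (1::real)) has_derivative (\<lambda>t. t *\<^sub>R axis i 1)) (at 0)"
    by (auto intro!: derivative_eq_intros)
   have 1: "((\<lambda>t. z (x + t *\<^sub>R axis i 1)) has_derivative (\<lambda>t. Z x \<bullet> (t *\<^sub>R axis i 1))) (at 0)"
    using has_derivative_compose[OF line, of z "\<lambda>h. Z x \<bullet> h"] z(1)[of x] by simp
   have "((\<lambda>t. F (x + t *\<^sub>R axis i 1)) has_derivative (\<lambda>t. F' x (t *\<^sub>R axis i 1))) (at 0)"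
    using has_derivative_compose[OF line, of F "F' x"] F(1)[of x] by simp
   then have 2: "((\<lambda>t. F (x + t *\<^sub>R axis i 1) $ i) has_derivative (\<lambda>t. F' x (t *\<^sub>R axis i 1) $ i)) (at 0)"
    by (rule bounded_linear.has_derivative[OF bounded_linear_vec_nth])
   have lin: "F' x (t *\<^sub>R axis i 1) $ i = t * F' x (axis i 1) $ i" for t
    using linear_cmul[OF has_derivative_linear[OF F(1)[of x]]] by simp
   show ?thesis unfolding has_field_derivative_def by (rule has_derivative_eq_rhs[OF has_derivative_mult[OF 1 2]])
     (auto simp: lin X'_def fun_eq_iff algebra_simps inner_axis)
  qed
 qed (use cont' supp in auto)
 have eq: "integral\<^sup>L lborel (X' i) = (LINT x:cball c r|lborel. X' i x)" for i unfolding set_lebesgue_integral_def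
  by (rule Bochner_Integration.integral_cong) (use supp in \<open>auto simp: X'_def indicator_def simp del: mem_cball\<close>)
 have "(LINT x:cball c r|lborel. \<Sum>i\<in>UNIV. X' i x) = (\<Sum>i\<in>UNIV. LINT x:cball c r|lborel. X' i x)"
  unfolding set_lebesgue_integral_def scaleR_sum_right by (rule Bochner_Integration.integral_sum)
   (use set_integrable_cball[OF cont'] in \<open>auto simp: set_integrable_def\<close>)
 also have "... = 0" using int0 eq by simp
 finally show ?thesis by (simp add: X'_def sum.distrib sum_distrib_left inner_vec_def)
qed

text \<open>Only Lipschitz, but its square is continuously differentiable, which is enough for the
  test function p^2 (w - k); the parabolic profile keeps the gradient explicit.\<close>

definition bump :: "'a::real_inner => real => 'a => real" where
 "bump c R x = max 0 (1 - (norm (x - c))\<^sup>2 / R^2)"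

lemma max0_sq_deriv: "((\<lambda>t::real. (max 0 t)^2) has_real_derivative 2 * max 0 t) (at t)"
proof -
 consider "t < 0" | "t = 0" | "t > 0" by linarith
 then show ?thesis
 proof cases
  case 1
  have "((\<lambda>t::real. 0) has_real_derivative 2 * max 0 t) (at t)" using 1 by auto
  then show ?thesis
   by (rule has_field_derivative_transform_within[where d = "-t"]) (use 1 in \<open>auto simp: dist_real_def max_def\<close>)
 next
  case 3
  have "((\<lambda>t::real. t^2) has_real_derivative 2 * max 0 t) (at t)" using 3 by (auto intro!: derivative_eq_intros)
  then show ?thesis
   by (rule has_field_derivative_transform_within[where d = t]) (use 3 in \<open>auto simp: dist_real_def max_def\<close>)
 next
  case 2
  have "((\<lambda>h. (max 0 h)^2 / h) \<longlongrightarrow> 0) (at (0::real))"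
  proof (rule Lim_null_comparison)
   show "eventually (\<lambda>h::real. norm ((max 0 h)^2 / h) <= \<bar>h\<bar>) (at 0)"
    by (rule always_eventually) (auto simp: max_def power2_eq_square)
  qed (auto intro!: tendsto_eq_intros)
  then show ?thesis using 2 by (simp add: DERIV_def)
 qed
qed

lemma bump_sq_deriv:
 assumes "R > 0"
 shows "((\<lambda>x. (bump c R x)^2) has_derivative (\<lambda>h. (- (4 * bump c R x / R^2)) *\<^sub>R (x - c) \<bullet> h)) (at x)"
proof -
 have 1: "((\<lambda>x. 1 - (norm (x - c))\<^sup>2 / R^2) has_derivative (\<lambda>h. - (2 * ((x - c) \<bullet> h)) / R^2)) (at x)"
  unfolding power2_norm_eq_inner using assms
  by (auto intro!: derivative_eq_intros simp: inner_commute field_simps power2_eq_square)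
 have 2: "((\<lambda>t. (max 0 t)^2) has_derivative (\<lambda>h. h * (2 * bump c R x))) (at (1 - (norm (x - c))\<^sup>2 / R^2))"
  using max0_sq_deriv[of "1 - (norm (x - c))\<^sup>2 / R^2"] by (simp add: has_field_derivative_def bump_def mult_commute_abs)
 from has_derivative_compose[OF 1 2] show ?thesis by (simp add: bump_def[symmetric] algebra_simps diff_divide_distrib)
qed

text \<open>The bracket collects the Young constants of \<open>caccioppoli_pointwise\<close>. The
  factor 4 / \<mu> rounds up 32 / (9 \<mu>), the product of 2 / \<mu> from the absorption and 16 / 9
  from the cut-off, which is at least 3 / 4 on the half ball.\<close>

definition cacc_const :: "real => real => real" where
 "cacc_const \<mu> \<Lambda> = 4 / \<mu> * (4 * \<Lambda>^2 / \<mu> + 1 / \<mu> + 4)"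

text \<open>The integrand of the energy identity: ellipticity gives \<mu> p^2 |G|^2, and the mixed
  terms are absorbed by Young's inequality so that half of it survives. \<open>W\<close> stands for
  w - k; the gradient of the squared cut-off is \<open>p\<close> times \<open>g\<close>.\<close>

lemma caccioppoli_pointwise:
 fixes Gx Fx Ex g :: "'a::real_inner"
 assumes \<mu>: "\<mu> > 0" and r: "r > 0" and p: "0 <= p" "p <= 1"
  and Fx: "Fx = AG + Ex" and AG: "norm AG <= \<Lambda> * norm Gx" "Gx \<bullet> AG >= \<mu> * (norm Gx)^2"
  and g: "norm g <= 2 / r" 
 shows "\<mu> / 2 * p^2 * (norm Gx)^2 - (4 * \<Lambda>^2 / \<mu> + 1 / \<mu> + 4) * (W^2 / r^2 + (norm Ex)^2 + r^2 * f^2)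
   <= (p^2 *\<^sub>R Gx + (W * p) *\<^sub>R g) \<bullet> Fx + p^2 * W * (- f)"
proof -
 define a e q where "a = norm Gx" and "e = norm Ex" and "q = \<bar>W\<bar> / r"
 have nn: "0 <= a" "0 <= e" "0 <= q" using r by (auto simp: a_def e_def q_def)
 have p2: "p^2 <= 1" using p by (simp add: power_le_one)
 have L0: "\<Lambda> * a >= 0" using AG(1) norm_ge_zero order_trans unfolding a_def by blast
 have y: "x * z <= k * x^2 + z^2 / (4 * k)" if "k > 0" for x z k :: real
 proof -
  have "0 <= (2 * k * x - z)^2 / (4 * k)" using that by simp
  also have "... = k * x^2 + z^2 / (4 * k) - x * z" using that by (simp add: field_simps power2_eq_square)
  finally show ?thesis by simp
 qed
 have GE: "Gx \<bullet> Ex >= - (a * e)" using Cauchy_Schwarz_ineq2[of Gx Ex] by (simp add: a_def e_def)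
 have 1: "Gx \<bullet> Fx >= \<mu> * a^2 - a * e" using GE AG(2) by (simp add: Fx inner_add_right a_def)
 have 2: "p^2 * (Gx \<bullet> Fx) >= p^2 * (\<mu> * a^2) - p\<^sup>2 * (\<mu> / 4 * a^2 + e^2 / \<mu>)"
 proof -
  have "a * e <= \<mu> / 4 * a^2 + e^2 / \<mu>" using y[of "\<mu>/4" a e] \<mu> by simp
  with 1 have "p^2 * (Gx \<bullet> Fx) >= p^2 * (\<mu> * a^2 - (\<mu> / 4 * a^2 + e^2 / \<mu>))" by (intro mult_left_mono) auto
  then show ?thesis by (simp add: algebra_simps)
 qed
 have nF: "norm Fx <= \<Lambda> * a + e" using norm_triangle_ineq[of AG Ex] AG(1) by (simp add: Fx a_def e_def)
 have 3: "(W * p) * (g \<bullet> Fx) >= - (2 * q * p * (\<Lambda> * a + e))"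
 proof -
  have "\<bar>g \<bullet> Fx\<bar> <= (2 / r) * (\<Lambda> * a + e)"
   using Cauchy_Schwarz_ineq2[of g Fx] mult_mono[OF g nF] L0 nn r by (auto intro: order_trans)
  then have "\<bar>(W * p) * (g \<bullet> Fx)\<bar> <= \<bar>W * p\<bar> * ((2 / r) * (\<Lambda> * a + e))" unfolding abs_mult by (intro mult_left_mono) auto
  also have "... = 2 * q * p * (\<Lambda> * a + e)" using p by (simp add: q_def abs_mult)
  finally show ?thesis by linarith
 qed
 have 4: "2 * q * p * (\<Lambda> * a) <= \<mu> / 4 * (p * a)^2 + (2 * q * \<Lambda>)^2 / \<mu>"
  using y[of "\<mu>/4" "p * a" "2 * q * \<Lambda>"] \<mu> by (simp add: algebra_simps)
 have 5: "2 * q * p * e <= q^2 + (p * e)^2" using sum_squares_bound[of q "p * e"] by (simp add: algebra_simps)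
 have 6: "p^2 * W * f <= q^2 + r^2 * f^2"
 proof -
  have "p^2 * W * f <= \<bar>p\<^sup>2 * W * f\<bar>" by simp
  also have "... = p^2 * (\<bar>W\<bar> * \<bar>f\<bar>)" by (simp add: abs_mult)
  also have "... <= 1 * (\<bar>W\<bar> * \<bar>f\<bar>)" by (rule mult_right_mono[OF p2]) simp
  also have "... = q * (r * \<bar>f\<bar>)" using r by (simp add: q_def)
  also have "... <= q^2 + (r * \<bar>f\<bar>)^2"
  proof -
   have "0 <= q * (r * \<bar>f\<bar>)" using nn r by simp
   then show ?thesis using sum_squares_bound[of q "r * \<bar>f\<bar>"] by linarith
  qed
  finally show ?thesis by (simp add: power_mult_distrib)
 qed
 have pe: "(p * e)^2 <= e^2" "p^2 * (e^2 / \<mu>) <= e^2 / \<mu>"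
  using mult_right_mono[OF p2, of "e^2"] mult_right_mono[OF p2, of "e^2 / \<mu>"] \<mu> by (auto simp: power_mult_distrib)
 define L m h where "L = 4 * \<Lambda>^2 / \<mu>" and "m = 1 / \<mu>" and "h = r^2 * f^2"
 have K: "(L + m + 4) * (q^2 + e^2 + h) >= L * q^2 + 2 * q^2 + e^2 + m * e^2 + h"
 proof -
  have "0 <= L" "0 <= m" "0 <= h" using \<mu> by (auto simp: L_def m_def h_def)
  then have "0 <= L * e^2" "0 <= L * h" "0 <= m * q^2" "0 <= m * h" "0 <= e^2" "0 <= q^2" "0 <= h" by auto
  moreover have "(L + m + 4) * (q^2 + e^2 + h) = L * q^2 + L * e^2 + L * h + m * q^2 + m * e^2 + m * h
   + 4 * q^2 + 4 * e^2 + 4 * h" by (simp only: distrib_left distrib_right)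
  ultimately show ?thesis by linarith
 qed
 have q2: "W^2 / r^2 = q^2" by (simp add: q_def power_divide)
 have c1: "p^2 * (\<mu> * a^2) = 4 * (\<mu> / 4 * (p * a)^2)" "p^2 * (\<mu> / 4 * a^2 + e^2 / \<mu>) = \<mu> / 4 * (p * a)^2 + p^2 * (e^2 / \<mu>)"
  "\<mu> / 2 * p^2 * a^2 = 2 * (\<mu> / 4 * (p * a)^2)" "2 * q * p * (\<Lambda> * a + e) = 2 * q * p * (\<Lambda> * a) + 2 * q * p * e"
  by (simp_all add: power_mult_distrib distrib_left)
 have c2: "(2 * q * \<Lambda>)^2 / \<mu> = L * q^2" "e^2 / \<mu> = m * e^2" by (simp_all add: L_def m_def power_mult_distrib)
 have c3: "(p^2 *\<^sub>R Gx + (W * p) *\<^sub>R g) \<bullet> Fx + p^2 * W * (- f) = p^2 * (Gx \<bullet> Fx) + (W * p) * (g \<bullet> Fx) - p\<^sup>2 * W * f"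
  by (simp add: inner_add_left)
 show ?thesis unfolding q2 a_def[symmetric] e_def[symmetric] c3 L_def[symmetric] m_def[symmetric] h_def[symmetric]
  using 2 3 4 5 6 pe K unfolding c1(1,3,4) c1(2)[unfolded c2] c2 h_def[symmetric] by linarith
qed

section \<open>The Caccioppoli inequality\<close>

lemma bump_props:
 assumes "R > 0"
 shows "0 <= bump c R x" "bump c R x <= 1" "x \<notin> cball c R ==> bump c R x = 0"
  "x \<in> cball c (R / 2) ==> bump c R x >= 3 / 4"
proof -
 show "0 <= bump c R x" "bump c R x <= 1" by (auto simp: bump_def)
 show "bump c R x = 0" if "x \<notin> cball c R"
 proof -
  have "R^2 <= (norm (x - c))^2" using that assms by (intro power_mono) (auto simp: dist_norm norm_minus_commute)
  then have "1 <= (norm (x - c))^2 / R^2" using assms by simp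
  then show ?thesis by (simp add: bump_def)
 qed
 show "bump c R x >= 3 / 4" if "x \<in> cball c (R / 2)"
 proof -
  have "(norm (x - c))^2 <= (R / 2)^2" using that assms by (intro power_mono) (auto simp: dist_norm norm_minus_commute)
  then have "(norm (x - c))^2 / R^2 <= (R / 2)^2 / R^2" by (intro divide_right_mono) auto
  also have "... = 1 / 4" using assms by (simp add: power_divide)
  finally show ?thesis unfolding bump_def by linarith
 qed
qed

lemma continuous_on_bump: "continuous_on UNIV (bump c R)"
 unfolding bump_def divide_inverse by (intro continuous_intros)

lemma continuous_on_mv:
 fixes A :: "'a::topological_space => real^'n^'m"
 assumes "continuous_on S A" "continuous_on S G"
 shows "continuous_on S (\<lambda>x. A x *v G x)" unfolding matrix_vector_mult_def by (intro continuous_intros assms)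

text \<open>Obtained by testing -div F = f with p^2 (w - k). The free constant \<open>k\<close>
  matters: when \<open>w\<close> is a difference of \<open>v\<close>, it is taken to be the
  increment of a linear function, and the right-hand side then sees the gradient minus a
  constant.\<close>

lemma caccioppoli:
 fixes w :: "real^'n::finite => real" and A :: "real^'n => real^'n^'n"
 assumes w: "grad_pair w G" and F: "div_pair F f" and A: "continuous_on UNIV A"
  and bd: "!!x \<xi>. norm (A x *v \<xi>) <= \<Lambda> * norm \<xi>"
  and el: "!!x \<xi>. \<mu> * (norm \<xi>)^2 <= \<xi> \<bullet> (A x *v \<xi>)" and \<mu>: "\<mu> > 0" and r: "r > 0"
 shows "ball_energy c r G <= cacc_const \<mu> \<Lambda> * (1 / r^2 * ball_energy c (2 * r) (\<lambda>x. w x - k)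
  + ball_energy c (2 * r) (\<lambda>x. F x - A x *v G x) + r^2 * ball_energy c (2 * r) f)"
proof -
 obtain F' where F': "!!x. (F has_derivative F' x) (at x)"
  "!!i. continuous_on UNIV (\<lambda>x. F' x (axis i 1) $ i)" "!!x. f x = - (\<Sum>i\<in>UNIV. F' x (axis i 1) $ i)"
  using F unfolding div_pair_def by blast
 note cont = grad_pair_cont[OF w] div_pair_cont[OF F] A continuous_on_bump
 define R p g where "R = 2 * r" and "p = bump c R" and "g x = (- (4 / R^2)) *\<^sub>R (x - c)" for x :: "real^'n"
 have R: "R > 0" using r by (simp add: R_def)
 have contp: "continuous_on UNIV p" by (simp add: p_def continuous_on_bump)
 note pb = bump_props[OF R, where c = c, folded p_def]
 define K where "K = 4 * \<Lambda>^2 / \<mu> + 1 / \<mu> + 4"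
 define Z where "Z x = (p x)^2 *\<^sub>R G x + ((w x - k) * p x) *\<^sub>R g x" for x
 have contZ: "continuous_on UNIV Z" unfolding Z_def g_def by (intro continuous_intros cont contp)
 have "(LINT x:cball c R|lborel. Z x \<bullet> F x + ((p x)^2 * (w x - k)) * (\<Sum>i\<in>UNIV. F' x (axis i 1) $ i)) = 0"
 proof (rule integral_div_eq_0[OF F'(1,2)])
  fix x
  have 1: "((\<lambda>x. (p x)^2) has_derivative (\<lambda>h. (- (4 * p x / R^2)) *\<^sub>R (x - c) \<bullet> h)) (at x)"
   unfolding p_def by (rule bump_sq_deriv[OF R])
  have 2: "((\<lambda>x. w x - k) has_derivative (\<lambda>h. G x \<bullet> h)) (at x)"
   using w by (auto simp: grad_pair_def intro!: derivative_eq_intros)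
  show "((\<lambda>x. (p x)^2 * (w x - k)) has_derivative (\<lambda>h. Z x \<bullet> h)) (at x)"
   by (rule has_derivative_eq_rhs[OF has_derivative_mult[OF 1 2]])
    (auto simp: Z_def g_def fun_eq_iff inner_add_left algebra_simps)
 qed (use contZ pb in \<open>auto simp: Z_def simp del: mem_cball\<close>)
 also have "(\<lambda>x. Z x \<bullet> F x + ((p x)^2 * (w x - k)) * (\<Sum>i\<in>UNIV. F' x (axis i 1) $ i))
   = (\<lambda>x. Z x \<bullet> F x + (p x)^2 * (w x - k) * (- f x))" by (simp add: F'(3))
 finally have int0: "(LINT x:cball c R|lborel. Z x \<bullet> F x + (p x)^2 * (w x - k) * (- f x)) = 0" .
 define E where "E x = F x - A x *v G x" for x
 have contE: "continuous_on UNIV E" unfolding E_def by (intro continuous_intros continuous_on_mv cont)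
 define S where "S = 1 / r^2 * ball_energy c R (\<lambda>x. w x - k) + ball_energy c R E + r^2 * ball_energy c R f"
 have "(LINT x:cball c R|lborel. \<mu> / 2 * (norm (p x *\<^sub>R G x))^2
    - K * (1 / r^2 * (norm (w x - k))^2 + (norm (E x))^2 + r^2 * (norm (f x))^2))
   <= (LINT x:cball c R|lborel. Z x \<bullet> F x + (p x)^2 * (w x - k) * (- f x))"
 proof (rule set_integral_mono)
  fix x assume x: "x \<in> cball c R"
  have "norm (g x) = 4 / R^2 * norm (x - c)" using R by (simp add: g_def)
  also have "... <= 4 / R^2 * R" using x R by (intro mult_left_mono) (auto simp: dist_norm norm_minus_commute)
  also have "... = 2 / r" using r by (simp add: R_def power2_eq_square)
  finally have g: "norm (g x) <= 2 / r" .
  show "\<mu> / 2 * (norm (p x *\<^sub>R G x))^2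
    - K * (1 / r^2 * (norm (w x - k))^2 + (norm (E x))^2 + r^2 * (norm (f x))^2)
    <= Z x \<bullet> F x + (p x)^2 * (w x - k) * (- f x)"
  proof -
   have "F x = A x *v G x + E x" by (simp add: E_def)
   from caccioppoli_pointwise[OF \<mu> r pb(1)[of x] pb(2)[of x] this bd[of x "G x"] el[of "G x" x] g, of "w x - k" "f x"]
   show ?thesis using pb(1)[of x] unfolding K_def Z_def by (simp add: power_mult_distrib)
  qed
 qed (intro set_integrable_cball continuous_intros cont contp contZ contE; simp)+
 also have "... = 0" by (rule int0)
 also have "(LINT x:cball c R|lborel. \<mu> / 2 * (norm (p x *\<^sub>R G x))^2
    - K * (1 / r^2 * (norm (w x - k))^2 + (norm (E x))^2 + r^2 * (norm (f x))^2))
   = \<mu> / 2 * ball_energy c R (\<lambda>x. p x *\<^sub>R G x) - K * S" unfolding S_def ball_energy_def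
  by (subst set_integral_diff(2) set_integral_add(2) set_integral_mult_right
    | (intro set_integrable_cball continuous_intros cont contp contZ contE; fail) | simp only: refl)+
 finally have main: "\<mu> / 2 * ball_energy c R (\<lambda>x. p x *\<^sub>R G x) <= K * S" by simp
 have "ball_energy c r G <= ball_energy c r (\<lambda>x. (4 / 3) *\<^sub>R p x *\<^sub>R G x)"
 proof (rule ball_energy_mono_fun)
  fix x assume "x \<in> cball c r"
  then have "1 <= 4 / 3 * p x" using pb(4)[of x] by (simp add: R_def)
  then show "norm (G x) <= norm ((4 / 3) *\<^sub>R p x *\<^sub>R G x)"
   using mult_right_mono[of 1 "4 / 3 * p x" "norm (G x)"] pb(1)[of x] by simp
 qed (intro continuous_intros cont contp)+
 also have "... = 16 / 9 * ball_energy c r (\<lambda>x. p x *\<^sub>R G x)" by (simp only: ball_energy_cmul) (simp add: power_divide)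
 also have "... <= 16 / 9 * ball_energy c R (\<lambda>x. p x *\<^sub>R G x)"
  using r by (intro mult_left_mono ball_energy_mono continuous_intros cont contp) (auto simp: R_def)
 also have "... = 32 / (9 * \<mu>) * (\<mu> / 2 * ball_energy c R (\<lambda>x. p x *\<^sub>R G x))" using \<mu> by simp
 also have "... <= 32 / (9 * \<mu>) * (K * S)" using main \<mu> by (intro mult_left_mono) auto
 also have "... <= 4 / \<mu> * (K * S)"
 proof (rule mult_right_mono)
  show "32 / (9 * \<mu>) <= 4 / \<mu>" using \<mu> by (simp add: field_simps)
  have "0 <= K" using \<mu> by (simp add: K_def)
  moreover have "0 <= S" unfolding S_def by (intro add_nonneg_nonneg mult_nonneg_nonneg ball_energy_nonneg) auto
  ultimately show "0 <= K * S" by simp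
 qed
 finally show ?thesis unfolding cacc_const_def K_def S_def R_def mult.assoc by (simp only: E_def[abs_def])
qed

section \<open>Differences against gradients, and a Poincare inequality\<close>

lemma Fubini_compact:
 fixes \<phi> :: "'a::euclidean_space => 'b::euclidean_space => real"
 assumes cont: "continuous_on UNIV (\<lambda>(x, y). \<phi> x y)" and S: "compact S" and T: "compact T"
 shows "(LINT x:S|lborel. LINT y:T|lborel. \<phi> x y) = (LINT y:T|lborel. LINT x:S|lborel. \<phi> x y)"
  and "set_integrable lborel S (\<lambda>x. LINT y:T|lborel. \<phi> x y)"
  and "set_integrable lborel T (\<lambda>y. LINT x:S|lborel. \<phi> x y)"
proof -
 have sf: "pair_sigma_finite (lborel::'a measure) (lborel::'b measure)" ..
 define \<Phi> where "\<Phi> x y = indicat_real S x * (indicat_real T y * \<phi> x y)" for x y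
 have "integrable lborel (\<lambda>z. indicator (S \<times> T) z *\<^sub>R (case z of (x, y) => \<phi> x y))"
  by (rule borel_integrable_compact) (use S T in \<open>auto intro!: compact_Times continuous_on_subset[OF cont]\<close>)
 moreover have "(\<lambda>z. indicator (S \<times> T) z *\<^sub>R (case z of (x, y) => \<phi> x y)) = (\<lambda>(x, y). \<Phi> x y)"
  by (auto simp: \<Phi>_def fun_eq_iff indicator_def)
 ultimately have int: "integrable (lborel \<Otimes>\<^sub>M lborel) (\<lambda>(x, y). \<Phi> x y)" by (simp add: lborel_prod)
 have 1: "(\<integral>y. \<Phi> x y \<partial>lborel) = indicator S x *\<^sub>R (LINT y:T|lborel. \<phi> x y)" for x
  by (simp add: \<Phi>_def set_lebesgue_integral_def)
 have 2: "(\<integral>x. \<Phi> x y \<partial>lborel) = indicator T y *\<^sub>R (LINT x:S|lborel. \<phi> x y)" for y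
  by (simp add: \<Phi>_def set_lebesgue_integral_def mult.left_commute[of "indicator S _"])
 show "(LINT x:S|lborel. LINT y:T|lborel. \<phi> x y) = (LINT y:T|lborel. LINT x:S|lborel. \<phi> x y)"
  using pair_sigma_finite.Fubini_integral[OF sf int] 1 2 by (simp add: set_lebesgue_integral_def)
 show "set_integrable lborel S (\<lambda>x. LINT y:T|lborel. \<phi> x y)"
  using pair_sigma_finite.integrable_fst'[OF sf int] 1 by (simp add: set_integrable_def)
 show "set_integrable lborel T (\<lambda>y. LINT x:S|lborel. \<phi> x y)"
  using pair_sigma_finite.integrable_snd[OF sf int] 2 by (simp add: set_integrable_def)
qed

text \<open>Along the segment from x to x + a the corrected increment is the mean of (G - k) . a.
  Jensen's inequality and Fubini turn its energy into an average over shifted balls, all of which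
  lie in the ball of radius \<open>r\<close>.\<close>

lemma ball_energy_diff_op_le:
 fixes w :: "'a::euclidean_space => real"
 assumes w: "grad_pair w G" and r: "norm a + s <= r"
 shows "ball_energy c s (\<lambda>x. diff_op a w x - a \<bullet> k) <= (norm a)^2 * ball_energy c r (\<lambda>x. G x - k)"
proof -
 note cont = grad_pair_cont[OF w]
 define \<phi> where "\<phi> x t = (norm (G (x + t *\<^sub>R a) - k))^2" for x and t :: real
 have cG: "continuous_on UNIV (\<lambda>(x, t). G (x + t *\<^sub>R a))"
  unfolding case_prod_beta by (rule continuous_on_compose2[OF cont(2)]) (auto intro!: continuous_intros)
 have c\<phi>: "continuous_on UNIV (\<lambda>(x, t). \<phi> x t)"
  unfolding \<phi>_def case_prod_beta by (intro continuous_intros cG[unfolded case_prod_beta])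
 have cGt: "continuous_on UNIV (\<lambda>t. G (x + t *\<^sub>R a))" for x
  by (rule continuous_on_compose2[OF cont(2)]) (auto intro!: continuous_intros)
 have c\<phi>t: "continuous_on UNIV (\<phi> x)" for x unfolding \<phi>_def by (intro continuous_intros cGt)
 have intt: "set_integrable lborel {0..1} h" if "continuous_on UNIV h" for h :: "real => real"
  unfolding set_integrable_def by (rule borel_integrable_compact) (auto intro: continuous_on_subset[OF that])
 have point: "(diff_op a w x - a \<bullet> k)^2 <= (norm a)^2 * (LINT t:{0..1}|lborel. \<phi> x t)" for x
 proof -
  define q where "q t = (G (x + t *\<^sub>R a) - k) \<bullet> a" for t
  have cq: "continuous_on UNIV q" unfolding q_def by (intro continuous_intros cGt)
  have "((\<lambda>t. w (x + t *\<^sub>R a) - t * (k \<bullet> a)) has_vector_derivative q t) (at t within {0..1})" for t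
  proof -
   have "((\<lambda>t. w (x + t *\<^sub>R a)) has_derivative (\<lambda>s. G (x + t *\<^sub>R a) \<bullet> (s *\<^sub>R a))) (at t)"
   proof -
    have "((\<lambda>t. x + t *\<^sub>R a) has_derivative (\<lambda>s. s *\<^sub>R a)) (at t)" by (auto intro!: derivative_eq_intros)
    moreover have "(w has_derivative (\<lambda>h. G (x + t *\<^sub>R a) \<bullet> h)) (at (x + t *\<^sub>R a))"
     using w by (auto simp: grad_pair_def)
    ultimately show ?thesis by (rule has_derivative_compose)
   qed
   then have "((\<lambda>t. w (x + t *\<^sub>R a)) has_vector_derivative (G (x + t *\<^sub>R a) \<bullet> a)) (at t)"
    by (simp add: has_vector_derivative_def)
   then have "((\<lambda>t. w (x + t *\<^sub>R a) - t * (k \<bullet> a)) has_vector_derivative (G (x + t *\<^sub>R a) \<bullet> a - k \<bullet> a)) (at t)"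
    by (auto intro!: derivative_eq_intros)
   then show ?thesis by (auto simp: q_def inner_diff_left intro: has_vector_derivative_at_within)
  qed
  then have "(q has_integral (w (x + 1 *\<^sub>R a) - 1 * (k \<bullet> a)) - (w (x + 0 *\<^sub>R a) - 0 * (k \<bullet> a))) {0..1}"
   by (intro fundamental_theorem_of_calculus) auto
  then have hi: "(q has_integral (diff_op a w x - a \<bullet> k)) {0..1}" by (simp add: diff_op_def inner_commute algebra_simps)
  define m where "m = diff_op a w x - a \<bullet> k"
  have m: "m = (LINT t:{0..1}|lborel. q t)" using set_borel_integral_eq_integral(2)[OF intt[OF cq]] hi
   by (simp add: m_def integral_unique)
  \<comment> \<open>Expanding the variance of \<open>q\<close> about its mean \<open>m\<close> gives
    Jensen's inequality.\<close>
  have "0 <= (LINT t:{0..1}|lborel. (q t - m)^2)" unfolding set_lebesgue_integral_def by (intro integral_nonneg_AE) auto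
  also have "... = (LINT t:{0..1}|lborel. (q t)^2 + ((- 2 * m) * q t + m^2))"
   by (simp add: power2_eq_square algebra_simps)
  also have "... = (LINT t:{0..1}|lborel. (q t)^2) + ((- 2 * m) * (LINT t:{0..1}|lborel. q t) + (LINT t:{0..(1::real)}|lborel. m^2))"
   by (subst set_integral_add, (intro intt continuous_intros cq)+,
     subst set_integral_add, (intro intt continuous_intros cq)+, simp only: set_integral_mult_right)
  also have "(LINT t:{0..(1::real)}|lborel. m^2) = m^2" by (simp add: set_lebesgue_integral_def)
  also have "(LINT t:{0..1}|lborel. (q t)^2) + ((- 2 * m) * (LINT t:{0..1}|lborel. q t) + m^2)
    = (LINT t:{0..1}|lborel. (q t)^2) - m\<^sup>2" by (simp add: m[symmetric] power2_eq_square)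
  finally have "m^2 <= (LINT t:{0..1}|lborel. (q t)^2)" by simp
  also have "... <= (LINT t:{0..1}|lborel. (norm a)^2 * \<phi> x t)"
  proof (rule set_integral_mono)
   fix t
   have "\<bar>q t\<bar> <= norm (G (x + t *\<^sub>R a) - k) * norm a" unfolding q_def by (rule Cauchy_Schwarz_ineq2)
   then have "\<bar>q t\<bar>\<^sup>2 <= (norm (G (x + t *\<^sub>R a) - k) * norm a)^2" by (intro power_mono) auto
   then show "(q t)^2 <= (norm a)^2 * \<phi> x t" by (simp add: \<phi>_def power_mult_distrib mult.commute)
  qed (intro intt continuous_intros cq c\<phi>t)+
  finally show ?thesis by (simp add: m_def)
 qed
 have F: "(LINT x:cball c s|lborel. LINT t:{0..1}|lborel. \<phi> x t) = (LINT t:{0..1}|lborel. LINT x:cball c s|lborel. \<phi> x t)"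
  "set_integrable lborel (cball c s) (\<lambda>x. LINT t:{0..1}|lborel. \<phi> x t)"
  "set_integrable lborel {0..1} (\<lambda>t. LINT x:cball c s|lborel. \<phi> x t)"
  using Fubini_compact[OF c\<phi>, of "cball c s" "{0..1}"] by auto
 have "ball_energy c s (\<lambda>x. diff_op a w x - a \<bullet> k) <= (LINT x:cball c s|lborel. (norm a)^2 * (LINT t:{0..1}|lborel. \<phi> x t))"
  unfolding ball_energy_def
 proof (rule set_integral_mono)
  show "set_integrable lborel (cball c s) (\<lambda>x. (norm (diff_op a w x - a \<bullet> k))^2)"
   by (intro set_integrable_cball continuous_intros cont_diff_op cont)
  show "set_integrable lborel (cball c s) (\<lambda>x. (norm a)^2 * (LINT t:{0..1}|lborel. \<phi> x t))" using F(2) by simp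
 qed (use point in auto)
 also have "... = (norm a)^2 * (LINT t:{0..1}|lborel. LINT x:cball c s|lborel. \<phi> x t)" by (simp add: F(1))
 also have "(LINT t:{0..1}|lborel. LINT x:cball c s|lborel. \<phi> x t) <= (LINT t:{0..1::real}|lborel. ball_energy c r (\<lambda>x. G x - k))"
 proof (rule set_integral_mono[OF F(3)])
  show "set_integrable lborel {0..1::real} (\<lambda>t. ball_energy c r (\<lambda>x. G x - k))" by (intro intt continuous_intros)
  fix t :: real assume t: "t \<in> {0..1}"
  have "(LINT x:cball c s|lborel. \<phi> x t) = ball_energy c s (\<lambda>x. (\<lambda>y. G y - k) (x + t *\<^sub>R a))"
   by (simp add: ball_energy_def \<phi>_def)
  also have "... <= ball_energy c r (\<lambda>x. G x - k)"
  proof (rule ball_energy_shift)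
   have "norm (t *\<^sub>R a) <= norm a" using t by (simp add: mult_left_le_one_le)
   then show "norm (t *\<^sub>R a) + s <= r" using r by linarith
  qed (intro continuous_intros cont)
  finally show "(LINT x:cball c s|lborel. \<phi> x t) <= ball_energy c r (\<lambda>x. G x - k)" .
 qed
 also have "(LINT t:{0..1::real}|lborel. ball_energy c r (\<lambda>x. G x - k)) = ball_energy c r (\<lambda>x. G x - k)"
  by (simp add: set_lebesgue_integral_def)
 finally show ?thesis by (simp add: mult_left_mono)
qed

lemma measure_cball_scale:
 fixes c :: "'a::euclidean_space"
 assumes "r > 0"
 shows "measure lborel (cball c r) = r ^ DIM('a) * measure lborel (cball (0::'a) 1)"
  "measure lborel (cball (0::'a) 1) > 0"
 using assms content_cball[of r c] content_cball[of 1 "0::'a"] unit_ball_vol_pos[of "DIM('a)"] by auto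

text \<open>If no constant worked, none of the values \<open>G x\<close> would. Integrating the
  squared distance from \<open>G x\<close> over \<open>x\<close> and writing y = x + h contradicts
  the bound on the differences: the volume ratio of the balls of radii 2 r and r is 2^d, and the
  spare factor 2 makes the contradiction strict.\<close>

lemma poincare_by_differences:
 fixes G :: "'a::euclidean_space => 'b::euclidean_space"
 assumes cont: "continuous_on UNIV G" and r: "r > 0"
  and B: "!!h. norm h <= 2 * r ==> ball_energy c r (diff_op h G) <= B"
  and B0: "B > 0"
 shows "\<exists>k. ball_energy c r (\<lambda>x. G x - k) <= 2 ^ (DIM('a) + 1) * B"
proof (rule ccontr)
 assume "\<not> ?thesis"
 then have big: "2 ^ (DIM('a) + 1) * B < ball_energy c r (\<lambda>x. G x - k)" for k by (auto simp: not_le)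
 define \<phi> where "\<phi> x y = (norm (G (x + y) - G x))^2" for x y
 have c\<phi>: "continuous_on UNIV (\<lambda>(x, y). \<phi> x y)"
 proof -
  have "continuous_on UNIV (\<lambda>(x, y). G (x + y))"
   unfolding case_prod_beta by (rule continuous_on_compose2[OF cont]) (auto intro!: continuous_intros)
  moreover have "continuous_on UNIV (\<lambda>(x, y::'a). G x)"
   unfolding case_prod_beta by (rule continuous_on_compose2[OF cont]) (auto intro!: continuous_intros)
  ultimately show ?thesis unfolding \<phi>_def case_prod_beta by (intro continuous_intros)
 qed
 let ?V = "measure lborel (cball c r)"
 have lower: "2 ^ (DIM('a) + 1) * B <= (LINT h:cball 0 (2 * r)|lborel. \<phi> x h)" if x: "x \<in> cball c r" for x
 proof -
  have "ball_energy c r (\<lambda>y. G y - G x) = ball_energy (c - x) r (\<lambda>h. G (h + x) - G x)"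
   using ball_energy_shift_eq[of "\<lambda>y. G y - G x" "c - x" r x] cont by (simp add: continuous_on_diff)
  also have "... <= ball_energy 0 (2 * r) (\<lambda>h. G (h + x) - G x)"
  proof (rule ball_energy_mono_set)
   show "cball (c - x) r \<subseteq> cball 0 (2 * r)"
   proof
    fix z assume "z \<in> cball (c - x) r"
    then have "norm (z - (c - x)) <= r" "norm (c - x) <= r" using x by (auto simp: dist_norm norm_minus_commute)
    then show "z \<in> cball 0 (2 * r)" using norm_triangle_ineq[of "z - (c - x)" "c - x"] by simp
   qed
  qed (intro continuous_intros cont_shift cont)
  finally show ?thesis using big[of "G x"] by (simp add: ball_energy_def \<phi>_def add.commute)
 qed
 note F = Fubini_compact[OF c\<phi> compact_cball[of c r] compact_cball[of 0 "2 * r"]]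
 have intc: "set_integrable lborel (cball a s) (\<lambda>_. k)" for a :: 'a and s k :: real
  by (intro set_integrable_cball continuous_intros)
 have cst: "(LINT x:cball a s|lborel. k) = measure lborel (cball a s) * k" for a :: 'a and s k :: real
  by (simp add: set_lebesgue_integral_def)
 have "?V * (2 ^ (DIM('a) + 1) * B) <= (LINT x:cball c r|lborel. LINT h:cball 0 (2 * r)|lborel. \<phi> x h)"
  unfolding cst[symmetric] by (rule set_integral_mono[OF intc F(2)]) (use lower in auto)
 also have "... = (LINT h:cball 0 (2 * r)|lborel. LINT x:cball c r|lborel. \<phi> x h)" by (rule F(1))
 also have "... <= (LINT h:cball (0::'a) (2 * r)|lborel. B)"
 proof (rule set_integral_mono[OF F(3) intc])
  fix h :: 'a assume "h \<in> cball 0 (2 * r)"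
  then show "(LINT x:cball c r|lborel. \<phi> x h) <= B" using B[of h] by (simp add: ball_energy_def diff_op_def \<phi>_def)
 qed
 also have "... = measure lborel (cball (0::'a) (2 * r)) * B" by (rule cst)
 also have "measure lborel (cball (0::'a) (2 * r)) = 2 ^ DIM('a) * ?V"
  using r measure_cball_scale(1)[of "2 * r" "0::'a"] measure_cball_scale(1)[of r c] by (simp add: power_mult_distrib)
 finally have "(?V * B) * 2 ^ DIM('a) <= 0" by (simp add: algebra_simps)
 moreover have "?V > 0" using measure_cball_scale(1)[of r c] measure_cball_scale(2)[OF r, where 'a='a] r by simp
 ultimately show False using B0 by (smt (verit) mult_pos_pos zero_less_power)
qed

section \<open>Differences of approximate solutions\<close>

text \<open>\<open>v\<close> with gradient \<open>G\<close> solves -div(A G) = f up to the defect F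
  - A G, which is kept as an error so that mollified weak solutions fit. The modulus \<omega> is any
  even subadditive function; it controls \<open>A\<close> only inside the ball of radius
  \<open>r0\<close>, whereas the bounds on \<open>A\<close> itself are global.\<close>

locale approx_solution =
 fixes A :: "real^'n::finite => real^'n^'n" and \<mu> \<Lambda> :: real and c :: "real^'n" and r0 :: real
  and \<omega> :: "real^'n => real" and v :: "real^'n => real" and G F :: "real^'n => real^'n"
  and f :: "real^'n => real"
 assumes contA: "continuous_on UNIV A"
  and bd: "!!x \<xi>. norm (A x *v \<xi>) <= \<Lambda> * norm \<xi>"
  and el: "!!x \<xi>. \<mu> * (norm \<xi>)^2 <= \<xi> \<bullet> (A x *v \<xi>)" and \<mu>: "\<mu> > 0"
  and om: "!!x h \<xi>. x \<in> cball c r0 ==> x + h \<in> cball c r0 ==> norm ((A (x + h) - A x) *v \<xi>) <= \<omega> h * norm \<xi>"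
  and om_nonneg: "!!h. 0 <= \<omega> h" and om_add: "!!h k. \<omega> (h + k) <= \<omega> h + \<omega> k"
  and om_minus: "!!h. \<omega> (- h) = \<omega> h" and om_zero: "\<omega> 0 = 0"
  and vG: "grad_pair v G" and Ff: "div_pair F f"
begin

abbreviation I :: "real => (real^'n => 'b::real_normed_vector) => real" where
 "I r g \<equiv> ball_energy c r g"

definition E :: "real^'n => real^'n" where "E x = F x - A x *v G x"

text \<open>What the equation of a difference feels apart from the difference itself: the
  oscillation of the coefficient acting on \<open>G\<close>, the defect, and the source with its
  natural factor r^2.\<close>

definition err :: "real => real => real" where
 "err \<tau> r = \<tau>^2 * I r G + I r E + r^2 * I r f"

abbreviation C1 :: real where "C1 \<equiv> cacc_const \<mu> \<Lambda>"

lemma C1_nonneg: "0 <= C1"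
 using \<mu> by (simp add: cacc_const_def)

lemmas contG = grad_pair_cont(2)[OF vG] and contF = div_pair_cont(1)[OF Ff] and contf = div_pair_cont(2)[OF Ff]

lemma contE: "continuous_on UNIV E"
 unfolding E_def by (intro continuous_intros continuous_on_mv contA contG contF)

lemma contDG: "continuous_on UNIV (diff_ops H G)"
 by (intro cont_diff_ops contG)

lemma om_diff: "\<omega> (h - k) <= \<omega> h + \<omega> k"
 using om_add[of h "- k"] om_minus[of k] by simp

lemma om_mult: "\<omega> (real n *\<^sub>R h) <= real n * \<omega> h"
proof (induction n)
 case (Suc n)
 have "\<omega> (real (Suc n) *\<^sub>R h) <= \<omega> (real n *\<^sub>R h) + \<omega> h" using om_add[of "real n *\<^sub>R h" h] by (simp add: algebra_simps)
 then show ?case using Suc by (simp add: algebra_simps)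
qed (simp add: om_zero)

lemma err_nonneg: "0 <= err \<tau> r"
 unfolding err_def by (intro add_nonneg_nonneg mult_nonneg_nonneg) auto

lemma err_mono:
 assumes "r <= s" "0 <= r"
 shows "err \<tau> r <= err \<tau> s"
proof -
 have "r^2 * I r f <= s^2 * I s f" using assms by (intro mult_mono ball_energy_mono contf power_mono) auto
 then show ?thesis unfolding err_def using assms(1) by (intro add_mono mult_left_mono ball_energy_mono contG contE) auto
qed

lemma err_scale:
 assumes "m >= 1" 
 shows "err (m * \<tau>) r <= m^2 * err \<tau> r"
proof -
 have "1 <= m^2" using assms by simp
 then have "I r E + r^2 * I r f <= m^2 * (I r E + r^2 * I r f)"
  using mult_right_mono[of 1 "m^2" "I r E + r^2 * I r f"] by simp
 then show ?thesis by (simp add: err_def power_mult_distrib algebra_simps)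
qed

text \<open>Discrete Leibniz rule: a difference falls either on the earlier commutator or on the
  coefficient, where it contributes \<tau> times a difference of \<open>G\<close> of lower order.
  The base 10 closes the induction because 8 * 10^k + 2 * 4^k <= 10^(k + 1).\<close>

lemma commutator:
 assumes "!!h. h \<in> set H ==> \<omega> h <= \<tau>" "s + len_sum H <= r" "r <= r0"
 shows "I s (\<lambda>x. diff_ops H F x - A x *v diff_ops H G x) <= 10 ^ length H * (\<tau>^2 * I r G + I r E)" using assms(1,2)
proof (induction H arbitrary: s)
 case Nil
 have "I s E <= I r E" using Nil by (intro ball_energy_mono contE) auto
 moreover have "0 <= \<tau>^2 * I r G" by simp
 ultimately show ?case by (simp add: E_def[abs_def] add_increasing)
next
 case (Cons h H)
 define K where "K x = diff_ops H F x - A x *v diff_ops H G x" for x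
 define g where "g = diff_ops H G"
 have contK: "continuous_on UNIV K"
  unfolding K_def by (intro continuous_intros continuous_on_mv contA cont_diff_ops contG contF)
 have contg: "continuous_on UNIV g" unfolding g_def by (rule contDG)
 have contM: "continuous_on UNIV (\<lambda>x. (A (x + h) - A x) *v g (x + h))"
  by (intro continuous_on_mv continuous_intros contA cont_shift contg)
 have eq: "diff_ops (h # H) F x - A x *v diff_ops (h # H) G x
   = diff_op h K x + (A (x + h) - A x) *v g (x + h)" for x
  by (simp add: diff_op_def K_def g_def matrix_vector_mult_diff_distrib matrix_vector_mult_diff_rdistrib)
 have sr: "s + norm h <= r" using Cons.prems(2) len_sum_nonneg[of H] unfolding len_sum_simps by linarith
 have "I s (\<lambda>x. diff_ops (h # H) F x - A x *v diff_ops (h # H) G x)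
   <= 2 * I s (diff_op h K) + 2 * I s (\<lambda>x. (A (x + h) - A x) *v g (x + h))"
  unfolding eq by (intro ball_energy_add cont_diff_op contK contM)
 also have "I s (diff_op h K) <= 4 * I (s + norm h) K" by (intro ball_energy_diff_op contK) auto
 also have "I (s + norm h) K <= 10 ^ length H * (\<tau>^2 * I r G + I r E)"
  unfolding K_def by (rule Cons.IH) (use Cons.prems in auto)
 also have "I s (\<lambda>x. (A (x + h) - A x) *v g (x + h)) <= I s (\<lambda>x. \<tau> *\<^sub>R g (x + h))"
 proof (rule ball_energy_mono_fun)
  fix x assume x: "x \<in> cball c s"
  have "x + h \<in> cball c (s + norm h)" using x dist_triangle[of c "x + h" x] by (simp add: dist_norm norm_minus_commute)
  then have "x \<in> cball c r0" "x + h \<in> cball c r0"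
   using x sr assms(3) norm_ge_zero[of h] unfolding mem_cball by linarith+
  then have "norm ((A (x + h) - A x) *v g (x + h)) <= \<omega> h * norm (g (x + h))" by (rule om)
  also have "... <= \<tau> * norm (g (x + h))" using Cons.prems(1)[of h] by (intro mult_right_mono) auto
  finally show "norm ((A (x + h) - A x) *v g (x + h)) <= norm (\<tau> *\<^sub>R g (x + h))"
   using Cons.prems(1)[of h] om_nonneg[of h] by simp
 qed (intro contM continuous_intros cont_shift contg)+
 also have "... = \<tau>^2 * I s (\<lambda>x. g (x + h))" by (rule ball_energy_cmul)
 also have "I s (\<lambda>x. g (x + h)) <= I (s + norm h) g" by (intro ball_energy_shift contg) auto
 also have "... <= 4 ^ length H * I r G" unfolding g_def using Cons.prems(2) by (intro ball_energy_diff_ops contG) auto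
 finally have "I s (\<lambda>x. diff_ops (h # H) F x - A x *v diff_ops (h # H) G x)
  <= 2 * (4 * (10 ^ length H * (\<tau>^2 * I r G + I r E))) + 2 * (\<tau>^2 * (4 ^ length H * I r G))"
  by (simp add: mult_left_mono)
 also have "\<tau>^2 * (4 ^ length H * I r G) <= 10 ^ length H * (\<tau>^2 * I r G)"
  using mult_right_mono[of "4 ^ length H" "10 ^ length H" "\<tau>^2 * I r G"] by (simp add: power_mono algebra_simps)
 also have "... <= 10 ^ length H * (\<tau>^2 * I r G + I r E)" by (intro mult_left_mono) auto
 finally show ?case by (simp add: algebra_simps)
qed

text \<open>The engine of the method: one more difference along a short vector gains (|a| / r)^2, as
  a derivative would for constant coefficients, at the price of \<open>err\<close>. The radius
  doubles once in the Caccioppoli inequality and once in the passage from differences of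
  \<open>v\<close> to \<open>G\<close>.\<close>

lemma diff_energy:
 assumes "\<omega> a <= \<tau>" "!!h. h \<in> set H ==> \<omega> h <= \<tau>" "norm a + len_sum H <= r" "4 * r <= r0" "r > 0"
 shows "I r (diff_op a (diff_ops H G))
   <= C1 * ((norm a / r)^2 * I (4 * r) (\<lambda>x. diff_ops H G x - k) + 10 ^ (length H + 1) * err \<tau> (4 * r))"
proof -
 let ?w = "diff_op a (diff_ops H v)"
 have w: "grad_pair ?w (diff_op a (diff_ops H G))" by (intro grad_pair_diff_op grad_pair_diff_ops vG)
 have F': "div_pair (diff_ops (a # H) F) (diff_ops (a # H) f)" by (intro div_pair_diff_ops Ff)
 have na: "norm a <= r" using assms(3) len_sum_nonneg[of H] by linarith
 have 1: "1 / r^2 * I (2 * r) (\<lambda>x. ?w x - a \<bullet> k) <= (norm a / r)^2 * I (4 * r) (\<lambda>x. diff_ops H G x - k)"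
 proof -
  have "I (2 * r) (\<lambda>x. ?w x - a \<bullet> k) <= (norm a)^2 * I (4 * r) (\<lambda>x. diff_ops H G x - k)"
   by (rule ball_energy_diff_op_le[OF grad_pair_diff_ops[OF vG]]) (use na assms(5) in auto)
  then have "1 / r^2 * I (2 * r) (\<lambda>x. ?w x - a \<bullet> k) <= 1 / r^2 * ((norm a)^2 * I (4 * r) (\<lambda>x. diff_ops H G x - k))"
   by (intro mult_left_mono) auto
  then show ?thesis by (simp add: power_divide)
 qed
 have 2: "I (2 * r) (\<lambda>x. diff_ops (a # H) F x - A x *v diff_op a (diff_ops H G) x)
   <= 10 ^ (length H + 1) * (\<tau>^2 * I (4 * r) G + I (4 * r) E)"
  using commutator[of "a # H" \<tau> "2 * r" "4 * r"] assms by auto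
 have 3: "r^2 * I (2 * r) (diff_ops (a # H) f) <= 10 ^ (length H + 1) * ((4 * r)^2 * I (4 * r) f)"
 proof -
  have "I (2 * r) (diff_ops (a # H) f) <= 4 ^ length (a # H) * I (4 * r) f"
   using assms by (intro ball_energy_diff_ops contf) auto
  also have "... <= 10 ^ length (a # H) * I (4 * r) f" by (intro mult_right_mono power_mono) auto
  finally have "r^2 * I (2 * r) (diff_ops (a # H) f) <= (4 * r)^2 * (10 ^ length (a # H) * I (4 * r) f)"
   using assms(5) by (intro mult_mono power_mono) auto
  then show ?thesis by (simp add: algebra_simps)
 qed
 have "I r (diff_op a (diff_ops H G)) <= C1 * (1 / r^2 * I (2 * r) (\<lambda>x. ?w x - a \<bullet> k)
  + I (2 * r) (\<lambda>x. diff_ops (a # H) F x - A x *v diff_op a (diff_ops H G) x) + r^2 * I (2 * r) (diff_ops (a # H) f))"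
  by (rule caccioppoli[OF w F' contA bd el \<mu> assms(5)])
 also have "... <= C1 * ((norm a / r)^2 * I (4 * r) (\<lambda>x. diff_ops H G x - k) + 10 ^ (length H + 1) * err \<tau> (4 * r))"
  using 1 2 3 C1_nonneg by (intro mult_left_mono) (auto simp: err_def algebra_simps)
 finally show ?thesis .
qed

section \<open>Almost periods and the lengthening of shifts\<close>

definition dense_shifts :: "real => real => real => bool" where
 "dense_shifts \<tau> l s \<longleftrightarrow> (\<forall>z. norm z <= s --> (\<exists>h. norm (h - z) <= l \<and> \<omega> h <= \<tau>))"

text \<open>Concerns the short vectors by which sums and differences of almost periods miss other
  almost periods. Their modulus can exceed \<tau>, hence the separate threshold \<sigma>.\<close>

definition small_shift_bound :: "real => real => real => real => bool" where
 "small_shift_bound \<sigma> l s W \<longleftrightarrow> (\<forall>a. norm a <= l --> \<omega> a <= \<sigma> --> I (s / 16) (diff_op a G) <= W)"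

lemma small_shift_bound_nonneg: "small_shift_bound \<sigma> l s W ==> 0 <= l ==> 0 <= \<sigma> ==> 0 <= W"
 unfolding small_shift_bound_def using om_zero ball_energy_nonneg by (metis norm_zero order_trans)

lemma shifted_small:
 assumes W: "small_shift_bound \<sigma> l s W" and b: "norm b <= l" "\<omega> b <= \<sigma>"
  and sz: "norm h + len_sum H + r <= s / 16"
 shows "I r (\<lambda>x. diff_op b (diff_ops H G) (x + h)) <= 4 ^ length H * W"
proof -
 have "I r (\<lambda>x. diff_op b (diff_ops H G) (x + h)) <= I (norm h + r) (diff_op b (diff_ops H G))"
  by (intro ball_energy_shift cont_diff_op contDG) auto
 also have "... = I (norm h + r) (diff_ops H (diff_op b G))" by (simp add: diff_op_diff_ops)
 also have "... <= 4 ^ length H * I (s / 16) (diff_op b G)"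
  by (intro ball_energy_diff_ops cont_diff_op contG) (use sz in auto)
 also have "... <= 4 ^ length H * W" using W b by (intro mult_left_mono) (auto simp: small_shift_bound_def)
 finally show ?thesis .
qed

text \<open>A telescoping sum shows that n D_h g equals D_(n h) g minus the sum of D_(i h) D_h g
  over i < n. So a short difference is 1 / n of a long one up to second differences, which
  \<open>diff_energy\<close> makes small. As n h need not be an almost period, a nearby one takes
  its place and \<open>W\<close> pays for the discrepancy.\<close>

lemma enlarge_slot:
 assumes dense: "dense_shifts \<tau> l s" and W: "small_shift_bound ((real n + 3) * \<tau>) (3 * l) s W"
  and h: "norm h <= \<rho> / (2 * real n)" "\<omega> h <= \<tau>"
  and H: "!!k. k \<in> set H ==> norm k <= \<rho> \<and> \<omega> k <= \<tau>"
  and sz: "n >= 1" "0 <= l" "l <= \<rho> / 2" "(real (length H) + 2) * \<rho> <= r" "r <= s / 64" "4 * r <= r0" "r > 0" "0 < \<rho>"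
 shows "\<exists>h'. norm h' <= \<rho> \<and> \<omega> h' <= \<tau> \<and>
  I r (diff_ops (h # H) G) <= 4 / (real n)^2 * (I r (diff_ops (h' # H) G) + 4 ^ length H * W)
   + 2 * C1 * ((\<rho> / (2 * r))^2 * I (4 * r) (diff_ops (h # H) G) + 10 ^ (length H + 2) * (real n)^2 * err \<tau> (4 * r))"
proof -
 have tau0: "0 <= \<tau>" using h(2) om_nonneg[of h] by linarith
 have lH: "len_sum H <= real (length H) * \<rho>" by (rule len_sum_le) (use H in auto)
 have rs: "\<rho> <= r" "len_sum H + 2 * \<rho> <= r" proof -
  have "0 <= real (length H) * \<rho>" using sz(8) by simp
  then show "\<rho> <= r" "len_sum H + 2 * \<rho> <= r" using sz(4,8) lH unfolding distrib_right by linarith+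
 qed
 have nh: "norm (real n *\<^sub>R h) <= \<rho> / 2" using mult_left_mono[OF h(1), of "real n"] sz(1) by simp
 obtain h' where h': "norm (h' - real n *\<^sub>R h) <= l" "\<omega> h' <= \<tau>"
 proof -
  have "norm (real n *\<^sub>R h) <= s" using nh rs(1) sz(5,7,8) by linarith
  then show ?thesis using dense that unfolding dense_shifts_def by blast
 qed
 define b where "b = real n *\<^sub>R h - h'"
 have nh': "norm h' <= \<rho>" using norm_triangle_ineq[of "h' - real n *\<^sub>R h" "real n *\<^sub>R h"] h'(1) nh sz by simp
 \<comment> \<open>Here l and n + 1 would do. The rounder constants let the same bound
   \<open>W\<close> serve \<open>shift_to_almost_period\<close>, where a difference of two almost
   periods is approximated by a third one.\<close>
 have b: "norm b <= 3 * l" "\<omega> b <= (real n + 3) * \<tau>"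
 proof -
  show "norm b <= 3 * l" using h'(1) sz(2) by (simp add: b_def norm_minus_commute)
  have "\<omega> b <= real n * \<omega> h + \<omega> h'" using om_diff[of "real n *\<^sub>R h" h'] om_mult[of n h] by (simp add: b_def)
  also have "... <= real n * \<tau> + \<tau>" using h(2) h'(2) by (intro add_mono mult_left_mono) auto
  finally show "\<omega> b <= (real n + 3) * \<tau>" using tau0 by (simp add: algebra_simps)
 qed
 define g where "g = diff_ops H G"
 have cg: "continuous_on UNIV g" unfolding g_def by (rule contDG)
 have tele: "(\<Sum>i<m. diff_op h g (x + real i *\<^sub>R h)) = diff_op (real m *\<^sub>R h) g x" for m x
  by (induction m) (auto simp: diff_op_def algebra_simps)
 have "(\<Sum>i<n. diff_op (real i *\<^sub>R h) (diff_op h g) x) = diff_op (real n *\<^sub>R h) g x - real n *\<^sub>R diff_op h g x" for x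
 proof -
  have "(\<Sum>i<n. diff_op (real i *\<^sub>R h) (diff_op h g) x) = (\<Sum>i<n. diff_op h g (x + real i *\<^sub>R h) - diff_op h g x)"
   by (simp add: diff_op_def)
  also have "... = diff_op (real n *\<^sub>R h) g x - real n *\<^sub>R diff_op h g x"
   by (simp add: sum_subtractf tele sum_constant_scaleR del: sum_constant)
  finally show ?thesis .
 qed
 moreover have "diff_op (real n *\<^sub>R h) g x = diff_op b g (x + h') + diff_op h' g x" for x
  by (simp add: diff_op_def b_def algebra_simps)
 ultimately have id: "(\<lambda>x. real n *\<^sub>R diff_op h g x) =
   (\<lambda>x. (diff_op b g (x + h') + diff_op h' g x) - (\<Sum>i<n. diff_op (real i *\<^sub>R h) (diff_op h g) x))"
  by (auto simp: fun_eq_iff)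
 have each: "I r (diff_op (real i *\<^sub>R h) (diff_op h g)) <= C1 * ((\<rho> / (2 * r))^2 * I (4 * r) (diff_op h g)
   + 10 ^ (length H + 2) * ((real n)^2 * err \<tau> (4 * r)))" if "i < n" for i
 proof -
  have ni: "norm (real i *\<^sub>R h) <= \<rho> / 2"
  proof -
   have "norm (real i *\<^sub>R h) <= norm (real n *\<^sub>R h)" using that by (simp add: mult_right_mono)
   then show ?thesis using nh by linarith
  qed
  have "norm h <= norm (real n *\<^sub>R h)" using sz(1) mult_right_mono[of 1 "real n" "norm h"] by simp
  then have nh1: "norm h <= \<rho> / 2" using nh by linarith
  have oi: "\<omega> (real i *\<^sub>R h) <= real n * \<tau>"
  proof -
   have "\<omega> (real i *\<^sub>R h) <= real i * \<omega> h" by (rule om_mult)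
   also have "... <= real n * \<tau>" using that h(2) om_nonneg[of h] by (intro mult_mono) auto
   finally show ?thesis .
  qed
  have t1: "\<tau> <= real n * \<tau>" using mult_right_mono[of 1 "real n" \<tau>] sz(1) tau0 by simp
  \<comment> \<open>The modulus of i h can reach n \<tau>, so \<open>diff_energy\<close> is used
    with n \<tau> in place of \<tau>; this produces the factor n^2 in front of
    \<open>err\<close>.\<close>
  have "I r (diff_op (real i *\<^sub>R h) (diff_ops (h # H) G))
    <= C1 * ((norm (real i *\<^sub>R h) / r)^2 * I (4 * r) (\<lambda>x. diff_ops (h # H) G x - 0)
      + 10 ^ (length (h # H) + 1) * err (real n * \<tau>) (4 * r))"
  proof (rule diff_energy)
   show "\<omega> k <= real n * \<tau>" if "k \<in> set (h # H)" for k using that H h(2) t1 by force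
   show "norm (real i *\<^sub>R h) + len_sum (h # H) <= r" unfolding len_sum_simps using ni nh1 rs sz(8) by linarith
  qed (use oi sz in auto)
  also have "... <= C1 * ((\<rho> / (2 * r))^2 * I (4 * r) (diff_op h g) + 10 ^ (length H + 2) * ((real n)^2 * err \<tau> (4 * r)))"
  proof (intro mult_left_mono add_mono C1_nonneg)
   have "(norm (real i *\<^sub>R h) / r)^2 <= (\<rho> / (2 * r))^2"
   proof (rule power_mono)
    show "norm (real i *\<^sub>R h) / r <= \<rho> / (2 * r)" using divide_right_mono[OF ni, of r] sz by simp
   qed (use sz in auto)
   then show "(norm (real i *\<^sub>R h) / r)^2 * I (4 * r) (\<lambda>x. diff_ops (h # H) G x - 0) <= (\<rho> / (2 * r))^2 * I (4 * r) (diff_op h g)"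
    by (simp add: g_def mult_right_mono)
   show "10 ^ (length (h # H) + 1) * err (real n * \<tau>) (4 * r) <= 10 ^ (length H + 2) * ((real n)^2 * err \<tau> (4 * r))"
    using err_scale[of "real n" \<tau> "4 * r"] sz(1) by simp
  qed
  finally show ?thesis by (simp add: g_def)
 qed
 define Q where "Q = (\<rho> / (2 * r))^2 * I (4 * r) (diff_op h g) + 10 ^ (length H + 2) * ((real n)^2 * err \<tau> (4 * r))"
 have "(real n)^2 * I r (diff_op h g) = I r (\<lambda>x. real n *\<^sub>R diff_op h g x)" by (simp add: ball_energy_cmul)
 also have "... <= 2 * I r (\<lambda>x. diff_op b g (x + h') + diff_op h' g x)
   + 2 * I r (\<lambda>x. \<Sum>i<n. diff_op (real i *\<^sub>R h) (diff_op h g) x)"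
  unfolding id by (intro ball_energy_diff continuous_intros cont_diff_op cont_shift cg continuous_on_sum)
 also have "I r (\<lambda>x. diff_op b g (x + h') + diff_op h' g x)
   <= 2 * I r (\<lambda>x. diff_op b g (x + h')) + 2 * I r (diff_op h' g)" by (intro ball_energy_add cont_diff_op cont_shift cg)
 also have "I r (\<lambda>x. diff_op b g (x + h')) <= 4 ^ length H * W"
  unfolding g_def by (rule shifted_small[OF W b]) (use nh' rs sz in auto)
 also have "I r (\<lambda>x. \<Sum>i<n. diff_op (real i *\<^sub>R h) (diff_op h g) x)
   <= real n * (\<Sum>i<n. I r (diff_op (real i *\<^sub>R h) (diff_op h g)))" by (intro ball_energy_sum cont_diff_op cg)
 also have "(\<Sum>i<n. I r (diff_op (real i *\<^sub>R h) (diff_op h g))) <= (\<Sum>i<n. C1 * Q)"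
  using each by (intro sum_mono) (auto simp: Q_def)
 finally have "(real n)^2 * I r (diff_op h g) <= 2 * (2 * (4 ^ length H * W) + 2 * I r (diff_op h' g)) + 2 * (real n * (\<Sum>i<n. C1 * Q))"
  by (simp only: mult_left_mono add_mono of_nat_0_le_iff zero_le_numeral)
 moreover have "2 * (real n * (\<Sum>i<n. C1 * Q)) = (real n)^2 * (2 * C1 * Q)" by (simp add: power2_eq_square)
 ultimately have "(real n)^2 * I r (diff_op h g) <= 4 * (I r (diff_op h' g) + 4 ^ length H * W) + (real n)^2 * (2 * C1 * Q)"
  by (simp only: distrib_left)
 then have "I r (diff_op h g) <= (4 * (I r (diff_op h' g) + 4 ^ length H * W) + (real n)^2 * (2 * C1 * Q)) / (real n)^2"
  using sz(1) by (simp add: pos_le_divide_eq mult.commute)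
 also have "... = 4 / (real n)^2 * (I r (diff_op h' g) + 4 ^ length H * W) + 2 * C1 * Q"
  using sz(1) by (simp add: add_divide_distrib)
 finally show ?thesis using nh' h'(2) by (intro exI[of _ h']) (simp add: g_def Q_def mult.assoc)
qed

end

text \<open>A tent is a convex combination of translated tents of half the radius, so averages of \<open>|G|\<^sup>2\<close> against tents pass to
 smaller radii with constant 1, whereas balls would lose a factor at every scale.\<close>

definition hat :: "real => real => real" where
 "hat r t = max 0 (1 - \<bar>t\<bar> / r)"

definition tent :: "real^'n::finite => real => real^'n => real" where
 "tent y r x = (\<Prod>k\<in>UNIV. hat r (x $ k - y $ k))"

text \<open>A tent of radius r has integral r^d, so this is a true average.\<close>

definition tent_avg :: "real^'n::finite => real => (real^'n => real) => real" where
 "tent_avg y r q = (\<integral>x. tent y r x * q x \<partial>lborel) / r ^ CARD('n)"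

lemma hat_bounds: "r > 0 ==> 0 <= hat r t" "r > 0 ==> hat r t <= 1"
 by (auto simp: hat_def)

text \<open>The two-scale relation of the linear B-spline. In the variable u = 2 t / r both sides
  are piecewise linear with integer breakpoints, so it reduces to a case check.\<close>

lemma hat_refine:
 assumes "r > 0"
 shows "hat r t = (\<Sum>e\<in>{-1, 0, 1::int}. (if e = 0 then 1 else 1 / 2) * hat (r / 2) (t - (r / 2) * of_int e))"
proof -
 define u where "u = t / (r / 2)"
 have t: "t = u * (r / 2)" using assms by (simp add: u_def)
 have 1: "hat (r / 2) (t - (r / 2) * of_int e) = max 0 (1 - \<bar>u - of_int e\<bar>)" for e
 proof -
  have "t - (r / 2) * of_int e = (u - of_int e) * (r / 2)" by (simp add: t algebra_simps)
  then have "\<bar>t - (r / 2) * of_int e\<bar> / (r / 2) = \<bar>(u - of_int e) * (r / 2)\<bar> / (r / 2)" by (simp only:)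
  also have "... = \<bar>u - of_int e\<bar>" using assms by (simp add: abs_mult)
  finally show ?thesis by (simp add: hat_def)
 qed
 have 2: "hat r t = max 0 (1 - \<bar>u\<bar> / 2)" using assms by (simp add: hat_def t abs_mult)
 show ?thesis unfolding 1 2 by (simp add: max_def abs_if field_simps)
qed

lemma hat_lipschitz:
 assumes "r > 0"
 shows "\<bar>hat r s - hat r t\<bar> <= \<bar>s - t\<bar> / r"
proof -
 have "\<bar>\<bar>s\<bar> / r - \<bar>t\<bar> / r\<bar> <= \<bar>s - t\<bar> / r" using assms by (simp add: diff_divide_distrib[symmetric] divide_right_mono)
 then show ?thesis unfolding hat_def by linarith
qed

lemma tent_bounds: "r > 0 ==> 0 <= tent y r x" "r > 0 ==> tent y r x <= 1"
 unfolding tent_def by (auto intro!: prod_nonneg prod_le_1 hat_bounds)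

lemma tent_eq_0:
 assumes "r > 0" "x \<notin> cball y (real CARD('n) * r)"
 shows "tent y r (x :: real^'n::finite) = 0"
proof -
 have "\<exists>k. \<bar>x $ k - y $ k\<bar> >= r"
 proof (rule ccontr)
  assume "\<not> ?thesis"
  then have "!!k. \<bar>(x - y) $ k\<bar> <= r" by (auto simp: not_le less_imp_le)
  then have "(\<Sum>k\<in>UNIV. \<bar>(x - y) $ k\<bar>) <= (\<Sum>k\<in>(UNIV::'n set). r)" by (intro sum_mono)
  then have "norm (x - y) <= real CARD('n) * r" using norm_le_l1_cart[of "x - y"] by simp
  then show False using assms by (simp add: dist_norm norm_minus_commute)
 qed
 then obtain k where "\<bar>x $ k - y $ k\<bar> >= r" by blast
 then have "hat r (x $ k - y $ k) = 0" using assms(1) by (simp add: hat_def)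
 then show ?thesis unfolding tent_def by (intro prod_zero) auto
qed

lemma tent_lower:
 assumes "r > 0" "x \<in> cball y (r / 2)"
 shows "(1 / 2) ^ CARD('n) <= tent y r (x :: real^'n::finite)"
proof -
 have "1 / 2 <= hat r (x $ k - y $ k)" for k
 proof -
  have "\<bar>x $ k - y $ k\<bar> <= norm (x - y)" using component_le_norm_cart[of "x - y" k] by simp
  also have "... <= r / 2" using assms by (simp add: dist_norm norm_minus_commute)
  finally have "\<bar>x $ k - y $ k\<bar> / r <= 1 / 2" using assms(1) by (simp add: field_simps)
  then show ?thesis unfolding hat_def by linarith
 qed
 then have "(\<Prod>k\<in>(UNIV::'n set). 1 / 2) <= tent y r x" unfolding tent_def by (intro prod_mono) auto
 then show ?thesis by simp
qed

lemma continuous_on_tent: "continuous_on UNIV (tent y r)"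
 unfolding tent_def hat_def divide_inverse by (intro continuous_intros)

lemma tent_shift: "tent (y + z) r (x + z) = tent y r x"
 by (simp add: tent_def)

lemma integrable_tent:
 fixes q :: "real^'n::finite => real"
 assumes "r > 0" "continuous_on UNIV q"
 shows "integrable lborel (\<lambda>x. tent y r x * q x)"
proof -
 have "set_integrable lborel (cball y (real CARD('n) * r)) (\<lambda>x. tent y r x * q x)"
  by (intro set_integrable_cball continuous_intros continuous_on_tent assms)
 moreover have "(\<lambda>x. indicat_real (cball y (real CARD('n) * r)) x *\<^sub>R (tent y r x * q x)) = (\<lambda>x. tent y r x * q x)"
  using tent_eq_0[OF assms(1)] by (auto simp: indicator_def fun_eq_iff simp del: mem_cball)
 ultimately show ?thesis by (simp add: set_integrable_def)
qed

lemma integral_tent_eq: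
 fixes q :: "real^'n::finite => real"
 assumes "r > 0" "cball y (real CARD('n) * r) \<subseteq> S"
 shows "(\<integral>x. tent y r x * q x \<partial>lborel) = (LINT x:S|lborel. tent y r x * q x)" unfolding set_lebesgue_integral_def
proof (rule Bochner_Integration.integral_cong)
 show "tent y r x * q x = indicat_real S x *\<^sub>R (tent y r x * q x)" for x
  using tent_eq_0[OF assms(1), of x y] assms(2) by (cases "x \<in> S") (auto simp: subset_iff)
qed simp

lemma tent_avg_diff:
 assumes "r > 0" "continuous_on UNIV q" "continuous_on UNIV q'"
 shows "tent_avg y r (\<lambda>x. q x - q' x) = tent_avg y r q - tent_avg y r q'"
 using assms by (simp add: tent_avg_def right_diff_distrib integrable_tent diff_divide_distrib)

lemma tent_avg_add:
 assumes "r > 0" "continuous_on UNIV q" "continuous_on UNIV q'"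
 shows "tent_avg y r (\<lambda>x. q x + q' x) = tent_avg y r q + tent_avg y r q'"
 using assms by (simp add: tent_avg_def distrib_left integrable_tent add_divide_distrib)

lemma tent_avg_cmul: "tent_avg y r (\<lambda>x. k * q x) = k * tent_avg y r q"
 by (simp add: tent_avg_def mult.left_commute)

lemma tent_avg_mono:
 assumes "r > 0" "continuous_on UNIV q" "continuous_on UNIV q'" "!!x. q x <= q' x"
 shows "tent_avg y r q <= tent_avg y r q'" unfolding tent_avg_def using assms
 by (intro divide_right_mono integral_mono integrable_tent mult_left_mono tent_bounds) auto

lemma integral_shift_lborel:
 fixes q :: "'a::euclidean_space => 'b::{banach, second_countable_topology}"
 assumes "q \<in> borel_measurable borel"
 shows "(\<integral>x. q (x + z) \<partial>lborel) = integral\<^sup>L lborel q"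
 by (subst (2) lborel_distr_plus[symmetric, of z], subst integral_distr)
  (use assms in \<open>auto simp: add.commute\<close>)

lemma tent_avg_shift:
 fixes q :: "real^'n::finite => real"
 assumes "continuous_on UNIV q"
 shows "tent_avg y r (\<lambda>x. q (x + z)) = tent_avg (y + z) r q"
proof -
 have "(\<integral>x. tent (y + z) r (x + z) * q (x + z) \<partial>lborel) = (\<integral>x. tent (y + z) r x * q x \<partial>lborel)"
  by (rule integral_shift_lborel[where q = "\<lambda>x. tent (y + z) r x * q x"])
   (intro borel_measurable_continuous_onI continuous_intros continuous_on_tent assms)
 then show ?thesis by (simp add: tent_avg_def tent_shift)
qed

lemma tent_refine:
 fixes x y :: "real^'n::finite"
 assumes "r > 0"
 shows "tent y r x = (\<Sum>e\<in>PiE UNIV (\<lambda>_. {-1, 0, 1::int}).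
  (\<Prod>k\<in>UNIV. if e k = 0 then 1 else 1 / 2) * tent (y + (\<chi> k. (r / 2) * of_int (e k))) (r / 2) x)"
proof -
 have "tent y r x = (\<Prod>k\<in>UNIV. \<Sum>e\<in>{-1, 0, 1::int}. (if e = 0 then 1 else 1 / 2) * hat (r / 2) (x $ k - y $ k - (r / 2) * of_int e))"
  unfolding tent_def by (rule prod.cong[OF refl hat_refine[OF assms]])
 also have "... = (\<Sum>e\<in>PiE UNIV (\<lambda>_. {-1, 0, 1::int}). \<Prod>k\<in>UNIV. (if e k = 0 then 1 else 1 / 2) * hat (r / 2) (x $ k - y $ k - (r / 2) * of_int (e k)))"
  by (rule prod_sum_PiE) auto
 also have "... = (\<Sum>e\<in>PiE UNIV (\<lambda>_. {-1, 0, 1::int}).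
  (\<Prod>k\<in>UNIV. if e k = 0 then 1 else 1 / 2) * tent (y + (\<chi> k. (r / 2) * of_int (e k))) (r / 2) x)"
  by (simp add: prod.distrib tent_def diff_diff_eq)
 finally show ?thesis .
qed

text \<open>The refinement weights sum to 2^d, exactly the ratio of the normalizing volumes. If
  every half-size tent had a larger average, so would their convex combination.\<close>

lemma tent_avg_halve:
 fixes q :: "real^'n::finite => real"
 assumes r: "r > 0" and q: "continuous_on UNIV q"
 shows "\<exists>z. (\<forall>k. \<bar>z $ k\<bar> <= r / 2) \<and> tent_avg (y + z) (r / 2) q <= tent_avg y r q"
proof (rule ccontr)
 assume no: "\<not> ?thesis"
 let ?P = "PiE (UNIV::'n set) (\<lambda>_. {-1, 0, 1::int})"
 define w where "w e = (\<Prod>k\<in>UNIV. if e k = 0 then 1 else 1 / 2 :: real)" for e :: "'n => int"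
 define Y where "Y e = (\<chi> k. (r / 2) * of_int (e k))" for e :: "'n => int"
 have fin: "finite ?P" by (intro finite_PiE) auto
 have wpos: "w e > 0" for e unfolding w_def by (intro prod_pos) auto
 have big: "tent_avg y r q < tent_avg (y + Y e) (r / 2) q" if "e \<in> ?P" for e
 proof -
  have "\<bar>Y e $ k\<bar> <= r / 2" for k
  proof -
   have "e k \<in> {-1, 0, 1}" using that by (auto simp: PiE_iff)
   then show ?thesis using r by (auto simp: Y_def)
  qed
  then show ?thesis using no not_le by blast
 qed
 have sumw: "(\<Sum>e\<in>?P. w e) = 2 ^ CARD('n)"
 proof -
  have "(\<Prod>k\<in>(UNIV::'n set). \<Sum>e\<in>{-1, 0, 1::int}. if e = 0 then 1 else 1 / 2 :: real) = (\<Sum>e\<in>?P. w e)"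
   unfolding w_def by (rule prod_sum_PiE) auto
  then show ?thesis by simp
 qed
 have "(\<integral>x. tent y r x * q x \<partial>lborel) = (\<integral>x. (\<Sum>e\<in>?P. w e * (tent (y + Y e) (r / 2) x * q x)) \<partial>lborel)"
  by (simp add: tent_refine[OF r] w_def Y_def sum_distrib_right mult.assoc)
 also have "... = (\<Sum>e\<in>?P. w e * (\<integral>x. tent (y + Y e) (r / 2) x * q x \<partial>lborel))"
  using r by (subst Bochner_Integration.integral_sum) (auto intro!: integrable_tent q)
 finally have "tent_avg y r q = (\<Sum>e\<in>?P. w e * (\<integral>x. tent (y + Y e) (r / 2) x * q x \<partial>lborel)) / r ^ CARD('n)"
  by (simp add: tent_avg_def)
 also have "... = (\<Sum>e\<in>?P. w e * tent_avg (y + Y e) (r / 2) q) / 2 ^ CARD('n)"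
  using r by (simp add: tent_avg_def sum_divide_distrib power_divide)
 also have "... > (\<Sum>e\<in>?P. w e * tent_avg y r q) / 2 ^ CARD('n)"
 proof (intro divide_strict_right_mono sum_strict_mono fin)
  show "?P \<noteq> {}" by (auto simp: PiE_eq_empty_iff)
  show "w e * tent_avg y r q < w e * tent_avg (y + Y e) (r / 2) q" if "e \<in> ?P" for e
   using big[OF that] wpos[of e] by simp
 qed auto
 also have "(\<Sum>e\<in>?P. w e * tent_avg y r q) / 2 ^ CARD('n) = tent_avg y r q"
  by (simp add: sum_distrib_right[symmetric] sumw)
 finally show False by simp
qed

lemma tent_avg_descend:
 fixes q :: "real^'n::finite => real"
 assumes r: "r > 0" and q: "continuous_on UNIV q"
 shows "\<exists>z. (\<forall>k. \<bar>z $ k\<bar> <= r - r / 2 ^ m) \<and> tent_avg (y + z) (r / 2 ^ m) q <= tent_avg y r q"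
proof (induction m)
 case 0
 show ?case by (intro exI[of _ 0]) auto
next
 case (Suc m)
 then obtain z where z: "!!k. \<bar>z $ k\<bar> <= r - r / 2 ^ m" "tent_avg (y + z) (r / 2 ^ m) q <= tent_avg y r q" by blast
 have "r / 2 ^ m > 0" using r by simp
 from tent_avg_halve[OF this q, of "y + z"] obtain z' where
  z': "!!k. \<bar>z' $ k\<bar> <= r / 2 ^ m / 2" "tent_avg (y + z + z') (r / 2 ^ m / 2) q <= tent_avg (y + z) (r / 2 ^ m) q" by blast
 show ?case
 proof (intro exI[of _ "z + z'"] conjI allI)
  fix k
  have "\<bar>(z + z') $ k\<bar> <= \<bar>z $ k\<bar> + \<bar>z' $ k\<bar>" by simp
  also have "... <= (r - r / 2 ^ m) + r / 2 ^ m / 2" by (intro add_mono z z')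
  finally show "\<bar>(z + z') $ k\<bar> <= r - r / 2 ^ Suc m" by (simp add: field_simps)
  show "tent_avg (y + (z + z')) (r / 2 ^ Suc m) q <= tent_avg y r q"
   using order_trans[OF z'(2) z(2)] by (simp add: add.assoc mult.commute)
 qed
qed

lemma tent_lipschitz:
 assumes "r > 0"
 shows "\<bar>tent y r x - tent y' r (x::real^'n::finite)\<bar> <= real CARD('n) * norm (y - y') / r"
proof -
 have "\<bar>tent y r x - tent y' r x\<bar> <= (\<Sum>k\<in>UNIV. \<bar>hat r (x $ k - y $ k) - hat r (x $ k - y' $ k)\<bar>)" unfolding tent_def
  using norm_prod_diff[of UNIV "\<lambda>k. hat r (x $ k - y $ k)" "\<lambda>k. hat r (x $ k - y' $ k)"] hat_bounds[OF assms] by simp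
 also have "... <= (\<Sum>k\<in>(UNIV::'n set). norm (y - y') / r)"
 proof (rule sum_mono)
  fix k
  have "\<bar>hat r (x $ k - y $ k) - hat r (x $ k - y' $ k)\<bar> <= \<bar>(y' - y) $ k\<bar> / r"
   using hat_lipschitz[OF assms, of "x $ k - y $ k" "x $ k - y' $ k"] by simp
  also have "... <= norm (y - y') / r"
   using component_le_norm_cart[of "y' - y" k] assms by (simp add: divide_right_mono norm_minus_commute)
  finally show "\<bar>hat r (x $ k - y $ k) - hat r (x $ k - y' $ k)\<bar> <= norm (y - y') / r" .
 qed
 finally show ?thesis by simp
qed

text \<open>Two translates of a tent have equal mass, so any constant \<open>Q\<close> may be
  subtracted before the Lipschitz bound is applied. In \<open>growth_step\<close> this makes the
  cost of moving a tent depend on the oscillation of |G|^2 and not on its size.\<close>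

lemma tent_avg_move:
 fixes q :: "real^'n::finite => real"
 assumes r: "r > 0" and q: "continuous_on UNIV q"
  and sub: "cball y (real CARD('n) * r) \<subseteq> cball c R" "cball y' (real CARD('n) * r) \<subseteq> cball c R"
 shows "tent_avg y r q <= tent_avg y' r q
  + real CARD('n) * norm (y - y') / r ^ (CARD('n) + 1) * (LINT x:cball c R|lborel. \<bar>q x - Q\<bar>)"
proof -
 define q0 where "q0 x = q x - Q" for x
 have q0: "continuous_on UNIV q0" unfolding q0_def by (intro continuous_intros q)
 have cst: "tent_avg y r (\<lambda>_. Q) = tent_avg y' r (\<lambda>_. Q)" using tent_avg_shift[of "\<lambda>_. Q" y' r "y - y'"] by simp
 have "(\<integral>x. tent y r x * q0 x \<partial>lborel) - (\<integral>x. tent y' r x * q0 x \<partial>lborel)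
   = (LINT x:cball c R|lborel. tent y r x * q0 x - tent y' r x * q0 x)"
  unfolding integral_tent_eq[OF r sub(1)] integral_tent_eq[OF r sub(2)]
  by (subst set_integral_diff) (auto intro!: set_integrable_cball continuous_intros continuous_on_tent q0)
 also have "... <= (LINT x:cball c R|lborel. (real CARD('n) * norm (y - y') / r) * \<bar>q0 x\<bar>)"
 proof (rule set_integral_mono)
  fix x
  have "tent y r x * q0 x - tent y' r x * q0 x <= \<bar>tent y r x - tent y' r x\<bar> * \<bar>q0 x\<bar>"
   by (metis abs_ge_self abs_mult left_diff_distrib)
  also have "... <= (real CARD('n) * norm (y - y') / r) * \<bar>q0 x\<bar>" by (intro mult_right_mono tent_lipschitz r) auto
  finally show "tent y r x * q0 x - tent y' r x * q0 x <= (real CARD('n) * norm (y - y') / r) * \<bar>q0 x\<bar>" .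
 qed (intro set_integrable_cball continuous_intros continuous_on_tent q0)+
 finally have "(\<integral>x. tent y r x * q0 x \<partial>lborel) - (\<integral>x. tent y' r x * q0 x \<partial>lborel)
   <= (real CARD('n) * norm (y - y') / r) * (LINT x:cball c R|lborel. \<bar>q0 x\<bar>)" by simp
 then have "tent_avg y r q0 - tent_avg y' r q0
   <= (real CARD('n) * norm (y - y') / r) * (LINT x:cball c R|lborel. \<bar>q0 x\<bar>) / r ^ CARD('n)"
  unfolding tent_avg_def diff_divide_distrib[symmetric] using r by (intro divide_right_mono) auto
 moreover have "tent_avg y r q0 = tent_avg y r q - tent_avg y r (\<lambda>_. Q)"
  "tent_avg y' r q0 = tent_avg y' r q - tent_avg y' r (\<lambda>_. Q)"
  unfolding q0_def by (auto intro!: tent_avg_diff r q continuous_intros)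
 ultimately show ?thesis using cst by (simp add: q0_def)
qed

text \<open>Comparing tents with balls loses a constant. For |G|^2 this is never iterated: the
  quantity carried from scale to scale is the tent average itself, and ball energies are read off
  from it anew each time.\<close>

lemma tent_avg_lower:
 fixes g :: "real^'n::finite => 'b::real_normed_vector"
 assumes r: "r > 0" and g: "continuous_on UNIV g"
 shows "ball_energy y (r / 2) g <= (2 * r) ^ CARD('n) * tent_avg y r (\<lambda>x. (norm (g x))^2)"
proof -
 have "(1 / 2) ^ CARD('n) * ball_energy y (r / 2) g <= (LINT x:cball y (r / 2)|lborel. tent y r x * (norm (g x))^2)"
 proof -
  have "(1 / 2) ^ CARD('n) * ball_energy y (r / 2) g = (LINT x:cball y (r / 2)|lborel. (1 / 2) ^ CARD('n) * (norm (g x))^2)"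
   by (simp add: ball_energy_def)
  also have "... <= (LINT x:cball y (r / 2)|lborel. tent y r x * (norm (g x))^2)" by (rule set_integral_mono)
    (auto intro!: set_integrable_cball continuous_intros continuous_on_tent g mult_right_mono tent_lower r)
  finally show ?thesis .
 qed
 also have "... <= (\<integral>x. tent y r x * (norm (g x))^2 \<partial>lborel)" unfolding set_lebesgue_integral_def
 proof (rule integral_mono)
  show "integrable lborel (\<lambda>x. indicat_real (cball y (r / 2)) x *\<^sub>R (tent y r x * (norm (g x))^2))"
   using set_integrable_cball[of "\<lambda>x. tent y r x * (norm (g x))^2" y "r / 2"]
   by (simp add: set_integrable_def continuous_intros continuous_on_tent g)
 qed (use r in \<open>auto intro!: integrable_tent continuous_intros g simp: indicator_def tent_bounds\<close>)
 finally show ?thesis using r by (simp add: tent_avg_def power_mult_distrib field_simps)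
qed

lemma tent_avg_upper:
 fixes g :: "real^'n::finite => 'b::real_normed_vector"
 assumes r: "r > 0" and g: "continuous_on UNIV g" and sub: "cball y (real CARD('n) * r) \<subseteq> cball c R"
 shows "r ^ CARD('n) * tent_avg y r (\<lambda>x. (norm (g x))^2) <= ball_energy c R g"
proof -
 have "(LINT x:cball c R|lborel. tent y r x * (norm (g x))^2) <= (LINT x:cball c R|lborel. (norm (g x))^2)"
  by (rule set_integral_mono)
   (auto intro!: set_integrable_cball continuous_intros continuous_on_tent g mult_left_le_one_le tent_bounds r)
 then show ?thesis using r by (simp add: tent_avg_def integral_tent_eq[OF r sub] ball_energy_def)
qed

section \<open>Averages over dyadic tents\<close>

text \<open>The halving argument does not control where the good centre z lies, but every centre
  within \<open>l\<close> of it is almost as good, and among those there is an almost period. A tent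
  of radius r lives in a ball of radius d r, which explains the radius s / (64 d).\<close>

lemma descend_ball:
 fixes f :: "real^'n::finite => 'b::real_normed_vector" and c :: "real^'n"
 assumes f: "continuous_on UNIV f" and s: "s > 0" and l: "l <= s / 64"
 defines "\<sigma> \<equiv> s / (64 * real CARD('n))"
 shows "\<exists>z. norm z <= s / 64 \<and> (\<forall>h Q. norm (h - z) <= l -->
  tent_avg (c + h) (\<sigma> / 2 ^ a) (\<lambda>x. (norm (f x))^2) <= tent_avg c \<sigma> (\<lambda>x. (norm (f x))^2)
   + real CARD('n) * l / (\<sigma> / 2 ^ a) ^ (CARD('n) + 1) * (LINT x:cball c (s / 16)|lborel. \<bar>(norm (f x))\<^sup>2 - Q\<bar>))"
proof -
 let ?d = "real CARD('n)"
 have d: "?d > 0" by simp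
 have \<sigma>: "\<sigma> > 0" using s by (simp add: \<sigma>_def)
 have d\<sigma>: "?d * \<sigma> = s / 64" by (simp add: \<sigma>_def)
 have cq: "continuous_on UNIV (\<lambda>x. (norm (f x))^2)" by (intro cont_norm_sq f)
 obtain z where z: "!!k. \<bar>z $ k\<bar> <= \<sigma> - \<sigma> / 2 ^ a"
  "tent_avg (c + z) (\<sigma> / 2 ^ a) (\<lambda>x. (norm (f x))^2) <= tent_avg c \<sigma> (\<lambda>x. (norm (f x))^2)"
  using tent_avg_descend[OF \<sigma> cq, of a c] by blast
 have nz: "norm z <= s / 64"
 proof -
  have "norm z <= (\<Sum>k\<in>UNIV. \<bar>z $ k\<bar>)" by (rule norm_le_l1_cart)
  also have "... <= (\<Sum>k\<in>(UNIV::'n set). \<sigma>)"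
  proof (rule sum_mono)
   fix k
   have "0 <= \<sigma> / 2 ^ a" using \<sigma> by simp
   then show "\<bar>z $ k\<bar> <= \<sigma>" using z(1)[of k] by linarith
  qed
  finally show ?thesis using d\<sigma> by simp
 qed
 have r': "\<sigma> / 2 ^ a > 0" "?d * (\<sigma> / 2 ^ a) <= s / 64"
 proof -
  show "\<sigma> / 2 ^ a > 0" using \<sigma> by simp
  have "?d * (\<sigma> / 2 ^ a) <= ?d * \<sigma>"
   using \<sigma> one_le_power[of "2::real" a] by (intro mult_left_mono) (auto simp: divide_le_eq)
  then show "?d * (\<sigma> / 2 ^ a) <= s / 64" using d\<sigma> by simp
 qed
 have sub: "cball (c + y) (?d * (\<sigma> / 2 ^ a)) \<subseteq> cball c (s / 16)" if "norm y <= s / 32" for y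
 proof
  fix x assume "x \<in> cball (c + y) (?d * (\<sigma> / 2 ^ a))"
  then have "dist (c + y) x <= s / 64" using r'(2) unfolding mem_cball by linarith
  then show "x \<in> cball c (s / 16)"
   using dist_triangle[of c x "c + y"] that s unfolding mem_cball by (simp add: dist_norm)
 qed
 show ?thesis
 proof (intro exI[of _ z] conjI allI impI nz)
  fix h Q assume h: "norm (h - z) <= l"
  have nh: "norm h <= s / 32" using norm_triangle_ineq[of "h - z" z] h l nz by simp
  have "tent_avg (c + h) (\<sigma> / 2 ^ a) (\<lambda>x. (norm (f x))^2) <= tent_avg (c + z) (\<sigma> / 2 ^ a) (\<lambda>x. (norm (f x))^2)
   + ?d * norm (c + h - (c + z)) / (\<sigma> / 2 ^ a) ^ (CARD('n) + 1) * (LINT x:cball c (s / 16)|lborel. \<bar>(norm (f x))\<^sup>2 - Q\<bar>)"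
   by (rule tent_avg_move[OF r'(1) cq sub sub]) (use nh nz s in linarith)+
  also have "... <= tent_avg c \<sigma> (\<lambda>x. (norm (f x))^2)
   + ?d * l / (\<sigma> / 2 ^ a) ^ (CARD('n) + 1) * (LINT x:cball c (s / 16)|lborel. \<bar>(norm (f x))\<^sup>2 - Q\<bar>)"
  proof (intro add_mono z mult_right_mono divide_right_mono mult_left_mono)
   show "0 <= (LINT x:cball c (s / 16)|lborel. \<bar>(norm (f x))\<^sup>2 - Q\<bar>)"
    unfolding set_lebesgue_integral_def by (intro integral_nonneg_AE) auto
   show "norm (c + h - (c + z)) <= l" using h by simp
  qed (use \<sigma> in auto)
  finally show "tent_avg (c + h) (\<sigma> / 2 ^ a) (\<lambda>x. (norm (f x))^2) <= tent_avg c \<sigma> (\<lambda>x. (norm (f x))^2)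
   + ?d * l / (\<sigma> / 2 ^ a) ^ (CARD('n) + 1) * (LINT x:cball c (s / 16)|lborel. \<bar>(norm (f x))\<^sup>2 - Q\<bar>)" .
 qed
qed

context approx_solution
begin

text \<open>Only shifts that are almost periods (\<open>\<omega> h <= \<tau>\<close>) are admitted here; \<open>zall\<close> below drops this restriction.\<close>

definition zbound :: "real => real => real => nat => real => bool" where
 "zbound \<tau> \<rho> s j B \<longleftrightarrow> (\<forall>H. length H = j --> (\<forall>h\<in>set H. norm h <= \<rho> \<and> \<omega> h <= \<tau>) --> I s (diff_ops H G) <= B)"

lemma zboundD: "zbound \<tau> \<rho> s j B ==> length H = j ==> (!!h. h \<in> set H ==> norm h <= \<rho> \<and> \<omega> h <= \<tau>) ==> I s (diff_ops H G) <= B"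
 by (auto simp: zbound_def)

lemma zbound_mono: "zbound \<tau> \<rho> s j B ==> \<tau>' <= \<tau> ==> \<rho>' <= \<rho> ==> B <= B' ==> zbound \<tau>' \<rho>' s j B'"
 unfolding zbound_def
proof (intro allI impI)
 fix H assume *: "\<forall>H. length H = j --> (\<forall>h\<in>set H. norm h <= \<rho> \<and> \<omega> h <= \<tau>) --> I s (diff_ops H G) <= B"
  "\<tau>' <= \<tau>" "\<rho>' <= \<rho>" "B <= B'" "length H = j" "\<forall>h\<in>set H. norm h <= \<rho>' \<and> \<omega> h <= \<tau>'"
 then have "\<forall>h\<in>set H. norm h <= \<rho> \<and> \<omega> h <= \<tau>" by force
 then show "I s (diff_ops H G) <= B'" using * by fastforce
qed

lemma tau_nonneg: "dense_shifts \<tau> l s ==> 0 <= s ==> 0 <= \<tau>"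
 unfolding dense_shifts_def using om_nonneg by (metis norm_zero order_trans)

text \<open>Bounds for shifts up to \<rho> reach shifts up to s / 2 by chaining \<open>N\<close>
  equal steps, at the cost of N^2; then \<open>poincare_by_differences\<close> applies on the ball
  of radius s / 4.\<close>

lemma poincare_scale:
 assumes Y: "!!h. norm h <= \<rho> ==> I s (diff_op h G) <= Y" and Y0: "Y > 0"
  and sz: "N >= 1" "s / 2 <= real N * \<rho>" "s > 0"
 shows "\<exists>k. I (s / 4) (\<lambda>x. G x - k) <= 2 ^ (CARD('n) + 1) * ((real N)^2 * Y)"
proof -
 have "\<exists>k. I (s / 4) (\<lambda>x. G x - k) <= 2 ^ (DIM(real^'n) + 1) * ((real N)^2 * Y)"
 proof (rule poincare_by_differences[OF contG])
  fix h :: "real^'n" assume "norm h <= 2 * (s / 4)"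
  then have h: "norm h <= s / 2" by simp
  define k where "k = (1 / real N) *\<^sub>R h"
  have hk: "h = real N *\<^sub>R k" using sz(1) by (simp add: k_def)
  have nk: "norm k <= \<rho>"
  proof -
   have "real N * norm k <= real N * \<rho>" using h sz(2) by (simp add: hk)
   then show ?thesis using sz(1) by simp
  qed
  have tele: "(\<Sum>i<m. diff_op k G (x + real i *\<^sub>R k)) = diff_op (real m *\<^sub>R k) G x" for m x
   by (induction m) (auto simp: diff_op_def algebra_simps)
  have "I (s / 4) (diff_op h G) = I (s / 4) (\<lambda>x. \<Sum>i<N. diff_op k G (x + real i *\<^sub>R k))" unfolding tele hk ..
  also have "... <= real N * (\<Sum>i<N. I (s / 4) (\<lambda>x. diff_op k G (x + real i *\<^sub>R k)))"
   by (intro ball_energy_sum cont_shift cont_diff_op contG)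
  also have "... <= real N * (\<Sum>i<N. Y)"
  proof (intro mult_left_mono sum_mono)
   fix i assume i: "i \<in> {..<N}"
   have "norm (real i *\<^sub>R k) <= norm h" using i by (simp add: hk mult_right_mono)
   then have "I (s / 4) (\<lambda>x. diff_op k G (x + real i *\<^sub>R k)) <= I s (diff_op k G)"
    using h sz(3) by (intro ball_energy_shift cont_diff_op contG) linarith
   then show "I (s / 4) (\<lambda>x. diff_op k G (x + real i *\<^sub>R k)) <= Y" using Y[OF nk] by linarith
  qed simp
  finally show "I (s / 4) (diff_op h G) <= (real N)^2 * Y" by (simp add: power2_eq_square)
 qed (use sz Y0 in auto)
 then show ?thesis by simp
qed

text \<open>Supplies the \<open>W\<close> of the other estimates: \<open>diff_energy\<close> with an
  empty list of earlier differences gains (l / s)^2 against the Poincare bound \<open>P\<close>. The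
  constant is 48 = 3 * 16, from shifts up to 3 l on the ball of radius s / 16.\<close>

lemma small_shift:
 assumes k: "I (s / 4) (\<lambda>x. G x - k) <= P"
  and sz: "0 <= l" "3 * l <= s / 16" "s <= r0" "s > 0" "m >= 1"
 shows "small_shift_bound (m * \<tau>) (3 * l) s (C1 * ((48 * l / s)^2 * P + 10 * m^2 * err \<tau> s))"
 unfolding small_shift_bound_def
proof (intro allI impI)
 fix a assume a: "norm a <= 3 * l" "\<omega> a <= m * \<tau>"
 have P0: "0 <= P" using k ball_energy_nonneg[of c "s / 4" "\<lambda>x. G x - k"] by linarith
 have "I (s / 16) (diff_op a (diff_ops [] G)) <= C1 * ((norm a / (s / 16))^2 * I (4 * (s / 16)) (\<lambda>x. diff_ops [] G x - k)
   + 10 ^ (length ([] :: (real^'n) list) + 1) * err (m * \<tau>) (4 * (s / 16)))" by (rule diff_energy) (use a sz in auto)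
 also have "... <= C1 * ((48 * l / s)^2 * P + 10 * m^2 * err \<tau> s)"
 proof (intro mult_left_mono add_mono C1_nonneg)
  have "norm a / (s / 16) <= 48 * l / s" using a(1) sz by (simp add: field_simps)
  then have "(norm a / (s / 16))^2 <= (48 * l / s)^2" using sz by (intro power_mono) auto
  then show "(norm a / (s / 16))^2 * I (4 * (s / 16)) (\<lambda>x. diff_ops [] G x - k) <= (48 * l / s)^2 * P"
   using k by (intro mult_mono) auto
  have "err (m * \<tau>) (4 * (s / 16)) <= m^2 * err \<tau> (s / 4)" using err_scale[of m \<tau> "s / 4"] sz by simp
  also have "... <= m^2 * err \<tau> s" using sz by (intro mult_left_mono err_mono) auto
  finally show "10 ^ (length ([] :: (real^'n) list) + 1) * err (m * \<tau>) (4 * (s / 16)) <= 10 * m^2 * err \<tau> s" by simp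
 qed
 finally show "I (s / 16) (diff_op a G) <= C1 * ((48 * l / s)^2 * P + 10 * m^2 * err \<tau> s)" by simp
qed

text \<open>The displacement \<open>z\<close> can be longer than \<rho>, so it is reached through
  almost periods near the points (i / N) z. Two consecutive ones differ by a vector of modulus up to
  2 \<tau>, which is replaced by an almost period up to a small shift. The point \<open>h\<close>
  depends on \<open>z\<close> alone and serves all difference lists \<open>H\<close>.\<close>

lemma shift_to_almost_period:
 assumes dense: "dense_shifts \<tau> l s" and W: "small_shift_bound \<sigma> (3 * l) s W" "3 * \<tau> <= \<sigma>"
  and z: "norm z <= s / 64"
  and sz: "N >= 1" "s / 16 <= real N * \<rho>" "0 <= l" "l <= \<rho> / 8" "(real m + 2) * \<rho> <= s / 64" "\<rho> > 0" "s > 0"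
 shows "\<exists>h. norm (h - z) <= l \<and> \<omega> h <= \<tau> \<and>
  (\<forall>H B. length H <= m --> (\<forall>k\<in>set H. norm k <= \<rho> \<and> \<omega> k <= \<tau>) --> zbound \<tau> \<rho> s (Suc (length H)) B -->
    I (s / 64) (diff_op h (diff_ops H G)) <= 2 * (real N)^2 * (B + 4 ^ length H * W))"
proof -
 have tau0: "0 <= \<tau>" by (rule tau_nonneg[OF dense]) (use sz in simp)
 define good where "good i h \<longleftrightarrow> norm (h - (real i / real N) *\<^sub>R z) <= l \<and> \<omega> h <= \<tau>" for i and h :: "real^'n"
 have ex: "\<exists>h. good i h \<and> (i = 0 --> h = 0)" if "i <= N" for i
 proof (cases "i = 0")
  case True
  then show ?thesis using sz tau0 om_zero by (auto simp: good_def)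
 next
  case False
  have "real i / real N <= 1" using that sz(1) by simp
  then have "norm ((real i / real N) *\<^sub>R z) <= norm z" using mult_right_mono[of "real i / real N" 1 "norm z"] by simp
  then have "norm ((real i / real N) *\<^sub>R z) <= s" using z sz by linarith
  then show ?thesis using dense False unfolding dense_shifts_def good_def by blast
 qed
 \<comment> \<open>The chain starts exactly at 0, so that the telescoping sum has no boundary
   term.\<close>
 define \<eta> where "\<eta> i = (SOME h. good i h \<and> (i = 0 --> h = 0))" for i
 have "good i (\<eta> i) \<and> (i = 0 --> \<eta> i = 0)" if "i <= N" for i unfolding \<eta>_def by (rule someI_ex[OF ex[OF that]])
 then have \<eta>: "!!i. i <= N ==> good i (\<eta> i)" "\<eta> 0 = 0" by auto
 show ?thesis
 proof (intro exI[of _ "\<eta> N"] conjI allI impI)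
  show "norm (\<eta> N - z) <= l" "\<omega> (\<eta> N) <= \<tau>" using \<eta>(1)[of N] sz(1) by (auto simp: good_def)
  fix H B assume lH: "length H <= m" and H: "\<forall>k\<in>set H. norm k <= \<rho> \<and> \<omega> k <= \<tau>"
   and zb: "zbound \<tau> \<rho> s (Suc (length H)) B"
  define g where "g = diff_ops H G"
  have cg: "continuous_on UNIV g" unfolding g_def by (rule contDG)
  have "len_sum H <= real (length H) * \<rho>" by (rule len_sum_le) (use H in auto)
  also have "... <= real m * \<rho>" using lH sz by (intro mult_right_mono) auto
  finally have lsum: "len_sum H + 2 * \<rho> <= s / 64" using sz(5) by (simp add: algebra_simps)
  have rs: "\<rho> <= s / 64" using lsum len_sum_nonneg[of H] sz(6) by linarith
  have each: "I (s / 64) (\<lambda>x. diff_op (\<eta> (Suc i) - \<eta> i) g (x + \<eta> i)) <= 2 * (B + 4 ^ length H * W)" if i: "i < N" for i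
  proof -
   define d where "d = \<eta> (Suc i) - \<eta> i"
   have g1: "good i (\<eta> i)" "good (Suc i) (\<eta> (Suc i))" using \<eta>(1) i by auto
   have ni: "norm (\<eta> i) <= s / 64 + l"
   proof -
    have "real i / real N <= 1" using i sz(1) by simp
    then have "norm ((real i / real N) *\<^sub>R z) <= norm z" using mult_right_mono[of "real i / real N" 1 "norm z"] by simp
    then show ?thesis using norm_triangle_ineq[of "\<eta> i - (real i / real N) *\<^sub>R z" "(real i / real N) *\<^sub>R z"] g1(1) z
     by (simp add: good_def)
   qed
   have nd: "norm d <= \<rho> / 2"
   proof -
    define p q where "p = \<eta> (Suc i) - (real (Suc i) / real N) *\<^sub>R z" and "q = \<eta> i - (real i / real N) *\<^sub>R z"
    have "d = (p - q) + (1 / real N) *\<^sub>R z" by (simp add: p_def q_def d_def add_divide_distrib scaleR_left_distrib)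
    then have "norm d <= (norm p + norm q) + norm ((1 / real N) *\<^sub>R z)"
     using norm_triangle_ineq[of "p - q" "(1 / real N) *\<^sub>R z"] norm_triangle_ineq4[of p q] by simp
    moreover have "norm p <= l" "norm q <= l" using g1 by (auto simp: good_def p_def q_def)
    moreover have "norm ((1 / real N) *\<^sub>R z) <= \<rho> / 4"
    proof -
     have "norm z <= real N * (\<rho> / 4)" using z sz(2) by simp
     then show ?thesis using sz(1) by (simp add: field_simps)
    qed
    ultimately show ?thesis using sz(4) by linarith
   qed
   have od: "\<omega> d <= 2 * \<tau>" using om_diff[of "\<eta> (Suc i)" "\<eta> i"] g1 by (simp add: d_def good_def)
   have "norm d <= s" using nd rs sz by linarith
   then obtain h where h: "norm (h - d) <= l" "\<omega> h <= \<tau>" using dense unfolding dense_shifts_def by blast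
   have nh: "norm h <= \<rho>" using norm_triangle_ineq[of "h - d" d] h(1) nd sz(4,6) by simp
   define b where "b = d - h"
   have b: "norm b <= 3 * l" "\<omega> b <= \<sigma>" using h sz(3) om_diff[of d h] od W(2) by (auto simp: b_def norm_minus_commute)
   have "I (s / 64) (\<lambda>x. diff_op d g (x + \<eta> i)) = I (s / 64) (\<lambda>x. diff_op b g (x + (h + \<eta> i)) + diff_op h g (x + \<eta> i))"
    by (simp add: diff_op_def b_def algebra_simps)
   also have "... <= 2 * I (s / 64) (\<lambda>x. diff_op b g (x + (h + \<eta> i))) + 2 * I (s / 64) (\<lambda>x. diff_op h g (x + \<eta> i))"
    by (intro ball_energy_add cont_shift cont_diff_op cg)
   also have "I (s / 64) (\<lambda>x. diff_op b g (x + (h + \<eta> i))) <= 4 ^ length H * W" unfolding g_def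
   proof (rule shifted_small[OF W(1) b])
    show "norm (h + \<eta> i) + len_sum H + s / 64 <= s / 16"
     using norm_triangle_ineq[of h "\<eta> i"] nh ni lsum sz(4,6,7) by linarith
   qed
   also have "I (s / 64) (\<lambda>x. diff_op h g (x + \<eta> i)) <= I s (diff_op h g)"
    using ni sz(4,7) rs by (intro ball_energy_shift cont_diff_op cg) linarith
   also have "... = I s (diff_ops (h # H) G)" by (simp add: g_def)
   also have "... <= B" by (rule zboundD[OF zb]) (use H nh h in auto)
   finally show ?thesis by (simp add: d_def algebra_simps)
  qed
  have tele: "(\<Sum>i<k. diff_op (\<eta> (Suc i) - \<eta> i) g (x + \<eta> i)) = diff_op (\<eta> k) g x" for k x
   by (induction k) (auto simp: diff_op_def \<eta>(2) algebra_simps)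
  have "I (s / 64) (diff_op (\<eta> N) g) = I (s / 64) (\<lambda>x. \<Sum>i<N. diff_op (\<eta> (Suc i) - \<eta> i) g (x + \<eta> i))" unfolding tele ..
  also have "... <= real N * (\<Sum>i<N. I (s / 64) (\<lambda>x. diff_op (\<eta> (Suc i) - \<eta> i) g (x + \<eta> i)))"
   by (intro ball_energy_sum cont_shift cont_diff_op cg)
  also have "... <= real N * (\<Sum>i<N. 2 * (B + 4 ^ length H * W))" using each by (intro mult_left_mono sum_mono) auto
  finally show "I (s / 64) (diff_op (\<eta> N) (diff_ops H G)) <= 2 * (real N)^2 * (B + 4 ^ length H * W)"
   by (simp add: g_def power2_eq_square algebra_simps)
 qed
qed

text \<open>Lengthens the shifts in \<open>S\<close> one after the other, each time gaining 4 / n^2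
  on a ball 64 times smaller. The additive error keeps its factor 2 along the induction because 4 /
  n^2 <= 1 / 2 turns 2 R into R before the next R is added.\<close>

lemma enlarge_all:
 assumes dense: "dense_shifts \<tau> l s" and W: "small_shift_bound ((real n + 3) * \<tau>) (3 * l) s W"
  and zb: "zbound \<tau> \<rho> s m B"
  and sz: "n >= 3" "0 <= l" "l <= \<rho> / 2" "(real m + 2) * \<rho> <= s / 64 ^ m" "s <= r0" "s > 0" "0 < \<rho>"
  and lens: "length S + length T = m"
  and S: "!!k. k \<in> set S ==> norm k <= \<rho> / (2 * real n) \<and> \<omega> k <= \<tau>"
  and T: "!!k. k \<in> set T ==> norm k <= \<rho> \<and> \<omega> k <= \<tau>"
 shows "I (s / 64 ^ length S) (diff_ops (S @ T) G) <= (4 / (real n)^2) ^ length S * B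
  + 2 * (4 ^ m * W + 2 * C1 * ((\<rho> * 64 ^ m / (2 * s))^2 * B + 10 ^ (m + 1) * (real n)^2 * err \<tau> s))" using lens S T
proof (induction S arbitrary: T)
 case Nil
 define R where "R = 4 ^ m * W + 2 * C1 * ((\<rho> * 64 ^ m / (2 * s))^2 * B + 10 ^ (m + 1) * (real n)^2 * err \<tau> s)"
 have tau0: "0 <= \<tau>" by (rule tau_nonneg[OF dense]) (use sz in simp)
 have "I s (diff_ops T G) <= B" by (rule zboundD[OF zb]) (use Nil in auto)
 moreover have "0 <= B" using \<open>I s (diff_ops T G) <= B\<close> ball_energy_nonneg[of c s "diff_ops T G"] by linarith
 moreover have "0 <= W" by (rule small_shift_bound_nonneg[OF W]) (use sz tau0 in auto)
 ultimately have "0 <= R" unfolding R_def by (intro add_nonneg_nonneg mult_nonneg_nonneg err_nonneg C1_nonneg) auto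
 then show ?case using \<open>I s (diff_ops T G) <= B\<close> by (simp add: R_def)
next
 case (Cons h S)
 define R where "R = 4 ^ m * W + 2 * C1 * ((\<rho> * 64 ^ m / (2 * s))^2 * B + 10 ^ (m + 1) * (real n)^2 * err \<tau> s)"
 have tau0: "0 <= \<tau>" by (rule tau_nonneg[OF dense]) (use sz in simp)
 have W0: "0 <= W" by (rule small_shift_bound_nonneg[OF W]) (use sz tau0 in auto)
 define r where "r = s / 64 ^ Suc (length S)"
 have lm: "Suc (length S) <= m" using Cons.prems(1) by simp
 have r: "r > 0" "r <= s / 64" "s / 64 ^ m <= r"
 proof -
  show "r > 0" using sz by (simp add: r_def)
  have "s / 64 ^ Suc (length S) <= s / 64 ^ 1" using sz by (intro divide_left_mono power_increasing) auto
  then show "r <= s / 64" by (simp add: r_def)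
  show "s / 64 ^ m <= r" unfolding r_def using sz lm by (intro divide_left_mono power_increasing) auto
 qed
 have small_big: "norm k <= \<rho>" if "norm k <= \<rho> / (2 * real n)" for k :: "real^'n"
 proof -
  have "\<rho> / (2 * real n) <= \<rho> / 1" using sz by (intro divide_left_mono) auto
  then show ?thesis using that by simp
 qed
 have big: "norm k <= \<rho> \<and> \<omega> k <= \<tau>" if "k \<in> set (h # S @ T)" for k
  using that Cons.prems(2,3) small_big by (auto simp del: divide_le_eq)
 have "\<exists>h'. norm h' <= \<rho> \<and> \<omega> h' <= \<tau> \<and>
  I r (diff_ops (h # S @ T) G) <= 4 / (real n)^2 * (I r (diff_ops (h' # S @ T) G) + 4 ^ length (S @ T) * W)
   + 2 * C1 * ((\<rho> / (2 * r))^2 * I (4 * r) (diff_ops (h # S @ T) G) + 10 ^ (length (S @ T) + 2) * (real n)^2 * err \<tau> (4 * r))"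
 proof (rule enlarge_slot[OF dense W])
  show "norm h <= \<rho> / (2 * real n)" "\<omega> h <= \<tau>" using Cons.prems(2)[of h] by auto
  show "(real (length (S @ T)) + 2) * \<rho> <= r"
  proof -
   have "(real (length (S @ T)) + 2) * \<rho> <= (real m + 2) * \<rho>" using Cons.prems(1) sz by (intro mult_right_mono) auto
   then show ?thesis using sz(4) r(3) by linarith
  qed
 qed (use big sz r in auto)
 then obtain h' where h': "norm h' <= \<rho>" "\<omega> h' <= \<tau>"
  "I r (diff_ops (h # S @ T) G) <= 4 / (real n)^2 * (I r (diff_ops (h' # S @ T) G) + 4 ^ length (S @ T) * W)
   + 2 * C1 * ((\<rho> / (2 * r))^2 * I (4 * r) (diff_ops (h # S @ T) G) + 10 ^ (length (S @ T) + 2) * (real n)^2 * err \<tau> (4 * r))"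
  by blast
 have lST: "length (S @ T) + 1 = m" using Cons.prems(1) by simp
 have q: "4 / (real n)^2 <= 1 / 2" "0 <= 4 / (real n)^2"
 proof -
  have "3\<^sup>2 <= (real n)^2" using sz(1) by (intro power_mono) auto
  then have "4 / (real n)^2 <= 4 / 3\<^sup>2" using sz(1) by (intro divide_left_mono) auto
  then show "4 / (real n)^2 <= 1 / 2" by simp
 qed simp
 have B1: "I (4 * r) (diff_ops (h # S @ T) G) <= B"
 proof -
  have "I (4 * r) (diff_ops (h # S @ T) G) <= I s (diff_ops (h # S @ T) G)"
   using r sz by (intro ball_energy_mono contDG) auto
  also have "... <= B" by (rule zboundD[OF zb]) (use lST big in auto)
  finally show ?thesis .
 qed
 have IH: "I r (diff_ops (h' # S @ T) G) <= (4 / (real n)^2) ^ length S * B + 2 * R"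
 proof -
  have "I r (diff_ops (h' # S @ T) G) = I r (diff_ops (S @ (h' # T)) G)" by (simp only: diff_ops_mid)
  also have "... <= I (s / 64 ^ length S) (diff_ops (S @ (h' # T)) G)"
  proof (rule ball_energy_mono[OF contDG])
   show "r <= s / 64 ^ length S" unfolding r_def using sz by (intro divide_left_mono power_increasing) auto
  qed
  also have "... <= (4 / (real n)^2) ^ length S * B + 2 * R"
   unfolding R_def by (rule Cons.IH) (use Cons.prems h' in auto)
  finally show ?thesis .
 qed
 have P1: "4 / (real n)^2 * I r (diff_ops (h' # S @ T) G) <= (4 / (real n)^2) ^ Suc (length S) * B + R"
 proof -
  have R0: "0 <= R"
  proof -
   have "0 <= B" using B1 ball_energy_nonneg[of c "4 * r" "diff_ops (h # S @ T) G"] by linarith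
   then show ?thesis unfolding R_def using W0 by (intro add_nonneg_nonneg mult_nonneg_nonneg err_nonneg C1_nonneg) auto
  qed
  have "4 / (real n)^2 * I r (diff_ops (h' # S @ T) G) <= 4 / (real n)^2 * ((4 / (real n)^2) ^ length S * B + 2 * R)"
   by (rule mult_left_mono[OF IH q(2)])
  also have "... = (4 / (real n)^2) ^ Suc (length S) * B + 4 / (real n)^2 * (2 * R)"
   by (simp only: distrib_left power_Suc mult.assoc)
  also have "4 / (real n)^2 * (2 * R) <= 1 / 2 * (2 * R)" using R0 by (intro mult_right_mono q) auto
  finally show ?thesis by simp
 qed
 have P2: "4 / (real n)^2 * (4 ^ length (S @ T) * W) <= 4 ^ m * W"
 proof -
  have "4 / (real n)^2 * (4 ^ length (S @ T) * W) <= 1 * (4 ^ length (S @ T) * W)"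
   using q W0 by (intro mult_right_mono) auto
  also have "... <= 4 ^ m * W" using W0 lST[symmetric] by (simp add: mult_right_mono)
  finally show ?thesis .
 qed
 have P3: "2 * C1 * ((\<rho> / (2 * r))^2 * I (4 * r) (diff_ops (h # S @ T) G) + 10 ^ (length (S @ T) + 2) * (real n)^2 * err \<tau> (4 * r))
  <= 2 * C1 * ((\<rho> * 64 ^ m / (2 * s))^2 * B + 10 ^ (m + 1) * (real n)^2 * err \<tau> s)"
 proof (intro mult_left_mono add_mono mult_mono)
  have "s <= r * 64 ^ m" using r(3) by (simp add: field_simps)
  then have "\<rho> / (2 * r) <= \<rho> * 64 ^ m / (2 * s)"
   using sz r mult_left_mono[of s "r * 64 ^ m" \<rho>] by (simp add: field_simps)
  then show "(\<rho> / (2 * r))^2 <= (\<rho> * 64 ^ m / (2 * s))^2" using sz r by (intro power_mono) auto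
  show "(10::real) ^ (length (S @ T) + 2) <= 10 ^ (m + 1)" using lST by (intro power_increasing) auto
  show "err \<tau> (4 * r) <= err \<tau> s" using r sz by (intro err_mono) auto
 qed (use B1 C1_nonneg err_nonneg in auto)
 have "I r (diff_ops (h # S @ T) G) <= (4 / (real n)^2) ^ Suc (length S) * B + 2 * R"
  using h'(3) P1 P2 P3 unfolding distrib_left R_def by linarith
 then show ?case by (simp add: r_def R_def)
qed

end

section \<open>Transfer between the orders of differences\<close>

context approx_solution
begin

text \<open>Serves the orders j < d, where the gain 4 / n^2 of a single slot cannot in general
  outweigh the loss of volume. The missing factor comes from descending in tents: some small tent
  has at most the average of |f|^2 and so carries the share 2^(-a d) of the energy. Returning from
  it to the centre \<open>c\<close> along an almost period costs a difference of order j + 1, which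
  is bounded by \<open>B'\<close>.\<close>

lemma coupling:
 fixes b :: nat
 defines "\<sigma> \<equiv> \<lambda>s. s / (64 * real CARD('n))"
 assumes dense: "dense_shifts \<tau> l s" and W: "small_shift_bound ((real n + 3) * \<tau>) (3 * l) s W"
  and zb: "zbound \<tau> \<rho> s j B" "zbound \<tau> \<rho> s (Suc j) B'"
  and H: "length H = j" "!!k. k \<in> set H ==> norm k <= \<rho> / (2 * real n) \<and> \<omega> k <= \<tau>"
  and sz: "j >= 1" "n >= 3" "0 <= l" "l <= \<rho> / 8" "(real j + 3) * \<rho> <= s / 64" "s / 16 <= real N * \<rho>" "N >= 1"
   "s <= r0" "s > 0" "0 < \<rho>" and t: "t <= \<sigma> s / 2 ^ a / 2" "t <= s / 64"
 shows "I t (diff_ops H G) <= 2 ^ (CARD('n) + 1) *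
   ((4 / (real n)^2 * (B + 4 ^ j * W) + 2 * C1 * ((32 * \<rho> / s)^2 * B + 10 ^ (j + 1) * (real n)^2 * err \<tau> s)) / 2 ^ (a * CARD('n))
    + real CARD('n) * l / (\<sigma> s / 2 ^ a) * B)
  + 4 * (real N)^2 * (B' + 4 ^ j * W)"
proof -
 let ?d = "CARD('n)"
 define f where "f = diff_ops H G"
 define r' where "r' = \<sigma> s / 2 ^ a"
 have tau0: "0 <= \<tau>" by (rule tau_nonneg[OF dense]) (use sz in simp)
 have W0: "0 <= W" by (rule small_shift_bound_nonneg[OF W]) (use sz tau0 in auto)
 have cf: "continuous_on UNIV f" unfolding f_def by (rule contDG)
 have \<sigma>0: "\<sigma> s > 0" using sz by (simp add: \<sigma>_def)
 have r'0: "r' > 0" using \<sigma>0 by (simp add: r'_def)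
 have small_big: "norm k <= \<rho>" if "norm k <= \<rho> / (2 * real n)" for k :: "real^'n"
 proof -
  have "\<rho> / (2 * real n) <= \<rho> / 1" using sz by (intro divide_left_mono) auto
  then show ?thesis using that by simp
 qed
 have big: "norm k <= \<rho> \<and> \<omega> k <= \<tau>" if "k \<in> set H" for k using H(2)[OF that] small_big by blast
 have Bf: "I s f <= B" unfolding f_def by (rule zboundD[OF zb(1)]) (use H big in auto)
 have rs: "\<rho> <= s / 64"
 proof -
  have "1 * \<rho> <= (real j + 3) * \<rho>" using sz by (intro mult_right_mono) auto
  then show ?thesis using sz(5) by linarith
 qed
 have ls: "l <= s / 64" using rs sz(4,10) by linarith
 \<comment> \<open>One slot is lengthened before the descent. Its gain 4 / n^2 later outweighs the
   factor 2^((b - a) d) lost in comparing tents with balls.\<close>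
 define X1 where "X1 = 4 / (real n)^2 * (B + 4 ^ j * W) + 2 * C1 * ((32 * \<rho> / s)^2 * B + 10 ^ (j + 1) * (real n)^2 * err \<tau> s)"
 have X1: "I (s / 64) f <= X1"
 proof -
  obtain h H' where HH: "H = h # H'" using H(1) sz(1) by (cases H) auto
  have j: "j = Suc (length H')" using H(1) HH by simp
  have "\<exists>h'. norm h' <= \<rho> \<and> \<omega> h' <= \<tau> \<and>
   I (s / 64) (diff_ops (h # H') G) <= 4 / (real n)^2 * (I (s / 64) (diff_ops (h' # H') G) + 4 ^ length H' * W)
   + 2 * C1 * ((\<rho> / (2 * (s / 64)))^2 * I (4 * (s / 64)) (diff_ops (h # H') G) + 10 ^ (length H' + 2) * (real n)^2 * err \<tau> (4 * (s / 64)))"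
  proof (rule enlarge_slot[OF dense W])
   show "(real (length H') + 2) * \<rho> <= s / 64"
   proof -
    have "(real (length H') + 2) * \<rho> <= (real j + 3) * \<rho>" using sz by (intro mult_right_mono) (auto simp: j)
    then show ?thesis using sz(5) by linarith
   qed
  qed (use H(2) big HH sz in auto)
  then obtain h' where h': "norm h' <= \<rho>" "\<omega> h' <= \<tau>"
   "I (s / 64) (diff_ops (h # H') G) <= 4 / (real n)^2 * (I (s / 64) (diff_ops (h' # H') G) + 4 ^ length H' * W)
   + 2 * C1 * ((\<rho> / (2 * (s / 64)))^2 * I (4 * (s / 64)) (diff_ops (h # H') G) + 10 ^ (length H' + 2) * (real n)^2 * err \<tau> (4 * (s / 64)))"
   by blast
  have "I (s / 64) (diff_ops (h' # H') G) <= I s (diff_ops (h' # H') G)" using sz by (intro ball_energy_mono contDG) auto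
  also have "... <= B" by (rule zboundD[OF zb(1)]) (use H(1) HH big h' in auto)
  finally have b1: "I (s / 64) (diff_ops (h' # H') G) <= B" .
  have "I (4 * (s / 64)) (diff_ops (h # H') G) <= I s (diff_ops (h # H') G)"
   using sz by (intro ball_energy_mono contDG) auto
  then have b2: "I (4 * (s / 64)) (diff_ops (h # H') G) <= B" using Bf by (simp add: f_def HH)
  have b3: "(4::real) ^ length H' * W <= 4 ^ j * W" using W0 by (intro mult_right_mono power_increasing) (auto simp: j)
  have b4: "err \<tau> (4 * (s / 64)) <= err \<tau> s" using sz by (intro err_mono) auto
  have eq32: "\<rho> / (2 * (s / 64)) = 32 * \<rho> / s" by simp
  have "I (s / 64) (diff_ops (h # H') G) <= 4 / (real n)^2 * (B + 4 ^ j * W)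
   + 2 * C1 * ((\<rho> / (2 * (s / 64)))^2 * B + 10 ^ (length H' + 2) * (real n)^2 * err \<tau> s)"
   by (rule order_trans[OF h'(3)]) (intro add_mono mult_left_mono b1 b2 b3 b4 mult_nonneg_nonneg C1_nonneg; simp add: C1_nonneg)
  then show ?thesis unfolding eq32 X1_def f_def HH j by simp
 qed
 obtain z where z: "norm z <= s / 64" "!!h Q. norm (h - z) <= l ==>
  tent_avg (c + h) r' (\<lambda>x. (norm (f x))^2) <= tent_avg c (\<sigma> s) (\<lambda>x. (norm (f x))^2)
   + real ?d * l / r' ^ (?d + 1) * (LINT x:cball c (s / 16)|lborel. \<bar>(norm (f x))\<^sup>2 - Q\<bar>)"
  using descend_ball[OF cf sz(9) ls, of c a] unfolding r'_def \<sigma>_def by blast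
 have "\<exists>h. norm (h - z) <= l \<and> \<omega> h <= \<tau> \<and>
  (\<forall>H B. length H <= j --> (\<forall>k\<in>set H. norm k <= \<rho> \<and> \<omega> k <= \<tau>) --> zbound \<tau> \<rho> s (Suc (length H)) B -->
    I (s / 64) (diff_op h (diff_ops H G)) <= 2 * (real N)^2 * (B + 4 ^ length H * W))"
 proof (rule shift_to_almost_period[OF dense W _ z(1)])
  show "3 * \<tau> <= (real n + 3) * \<tau>" using tau0 by (simp add: mult_right_mono)
  show "(real j + 2) * \<rho> <= s / 64"
  proof -
   have "(real j + 2) * \<rho> <= (real j + 3) * \<rho>" using sz by (intro mult_right_mono) auto
   then show ?thesis using sz(5) by linarith
  qed
 qed (use sz in auto)
 then obtain h where h: "norm (h - z) <= l" "I (s / 64) (diff_op h f) <= 2 * (real N)^2 * (B' + 4 ^ j * W)"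
  using H(1) big zb(2) unfolding f_def by blast
 have low: "ball_energy (c + h) t f <= 2 ^ ?d * (X1 / 2 ^ (a * ?d) + real ?d * l / r' * B)"
 proof -
  have "ball_energy (c + h) t f <= ball_energy (c + h) (r' / 2) f"
   using t(1) by (intro ball_energy_mono cf) (simp add: r'_def)
  also have "... <= (2 * r') ^ ?d * tent_avg (c + h) r' (\<lambda>x. (norm (f x))^2)" by (rule tent_avg_lower[OF r'0 cf])
  also have "... <= (2 * r') ^ ?d * (tent_avg c (\<sigma> s) (\<lambda>x. (norm (f x))^2)
   + real ?d * l / r' ^ (?d + 1) * (LINT x:cball c (s / 16)|lborel. \<bar>(norm (f x))\<^sup>2 - 0\<bar>))"
   using r'0 by (intro mult_left_mono z(2) h(1)) auto
  also have "(LINT x:cball c (s / 16)|lborel. \<bar>(norm (f x))\<^sup>2 - 0\<bar>) = I (s / 16) f" by (simp add: ball_energy_def)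
  also have "(2 * r') ^ ?d * (tent_avg c (\<sigma> s) (\<lambda>x. (norm (f x))^2) + real ?d * l / r' ^ (?d + 1) * I (s / 16) f)
   = 2 ^ ?d * ((\<sigma> s ^ ?d * tent_avg c (\<sigma> s) (\<lambda>x. (norm (f x))^2)) / 2 ^ (a * ?d) + real ?d * l / r' * I (s / 16) f)"
  proof -
   have "r' ^ ?d = \<sigma> s ^ ?d / 2 ^ (a * ?d)" by (simp add: r'_def power_divide power_mult)
   moreover have "r' ^ ?d / r' ^ (?d + 1) = 1 / r'" using r'0 by simp
   ultimately show ?thesis using r'0 \<sigma>0 by (simp add: power_mult_distrib algebra_simps)
  qed
  also have "... <= 2 ^ ?d * (X1 / 2 ^ (a * ?d) + real ?d * l / r' * B)"
  proof (intro mult_left_mono add_mono divide_right_mono)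
   have "\<sigma> s ^ ?d * tent_avg c (\<sigma> s) (\<lambda>x. (norm (f x))^2) <= I (s / 64) f"
    by (rule tent_avg_upper[OF \<sigma>0 cf]) (simp add: \<sigma>_def)
   then show "\<sigma> s ^ ?d * tent_avg c (\<sigma> s) (\<lambda>x. (norm (f x))^2) <= X1" using X1 by linarith
   have "I (s / 16) f <= I s f" using sz by (intro ball_energy_mono cf) auto
   then show "I (s / 16) f <= B" using Bf by linarith
   show "0 <= real ?d * l / r'" using sz r'0 by simp
  qed auto
  finally show ?thesis .
 qed
 have "I t f = I t (\<lambda>x. f (x + h) - diff_op h f x)" by (simp add: diff_op_def)
 also have "... <= 2 * I t (\<lambda>x. f (x + h)) + 2 * I t (diff_op h f)"
  by (intro ball_energy_diff cont_shift cont_diff_op cf)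
 also have "I t (\<lambda>x. f (x + h)) = ball_energy (c + h) t f" by (rule ball_energy_shift_eq[OF cf])
 also have "I t (diff_op h f) <= I (s / 64) (diff_op h f)" using t(2) by (intro ball_energy_mono cont_diff_op cf)
 finally have "I t f <= 2 * (2 ^ ?d * (X1 / 2 ^ (a * ?d) + real ?d * l / r' * B)) + 2 * (2 * (real N)^2 * (B' + 4 ^ j * W))"
  using low h(2) by linarith
 then show ?thesis by (simp add: f_def X1_def r'_def)
qed

text \<open>Below the top order \<open>coupling\<close> is used, and the weights \<beta>^j make the
  next order contribute at most the fraction \<theta>^d / 16. At order d \<open>enlarge_all\<close>
  gains (4 / n^2)^d, which beats \<theta>^d without help from a higher order. Normalized by volume,
  the factor \<theta>^d / 2 is a decay by 1 / 2.\<close>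

lemma decay_step:
 fixes a b n :: nat
 defines "d \<equiv> CARD('n)" and "\<theta> \<equiv> 1 / 2 ^ b"
 assumes par: "2 ^ (d + 1) / 2 ^ (a * d) * (4 / (real n)^2) <= \<theta> ^ d / 16"
   "2 ^ (d + 1) / 2 ^ (a * d) * (2 * C1 * (32 * \<kappa>)^2) <= \<theta> ^ d / 16"
   "2 ^ (d + 1) * (real d * l / (s / (64 * real d) / 2 ^ a)) <= \<theta> ^ d / 16"
   "4 * (real N)^2 * \<beta> <= \<theta> ^ d / 16" "0 < \<beta>" "\<beta> <= 1"
   "(4 / (real n)^2) ^ d <= \<theta> ^ d / 8" "4 * C1 * (\<kappa> * 64 ^ d / 2)^2 <= \<theta> ^ d / 8"
   "1 / 16 <= real N * \<kappa>" "N >= 1" "(real d + 3) * \<kappa> <= 1 / 64 ^ (d + 1)" "0 < \<kappa>"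
   "\<theta> <= 1 / 64 ^ d" "\<theta> <= 1 / (128 * real d * 2 ^ a)" "2 * real n = 2 ^ b" "n >= 3"
   "2 ^ (d + 1) * (4 * 4 ^ d + 2 * C1 * 10 ^ (d + 1) * (real n)^2) + 4 * (real N)^2 * 4 ^ d <= K * \<beta> ^ d"
  and dense: "dense_shifts \<tau> l s" and W: "small_shift_bound ((real n + 3) * \<tau>) (3 * l) s W"
  and zb: "!!j. 1 <= j ==> j <= d ==> zbound \<tau> (\<kappa> * s) s j (\<beta> ^ j * B)"
  and sz: "0 <= l" "l <= \<kappa> * s / 8" "s <= r0" "s > 0" "B >= 0" and j: "1 <= j" "j <= d"
 shows "zbound \<tau> (\<kappa> * (\<theta> * s)) (\<theta> * s) j (\<beta> ^ j * (\<theta> ^ d / 2 * B + K * (W + err \<tau> s)))" unfolding zbound_def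
proof (intro allI impI)
 fix H assume H: "length H = j" "\<forall>h\<in>set H. norm h <= \<kappa> * (\<theta> * s) \<and> \<omega> h <= \<tau>"
 define X where "X = err \<tau> s"
 have X0: "0 <= X" unfolding X_def by (rule err_nonneg)
 have tau0: "0 <= \<tau>" by (rule tau_nonneg[OF dense]) (use sz in simp)
 have W0: "0 <= W" by (rule small_shift_bound_nonneg[OF W]) (use sz tau0 in auto)
 have \<theta>n: "\<theta> = 1 / (2 * real n)" using par(15) by (simp add: \<theta>_def)
 have \<theta>0: "\<theta> > 0" by (simp add: \<theta>_def)
 have \<rho>: "\<kappa> * (\<theta> * s) = \<kappa> * s / (2 * real n)" by (simp add: \<theta>n)
 have H': "norm k <= \<kappa> * s / (2 * real n) \<and> \<omega> k <= \<tau>" if "k \<in> set H" for k using H(2) that \<rho> by auto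
 have \<rho>0: "0 < \<kappa> * s" using par(12) sz by simp
 have d64: "(real d + 3) * (\<kappa> * s) <= s / 64 ^ (d + 1)"
  using mult_right_mono[OF par(11), of s] sz by (simp add: algebra_simps)
 define Q where "Q = 2 ^ (d + 1) * (4 * 4 ^ d + 2 * C1 * 10 ^ (d + 1) * (real n)^2) + 4 * (real N)^2 * 4 ^ d"
 \<comment> \<open>The errors carry no factor \<beta>^j, so \<open>K\<close> is so large that even K
   \<beta>^d dominates their constants.\<close>
 have Kb: "Q * (W + X) <= \<beta> ^ j * (K * (W + X))"
 proof -
  have K0: "0 <= K"
  proof -
   have "0 <= Q" unfolding Q_def by (intro add_nonneg_nonneg mult_nonneg_nonneg C1_nonneg) auto
   then have "0 <= K * \<beta> ^ d" using par(17) by (simp add: Q_def)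
   moreover have "0 < \<beta> ^ d" using par(5) by simp
   ultimately show ?thesis by (simp add: zero_le_mult_iff)
  qed
  have "Q <= K * \<beta> ^ d" using par(17) by (simp add: Q_def)
  also have "... <= K * \<beta> ^ j" using K0 par(5,6) j by (intro mult_left_mono power_decreasing) auto
  finally have "Q * (W + X) <= K * \<beta> ^ j * (W + X)" using W0 X0 by (intro mult_right_mono) auto
  then show ?thesis by (simp add: algebra_simps)
 qed
 have p4: "(4::real) ^ i * W <= 4 ^ d * W" if "i <= d" for i using that W0 by (intro mult_right_mono power_increasing) auto
 have C10: "0 <= C1" by (rule C1_nonneg)
 have n2: "4 / (real n)^2 <= 1"
 proof -
  have "3\<^sup>2 <= (real n)^2" using par(16) by (intro power_mono) auto
  then have "4 / (real n)^2 <= 4 / 3\<^sup>2" using par(16) by (intro divide_left_mono) auto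
  then show ?thesis by simp
 qed
 show "I (\<theta> * s) (diff_ops H G) <= \<beta> ^ j * (\<theta> ^ d / 2 * B + K * (W + err \<tau> s))"
 proof (cases "j = d")
  case False
  then have jd: "Suc j <= d" using j by simp
  let ?B = "\<beta> ^ j * B"
  have B0: "0 <= ?B" using par(5) sz by simp
  have "I (\<theta> * s) (diff_ops H G) <= 2 ^ (CARD('n) + 1) *
   ((4 / (real n)^2 * (?B + 4 ^ j * W) + 2 * C1 * ((32 * (\<kappa> * s) / s)^2 * ?B + 10 ^ (j + 1) * (real n)^2 * err \<tau> s)) / 2 ^ (a * CARD('n))
    + real CARD('n) * l / (s / (64 * real CARD('n)) / 2 ^ a) * ?B)
   + 4 * (real N)^2 * (\<beta> ^ Suc j * B + 4 ^ j * W)"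
  proof (rule coupling[OF dense W zb[OF j] zb[OF _ jd] H(1) H'])
   show "(real j + 3) * (\<kappa> * s) <= s / 64"
   proof -
    have "(real j + 3) * (\<kappa> * s) <= (real d + 3) * (\<kappa> * s)" using j \<rho>0 by (intro mult_right_mono) auto
    also have "... <= s / 64 ^ (d + 1)" by (rule d64)
    also have "... <= s / 64 ^ 1" using sz by (intro divide_left_mono power_increasing) auto
    finally show ?thesis by simp
   qed
   show "s / 16 <= real N * (\<kappa> * s)" using mult_right_mono[OF par(9), of s] sz by (simp add: algebra_simps)
   show "\<theta> * s <= s / (64 * real CARD('n)) / 2 ^ a / 2" using mult_right_mono[OF par(14), of s] sz by (simp add: d_def)
   show "\<theta> * s <= s / 64"
   proof -
    have "\<theta> * s <= 1 / 64 ^ d * s" using par(13) sz by (intro mult_right_mono) auto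
    also have "... <= 1 / 64 ^ 1 * s" using sz jd by (intro mult_right_mono divide_left_mono power_increasing) auto
    finally show ?thesis by simp
   qed
  qed (use par sz j \<rho>0 in auto)
  also have "... = (2 ^ (d + 1) / 2 ^ (a * d) * (4 / (real n)^2)) * ?B + (2 ^ (d + 1) / 2 ^ (a * d) * (2 * C1 * (32 * \<kappa>)^2)) * ?B
    + (2 ^ (d + 1) * (real d * l / (s / (64 * real d) / 2 ^ a))) * ?B + (4 * (real N)^2 * \<beta>) * ?B
    + (2 ^ (d + 1) * (4 / (real n)^2 * (4 ^ j * W) + 2 * C1 * (10 ^ (j + 1) * (real n)^2 * X)) / 2 ^ (a * d) + 4 * (real N)^2 * (4 ^ j * W))"
   using sz by (simp add: d_def[symmetric] X_def add_divide_distrib distrib_left distrib_right mult.assoc)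
  also have "... <= (\<theta> ^ d / 16) * ?B + (\<theta> ^ d / 16) * ?B + (\<theta> ^ d / 16) * ?B + (\<theta> ^ d / 16) * ?B + Q * (W + X)"
  proof (intro add_mono mult_right_mono par B0)
   have e1: "4 / (real n)^2 * (4 ^ j * W) <= 4 * 4 ^ d * W"
   proof -
    have "4 / (real n)^2 * (4 ^ j * W) <= 1 * (4 ^ d * W)" by (rule mult_mono[OF n2 p4]) (use j W0 in auto)
    also have "... <= 4 * (4 ^ d * W)" using W0 by simp
    finally show ?thesis by (simp only: mult.assoc)
   qed
   have e2: "2 * C1 * (10 ^ (j + 1) * (real n)^2 * X) <= 2 * C1 * 10 ^ (d + 1) * (real n)^2 * X"
   proof -
    have "(10::real) ^ (j + 1) <= 10 ^ (d + 1)" using j by (intro power_increasing) auto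
    then have "2 * C1 * (10 ^ (j + 1) * (real n)^2 * X) <= 2 * C1 * (10 ^ (d + 1) * (real n)^2 * X)"
     using C10 X0 by (intro mult_left_mono mult_right_mono) auto
    then show ?thesis by (simp add: mult.assoc)
   qed
   have nn: "0 <= 4 / (real n)^2 * (4 ^ j * W) + 2 * C1 * (10 ^ (j + 1) * (real n)^2 * X)"
    using W0 X0 C10 by (intro add_nonneg_nonneg mult_nonneg_nonneg) auto
   have "2 ^ (d + 1) * (4 / (real n)^2 * (4 ^ j * W) + 2 * C1 * (10 ^ (j + 1) * (real n)^2 * X)) / 2 ^ (a * d)
     <= 2 ^ (d + 1) * (4 / (real n)^2 * (4 ^ j * W) + 2 * C1 * (10 ^ (j + 1) * (real n)^2 * X)) / 1"
    using nn by (intro divide_left_mono mult_nonneg_nonneg) auto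
   also have "... <= 2 ^ (d + 1) * (4 * 4 ^ d * W + 2 * C1 * 10 ^ (d + 1) * (real n)^2 * X)"
    unfolding div_by_1 using e1 e2 by (intro mult_left_mono add_mono) auto
   also have "... <= 2 ^ (d + 1) * ((4 * 4 ^ d + 2 * C1 * 10 ^ (d + 1) * (real n)^2) * (W + X))"
   proof (rule mult_left_mono)
    have "0 <= 4 * 4 ^ d * X" "0 <= 2 * C1 * 10 ^ (d + 1) * (real n)^2 * W"
     using W0 X0 C10 by (auto intro!: mult_nonneg_nonneg)
    then show "4 * 4 ^ d * W + 2 * C1 * 10 ^ (d + 1) * (real n)^2 * X <= (4 * 4 ^ d + 2 * C1 * 10 ^ (d + 1) * (real n)^2) * (W + X)"
     unfolding distrib_left distrib_right by linarith
   qed simp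
   finally have t1: "2 ^ (d + 1) * (4 / (real n)^2 * (4 ^ j * W) + 2 * C1 * (10 ^ (j + 1) * (real n)^2 * X)) / 2 ^ (a * d)
    <= 2 ^ (d + 1) * (4 * 4 ^ d + 2 * C1 * 10 ^ (d + 1) * (real n)^2) * (W + X)" by (simp only: mult.assoc)
   have t2: "4 * (real N)^2 * (4 ^ j * W) <= 4 * (real N)^2 * 4 ^ d * (W + X)"
   proof -
    have "4 ^ j * W <= 4 ^ d * (W + X)" using p4[of j] j X0 by (simp add: distrib_left add_increasing2)
    then have "4 * (real N)^2 * (4 ^ j * W) <= 4 * (real N)^2 * (4 ^ d * (W + X))" by (intro mult_left_mono) auto
    then show ?thesis by (simp only: mult.assoc)
   qed
   show "2 ^ (d + 1) * (4 / (real n)^2 * (4 ^ j * W) + 2 * C1 * (10 ^ (j + 1) * (real n)^2 * X)) / 2 ^ (a * d)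
    + 4 * (real N)^2 * (4 ^ j * W) <= Q * (W + X)" using t1 t2 unfolding Q_def distrib_right[of _ _ "W + X"] by linarith
  qed
  also have "... <= \<theta> ^ d / 2 * ?B + \<beta> ^ j * (K * (W + X))"
  proof -
   have "0 <= \<theta> ^ d * ?B" using \<theta>0 B0 by simp
   then show ?thesis using Kb by (simp add: algebra_simps)
  qed
  finally show ?thesis by (simp add: X_def algebra_simps)
 next
  case True
  let ?B = "\<beta> ^ d * B"
  have B0: "0 <= ?B" using par(5) sz by simp
  have "I (s / 64 ^ length H) (diff_ops (H @ []) G) <= (4 / (real n)^2) ^ length H * ?B
   + 2 * (4 ^ d * W + 2 * C1 * ((\<kappa> * s * 64 ^ d / (2 * s))^2 * ?B + 10 ^ (d + 1) * (real n)^2 * err \<tau> s))"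
  proof (rule enlarge_all[OF dense W zb])
   show "(real d + 2) * (\<kappa> * s) <= s / 64 ^ d"
   proof -
    have "(real d + 2) * (\<kappa> * s) <= (real d + 3) * (\<kappa> * s)" using \<rho>0 by (intro mult_right_mono) auto
    also have "... <= s / 64 ^ (d + 1)" by (rule d64)
    also have "... <= s / 64 ^ d" using sz by (intro divide_left_mono power_increasing) auto
    finally show ?thesis .
   qed
  qed (use H(1) H' True j par sz \<rho>0 in auto)
  moreover have "I (\<theta> * s) (diff_ops H G) <= I (s / 64 ^ length H) (diff_ops H G)"
  proof (rule ball_energy_mono[OF contDG])
   show "\<theta> * s <= s / 64 ^ length H" using mult_right_mono[OF par(13), of s] sz H(1) True by simp
  qed
  ultimately have "I (\<theta> * s) (diff_ops H G) <= (4 / (real n)^2) ^ d * ?B + (4 * C1 * (\<kappa> * 64 ^ d / 2)^2) * ?B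
    + (2 * 4 ^ d * W + 2 * (2 * C1 * 10 ^ (d + 1) * (real n)^2) * X)"
   using sz H(1) True by (simp add: X_def algebra_simps)
  also have "... <= \<theta> ^ d / 8 * ?B + \<theta> ^ d / 8 * ?B + Q * (W + X)"
  proof (intro add_mono mult_right_mono par B0)
   define L where "L = 2 * C1 * 10 ^ (d + 1) * (real n)^2"
   have L0: "0 <= L" unfolding L_def using C10 by simp
   have "(2::real) ^ 1 <= 2 ^ (d + 1)" by (rule power_increasing) auto
   then have "2 * (4 * 4 ^ d + L) <= 2 ^ (d + 1) * (4 * 4 ^ d + L)" using L0 by (intro mult_right_mono) auto
   also have "... <= Q" by (simp add: Q_def L_def)
   finally have "2 * (4 * 4 ^ d + L) * (W + X) <= Q * (W + X)" using W0 X0 by (intro mult_right_mono) auto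
   moreover have "2 * 4 ^ d * W + 2 * L * X <= 2 * (4 * 4 ^ d + L) * (W + X)"
   proof -
    have "0 <= 4 ^ d * W" "0 <= L * W" "0 <= 4 ^ d * X" using W0 X0 L0 by auto
    then show ?thesis by (simp add: algebra_simps)
   qed
   ultimately show "2 * 4 ^ d * W + 2 * (2 * C1 * 10 ^ (d + 1) * (real n)^2) * X <= Q * (W + X)" by (simp add: L_def)
  qed
  also have "... <= \<theta> ^ d / 2 * ?B + \<beta> ^ j * (K * (W + X))"
  proof -
   have "0 <= \<theta> ^ d * ?B" using \<theta>0 B0 by simp
   then show ?thesis using Kb by (simp add: algebra_simps)
  qed
  finally show ?thesis using True by (simp add: X_def algebra_simps)
 qed
qed

text \<open>At order 0 the leading constant must stay close to 1. Hence Young's inequality with a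
  free \<open>e\<close> for the return from the shifted centre, and subtraction of |k|^2 before the
  tent is moved, with a second free parameter \<open>i\<close> for the difference of |G|^2 and
  |k|^2. Both are chosen in \<open>one_step\<close>.\<close>

lemma growth_step:
 fixes b :: nat and s :: real
 defines "\<sigma> \<equiv> s / (64 * real CARD('n))"
 assumes dense: "dense_shifts \<tau> l s" and W: "small_shift_bound ((real n + 3) * \<tau>) (3 * l) s W"
  and zb: "zbound \<tau> \<rho> s 1 B" and P: "I (s / 4) (\<lambda>x. G x - k) <= P"
  and sz: "0 <= l" "l <= \<rho> / 8" "2 * \<rho> <= s / 64" "s / 16 <= real N * \<rho>" "N >= 1" "s > 0" "0 < \<rho>"
  and e: "e > 0" "i > 0"
 shows "tent_avg c (\<sigma> / 2 ^ b) (\<lambda>x. (norm (G x))^2) <=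
  (1 + e) * (tent_avg c \<sigma> (\<lambda>x. (norm (G x))^2)
    + real CARD('n) * l / (\<sigma> / 2 ^ b) ^ (CARD('n) + 1) * ((1 + 1 / i) * P + i * I s G))
  + (1 + 1 / e) / (\<sigma> / 2 ^ b) ^ CARD('n) * (2 * (real N)^2 * (B + W))"
proof -
 let ?d = "CARD('n)"
 define r' where "r' = \<sigma> / 2 ^ b"
 have tau0: "0 <= \<tau>" by (rule tau_nonneg[OF dense]) (use sz in simp)
 have \<sigma>0: "\<sigma> > 0" using sz by (simp add: \<sigma>_def)
 have r'0: "r' > 0" using \<sigma>0 by (simp add: r'_def)
 have ls: "l <= s / 64" using sz(2,3,7) by linarith
 obtain z where z: "norm z <= s / 64" "!!h Q. norm (h - z) <= l ==>
  tent_avg (c + h) r' (\<lambda>x. (norm (G x))^2) <= tent_avg c \<sigma> (\<lambda>x. (norm (G x))^2)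
   + real ?d * l / r' ^ (?d + 1) * (LINT x:cball c (s / 16)|lborel. \<bar>(norm (G x))\<^sup>2 - Q\<bar>)"
  using descend_ball[OF contG sz(6) ls, of c b] unfolding r'_def \<sigma>_def by blast
 have "\<exists>h. norm (h - z) <= l \<and> \<omega> h <= \<tau> \<and>
  (\<forall>H B. length H <= 0 --> (\<forall>k\<in>set H. norm k <= \<rho> \<and> \<omega> k <= \<tau>) --> zbound \<tau> \<rho> s (Suc (length H)) B -->
    I (s / 64) (diff_op h (diff_ops H G)) <= 2 * (real N)^2 * (B + 4 ^ length H * W))"
 proof (rule shift_to_almost_period[OF dense W _ z(1)])
  show "3 * \<tau> <= (real n + 3) * \<tau>" using tau0 by (simp add: mult_right_mono)
 qed (use sz in auto)
 then obtain h where h: "norm (h - z) <= l" "I (s / 64) (diff_op h G) <= 2 * (real N)^2 * (B + W)"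
  using zb by (metis One_nat_def diff_ops.simps(1) empty_iff empty_set le_zero_eq list.size(3) mult_1 power_0)
 let ?q = "\<lambda>x. (norm (G x))^2"
 have cq: "continuous_on UNIV ?q" by (intro cont_norm_sq contG)
 have point: "?q x <= (1 + e) * ?q (x + h) + (1 + 1 / e) * (norm (diff_op h G x))^2" for x
 proof -
  define u w where "u = norm (G (x + h))" and "w = norm (diff_op h G x)"
  have "norm (G x) <= u + w"
   using norm_triangle_ineq4[of "G (x + h)" "diff_op h G x"] by (simp add: u_def w_def diff_op_def)
  then have "?q x <= (u + w)^2" by (intro power_mono) auto
  also have "... <= (1 + e) * u^2 + (1 + 1 / e) * w^2"
  proof -
   have "0 <= (e * u - w)^2 / e" using e by simp
   also have "... = e * u^2 + w^2 / e - 2 * (u * w)" using e by (simp add: field_simps power2_eq_square)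
   finally show ?thesis by (simp add: power2_eq_square algebra_simps)
  qed
  finally show ?thesis by (simp add: u_def w_def)
 qed
 have c1: "continuous_on UNIV (\<lambda>x. ?q (x + h))" by (intro cont_norm_sq cont_shift contG)
 have c2: "continuous_on UNIV (\<lambda>x. (norm (diff_op h G x))^2)" by (intro cont_norm_sq cont_diff_op contG)
 have "tent_avg c r' ?q <= tent_avg c r' (\<lambda>x. (1 + e) * ?q (x + h) + (1 + 1 / e) * (norm (diff_op h G x))^2)"
  by (intro tent_avg_mono[OF r'0] cq continuous_intros c1 c2 point)
 also have "... = (1 + e) * tent_avg (c + h) r' ?q + (1 + 1 / e) * tent_avg c r' (\<lambda>x. (norm (diff_op h G x))^2)"
  by (subst tent_avg_add[OF r'0]) (auto intro!: continuous_intros c1 c2 simp: tent_avg_cmul tent_avg_shift[OF cq])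
 finally have A0: "tent_avg c r' ?q <= (1 + e) * tent_avg (c + h) r' ?q + (1 + 1 / e) * tent_avg c r' (\<lambda>x. (norm (diff_op h G x))^2)" .
 have A1: "tent_avg (c + h) r' ?q <= tent_avg c \<sigma> ?q
    + real ?d * l / r' ^ (?d + 1) * (LINT x:cball c (s / 16)|lborel. \<bar>?q x - (norm k)\<^sup>2\<bar>)" by (rule z(2)[OF h(1)])
 have A2: "(LINT x:cball c (s / 16)|lborel. \<bar>?q x - (norm k)\<^sup>2\<bar>) <= (1 + 1 / i) * P + i * I s G"
 proof -
  have "(LINT x:cball c (s / 16)|lborel. \<bar>?q x - (norm k)\<^sup>2\<bar>)
   <= (LINT x:cball c (s / 16)|lborel. (1 + 1 / i) * (norm (G x - k))^2 + i * ?q x)"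
  proof (rule set_integral_mono)
   fix x
   define u w where "u = norm (G x)" and "w = norm (G x - k)"
   have uk: "\<bar>u - norm k\<bar> <= w" unfolding u_def w_def by (rule norm_triangle_ineq3)
   have "\<bar>u\<^sup>2 - (norm k)\<^sup>2\<bar> = \<bar>u - norm k\<bar> * (u + norm k)"
    by (simp add: power2_eq_square square_diff_square_factored abs_mult u_def)
   also have "... <= w * (2 * u + w)" using uk by (intro mult_mono) (auto simp: u_def)
   also have "... <= (1 + 1 / i) * w^2 + i * u^2"
   proof -
    have "0 <= (i * u - w)^2 / i" using e by simp
    also have "... = i * u^2 + w^2 / i - 2 * (u * w)" using e by (simp add: field_simps power2_eq_square)
    finally show ?thesis by (simp add: power2_eq_square algebra_simps)
   qed
   finally show "\<bar>?q x - (norm k)\<^sup>2\<bar> <= (1 + 1 / i) * (norm (G x - k))^2 + i * ?q x" by (simp add: u_def w_def)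
  qed (intro set_integrable_cball continuous_intros contG)+
  also have "... = (1 + 1 / i) * I (s / 16) (\<lambda>x. G x - k) + i * I (s / 16) G" unfolding ball_energy_def
   by (subst set_integral_add) (auto intro!: set_integrable_cball continuous_intros contG)
  also have "... <= (1 + 1 / i) * P + i * I s G"
  proof (intro add_mono mult_left_mono)
   have "I (s / 16) (\<lambda>x. G x - k) <= I (s / 4) (\<lambda>x. G x - k)"
    using sz by (intro ball_energy_mono continuous_intros contG) auto
   then show "I (s / 16) (\<lambda>x. G x - k) <= P" using P by linarith
   show "I (s / 16) G <= I s G" using sz by (intro ball_energy_mono contG) auto
  qed (use e in auto)
  finally show ?thesis .
 qed
 have A3: "tent_avg c r' (\<lambda>x. (norm (diff_op h G x))^2) <= (2 * (real N)^2 * (B + W)) / r' ^ ?d"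
 proof -
  have "r' ^ ?d * tent_avg c r' (\<lambda>x. (norm (diff_op h G x))^2) <= I (s / 64) (diff_op h G)"
  proof (rule tent_avg_upper[OF r'0 cont_diff_op[OF contG]])
   have "real ?d * r' <= real ?d * \<sigma>"
    using \<sigma>0 one_le_power[of "2::real" b] by (intro mult_left_mono) (auto simp: r'_def divide_le_eq)
   also have "... = s / 64" by (simp add: \<sigma>_def)
   finally show "cball c (real ?d * r') \<subseteq> cball c (s / 64)" by auto
  qed
  then show ?thesis using h(2) r'0 by (simp add: pos_le_divide_eq mult.commute)
 qed
 have A4: "tent_avg (c + h) r' ?q <= tent_avg c \<sigma> ?q + real ?d * l / r' ^ (?d + 1) * ((1 + 1 / i) * P + i * I s G)"
  by (rule order_trans[OF A1]) (use sz r'0 A2 in \<open>intro add_left_mono mult_left_mono; simp\<close>)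
 have "(1 + e) * tent_avg (c + h) r' ?q <= (1 + e) * (tent_avg c \<sigma> ?q + real ?d * l / r' ^ (?d + 1) * ((1 + 1 / i) * P + i * I s G))"
  using e by (intro mult_left_mono A4) auto
 moreover have "(1 + 1 / e) * tent_avg c r' (\<lambda>x. (norm (diff_op h G x))^2) <= (1 + 1 / e) * ((2 * (real N)^2 * (B + W)) / r' ^ ?d)"
  using e by (intro mult_left_mono A3) auto
 ultimately show ?thesis using A0 unfolding r'_def by simp
qed

end

section \<open>A single change of scale\<close>

definition good_params :: "nat => real => nat => nat => nat => nat => real => real => real => real => bool" where
 "good_params d C a b n N \<kappa> \<beta> K L0 \<longleftrightarrow>
   2 ^ (d + 1) / 2 ^ (a * d) * (4 / (real n)^2) <= (1 / 2 ^ b) ^ d / 16 \<and>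
   2 ^ (d + 1) / 2 ^ (a * d) * (2 * C * (32 * \<kappa>)^2) <= (1 / 2 ^ b) ^ d / 16 \<and>
   4 * (real N)^2 * \<beta> <= (1 / 2 ^ b) ^ d / 16 \<and> 0 < \<beta> \<and> \<beta> <= 1 \<and>
   (4 / (real n)^2) ^ d <= (1 / 2 ^ b) ^ d / 8 \<and> 4 * C * (\<kappa> * 64 ^ d / 2)^2 <= (1 / 2 ^ b) ^ d / 8 \<and>
   1 / 2 <= real N * \<kappa> \<and> N >= 1 \<and> (real d + 3) * \<kappa> <= 1 / 64 ^ (d + 1) \<and> 0 < \<kappa> \<and>
   1 / 2 ^ b <= (1 / 64 ^ d :: real) \<and> 1 / 2 ^ b <= 1 / (128 * real d * 2 ^ a) \<and> 2 * real n = 2 ^ b \<and> n >= 3 \<and>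
   2 ^ (d + 1) * (4 * 4 ^ d + 2 * C * 10 ^ (d + 1) * (real n)^2) + 4 * (real N)^2 * 4 ^ d <= K * \<beta> ^ d \<and> K > 0 \<and> L0 > 0 \<and>
   (\<forall>l s. 0 <= l --> 0 < s --> L0 * l <= s --> l <= \<kappa> * s / 8 \<and>
     2 ^ (d + 1) * (real d * l / (s / (64 * real d) / 2 ^ a)) <= (1 / 2 ^ b) ^ d / 16)"

text \<open>The choices are nested and not circular: a, b and n depend on d only; then \<kappa> is
  small in terms of these and C, \<open>N\<close> is large in terms of \<kappa>, \<beta> small in
  terms of \<open>N\<close>, and \<open>K\<close> comes last.\<close>

lemma good_params_exist:
 assumes C: "C >= 0" and d: "d >= 1"
 shows "\<exists>a b n N \<kappa> \<beta> K L0. good_params d C a b n N \<kappa> \<beta> K L0 \<and> b >= 1"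
proof -
 \<comment> \<open>7 + d is chosen because 128 d <= 2^(7 + d). The linear terms in b give d + 9 + e
   d <= 2 b for the first inequality and 6 d <= b for \<theta> <= 64^(-d).\<close>
 define e b a n where "e = 7 + d" and "b = e * d + 6 * d + 20" and "a = b - e" and "n = (2::nat) ^ (b - 1)"
 have eb: "e <= b" using d by (auto simp: b_def e_def)
 have ab: "b = a + e" using eb by (simp add: a_def)
 have n2: "2 * real n = 2 ^ b" unfolding n_def by (simp add: power_Suc[symmetric] b_def)
 have n4: "4 / (real n)^2 = 16 / 4 ^ b"
 proof -
  have "(2 * real n)^2 = 4 ^ b" unfolding n2 by (simp add: power_mult[symmetric] mult.commute[of b] power_mult[of 2 2])
  then have h: "(real n)^2 = 4 ^ b / 4" by (simp add: power_mult_distrib)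
  show ?thesis unfolding h by simp
 qed
 define t where "t = (1 / 2 ^ b :: real) ^ d"
 have t0: "t > 0" by (simp add: t_def)
 have t_eq: "t = 1 / 2 ^ (b * d)" by (simp add: t_def power_mult power_one_over)
 have p1: "2 ^ (d + 1) / 2 ^ (a * d) * (4 / (real n)^2) <= t / 16"
 proof -
  have "(2::real) ^ (d + 1) * 2 ^ 8 * 2 ^ (b * d) <= 2 ^ (a * d) * 2 ^ (2 * b)" unfolding power_add[symmetric]
  proof (rule power_increasing)
   have "d + 1 + 8 + b * d = d + 9 + e * d + a * d" by (simp add: ab algebra_simps)
   moreover have "d + 9 + e * d <= 2 * b" by (simp add: b_def)
   ultimately show "d + 1 + 8 + b * d <= a * d + 2 * b" by linarith
  qed simp
  moreover have "(2::real) ^ (2 * b) = 4 ^ b" by (simp add: power_mult)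
  ultimately show ?thesis unfolding n4 t_eq by (simp add: field_simps)
 qed
 have p7: "(4 / (real n)^2) ^ d <= t / 8"
 proof -
  have "(2::real) ^ (4 * d) * 2 ^ (b * d) * 2 ^ 3 <= 2 ^ (2 * b * d)" unfolding power_add[symmetric]
  proof (rule power_increasing)
   have "4 * d + 3 <= b * d" using d by (auto simp: b_def algebra_simps)
   then show "4 * d + b * d + 3 <= 2 * b * d" by simp
  qed simp
  moreover have "(2::real) ^ (2 * b * d) = (4 ^ b) ^ d" "(2::real) ^ (4 * d) = 16 ^ d" by (simp_all add: power_mult)
  ultimately show ?thesis unfolding n4 t_eq power_divide by (simp add: field_simps)
 qed
 have p13: "1 / 2 ^ b <= (1 / 64 ^ d :: real)"
 proof -
  have "(2::real) ^ (6 * d) <= 2 ^ b" by (rule power_increasing) (auto simp: b_def)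
  moreover have "(2::real) ^ (6 * d) = 64 ^ d" by (simp add: power_mult)
  ultimately show ?thesis by (intro divide_left_mono) auto
 qed
 have p14: "1 / 2 ^ b <= 1 / (128 * real d * 2 ^ a)"
 proof -
  have "real d <= 2 ^ d" using less_exp[of d] by (metis less_imp_le of_nat_le_iff of_nat_numeral of_nat_power)
  then have "128 * real d * 2 ^ a <= 2 ^ 7 * 2 ^ d * 2 ^ a" by simp
  also have "... = 2 ^ b" by (simp add: ab e_def power_add)
  finally show ?thesis using d by (intro divide_left_mono) auto
 qed
 have p16: "n >= 3"
 proof -
  have "(2::nat) ^ 2 <= 2 ^ (b - 1)" by (rule power_increasing) (auto simp: b_def)
  then show ?thesis by (simp add: n_def)
 qed
 define q1 q2 where "q1 = 2 ^ (d + 1) / 2 ^ (a * d) * (2 * C * 1024)" and "q2 = 4 * C * (64 ^ d / 2)^2"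
 have q0: "q1 >= 0" "q2 >= 0" using C by (auto simp: q1_def q2_def)
 \<comment> \<open>The bound by 1 makes \<kappa>^2 <= \<kappa>, so that linear conditions on
   \<kappa> imply the quadratic ones.\<close>
 define \<kappa> where "\<kappa> = min 1 (min (t / 16 / (1 + q1)) (min (t / 8 / (1 + q2)) (1 / 64 ^ (d + 1) / (real d + 3))))"
 have \<kappa>0: "\<kappa> > 0" unfolding \<kappa>_def using t0 q0 by auto
 have \<kappa>: "\<kappa> <= 1" "\<kappa> * (1 + q1) <= t / 16" "\<kappa> * (1 + q2) <= t / 8" "\<kappa> * (real d + 3) <= 1 / 64 ^ (d + 1)"
 proof -
  have "\<kappa> <= t / 16 / (1 + q1)" "\<kappa> <= t / 8 / (1 + q2)" "\<kappa> <= 1 / 64 ^ (d + 1) / (real d + 3)" unfolding \<kappa>_def by linarith+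
  then show "\<kappa> * (1 + q1) <= t / 16" "\<kappa> * (1 + q2) <= t / 8" "\<kappa> * (real d + 3) <= 1 / 64 ^ (d + 1)"
   using q0 by (auto intro!: pos_le_divide_eq[THEN iffD1])
  show "\<kappa> <= 1" by (simp add: \<kappa>_def)
 qed
 have sq: "x * \<kappa>^2 <= \<kappa> * (1 + x)" if "x >= 0" for x
 proof -
  have "\<kappa>^2 <= \<kappa>" using \<kappa>(1) \<kappa>0 by (simp add: power2_eq_square mult_left_le)
  then have "x * \<kappa>^2 <= x * \<kappa>" using that by (intro mult_left_mono)
  then show ?thesis using \<kappa>0 by (simp add: algebra_simps)
 qed
 have p2: "2 ^ (d + 1) / 2 ^ (a * d) * (2 * C * (32 * \<kappa>)^2) <= t / 16"
 proof -
  have "2 ^ (d + 1) / 2 ^ (a * d) * (2 * C * (32 * \<kappa>)^2) = q1 * \<kappa>^2" by (simp add: q1_def power_mult_distrib)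
  then show ?thesis using sq[OF q0(1)] \<kappa>(2) by linarith
 qed
 have p8: "4 * C * (\<kappa> * 64 ^ d / 2)^2 <= t / 8"
 proof -
  have "4 * C * (\<kappa> * 64 ^ d / 2)^2 = q2 * \<kappa>^2" by (simp add: q2_def power_mult_distrib power_divide)
  then show ?thesis using sq[OF q0(2)] \<kappa>(3) by linarith
 qed
 obtain N :: nat where N: "1 / (2 * \<kappa>) <= real N" "N >= 1"
 proof -
  obtain N0 :: nat where "1 / (2 * \<kappa>) <= real N0" using real_arch_simple by blast
  then show ?thesis using that[of "Suc N0"] by auto
 qed
 have p9: "1 / 2 <= real N * \<kappa>" using N(1) \<kappa>0 by (simp add: field_simps)
 define \<beta> where "\<beta> = min 1 (t / 16 / (4 * (real N)^2))"
 have \<beta>: "0 < \<beta>" "\<beta> <= 1" "4 * (real N)^2 * \<beta> <= t / 16"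
 proof -
  have N2: "0 < 4 * (real N)^2" using N by simp
  show "0 < \<beta>" unfolding \<beta>_def using t0 N2 by (simp only: min_less_iff_conj) simp
  show "\<beta> <= 1" by (simp add: \<beta>_def)
  have "\<beta> <= t / 16 / (4 * (real N)^2)" by (simp only: \<beta>_def min.cobounded2)
  then show "4 * (real N)^2 * \<beta> <= t / 16" using N2 by (simp add: pos_le_divide_eq mult.commute)
 qed
 define Q where "Q = 2 ^ (d + 1) * (4 * 4 ^ d + 2 * C * 10 ^ (d + 1) * (real n)^2) + 4 * (real N)^2 * 4 ^ d"
 have Q0: "Q > 0" unfolding Q_def using C by (intro add_pos_nonneg mult_pos_pos add_pos_nonneg mult_nonneg_nonneg) auto
 define q3 where "q3 = 2 ^ (d + 1) * (real d * (64 * real d) * 2 ^ a)"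
 have q3: "q3 > 0" using d by (simp add: q3_def)
 \<comment> \<open>The first entry yields l <= \<kappa> s / 8, the second controls the cost of
   moving a tent in \<open>coupling\<close>.\<close>
 define L0 where "L0 = max (8 / \<kappa>) (q3 * 16 / t)"
 have L00: "L0 > 0" using \<kappa>0 by (simp add: L0_def less_max_iff_disj)
 have L: "l <= \<kappa> * s / 8 \<and> 2 ^ (d + 1) * (real d * l / (s / (64 * real d) / 2 ^ a)) <= t / 16"
  if ls: "0 <= l" "0 < s" "L0 * l <= s" for l s
 proof
  have "8 / \<kappa> * l <= L0 * l" using ls(1) by (intro mult_right_mono) (auto simp: L0_def)
  then have "8 / \<kappa> * l <= s" using ls(3) by linarith
  then show "l <= \<kappa> * s / 8" using \<kappa>0 by (simp add: field_simps)
  have "q3 * 16 / t * l <= L0 * l" using ls(1) by (intro mult_right_mono) (auto simp: L0_def)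
  then have "q3 * 16 / t * l <= s" using ls(3) by linarith
  then have "q3 * l / s <= t / 16" using t0 ls(2) by (simp add: field_simps)
  moreover have "2 ^ (d + 1) * (real d * l / (s / (64 * real d) / 2 ^ a)) = q3 * l / s"
   using ls(2) d by (simp add: q3_def field_simps)
  ultimately show "2 ^ (d + 1) * (real d * l / (s / (64 * real d) / 2 ^ a)) <= t / 16" by (simp only:)
 qed
 have "good_params d C a b n N \<kappa> \<beta> (Q / \<beta> ^ d) L0" unfolding good_params_def t_def[symmetric] Q_def[symmetric]
 proof (intro conjI p1 p2 p7 p8 p9 p13 p14 p16 n2 \<beta> N(2) \<kappa>0 L00)
  show "(real d + 3) * \<kappa> <= 1 / 64 ^ (d + 1)" using \<kappa>(4) by (simp only: mult.commute)
  show "Q <= Q / \<beta> ^ d * \<beta> ^ d" "Q / \<beta> ^ d > 0" using \<beta>(1) Q0 by auto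
 qed (use L in blast)
 moreover have "b >= 1" by (simp add: b_def)
 ultimately show ?thesis by blast
qed

context approx_solution
begin

definition zall :: "real => real => nat => real => bool" where
 "zall \<rho> s j B \<longleftrightarrow> (\<forall>H. length H = j --> (\<forall>h\<in>set H. norm h <= \<rho>) --> I s (diff_ops H G) <= B)"

lemma zall_imp_zbound: "zall \<rho> s j B ==> zbound \<tau> \<rho> s j B"
 by (auto simp: zall_def zbound_def)

lemma zbound_imp_zall: "zbound \<tau> \<rho> s j B ==> (!!h. norm h <= \<rho> ==> \<omega> h <= \<tau>) ==> zall \<rho> s j B"
 by (auto simp: zall_def zbound_def)

lemma zbound_weaken: "zbound \<tau> \<rho> s j B ==> \<tau>' <= \<tau> ==> B <= B' ==> zbound \<tau>' \<rho> s j B'"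
 by (rule zbound_mono) auto

lemma zall_weaken: "zall \<rho> s j B ==> B <= B' ==> zall \<rho> s j B'"
 unfolding zall_def
proof (intro allI impI)
 fix H :: "(real^'n) list" assume *: "\<forall>H. length H = j --> (\<forall>h\<in>set H. norm h <= \<rho>) --> I s (diff_ops H G) <= B"
  "B <= B'" "length H = j" "\<forall>h\<in>set H. norm h <= \<rho>"
 then have "I s (diff_ops H G) <= B" by blast
 then show "I s (diff_ops H G) <= B'" using *(2) by linarith
qed

text \<open>Everything is normalized by m s^d, where m bounds the tent average: Y^2 for all shifts,
  Z^2 for almost periods. The 3 / 4 comes from halving the squares, as 1 / 2 <= (3 / 4)^2;
  \<open>K5\<close> absorbs the error constants after division by \<theta>^d. Square roots and not
  energies are iterated because the growth of m is exponential in quantities linear in Z, \<tau> and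
  g.\<close>

lemma one_step:
 fixes a b n N :: nat and \<kappa> \<beta> K L0 :: real
 defines "d \<equiv> CARD('n)" and "\<theta> \<equiv> 1 / 2 ^ b"
 defines "cG \<equiv> (2 * 2 ^ b) ^ d"
 defines "K7 \<equiv> C1 * 2304 * 2 ^ (d + 1) * (real N)^2 + (10 * C1 * (real n + 3)^2 + 1) * cG"
 defines "K8 \<equiv> 2 * (real N)^2 * (1 + K7) * (64 * real d * 2 ^ b) ^ d"
 defines "K9 \<equiv> real d * (64 * real d * 2 ^ b) ^ (d + 1) * (2 ^ (d + 1) * (real N)^2 + cG)"
 defines "sg \<equiv> \<lambda>s. s / (64 * real d)"
 assumes par: "good_params d C1 a b n N \<kappa> \<beta> K L0"
  and K5: "K5 >= 0" "K5^2 >= K * K7 / \<theta> ^ d"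
  and dense: "dense_shifts \<tau> l s" and l: "0 <= l" "L0 * l <= s" and s: "0 < s" "s <= r0"
  and \<Omega>: "!!h. norm h <= s ==> \<omega> h <= \<Omega>"
  and g: "g > 0" "I s E + s^2 * I s f <= g^2 * m0 * s ^ d" and m0: "0 < m0" "m0 <= m"
  and GI: "I s G <= cG * m * s ^ d" and T: "tent_avg c (sg s) (\<lambda>x. (norm (G x))^2) <= m"
  and Y: "Y > 0" "!!j. 1 <= j ==> j <= d ==> zall (\<kappa> * s) s j (\<beta> ^ j * (Y^2 * m * s ^ d))"
  and Z: "Z >= 0" "!!j. 1 <= j ==> j <= d ==> zbound \<tau> (\<kappa> * s) s j (\<beta> ^ j * (Z^2 * m * s ^ d))"
  and m': "m' = m * exp ((1 + K8 + K9) * (Z + \<tau> + g + l / s * (Y + Y^2)))"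
 shows "m <= m'" "I (\<theta> * s) G <= cG * m' * (\<theta> * s) ^ d"
  and "tent_avg c (sg (\<theta> * s)) (\<lambda>x. (norm (G x))^2) <= m'"
  and "!!j. 1 <= j ==> j <= d ==>
   zall (\<kappa> * (\<theta> * s)) (\<theta> * s) j (\<beta> ^ j * ((3 / 4 * Y + K5 * (\<Omega> + g))^2 * m' * (\<theta> * s) ^ d))"
  and "!!j. 1 <= j ==> j <= d ==>
   zbound \<tau> (\<kappa> * (\<theta> * s)) (\<theta> * s) j (\<beta> ^ j * ((3 / 4 * Z + K5 * (\<tau> + l / s * Y + g))^2 * m' * (\<theta> * s) ^ d))"
proof -
 note P = par[unfolded good_params_def, folded \<theta>_def]
 have d1: "d >= 1" by (simp add: d_def Suc_le_eq)
 have cG1: "cG >= 1" unfolding cG_def by (rule one_le_power) (use one_le_power[of "2::real" b] in linarith)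
 have C10: "0 <= C1" by (rule C1_nonneg)
 have m: "m > 0" using m0 by simp
 have sd: "s ^ d > 0" using s by simp
 have \<theta>0: "\<theta> > 0" by (simp add: \<theta>_def)
 have K0: "K > 0" using P by blast
 have \<kappa>0: "\<kappa> > 0" and \<beta>: "0 < \<beta>" "\<beta> <= 1" using P by blast+
 have lk: "l <= \<kappa> * s / 8" and lp: "2 ^ (d + 1) * (real d * l / (s / (64 * real d) / 2 ^ a)) <= \<theta> ^ d / 16"
  using P l s by blast+
 define q where "q = l / s"
 have q0: "0 <= q" using l s by (simp add: q_def)
 have tau0: "0 <= \<tau>" by (rule tau_nonneg[OF dense]) (use s in simp)
 have Om0: "0 <= \<Omega>" using \<Omega>[of 0] om_zero s by simp
 have kd: "(real d + 3) * \<kappa> <= 1 / 64 ^ (d + 1)" using P by blast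
 have k4: "4 * \<kappa> <= 1 / 64"
 proof -
  have "4 * \<kappa> <= (real d + 3) * \<kappa>" using \<kappa>0 d1 by (intro mult_right_mono) auto
  also have "... <= 1 / 64 ^ (d + 1)" by (rule kd)
  also have "... <= 1 / 64 ^ 1" by (intro divide_left_mono power_increasing) auto
  finally show ?thesis by simp
 qed
 have ks: "4 * (\<kappa> * s) <= s / 64" using mult_right_mono[OF k4, of s] s by simp
 have K7: "K7 >= cG" "K7 >= 0"
 proof -
  have "0 <= 10 * C1 * (real n + 3)^2" "0 <= C1 * 2304 * 2 ^ (d + 1) * (real N)^2" using C10 by auto
  moreover have "0 <= 10 * C1 * (real n + 3)^2 * cG" using C10 cG1 by simp
  ultimately show "K7 >= cG" unfolding K7_def distrib_right[of _ _ cG] by simp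
  then show "K7 >= 0" using cG1 by simp
 qed
 have K8: "K8 >= 0" unfolding K8_def using K7 by (intro mult_nonneg_nonneg) auto
 have K9: "K9 >= 0" unfolding K9_def using cG1 by (intro mult_nonneg_nonneg add_nonneg_nonneg) auto
 have errb: "err t s <= cG * (t^2 + g^2) * (m * s ^ d)" for t
 proof -
  have "t^2 * I s G <= t^2 * (cG * m * s ^ d)" by (intro mult_left_mono GI) auto
  moreover have "g^2 * m0 * s ^ d <= g^2 * (cG * m) * s ^ d"
   using m0 cG1 sd mult_mono[of 1 cG m0 m] by (intro mult_right_mono mult_left_mono) auto
  ultimately show ?thesis using g(2) unfolding err_def by (simp add: algebra_simps)
 qed
 \<comment> \<open>The Young parameter of \<open>growth_step\<close> is taken equal to the square
   root of the size of its error: (1 + 1 / x) x^2 = (1 + x) x is then linear for small x. Its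
   positivity comes from g > 0.\<close>
 define x where "x = Z + \<tau> + g + q * Y"
 have x0: "x > 0" unfolding x_def using Z Y tau0 g q0 by (intro add_nonneg_pos add_pos_nonneg) auto
 have ex: "(1 + K8 + K9) * (Z + \<tau> + g + l / s * (Y + Y^2)) >= x + K8 * x + K9 * (q * (Y + Y^2))"
 proof -
  have "0 <= q * Y^2" using q0 by simp
  then have 1: "x <= Z + \<tau> + g + q * (Y + Y^2)" by (simp add: x_def algebra_simps)
  have 2: "q * (Y + Y^2) <= Z + \<tau> + g + q * (Y + Y^2)" using Z tau0 g by simp
  have "K8 * x <= K8 * (Z + \<tau> + g + q * (Y + Y^2))" "K9 * (q * (Y + Y^2)) <= K9 * (Z + \<tau> + g + q * (Y + Y^2))"
   using 1 2 K8 K9 by (auto intro: mult_left_mono)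
  then show ?thesis using 1 unfolding q_def[symmetric] distrib_right mult_1 by linarith
 qed
 have ex0: "0 <= (1 + K8 + K9) * (Z + \<tau> + g + l / s * (Y + Y^2))"
  using Z tau0 g Y l s K8 K9 by (intro mult_nonneg_nonneg add_nonneg_nonneg) auto
 show mm': "m <= m'" unfolding m' using m ex0 by simp
 show "I (\<theta> * s) G <= cG * m' * (\<theta> * s) ^ d"
 proof -
  have sg0: "sg s > 0" using s d1 by (simp add: sg_def)
  have "I (\<theta> * s) G <= I (sg s / 2) G"
  proof (rule ball_energy_mono[OF contG])
   have "\<theta> <= 1 / (128 * real d * 2 ^ a)" using P by blast
   also have "... <= 1 / (128 * real d * 1)" using d1 by (intro divide_left_mono mult_left_mono) auto
   finally have "\<theta> * s <= 1 / (128 * real d) * s" using s by (intro mult_right_mono) auto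
   then show "\<theta> * s <= sg s / 2" by (simp add: sg_def)
  qed
  also have "... <= (2 * sg s) ^ d * tent_avg c (sg s) (\<lambda>x. (norm (G x))^2)"
   unfolding d_def by (rule tent_avg_lower[OF sg0 contG])
  also have "... <= (2 * sg s) ^ d * m'" using T mm' sg0 by (intro mult_left_mono) auto
  also have "... <= (2 * s) ^ d * m'"
  proof (intro mult_right_mono power_mono)
   show "2 * sg s <= 2 * s" unfolding sg_def using s d1 by (simp add: field_simps)
  qed (use sg0 m mm' in auto)
  also have "(2 * s) ^ d = cG * (\<theta> * s) ^ d" unfolding cG_def \<theta>_def power_mult_distrib[symmetric] by simp
  finally show ?thesis by (simp add: algebra_simps)
 qed
 have Q_pos: "0 < Y^2 * m * s ^ d" using Y(1) m sd by simp
 have par9: "1 / 2 <= real N * \<kappa>" and N1: "N >= 1" using P by blast+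
 obtain k where k: "I (s / 4) (\<lambda>x. G x - k) <= 2 ^ (CARD('n) + 1) * ((real N)^2 * (\<beta> ^ 1 * (Y^2 * m * s ^ d)))"
 proof -
  have "\<exists>k. I (s / 4) (\<lambda>x. G x - k) <= 2 ^ (CARD('n) + 1) * ((real N)^2 * (\<beta> ^ 1 * (Y^2 * m * s ^ d)))"
  proof (rule poincare_scale)
   fix h :: "real^'n" assume "norm h <= \<kappa> * s"
   then show "I s (diff_op h G) <= \<beta> ^ 1 * (Y^2 * m * s ^ d)"
    using Y(2)[OF order_refl d1] unfolding zall_def by (auto dest: spec[of _ "[h]"])
  next
   show "0 < \<beta> ^ 1 * (Y^2 * m * s ^ d)" using Q_pos \<beta> by simp
   show "s / 2 <= real N * (\<kappa> * s)" using mult_right_mono[OF par9, of s] s by (simp add: algebra_simps)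
  qed (use N1 s in auto)
  then show ?thesis using that by blast
 qed
 define Pk where "Pk = 2 ^ (d + 1) * (real N)^2 * (Y^2 * m * s ^ d)"
 have kP: "I (s / 4) (\<lambda>x. G x - k) <= Pk"
 proof -
  have "\<beta> ^ 1 * (Y^2 * m * s ^ d) <= 1 * (Y^2 * m * s ^ d)" using \<beta> Q_pos by (intro mult_right_mono) auto
  then have "2 ^ (d + 1) * ((real N)^2 * (\<beta> ^ 1 * (Y^2 * m * s ^ d))) <= 2 ^ (d + 1) * ((real N)^2 * (1 * (Y^2 * m * s ^ d)))"
   by (intro mult_left_mono) auto
  from order_trans[OF k[folded d_def] this] show ?thesis by (simp add: Pk_def mult.assoc)
 qed
 define W where "W = C1 * ((48 * l / s)^2 * Pk + 10 * (real n + 3)^2 * err \<tau> s)"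
 have l16: "3 * l <= s / 16" using lk ks s by linarith
 have Wb: "small_shift_bound ((real n + 3) * \<tau>) (3 * l) s W"
  unfolding W_def by (rule small_shift[OF kP l(1) l16 s(2,1)]) simp
 have W0: "0 <= W" by (rule small_shift_bound_nonneg[OF Wb]) (use l tau0 in auto)
 have WE: "W + err \<tau> s <= K7 * (q^2 * Y^2 + \<tau>^2 + g^2) * (m * s ^ d)"
 proof -
  define V where "V = m * s ^ d"
  have V0: "V > 0" using m sd by (simp add: V_def)
  have 48: "(48 * l / s)^2 = 2304 * q^2" by (simp add: q_def power_mult_distrib power_divide)
  have e1: "C1 * ((48 * l / s)^2 * Pk) = (C1 * 2304 * 2 ^ (d + 1) * (real N)^2) * (q^2 * Y^2) * V"
   unfolding 48 Pk_def V_def by (simp add: algebra_simps)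
  have e2: "(10 * C1 * (real n + 3)^2 + 1) * err \<tau> s <= (10 * C1 * (real n + 3)^2 + 1) * cG * (\<tau>^2 + g^2) * V"
   using mult_left_mono[OF errb[of \<tau>], of "10 * C1 * (real n + 3)^2 + 1"] C10 by (simp add: V_def mult.assoc)
  define A1 A2 where "A1 = C1 * 2304 * 2 ^ (d + 1) * (real N)^2" and "A2 = (10 * C1 * (real n + 3)^2 + 1) * cG"
  have A0: "0 <= A1" "0 <= A2" using C10 cG1 by (auto simp: A1_def A2_def)
  have "W + err \<tau> s = C1 * ((48 * l / s)^2 * Pk) + (10 * C1 * (real n + 3)^2 + 1) * err \<tau> s"
   by (simp add: W_def algebra_simps)
  also have "... <= A1 * (q^2 * Y^2) * V + A2 * (\<tau>^2 + g^2) * V" unfolding A1_def A2_def using e1 e2 by linarith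
  also have "... <= (A1 + A2) * (q^2 * Y^2 + \<tau>^2 + g^2) * V"
  proof -
   have "0 <= A1 * (\<tau>^2 + g^2) * V" "0 <= A2 * (q^2 * Y^2) * V" using A0 V0 by auto
   then show ?thesis by (simp add: algebra_simps)
  qed
  finally show ?thesis by (simp add: K7_def A1_def A2_def V_def)
 qed
 have zZ: "zbound \<tau> (\<kappa> * s) s j (\<beta> ^ j * (Z^2 * m * s ^ d))" if "1 <= j" "j <= d" for j using Z(2) that by blast
 have decay: "zbound t (\<kappa> * (\<theta> * s)) (\<theta> * s) j (\<beta> ^ j * (\<theta> ^ d / 2 * B + K * (W' + err t s)))"
  if "dense_shifts t l' s" "small_shift_bound ((real n + 3) * t) (3 * l') s W'"
   "!!j. 1 <= j ==> j <= d ==> zbound t (\<kappa> * s) s j (\<beta> ^ j * B)" "0 <= l'" "L0 * l' <= s" "B >= 0" "1 <= j" "j <= d" for t l' W' B j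
  unfolding d_def \<theta>_def
 proof -
  note P' = P[unfolded d_def \<theta>_def] and that' = that[unfolded d_def \<theta>_def]
  show "zbound t (\<kappa> * (1 / 2 ^ b * s)) (1 / 2 ^ b * s) j (\<beta> ^ j * ((1 / 2 ^ b) ^ CARD('n) / 2 * B + K * (W' + err t s)))"
  proof (rule decay_step[where a = a and n = n and N = N])
  show "2 ^ (CARD('n) + 1) * (real CARD('n) * l' / (s / (64 * real CARD('n)) / 2 ^ a)) <= (1 / 2 ^ b) ^ CARD('n) / 16" "l' <= \<kappa> * s / 8"
   using P that(4,5) s unfolding d_def \<theta>_def by blast+
  show "1 / 16 <= real N * \<kappa>" using par9 by simp
   show "dense_shifts t l' s" "small_shift_bound ((real n + 3) * t) (3 * l') s W'" "0 <= l'" "s <= r0" "0 < s" "0 <= B" "1 <= j" "j <= CARD('n)"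
    by (fact that' s)+
   show "zbound t (\<kappa> * s) s j (\<beta> ^ j * B)" if "1 <= j" "j <= CARD('n)" for j using that by (rule that'(3))
  qed (insert P', (elim conjE, assumption)+)
 qed
 show "zall (\<kappa> * (\<theta> * s)) (\<theta> * s) j (\<beta> ^ j * ((3 / 4 * Y + K5 * (\<Omega> + g))^2 * m' * (\<theta> * s) ^ d))"
  if j: "1 <= j" "j <= d" for j
 \<comment> \<open>For all shifts \<open>decay\<close> is used with \<Omega> in place of \<tau>,
   spacing 0 and bound 0 for small shifts: every vector of length at most s then counts as an almost
   period.\<close>
 proof (rule zall_weaken[OF zbound_imp_zall])
  show "zbound \<Omega> (\<kappa> * (\<theta> * s)) (\<theta> * s) j (\<beta> ^ j * (\<theta> ^ d / 2 * (Y^2 * m * s ^ d) + K * (0 + err \<Omega> s)))"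
  proof (rule decay)
   show "dense_shifts \<Omega> 0 s" unfolding dense_shifts_def using \<Omega> by auto
   show "small_shift_bound ((real n + 3) * \<Omega>) (3 * 0) s 0"
    by (auto simp: small_shift_bound_def diff_op_def ball_energy_def)
   show "zbound \<Omega> (\<kappa> * s) s j (\<beta> ^ j * (Y^2 * m * s ^ d))" if "1 <= j" "j <= d" for j
    by (rule zall_imp_zbound[OF Y(2)[OF that]])
  qed (use j s Q_pos in auto)
  fix h :: "real^'n" assume h: "norm h <= \<kappa> * (\<theta> * s)"
  have "\<theta> <= 1" by (simp add: \<theta>_def)
  then have "\<kappa> * \<theta> <= 1 * 1" using k4 \<kappa>0 \<theta>0 by (intro mult_mono) auto
  then have "\<kappa> * (\<theta> * s) <= s" using s mult_right_mono[of "\<kappa> * \<theta>" 1 s] by (simp add: mult.assoc)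
  then show "\<omega> h <= \<Omega>" using \<Omega> h by simp
 next
  have "K * (0 + err \<Omega> s) <= K * (cG * (\<Omega>^2 + g^2) * (m * s ^ d))" using errb[of \<Omega>] K0 by (intro mult_left_mono) auto
  also have "... <= K * (K7 * (\<Omega>^2 + g^2) * (m * s ^ d))" using K0 K7 m sd by (intro mult_left_mono mult_right_mono) auto
  also have "... = K * K7 / \<theta> ^ d * (\<Omega>^2 + g^2) * (m * (\<theta> * s) ^ d)" using \<theta>0 by (simp add: power_mult_distrib)
  also have "... <= K5^2 * (\<Omega>^2 + g^2) * (m * (\<theta> * s) ^ d)" using K5 m s \<theta>0 by (intro mult_right_mono) auto
  finally have "\<theta> ^ d / 2 * (Y^2 * m * s ^ d) + K * (0 + err \<Omega> s) <= (Y^2 / 2 + K5^2 * (\<Omega>^2 + g^2)) * (m * (\<theta> * s) ^ d)"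
   by (simp add: power_mult_distrib algebra_simps)
  also have "... <= (3 / 4 * Y + K5 * (\<Omega> + g))^2 * (m' * (\<theta> * s) ^ d)"
  proof (rule mult_mono)
   have "0 <= 3 / 4 * Y * (K5 * (\<Omega> + g))" "0 <= K5^2 * (\<Omega> * g)" "0 <= Y^2" using Y K5 Om0 g by auto
   moreover have "(3 / 4 * Y + K5 * (\<Omega> + g))^2 = 9 / 16 * Y^2 + 2 * (3 / 4 * Y * (K5 * (\<Omega> + g)))
    + K5^2 * (\<Omega>^2 + g^2) + 2 * (K5^2 * (\<Omega> * g))" by (simp add: power2_eq_square algebra_simps)
   ultimately show "Y^2 / 2 + K5^2 * (\<Omega>^2 + g^2) <= (3 / 4 * Y + K5 * (\<Omega> + g))^2" by linarith
   show "m * (\<theta> * s) ^ d <= m' * (\<theta> * s) ^ d" using mm' s \<theta>0 by (intro mult_right_mono) auto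
  qed (use m s \<theta>0 in auto)
  finally show "\<beta> ^ j * (\<theta> ^ d / 2 * (Y^2 * m * s ^ d) + K * (0 + err \<Omega> s))
    <= \<beta> ^ j * ((3 / 4 * Y + K5 * (\<Omega> + g))^2 * m' * (\<theta> * s) ^ d)"
   using \<beta> by (intro mult_left_mono) (auto simp: mult.assoc)
 qed
 show "zbound \<tau> (\<kappa> * (\<theta> * s)) (\<theta> * s) j (\<beta> ^ j * ((3 / 4 * Z + K5 * (\<tau> + l / s * Y + g))^2 * m' * (\<theta> * s) ^ d))"
  if j: "1 <= j" "j <= d" for j
 proof (rule zbound_weaken[OF decay[OF dense Wb zZ l(1,2) _ j] order_refl])
  show "0 <= Z^2 * m * s ^ d" using m sd by simp
  have "K * (W + err \<tau> s) <= K * (K7 * (q^2 * Y^2 + \<tau>^2 + g^2) * (m * s ^ d))" using WE K0 by (intro mult_left_mono) auto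
  also have "... = K * K7 / \<theta> ^ d * (q^2 * Y^2 + \<tau>^2 + g^2) * (m * (\<theta> * s) ^ d)"
   using \<theta>0 by (simp add: power_mult_distrib)
  also have "... <= K5^2 * (q^2 * Y^2 + \<tau>^2 + g^2) * (m * (\<theta> * s) ^ d)" using K5 m s \<theta>0 by (intro mult_right_mono) auto
  finally have "\<theta> ^ d / 2 * (Z^2 * m * s ^ d) + K * (W + err \<tau> s)
    <= (Z^2 / 2 + K5^2 * (q^2 * Y^2 + \<tau>^2 + g^2)) * (m * (\<theta> * s) ^ d)" by (simp add: power_mult_distrib algebra_simps)
  also have "... <= (3 / 4 * Z + K5 * (\<tau> + q * Y + g))^2 * (m' * (\<theta> * s) ^ d)"
  proof (rule mult_mono)
   define u where "u = q * Y"
   have u0: "u >= 0" using q0 Y by (simp add: u_def)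
   have "0 <= Z * (K5 * (\<tau> + u + g))" "0 <= K5^2 * (\<tau> * u)" "0 <= K5^2 * (\<tau> * g)" "0 <= K5^2 * (u * g)" "0 <= Z^2"
    using Z K5 tau0 g u0 by auto
   moreover have "(3 / 4 * Z + K5 * (\<tau> + u + g))^2 = 9 / 16 * Z^2 + 3 / 2 * (Z * (K5 * (\<tau> + u + g)))
    + K5^2 * (u^2 + \<tau>^2 + g^2) + 2 * (K5^2 * (\<tau> * u)) + 2 * (K5^2 * (\<tau> * g)) + 2 * (K5^2 * (u * g))"
    by (simp add: power2_eq_square algebra_simps)
   ultimately have "Z^2 / 2 + K5^2 * (u^2 + \<tau>^2 + g^2) <= (3 / 4 * Z + K5 * (\<tau> + u + g))^2" by linarith
   then show "Z^2 / 2 + K5^2 * (q^2 * Y^2 + \<tau>^2 + g^2) <= (3 / 4 * Z + K5 * (\<tau> + q * Y + g))^2"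
    by (simp add: u_def power_mult_distrib)
   show "m * (\<theta> * s) ^ d <= m' * (\<theta> * s) ^ d" using mm' s \<theta>0 by (intro mult_right_mono) auto
  qed (use m s \<theta>0 in auto)
  finally show "\<beta> ^ j * (\<theta> ^ d / 2 * (Z^2 * m * s ^ d) + K * (W + err \<tau> s))
    <= \<beta> ^ j * ((3 / 4 * Z + K5 * (\<tau> + l / s * Y + g))^2 * m' * (\<theta> * s) ^ d)"
   using \<beta> by (intro mult_left_mono) (auto simp: mult.assoc q_def)
 qed
 show "tent_avg c (sg (\<theta> * s)) (\<lambda>x. (norm (G x))^2) <= m'"
 proof -
  define r' where "r' = sg s / 2 ^ b"
  define R where "R = 64 * real d * 2 ^ b"
  have R0: "R > 0" using d1 by (simp add: R_def)
  have r': "r' = s / R" by (simp add: r'_def sg_def R_def)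
  have sgr: "sg (\<theta> * s) = r'" by (simp add: sg_def \<theta>_def r'_def)
  have r'0: "r' > 0" using s R0 by (simp add: r')
  \<comment> \<open>The second Young parameter is Y: it balances \<open>Pk\<close>, of order Y^2,
    against Y times the energy of \<open>G\<close>, and leaves Y + Y^2.\<close>
  have "tent_avg c r' (\<lambda>x. (norm (G x))^2) <=
   (1 + x) * (tent_avg c (sg s) (\<lambda>x. (norm (G x))^2) + real d * l / r' ^ (d + 1) * ((1 + 1 / Y) * Pk + Y * I s G))
   + (1 + 1 / x) / r' ^ d * (2 * (real N)^2 * (\<beta> ^ 1 * (Z^2 * m * s ^ d) + W))" unfolding r'_def sg_def d_def
  proof (rule growth_step[OF dense Wb _ kP])
   show "zbound \<tau> (\<kappa> * s) s 1 (\<beta> ^ 1 * (Z^2 * m * s ^ CARD('n)))" using zZ[of 1] d1 by (simp add: d_def)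
   show "s / 16 <= real N * (\<kappa> * s)" using mult_right_mono[OF par9, of s] s by (simp add: algebra_simps)
  qed (use l lk ks N1 s \<kappa>0 x0 Y in auto)
  also have "... <= (1 + x) * (m + K9 * (q * (Y + Y^2)) * m) + (1 + x) * (K8 * x) * m"
  proof (intro add_mono mult_left_mono)
   have "real d * l / r' ^ (d + 1) * ((1 + 1 / Y) * Pk + Y * I s G)
     <= real d * l / r' ^ (d + 1) * ((Y + Y^2) * ((2 ^ (d + 1) * (real N)^2 + cG) * (m * s ^ d)))"
   proof (rule mult_left_mono)
    have "(1 + 1 / Y) * Pk = (Y + Y^2) * (2 ^ (d + 1) * (real N)^2 * (m * s ^ d))"
     using Y(1) by (simp add: Pk_def field_simps power2_eq_square)
    moreover have "Y * I s G <= (Y + Y^2) * (cG * (m * s ^ d))"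
     using Y(1) GI cG1 m sd by (intro mult_mono) (auto simp: mult.assoc)
    ultimately show "(1 + 1 / Y) * Pk + Y * I s G <= (Y + Y^2) * ((2 ^ (d + 1) * (real N)^2 + cG) * (m * s ^ d))"
     unfolding distrib_right[of _ cG] distrib_left[of "Y + Y^2"] by linarith
   qed (use l r'0 in auto)
   also have "... = K9 * (q * (Y + Y^2)) * m"
    using s R0 unfolding r' K9_def R_def[symmetric] q_def by (simp add: power_divide field_simps)
   finally show "real d * l / r' ^ (d + 1) * ((1 + 1 / Y) * Pk + Y * I s G) <= K9 * (q * (Y + Y^2)) * m" .
   have "\<beta> ^ 1 * (Z^2 * m * s ^ d) + W <= (1 + K7) * x^2 * (m * s ^ d)"
   proof -
    have "\<beta> ^ 1 * (Z^2 * m * s ^ d) <= 1 * (Z^2 * m * s ^ d)" using \<beta> m sd by (intro mult_right_mono) auto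
    also have "... <= x^2 * (m * s ^ d)" unfolding mult_1 mult.assoc using m sd Z tau0 g q0 Y
     by (intro mult_right_mono power_mono) (auto simp: x_def)
    finally have 1: "\<beta> ^ 1 * (Z^2 * m * s ^ d) <= x^2 * (m * s ^ d)" .
    have "q^2 * Y^2 + \<tau>^2 + g^2 <= x^2"
    proof -
     define u where "u = q * Y"
     have u0: "u >= 0" using q0 Y by (simp add: u_def)
     have "0 <= Z * Z" "0 <= Z * (\<tau> + g + u)" "0 <= \<tau> * g" "0 <= \<tau> * u" "0 <= g * u" using Z tau0 g u0 by auto
     then have "u^2 + \<tau>^2 + g^2 <= (Z + \<tau> + g + u)^2" by (simp add: power2_eq_square algebra_simps)
     then show ?thesis by (simp add: u_def x_def power_mult_distrib)
    qed
    then have "K7 * (q^2 * Y^2 + \<tau>^2 + g^2) * (m * s ^ d) <= K7 * x^2 * (m * s ^ d)"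
     using K7 m sd by (intro mult_right_mono mult_left_mono) auto
    moreover have "W <= W + err \<tau> s" using err_nonneg by simp
    ultimately have "W <= K7 * x^2 * (m * s ^ d)" using WE by linarith
    with 1 show ?thesis by (simp add: algebra_simps)
   qed
   then have "(1 + 1 / x) / r' ^ d * (2 * (real N)^2 * (\<beta> ^ 1 * (Z^2 * m * s ^ d) + W))
    <= (1 + 1 / x) / r' ^ d * (2 * (real N)^2 * ((1 + K7) * x^2 * (m * s ^ d)))"
    using x0 r'0 by (intro mult_left_mono) auto
   also have "... = (1 + x) * (K8 * x) * m"
    using s R0 x0 unfolding r' K8_def R_def[symmetric] by (simp add: power_divide power2_eq_square field_simps)
   finally show "(1 + 1 / x) / r' ^ d * (2 * (real N)^2 * (\<beta> ^ 1 * (Z^2 * m * s ^ d) + W)) <= (1 + x) * (K8 * x) * m" .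
  qed (use T x0 in auto)
  also have "... = m * ((1 + x) * (1 + (K8 * x + K9 * (q * (Y + Y^2)))))" by (simp add: algebra_simps)
  also have "... <= m * (exp x * exp (K8 * x + K9 * (q * (Y + Y^2))))"
  proof (intro mult_left_mono mult_mono exp_ge_add_one_self)
   have "0 <= K8 * x + K9 * (q * (Y + Y^2))" using K8 K9 x0 q0 Y by simp
   then show "0 <= 1 + (K8 * x + K9 * (q * (Y + Y^2)))" by simp
  qed (use m in auto)
  also have "... <= m'" unfolding m' exp_add[symmetric] using ex m by (intro mult_left_mono) (auto simp: add.assoc)
  finally show ?thesis by (simp add: sgr)
 qed
qed

end

section \<open>Iteration over the scales\<close>

text \<open>Squared, these bound the normalized differences over all shifts and over almost periods, respectively. When the level
 changes (\<open>same i\<close> fails), other shifts become almost periods, so \<open>zSeq\<close> restarts from the bound for all shifts.\<close>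

primrec ySeq :: "real => real => (nat => real) => (nat => real) => nat => real" where
 "ySeq K5 Y0 \<Omega> g 0 = Y0"
| "ySeq K5 Y0 \<Omega> g (Suc i) = 3 / 4 * ySeq K5 Y0 \<Omega> g i + K5 * (\<Omega> i + g i)"

primrec zSeq :: "real => (nat => real) => (nat => real) => (nat => real) => (nat => real) => (nat => bool) => nat => real" where
 "zSeq K5 Y \<tau> q g same 0 = Y 0"
| "zSeq K5 Y \<tau> q g same (Suc i) =
  (if same i then 3 / 4 * zSeq K5 Y \<tau> q g same i + K5 * (\<tau> i + q i * Y i + g i) else Y (Suc i))"

context approx_solution
begin

text \<open>Induction over the scales with \<open>one_step\<close>. The bound for almost periods is
  claimed for k < m only, as nothing is assumed about \<tau> at m. As long as the level stays the
  same \<tau> does not increase, so the new almost periods are among the old ones; otherwise the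
  bound for all shifts takes over.\<close>

lemma n_steps:
 fixes a b n N :: nat and \<kappa> \<beta> K L0 s0 :: real
 defines "d \<equiv> CARD('n)" and "\<theta> \<equiv> 1 / 2 ^ b"
 defines "cG \<equiv> (2 * 2 ^ b) ^ d"
 defines "K7 \<equiv> C1 * 2304 * 2 ^ (d + 1) * (real N)^2 + (10 * C1 * (real n + 3)^2 + 1) * cG"
 defines "K8 \<equiv> 2 * (real N)^2 * (1 + K7) * (64 * real d * 2 ^ b) ^ d"
 defines "K9 \<equiv> real d * (64 * real d * 2 ^ b) ^ (d + 1) * (2 ^ (d + 1) * (real N)^2 + cG)"
 defines "S \<equiv> \<lambda>i::nat. \<theta> ^ i * s0"
 assumes par: "good_params d C1 a b n N \<kappa> \<beta> K L0"
  and K5: "K5 >= 0" "K5^2 >= K * K7 / \<theta> ^ d"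
  and s0: "0 < s0" "s0 <= r0"
  and dense: "!!i. i < m ==> dense_shifts (\<tau> i) (l i) (S i)"
  and l: "!!i. i < m ==> 0 <= l i" "!!i. i < m ==> L0 * l i <= S i"
  and \<Omega>: "!!i h. i < m ==> norm h <= S i ==> \<omega> h <= \<Omega> i"
  and g: "!!i. i < m ==> g i > 0" "!!i. i < m ==> I (S i) E + (S i)^2 * I (S i) f <= (g i)^2 * m0 * (S i) ^ d"
  and m0: "0 < m0" "m0 <= m1"
  and init: "I s0 G <= cG * m1 * s0 ^ d" "tent_avg c (s0 / (64 * real d)) (\<lambda>x. (norm (G x))^2) <= m1"
  and Y0: "Y0 > 0" "!!j. 1 <= j ==> j <= d ==> zall (\<kappa> * s0) s0 j (\<beta> ^ j * (Y0^2 * m1 * s0 ^ d))"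
  and same: "!!i. Suc i < m ==> same i ==> \<tau> (Suc i) <= \<tau> i"
 shows "I (S m) G <= cG * (m1 * exp ((1 + K8 + K9) * (\<Sum>i<m. zSeq K5 (ySeq K5 Y0 \<Omega> g) \<tau> (\<lambda>i. l i / S i) g same i
   + \<tau> i + g i + l i / S i * (ySeq K5 Y0 \<Omega> g i + (ySeq K5 Y0 \<Omega> g i)^2)))) * (S m) ^ d"
proof -
 define Y where "Y = ySeq K5 Y0 \<Omega> g"
 define Z where "Z = zSeq K5 Y \<tau> (\<lambda>i. l i / S i) g same"
 define M where "M k = m1 * exp ((1 + K8 + K9) * (\<Sum>i<k. Z i + \<tau> i + g i + l i / S i * (Y i + (Y i)^2)))" for k
 have S0: "S 0 = s0" and SS: "S (Suc i) = \<theta> * S i" for i by (simp_all add: S_def)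
 have \<theta>: "0 < \<theta>" "\<theta> <= 1" by (auto simp: \<theta>_def)
 have Spos: "0 < S i" for i using s0 \<theta> by (simp add: S_def)
 have Sle: "S i <= r0" for i
 proof -
  have "\<theta> ^ i <= 1" using \<theta> by (simp add: power_le_one)
  then have "S i <= s0" using s0 unfolding S_def by (simp add: mult_left_le_one_le)
  then show ?thesis using s0 by linarith
 qed
 have "k <= m ==> m0 <= M k \<and> I (S k) G <= cG * M k * (S k) ^ d
   \<and> tent_avg c (S k / (64 * real d)) (\<lambda>x. (norm (G x))^2) <= M k \<and> Y k > 0 \<and> Z k >= 0
   \<and> (\<forall>j. 1 <= j --> j <= d --> zall (\<kappa> * S k) (S k) j (\<beta> ^ j * ((Y k)^2 * M k * (S k) ^ d)))
   \<and> (k < m --> (\<forall>j. 1 <= j --> j <= d --> zbound (\<tau> k) (\<kappa> * S k) (S k) j (\<beta> ^ j * ((Z k)^2 * M k * (S k) ^ d))))" for k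
 proof (induction k)
  case 0
  then show ?case using m0 init Y0 by (auto simp: M_def S0 Y_def Z_def intro: zall_imp_zbound)
 next
  case (Suc k)
  then have k: "k < m" and IH: "m0 <= M k" "I (S k) G <= cG * M k * (S k) ^ d"
   "tent_avg c (S k / (64 * real d)) (\<lambda>x. (norm (G x))^2) <= M k" "Y k > 0" "Z k >= 0"
   "!!j. 1 <= j ==> j <= d ==> zall (\<kappa> * S k) (S k) j (\<beta> ^ j * ((Y k)^2 * M k * (S k) ^ d))"
   "!!j. 1 <= j ==> j <= d ==> zbound (\<tau> k) (\<kappa> * S k) (S k) j (\<beta> ^ j * ((Z k)^2 * M k * (S k) ^ d))" by auto
  have MS: "M (Suc k) = M k * exp ((1 + K8 + K9) * (Z k + \<tau> k + g k + l k / S k * (Y k + (Y k)^2)))"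
   by (simp add: M_def distrib_left exp_add)
  have tau0: "0 <= \<tau> k" by (rule tau_nonneg[OF dense[OF k]]) (use Spos[of k] in simp)
  have Om0: "0 <= \<Omega> k" using \<Omega>[OF k, of 0] om_zero Spos[of k] by simp
  have q0: "0 <= l k / S k" using l(1)[OF k] Spos[of k] by simp
  note st = one_step[of a b n N \<kappa> \<beta> K L0 K5 "\<tau> k" "l k" "S k" "\<Omega> k" "g k" m0 "M k" "Y k" "Z k" "M (Suc k)",
    folded d_def, folded cG_def, folded K7_def, folded K8_def K9_def \<theta>_def]
  have step: "M k <= M (Suc k)" "I (\<theta> * S k) G <= cG * M (Suc k) * (\<theta> * S k) ^ d"
   "tent_avg c ((\<theta> * S k) / (64 * real d)) (\<lambda>x. (norm (G x))^2) <= M (Suc k)"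
   "!!j. 1 <= j ==> j <= d ==>
   zall (\<kappa> * (\<theta> * S k)) (\<theta> * S k) j (\<beta> ^ j * ((3 / 4 * Y k + K5 * (\<Omega> k + g k))^2 * M (Suc k) * (\<theta> * S k) ^ d))"
   "!!j. 1 <= j ==> j <= d ==>
   zbound (\<tau> k) (\<kappa> * (\<theta> * S k)) (\<theta> * S k) j (\<beta> ^ j * ((3 / 4 * Z k + K5 * (\<tau> k + l k / S k * Y k + g k))^2 * M (Suc k) * (\<theta> * S k) ^ d))"
   using st[OF par K5 dense[OF k] l[OF k] Spos Sle \<Omega>[OF k] g[OF k] m0(1) IH(1,2,3,4,6,5,7) MS] by auto
  have YS: "Y (Suc k) = 3 / 4 * Y k + K5 * (\<Omega> k + g k)" by (simp add: Y_def)
  have Ypos: "Y (Suc k) > 0"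
   unfolding YS using IH(4) K5(1) Om0 g(1)[OF k] by (intro add_pos_nonneg mult_nonneg_nonneg) auto
  have ZS: "Z (Suc k) = (if same k then 3 / 4 * Z k + K5 * (\<tau> k + l k / S k * Y k + g k) else Y (Suc k))"
   by (simp add: Z_def)
  have Zpos: "Z (Suc k) >= 0"
  proof -
   have "0 <= 3 / 4 * Z k + K5 * (\<tau> k + l k / S k * Y k + g k)"
    using IH(4,5) K5(1) tau0 q0 g(1)[OF k] by (intro add_nonneg_nonneg mult_nonneg_nonneg) auto
   then show ?thesis unfolding ZS using Ypos by auto
  qed
  have zz: "zbound (\<tau> (Suc k)) (\<kappa> * S (Suc k)) (S (Suc k)) j (\<beta> ^ j * ((Z (Suc k))^2 * M (Suc k) * (S (Suc k)) ^ d))"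
   if "Suc k < m" "1 <= j" "j <= d" for j
  proof (cases "same k")
   case True
   show ?thesis unfolding SS ZS using True
    by (simp only: if_True) (rule zbound_weaken[OF step(5)[OF that(2,3)] same[OF that(1) True] order_refl])
  next
   case False
   show ?thesis unfolding SS ZS using False step(4)[OF that(2,3)] by (simp only: if_False YS) (rule zall_imp_zbound)
  qed
  show ?case using step(1-4) IH(1) Ypos Zpos zz unfolding SS YS by auto
 qed
 from this[of m] show ?thesis by (simp add: M_def Y_def Z_def)
qed

end

text \<open>The term 3 a m is carried through the induction because 4 a (m + 1) <= 3 a m + 4 b
  m.\<close>

lemma sum_contracting:
 fixes a b :: "nat => real"
 assumes "!!i. i < n ==> a (Suc i) <= 3 / 4 * a i + b i" "!!i. i <= n ==> 0 <= a i" "m <= n"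
 shows "(\<Sum>i\<le>m. a i) <= 4 * (a 0 + (\<Sum>i<m. b i))"
proof -
 have "(\<Sum>i\<le>m. a i) + 3 * a m <= 4 * (a 0 + (\<Sum>i<m. b i))" using assms(3)
 proof (induction m)
  case (Suc m)
  have "a (Suc m) <= 3 / 4 * a m + b m" using assms(1)[of m] Suc.prems by simp
  then show ?case using Suc by (simp add: field_simps)
 qed simp
 moreover have "0 <= a m" using assms by simp
 ultimately show ?thesis by linarith
qed

text \<open>The term 2 t (k i + 1) of \<Omega> is constant along a level, so its sum over i is not
  under control. It drives Y towards the fixed point 8 K5 t (k i + 1) of u = 3/4 u + 2 K5 t. What
  remains is \<open>U\<close>, driven by summable terms, and \<open>P\<close>, driven by the drops
  of t between levels, whose sum telescopes. The fixed point itself does no harm: it enters with the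
  weight q i, or once per change of level.\<close>

lemma scalar_sum:
 fixes \<tau> q g \<Omega> slow fast t :: "nat => real" and k :: "nat => nat"
 assumes K5: "K5 >= 0" and Y0: "Y0 >= 0" and a: "a1 >= 0" "a2 >= 0"
  and nn: "!!i. 0 <= slow i" "!!i. 0 <= fast i" "!!i. 0 <= g i" "!!i. 0 <= q i" "!!i. q i <= 1" "!!i. 0 <= t i"
  and t: "antimono t" and k: "mono k"
  and \<Omega>: "!!i. \<Omega> i = a1 * slow i + 2 * t (k i + 1)" and \<tau>: "!!i. \<tau> i = a2 * slow i + fast i + g i"
  and same: "!!i. same i \<longleftrightarrow> k (Suc i) = k i"
  and B: "(\<Sum>i<n. slow i) <= B1" "(\<Sum>i<n. fast i) <= B2" "(\<Sum>i<n. g i) <= B3"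
   "(\<Sum>i<n. q i * t (k i + 1)) <= B4" "!!M. (\<Sum>j<M. t (j + 1)) <= B5"
  and Ymax: "!!i. ySeq K5 Y0 \<Omega> g i <= Ymax" "Ymax >= 0"
 defines "X \<equiv> 8 * (Y0 + K5 * (a1 * B1 + B3)) + 64 * K5 * B5 + 8 * K5 * (B4 + B5)"
 shows "(\<Sum>i<n. zSeq K5 (ySeq K5 Y0 \<Omega> g) \<tau> q g same i + \<tau> i + g i + q i * (ySeq K5 Y0 \<Omega> g i + (ySeq K5 Y0 \<Omega> g i)^2))
  <= 4 * (Y0 + K5 * (a2 * B1 + B2 + 2 * B3 + X) + X) + a2 * B1 + B2 + 2 * B3 + (1 + Ymax) * X"
proof -
 define Y where "Y = ySeq K5 Y0 \<Omega> g"
 define Z where "Z = zSeq K5 Y \<tau> q g same"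
 define U where "U = rec_nat Y0 (\<lambda>i u. 3 / 4 * u + K5 * (a1 * slow i + g i))"
 define Dl where "Dl i = t (k i + 1) - t (k (Suc i) + 1)" for i
 define P where "P = rec_nat 0 (\<lambda>i u. 3 / 4 * u + 8 * K5 * Dl i)"
 have YS: "Y 0 = Y0" "Y (Suc i) = 3 / 4 * Y i + K5 * (\<Omega> i + g i)" for i by (simp_all add: Y_def)
 have US: "U 0 = Y0" "U (Suc i) = 3 / 4 * U i + K5 * (a1 * slow i + g i)" for i by (simp_all add: U_def)
 have PS: "P 0 = 0" "P (Suc i) = 3 / 4 * P i + 8 * K5 * Dl i" for i by (simp_all add: P_def)
 have Dl0: "0 <= Dl i" for i
  unfolding Dl_def using antimonoD[OF t, of "k i + 1" "k (Suc i) + 1"] monoD[OF k, of i "Suc i"] by simp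
 have U0: "0 <= U i" for i by (induction i) (use Y0 K5 a nn in \<open>auto simp: US\<close>)
 have P0: "0 <= P i" for i by (induction i) (use K5 Dl0 in \<open>auto simp: PS\<close>)
 have Yle: "Y i <= U i + P i + 8 * K5 * t (k i + 1)" for i
 proof (induction i)
  case 0
  then show ?case using K5 nn(6) by (simp add: YS US PS)
 next
  case (Suc i)
  then show ?case unfolding YS US PS Dl_def \<Omega> by (simp add: algebra_simps)
 qed
 have Om0: "0 <= \<Omega> i" for i unfolding \<Omega> using a nn by simp
 have Ynn: "0 <= Y i" for i by (induction i) (use Y0 K5 nn Om0 in \<open>auto simp: YS\<close>)
 have tau0: "0 <= \<tau> i" for i unfolding \<tau> using a nn by simp
 have ZS: "Z 0 = Y0" "Z (Suc i) = (if same i then 3 / 4 * Z i + K5 * (\<tau> i + q i * Y i + g i) else Y (Suc i))" for i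
  by (simp_all add: Z_def YS)
 have Znn: "0 <= Z i" for i by (induction i) (use Y0 K5 nn Ynn tau0 in \<open>auto simp: ZS\<close>)
 have sumU: "(\<Sum>i\<le>n. U i) <= 4 * (Y0 + K5 * (a1 * B1 + B3))"
 proof -
  have "(\<Sum>i\<le>n. U i) <= 4 * (U 0 + (\<Sum>i<n. K5 * (a1 * slow i + g i)))" by (rule sum_contracting[of n]) (auto simp: US U0)
  also have "(\<Sum>i<n. K5 * (a1 * slow i + g i)) = K5 * (a1 * (\<Sum>i<n. slow i) + (\<Sum>i<n. g i))"
   by (simp add: sum_distrib_left[symmetric] sum.distrib)
  also have "... <= K5 * (a1 * B1 + B3)" using B K5 a by (intro mult_left_mono add_mono) auto
  finally show ?thesis by (simp add: US)
 qed
 have B5t: "t (k 0 + 1) <= B5"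
 proof -
  have "t (k 0 + 1) <= (\<Sum>j<Suc (k 0). t (j + 1))"
   by (rule member_le_sum[of "k 0" "{..<Suc (k 0)}" "\<lambda>j. t (j + 1)"]) (use nn in auto)
  then show ?thesis using B(5)[of "Suc (k 0)"] by linarith
 qed
 have sumP: "(\<Sum>i\<le>n. P i) <= 32 * K5 * B5"
 proof -
  have "(\<Sum>i\<le>n. P i) <= 4 * (P 0 + (\<Sum>i<n. 8 * K5 * Dl i))" by (rule sum_contracting[of n]) (auto simp: PS P0)
  also have "(\<Sum>i<n. 8 * K5 * Dl i) = 8 * K5 * (t (k 0 + 1) - t (k n + 1))"
   unfolding Dl_def sum_distrib_left[symmetric] by (subst sum_lessThan_telescope') simp
  also have "... <= 8 * K5 * B5" using B5t K5 nn(6)[of "k n + 1"] by (intro mult_left_mono) auto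
  finally show ?thesis by (simp add: PS)
 qed
 \<comment> \<open>The level strictly increases at a switch, so each tail t (j + 1) is used at most
   once.\<close>
 have switch: "(\<Sum>i<n'. if same i then 0 else t (k (Suc i) + 1)) <= B5" for n'
 proof -
  have "(\<Sum>i<n'. if same i then 0 else t (k (Suc i) + 1)) <= (\<Sum>j<Suc (k n'). t (j + 1)) - t (k 0 + 1)"
  proof (induction n')
   case 0
   have "t (k 0 + 1) <= (\<Sum>j<Suc (k 0). t (j + 1))"
    by (rule member_le_sum[of "k 0" "{..<Suc (k 0)}" "\<lambda>j. t (j + 1)"]) (use nn in auto)
   then show ?case by simp
  next
   case (Suc i)
   show ?case
   proof (cases "same i")
    case True
    then show ?thesis using Suc same by simp
   next
    case False
    then have "k i < k (Suc i)" using same monoD[OF k, of i "Suc i"] by simp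
    then have "(\<Sum>j<Suc (k i). t (j + 1)) <= (\<Sum>j<k (Suc i). t (j + 1))" by (intro sum_mono2) (use nn in auto)
    then show ?thesis using Suc False by simp
   qed
  qed
  then show ?thesis using B(5)[of "Suc (k n')"] nn(6)[of "k 0 + 1"] by linarith
 qed
 \<comment> \<open>Apart from the initial value, these are the two ways in which Y feeds the
   recursion for Z.\<close>
 have "(\<Sum>i<n. q i * Y i) + (\<Sum>i<n. if same i then 0 else Y (Suc i))
   <= ((\<Sum>i<n. U i + P i) + 8 * K5 * B4) + ((\<Sum>i<n. U (Suc i) + P (Suc i)) + 8 * K5 * B5)"
 proof (rule add_mono)
  have "(\<Sum>i<n. q i * Y i) <= (\<Sum>i<n. (U i + P i) + 8 * K5 * (q i * t (k i + 1)))"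
  proof (rule sum_mono)
   fix i
   have "q i * Y i <= q i * (U i + P i) + q i * (8 * K5 * t (k i + 1))"
    unfolding distrib_left[symmetric] using nn Yle by (intro mult_left_mono) auto
   moreover have "q i * (U i + P i) <= 1 * (U i + P i)" using nn U0[of i] P0[of i] by (intro mult_right_mono) auto
   ultimately show "q i * Y i <= (U i + P i) + 8 * K5 * (q i * t (k i + 1))" by (simp add: algebra_simps)
  qed
  also have "... = (\<Sum>i<n. U i + P i) + 8 * K5 * (\<Sum>i<n. q i * t (k i + 1))" by (simp add: sum.distrib sum_distrib_left)
  also have "... <= (\<Sum>i<n. U i + P i) + 8 * K5 * B4" using B K5 by (intro add_left_mono mult_left_mono) auto
  finally show "(\<Sum>i<n. q i * Y i) <= (\<Sum>i<n. U i + P i) + 8 * K5 * B4" .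
  have "(\<Sum>i<n. if same i then 0 else Y (Suc i)) <= (\<Sum>i<n. (U (Suc i) + P (Suc i)) + 8 * K5 * (if same i then 0 else t (k (Suc i) + 1)))"
  proof (rule sum_mono)
   fix i
   show "(if same i then 0 else Y (Suc i)) <= (U (Suc i) + P (Suc i)) + 8 * K5 * (if same i then 0 else t (k (Suc i) + 1))"
    using Yle[of "Suc i"] U0[of "Suc i"] P0[of "Suc i"] by (auto simp del: YS US PS)
  qed
  also have "... = (\<Sum>i<n. U (Suc i) + P (Suc i)) + 8 * K5 * (\<Sum>i<n. if same i then 0 else t (k (Suc i) + 1))"
   by (simp add: sum.distrib sum_distrib_left)
  also have "... <= (\<Sum>i<n. U (Suc i) + P (Suc i)) + 8 * K5 * B5"
   using switch K5 by (intro add_left_mono mult_left_mono) auto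
  finally show "(\<Sum>i<n. if same i then 0 else Y (Suc i)) <= (\<Sum>i<n. U (Suc i) + P (Suc i)) + 8 * K5 * B5" .
 qed
 also have "... <= X"
 proof -
  have "(\<Sum>i<n. U i + P i) <= (\<Sum>i\<le>n. U i) + (\<Sum>i\<le>n. P i)"
   unfolding sum.distrib[symmetric] using U0 P0 by (intro sum_mono2) auto
  moreover have "(\<Sum>i<n. U (Suc i) + P (Suc i)) <= (\<Sum>i\<le>n. U i) + (\<Sum>i\<le>n. P i)"
  proof -
   have "(\<Sum>i<n. U (Suc i) + P (Suc i)) = (\<Sum>i\<in>{1..n}. U i + P i)"
    by (rule sum.reindex_bij_witness[of _ "\<lambda>i. i - 1" Suc]) auto
   also have "... <= (\<Sum>i\<le>n. U i + P i)" using U0 P0 by (intro sum_mono2) auto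
   finally show ?thesis by (simp add: sum.distrib)
  qed
  ultimately show ?thesis using sumU sumP unfolding X_def by (simp add: algebra_simps)
 qed
 finally have X: "(\<Sum>i<n. q i * Y i) + (\<Sum>i<n. if same i then 0 else Y (Suc i)) <= X" .
 have nnX: "0 <= (\<Sum>i<n. q i * Y i)" "0 <= (\<Sum>i<n. if same i then 0 else Y (Suc i))"
  using nn Ynn by (auto intro!: sum_nonneg)
 have sumtau: "(\<Sum>i<n. \<tau> i) <= a2 * B1 + B2 + B3"
 proof -
  have "(\<Sum>i<n. \<tau> i) = a2 * (\<Sum>i<n. slow i) + (\<Sum>i<n. fast i) + (\<Sum>i<n. g i)" by (simp add: \<tau> sum.distrib sum_distrib_left)
  then show ?thesis using B(1-3) a mult_left_mono[OF B(1) a(2)] by linarith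
 qed
 have sumZ: "(\<Sum>i\<le>n. Z i) <= 4 * (Y0 + K5 * (a2 * B1 + B2 + 2 * B3 + X) + X)"
 proof -
  have "(\<Sum>i\<le>n. Z i) <= 4 * (Z 0 + (\<Sum>i<n. K5 * (\<tau> i + q i * Y i + g i) + (if same i then 0 else Y (Suc i))))"
  proof (rule sum_contracting[of n])
   fix i
   have "0 <= 3 / 4 * Z i + K5 * (\<tau> i + q i * Y i + g i)"
    using Znn[of i] K5 tau0 nn Ynn by (intro add_nonneg_nonneg mult_nonneg_nonneg) auto
   then show "Z (Suc i) <= 3 / 4 * Z i + (K5 * (\<tau> i + q i * Y i + g i) + (if same i then 0 else Y (Suc i)))"
    unfolding ZS(2) by (auto simp del: YS)
  qed (use Znn in auto)
  also have "(\<Sum>i<n. K5 * (\<tau> i + q i * Y i + g i) + (if same i then 0 else Y (Suc i)))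
    = K5 * ((\<Sum>i<n. \<tau> i) + (\<Sum>i<n. q i * Y i) + (\<Sum>i<n. g i)) + (\<Sum>i<n. if same i then 0 else Y (Suc i))"
   by (simp add: sum.distrib sum_distrib_left[symmetric] del: YS)
  also have "... <= K5 * (a2 * B1 + B2 + 2 * B3 + X) + X"
  proof (rule add_mono)
   have "(\<Sum>i<n. \<tau> i) + (\<Sum>i<n. q i * Y i) + (\<Sum>i<n. g i) <= a2 * B1 + B2 + 2 * B3 + X" using X nnX sumtau B(3) by linarith
   then show "K5 * ((\<Sum>i<n. \<tau> i) + (\<Sum>i<n. q i * Y i) + (\<Sum>i<n. g i)) <= K5 * (a2 * B1 + B2 + 2 * B3 + X)"
    using K5 by (rule mult_left_mono)
   show "(\<Sum>i<n. if same i then 0 else Y (Suc i)) <= X" using X nnX by linarith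
  qed
  finally show ?thesis by (simp add: ZS)
 qed
 have "(\<Sum>i<n. Z i + \<tau> i + g i + q i * (Y i + (Y i)^2)) <= (\<Sum>i<n. Z i + \<tau> i + g i + (1 + Ymax) * (q i * Y i))"
 proof (rule sum_mono)
  fix i
  have "Y i * Y i <= Ymax * Y i" using Ymax(1)[of i] Ynn[of i] by (intro mult_right_mono) (auto simp: Y_def)
  then have "q i * (Y i + (Y i)^2) <= q i * ((1 + Ymax) * Y i)"
   using nn by (intro mult_left_mono) (auto simp: power2_eq_square algebra_simps)
  then show "Z i + \<tau> i + g i + q i * (Y i + (Y i)^2) <= Z i + \<tau> i + g i + (1 + Ymax) * (q i * Y i)"
   by (simp add: algebra_simps)
 qed
 also have "... = (\<Sum>i<n. Z i) + (\<Sum>i<n. \<tau> i) + (\<Sum>i<n. g i) + (1 + Ymax) * (\<Sum>i<n. q i * Y i)"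
  by (simp add: sum.distrib sum_distrib_left)
 also have "... <= 4 * (Y0 + K5 * (a2 * B1 + B2 + 2 * B3 + X) + X) + (a2 * B1 + B2 + B3) + B3 + (1 + Ymax) * X"
 proof (intro add_mono sumtau B mult_left_mono)
  have "(\<Sum>i<n. Z i) <= (\<Sum>i\<le>n. Z i)" using Znn by (intro sum_mono2) auto
  then show "(\<Sum>i<n. Z i) <= 4 * (Y0 + K5 * (a2 * B1 + B2 + 2 * B3 + X) + X)" using sumZ by linarith
  show "(\<Sum>i<n. q i * Y i) <= X" using X nnX by linarith
 qed (use Ymax in auto)
 finally show ?thesis by (simp add: Y_def Z_def)
qed

text \<open>4 K5 B is the fixed point of u = 3/4 u + K5 B.\<close>

lemma ySeq_bound:
 assumes "K5 >= 0" "Y0 >= 0" "!!i. \<Omega> i + g i <= B" "B >= 0"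
 shows "ySeq K5 Y0 \<Omega> g i <= Y0 + 4 * K5 * B"
proof (induction i)
 case 0
 then show ?case using assms by simp
next
 case (Suc i)
 have "K5 * (\<Omega> i + g i) <= K5 * B" using assms by (intro mult_left_mono) auto
 then show ?case using Suc assms(2) by simp
qed

section \<open>Modulus of almost periodicity\<close>

definition frac_dist :: "real => real" where
 "frac_dist x = \<bar>x - of_int (round x)\<bar>"

lemma frac_dist_le_int: "frac_dist x <= \<bar>x - of_int z\<bar>"
 unfolding frac_dist_def by (metis abs_minus_commute round_diff_minimal)

lemma frac_dist_le: "frac_dist x <= \<bar>x\<bar>"
 using frac_dist_le_int[of x 0] by simp

lemma frac_dist_nonneg: "0 <= frac_dist x"
 by (simp add: frac_dist_def)

lemma frac_dist_add: "frac_dist (x + y) <= frac_dist x + frac_dist y"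
proof -
 have "frac_dist (x + y) <= \<bar>(x + y) - of_int (round x + round y)\<bar>" by (rule frac_dist_le_int)
 also have "... <= frac_dist x + frac_dist y" unfolding frac_dist_def by simp
 finally show ?thesis .
qed

lemma frac_dist_minus: "frac_dist (- x) = frac_dist x"
proof -
 have "frac_dist (- y) <= frac_dist y" for y
  using frac_dist_le_int[of "- y" "- round y"] by (simp add: frac_dist_def abs_minus_commute)
 from this[of x] this[of "- x"] show ?thesis by simp
qed

text \<open>The l^1 distance of h / \<epsilon> j from the integer lattice. The slot j = 0 is not
  periodic, so nothing is subtracted there.\<close>

definition osc :: "(nat => real) => nat => real^'n::finite => real" where
 "osc \<epsilon> j h = (if j = 0 then \<Sum>i\<in>UNIV. \<bar>h $ i\<bar> else \<Sum>i\<in>UNIV. frac_dist (h $ i / \<epsilon> j))"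

lemma osc_nonneg: "0 <= osc \<epsilon> j h"
 by (auto simp: osc_def frac_dist_nonneg intro!: sum_nonneg)

lemma osc_add: "osc \<epsilon> j (h + k) <= osc \<epsilon> j h + osc \<epsilon> j k"
 unfolding osc_def by (auto simp: sum.distrib[symmetric] add_divide_distrib frac_dist_add intro!: sum_mono)

lemma osc_minus: "osc \<epsilon> j (- h) = osc \<epsilon> j h"
 by (auto simp: osc_def frac_dist_minus)

lemma osc_zero: "osc \<epsilon> j 0 = 0"
 by (auto simp: osc_def frac_dist_def)

lemma osc_le:
 assumes "\<epsilon> j > 0" "\<epsilon> 0 = 1" "!!i. \<bar>h $ i\<bar> <= b"
 shows "osc \<epsilon> j (h :: real^'n::finite) <= real CARD('n) * (b / \<epsilon> j)"
proof (cases "j = 0")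
 case True
 then show ?thesis using assms sum_bounded_above[of UNIV "\<lambda>i. \<bar>h $ i\<bar>" b] by (simp add: osc_def)
next
 case False
 have "frac_dist (h $ i / \<epsilon> j) <= b / \<epsilon> j" for i
 proof -
  have "frac_dist (h $ i / \<epsilon> j) <= \<bar>h $ i / \<epsilon> j\<bar>" by (rule frac_dist_le)
  also have "... <= b / \<epsilon> j" using assms by (simp add: divide_right_mono)
  finally show ?thesis .
 qed
 then show ?thesis using False sum_bounded_above[of UNIV "\<lambda>i. frac_dist (h $ i / \<epsilon> j)" "b / \<epsilon> j"] by (simp add: osc_def)
qed

text \<open>\<delta> l bounds both B_l and its Lipschitz constant in each slot, so the l-th term
  moves by at most \<delta> l times the smaller of 2 and the total oscillation of the slots 0 to l.
  The cap 2 also makes the series converge.\<close>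

definition modulus :: "(nat => real) => (nat => real) => real^'n::finite => real" where
 "modulus \<delta> \<epsilon> h = (\<Sum>l. \<delta> l * min 2 (\<Sum>j\<le>l. osc \<epsilon> j h))"

lemma sum_osc_nonneg: "0 <= (\<Sum>j\<le>l. osc \<epsilon> j h)"
 by (intro sum_nonneg osc_nonneg)

lemma summable_modulus:
 assumes "summable \<delta>" "!!l. 0 <= \<delta> l"
 shows "summable (\<lambda>l. \<delta> l * min 2 (\<Sum>j\<le>l. osc \<epsilon> j h))"
proof (rule summable_comparison_test')
 show "summable (\<lambda>l. \<delta> l * 2)" using assms(1) by (rule summable_mult2)
 show "norm (\<delta> l * min 2 (\<Sum>j\<le>l. osc \<epsilon> j h)) <= \<delta> l * 2" for l
  using assms(2)[of l] sum_osc_nonneg[of \<epsilon> h l] by (simp add: abs_mult mult_left_mono)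
qed

lemma modulus_nonneg:
 assumes "summable \<delta>" "!!l. 0 <= \<delta> l"
 shows "0 <= modulus \<delta> \<epsilon> h" unfolding modulus_def
 by (rule suminf_nonneg[OF summable_modulus[OF assms]]) (use assms sum_osc_nonneg in \<open>auto intro!: mult_nonneg_nonneg\<close>)

lemma modulus_add:
 assumes "summable \<delta>" "!!l. 0 <= \<delta> l"
 shows "modulus \<delta> \<epsilon> (h + k) <= modulus \<delta> \<epsilon> h + modulus \<delta> \<epsilon> k"
proof -
 note s = summable_modulus[OF assms, of \<epsilon>]
 have "modulus \<delta> \<epsilon> (h + k) <= (\<Sum>l. \<delta> l * min 2 (\<Sum>j\<le>l. osc \<epsilon> j h) + \<delta> l * min 2 (\<Sum>j\<le>l. osc \<epsilon> j k))" unfolding modulus_def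
 proof (rule suminf_le[OF _ s summable_add[OF s s]])
  fix l
  have "(\<Sum>j\<le>l. osc \<epsilon> j (h + k)) <= (\<Sum>j\<le>l. osc \<epsilon> j h) + (\<Sum>j\<le>l. osc \<epsilon> j k)"
   unfolding sum.distrib[symmetric] by (intro sum_mono osc_add)
  then have "min 2 (\<Sum>j\<le>l. osc \<epsilon> j (h + k)) <= min 2 (\<Sum>j\<le>l. osc \<epsilon> j h) + min 2 (\<Sum>j\<le>l. osc \<epsilon> j k)"
   using sum_osc_nonneg[of \<epsilon> h l] sum_osc_nonneg[of \<epsilon> k l] by linarith
  then show "\<delta> l * min 2 (\<Sum>j\<le>l. osc \<epsilon> j (h + k)) <= \<delta> l * min 2 (\<Sum>j\<le>l. osc \<epsilon> j h) + \<delta> l * min 2 (\<Sum>j\<le>l. osc \<epsilon> j k)"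
   unfolding distrib_left[symmetric] using assms(2) by (intro mult_left_mono)
 qed
 also have "... = modulus \<delta> \<epsilon> h + modulus \<delta> \<epsilon> k" unfolding modulus_def by (rule suminf_add[OF s s, symmetric])
 finally show ?thesis .
qed

lemma modulus_minus: "modulus \<delta> \<epsilon> (- h) = modulus \<delta> \<epsilon> h"
 by (simp add: modulus_def osc_minus)

lemma modulus_zero: "modulus \<delta> \<epsilon> 0 = 0"
 by (simp add: modulus_def osc_zero)

lemma norm_matrix_vector_le: "norm (M *v \<xi>) <= norm M * norm \<xi>" for M :: "real^'n^'m"
proof -
 have "(norm (M *v \<xi>))^2 = (\<Sum>i\<in>UNIV. (M $ i \<bullet> \<xi>)^2)"
  by (simp add: norm_vec_def L2_set_def matrix_vector_mul_component real_sqrt_pow2 sum_nonneg)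
 also have "... <= (\<Sum>i\<in>UNIV. (norm (M $ i))^2 * (norm \<xi>)^2)"
 proof (rule sum_mono)
  fix i
  have "\<bar>M $ i \<bullet> \<xi>\<bar>\<^sup>2 <= (norm (M $ i) * norm \<xi>)^2" by (intro power_mono Cauchy_Schwarz_ineq2) auto
  then show "(M $ i \<bullet> \<xi>)^2 <= (norm (M $ i))^2 * (norm \<xi>)^2" by (simp add: power_mult_distrib)
 qed
 also have "... = (norm M * norm \<xi>)^2"
  by (simp add: norm_vec_def[of M] L2_set_def sum_distrib_right[symmetric] power_mult_distrib sum_nonneg)
 finally show ?thesis by (rule power2_le_imp_le) auto
qed

definition scaled :: "(nat => real) => real^'n::finite => nat => real^'n" where
 "scaled \<epsilon> x = (\<lambda>i. inverse (\<epsilon> i) *\<^sub>R x)"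

context
 fixes \<Omega>0 :: "(real^'n::finite) set" and B :: "nat => (nat => real^'n) => real^'n^'n"
  and \<mu> :: real and \<delta> \<epsilon> :: "nat => real"
 assumes SA: "standing_assumptions \<Omega>0 B \<mu>" and CB: "condition_B \<Omega>0 B \<delta>" and SC: "scales \<epsilon>"
begin

lemma delta_nonneg: "0 <= \<delta> l" and delta_summable: "summable \<delta>"
 and B_bound: "Y 0 \<in> \<Omega>0 ==> norm (B l Y) <= \<delta> l" using CB by (auto simp: condition_B_def)

lemma B_lipschitz:
 "j <= l ==> Y 0 \<in> \<Omega>0 ==> (j = 0 ==> closed_segment (Y 0) y \<subseteq> \<Omega>0) ==>
  norm (B l (Y(j := y)) - B l Y) <= \<delta> l * dist y (Y j)" using CB by (auto simp: condition_B_def)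

lemma B_local: "(!!i. i <= l ==> Y i = Y' i) ==> B l Y = B l Y'"
 using SA unfolding standing_assumptions_def by blast

text \<open>Periodicity is assumed for the partial sums; B_l is the difference of two consecutive
  ones.\<close>

lemma B_periodic:
 assumes "Y 0 \<in> \<Omega>0" "z 0 = 0" "!!i k. z i $ k \<in> \<int>"
 shows "B l (\<lambda>i. Y i + z i) = B l Y"
proof -
 have A: "A_n B n (\<lambda>i. Y i + z i) = A_n B n Y" for n using SA assms unfolding standing_assumptions_def by blast
 show ?thesis
 proof (cases l)
  case 0
  then show ?thesis using A[of 0] by (simp add: A_n_def)
 next
  case (Suc n)
  then show ?thesis using A[of "Suc n"] A[of n] by (simp add: A_n_def)
 qed
qed

lemma eps0: "\<epsilon> 0 = 1"
 using SC by (auto simp: scales_def)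

text \<open>Periodicity removes the integer part \<open>z i\<close> of the increment in each slot
  and leaves a remainder of size \<open>osc\<close>. The hybrid arguments \<open>W m\<close> then
  change one slot at a time, so that the Lipschitz bound applies l + 1 times; only slot 0 requires
  the segment to stay in the domain.\<close>

lemma B_difference:
 assumes y: "closed_segment y (y + h) \<subseteq> \<Omega>0"
 shows "norm (B l (scaled \<epsilon> (y + h)) - B l (scaled \<epsilon> y)) <= \<delta> l * min 2 (\<Sum>j\<le>l. osc \<epsilon> j h)"
proof -
 define z where "z i = (if i = 0 then 0 else (\<chi> k. of_int (round (h $ k / \<epsilon> i))) :: real^'n)" for i :: nat
 define r where "r i = inverse (\<epsilon> i) *\<^sub>R h - z i" for i
 define Y where "Y = scaled \<epsilon> y"
 define W where "W m = (\<lambda>i. if i < m then Y i + r i else Y i)" for m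
 have ends: "y \<in> \<Omega>0" "y + h \<in> \<Omega>0" using y by auto
 have Y0: "Y 0 = y" "r 0 = h" by (simp_all add: Y_def scaled_def eps0 r_def z_def)
 have W0: "W m 0 \<in> \<Omega>0" for m using ends Y0 by (auto simp: W_def)
 have nr: "norm (r j) <= osc \<epsilon> j h" for j
 proof -
  have "norm (r j) <= (\<Sum>i\<in>UNIV. \<bar>r j $ i\<bar>)" by (rule norm_le_l1_cart)
  also have "... = osc \<epsilon> j h" by (auto simp: r_def z_def osc_def eps0 frac_dist_def divide_inverse mult.commute)
  finally show ?thesis .
 qed
 have step: "norm (B l (W (Suc m)) - B l (W m)) <= \<delta> l * osc \<epsilon> m h" if "m <= l" for m
 proof -
  have eq: "W (Suc m) = (W m)(m := Y m + r m)" by (auto simp: W_def)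
  have "norm (B l ((W m)(m := Y m + r m)) - B l (W m)) <= \<delta> l * dist (Y m + r m) (W m m)"
  proof (rule B_lipschitz[where Y = "W m", OF that])
   show "W m 0 \<in> \<Omega>0" by (rule W0)
   assume "m = 0"
   then show "closed_segment (W m 0) (Y m + r m) \<subseteq> \<Omega>0" using y Y0 by (simp add: W_def)
  qed
  also have "... <= \<delta> l * osc \<epsilon> m h" using nr[of m] delta_nonneg by (intro mult_left_mono) (auto simp: W_def dist_norm)
  finally show ?thesis unfolding eq .
 qed
 have tele: "m <= Suc l ==> norm (B l (W m) - B l (W 0)) <= (\<Sum>j<m. \<delta> l * osc \<epsilon> j h)" for m
 proof (induction m)
  case (Suc m)
  have "norm (B l (W (Suc m)) - B l (W 0)) <= norm (B l (W (Suc m)) - B l (W m)) + norm (B l (W m) - B l (W 0))"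
   using norm_triangle_ineq[of "B l (W (Suc m)) - B l (W m)" "B l (W m) - B l (W 0)"] by simp
  then show ?case using Suc step[of m] by simp
 qed simp
 have e0: "B l (W 0) = B l Y" by (rule B_local) (simp add: W_def)
 have e1: "B l (W (Suc l)) = B l (scaled \<epsilon> (y + h))"
 proof -
  have "B l (W (Suc l)) = B l (\<lambda>i. Y i + r i)" by (rule B_local) (simp add: W_def)
  also have "... = B l (\<lambda>i. (Y i + r i) + z i)" by (rule B_periodic[symmetric]) (use ends Y0 in \<open>auto simp: z_def\<close>)
  also have "(\<lambda>i. (Y i + r i) + z i) = scaled \<epsilon> (y + h)" by (auto simp: Y_def r_def scaled_def scaleR_right_distrib)
  finally show ?thesis .
 qed
 have "norm (B l (scaled \<epsilon> (y + h)) - B l (scaled \<epsilon> y)) <= \<delta> l * (\<Sum>j\<le>l. osc \<epsilon> j h)"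
  using tele[of "Suc l"] unfolding e0 e1 by (simp add: Y_def sum_distrib_left lessThan_Suc_atMost)
 moreover have "norm (B l (scaled \<epsilon> (y + h)) - B l (scaled \<epsilon> y)) <= \<delta> l * 2"
 proof -
  have "norm (B l (scaled \<epsilon> (y + h))) <= \<delta> l" "norm (B l (scaled \<epsilon> y)) <= \<delta> l"
   using ends by (auto intro!: B_bound simp: scaled_def eps0)
  then show ?thesis using norm_triangle_ineq4[of "B l (scaled \<epsilon> (y + h))" "B l (scaled \<epsilon> y)"] by simp
 qed
 ultimately show ?thesis using delta_nonneg[of l] by (simp add: min_def)
qed

lemma A_eps_sums:
 assumes "x \<in> \<Omega>0"
 shows "summable (\<lambda>l. norm (B l (scaled \<epsilon> x)))" "A_eps B \<epsilon> x = (\<Sum>l. B l (scaled \<epsilon> x))"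
  "(\<lambda>n. A_n B n (scaled \<epsilon> x)) \<longlonglongrightarrow> A_eps B \<epsilon> x"
proof -
 show s: "summable (\<lambda>l. norm (B l (scaled \<epsilon> x)))"
 proof (rule summable_comparison_test'[OF delta_summable])
  show "norm (norm (B l (scaled \<epsilon> x))) <= \<delta> l" for l
   using B_bound[of "scaled \<epsilon> x" l] assms by (simp add: scaled_def eps0)
 qed
 have "(\<lambda>n. A_n B n (scaled \<epsilon> x)) \<longlonglongrightarrow> (\<Sum>l. B l (scaled \<epsilon> x))"
  unfolding A_n_def by (rule summable_LIMSEQ'[OF summable_norm_cancel[OF s]])
 moreover from this show "A_eps B \<epsilon> x = (\<Sum>l. B l (scaled \<epsilon> x))" unfolding A_eps_def scaled_def by (rule limI)
 ultimately show "(\<lambda>n. A_n B n (scaled \<epsilon> x)) \<longlonglongrightarrow> A_eps B \<epsilon> x" by simp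
qed

lemma A_eps_bound:
 assumes "x \<in> \<Omega>0"
 shows "norm (A_eps B \<epsilon> x) <= delta0 \<delta>"
proof -
 have "norm (A_eps B \<epsilon> x) <= (\<Sum>l. norm (B l (scaled \<epsilon> x)))"
  unfolding A_eps_sums(2)[OF assms] by (rule summable_norm[OF A_eps_sums(1)[OF assms]])
 also have "... <= (\<Sum>l. \<delta> l)" by (rule suminf_le[OF _ A_eps_sums(1)[OF assms] delta_summable])
   (use assms in \<open>auto intro!: B_bound simp: scaled_def eps0\<close>)
 finally show ?thesis by (simp add: delta0_def)
qed

lemma A_eps_elliptic:
 assumes "x \<in> \<Omega>0"
 shows "\<mu> * (norm \<xi>)^2 <= \<xi> \<bullet> (A_eps B \<epsilon> x *v \<xi>)"
proof (rule LIMSEQ_le_const)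
 have "isCont (\<lambda>M :: real^'n^'n. \<xi> \<bullet> (M *v \<xi>)) (A_eps B \<epsilon> x)"
 proof -
  have "continuous_on UNIV (\<lambda>M :: real^'n^'n. \<xi> \<bullet> (M *v \<xi>))" by (intro continuous_intros continuous_on_mv)
  then show ?thesis by (simp add: continuous_on_eq_continuous_at)
 qed
 then show "(\<lambda>n. \<xi> \<bullet> (A_n B n (scaled \<epsilon> x) *v \<xi>)) \<longlonglongrightarrow> \<xi> \<bullet> (A_eps B \<epsilon> x *v \<xi>)"
  by (rule isCont_tendsto_compose) (rule A_eps_sums(3)[OF assms])
 show "\<exists>N. \<forall>n\<ge>N. \<mu> * (norm \<xi>)^2 <= \<xi> \<bullet> (A_n B n (scaled \<epsilon> x) *v \<xi>)"
  using SA assms unfolding standing_assumptions_def by (auto simp: scaled_def eps0)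
qed

lemma A_eps_difference:
 assumes y: "closed_segment y (y + h) \<subseteq> \<Omega>0"
 shows "norm (A_eps B \<epsilon> (y + h) - A_eps B \<epsilon> y) <= modulus \<delta> \<epsilon> h"
proof -
 have ends: "y \<in> \<Omega>0" "y + h \<in> \<Omega>0" using y by auto
 note s = summable_norm_cancel[OF A_eps_sums(1)]
 note sm = summable_modulus[OF delta_summable delta_nonneg, of \<epsilon> h]
 have "A_eps B \<epsilon> (y + h) - A_eps B \<epsilon> y = (\<Sum>l. B l (scaled \<epsilon> (y + h)) - B l (scaled \<epsilon> y))"
  unfolding A_eps_sums(2)[OF ends(1)] A_eps_sums(2)[OF ends(2)] by (rule suminf_diff[OF s s]) (fact ends)+
 moreover have sn: "summable (\<lambda>l. norm (B l (scaled \<epsilon> (y + h)) - B l (scaled \<epsilon> y)))"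
  by (rule summable_comparison_test'[OF sm]) (use B_difference[OF y] in auto)
 ultimately have "norm (A_eps B \<epsilon> (y + h) - A_eps B \<epsilon> y) <= (\<Sum>l. norm (B l (scaled \<epsilon> (y + h)) - B l (scaled \<epsilon> y)))"
  using summable_norm[OF sn] by simp
 also have "... <= modulus \<delta> \<epsilon> h" unfolding modulus_def by (rule suminf_le[OF B_difference[OF y] sn sm])
 finally show ?thesis .
qed

lemma A_eps_continuous: "continuous_on \<Omega>0 (A_eps B \<epsilon>)"
proof -
 have "uniform_limit \<Omega>0 (\<lambda>n x. \<Sum>l<n. B l (scaled \<epsilon> x)) (\<lambda>x. \<Sum>l. B l (scaled \<epsilon> x)) sequentially"
  by (rule Weierstrass_m_test[OF _ delta_summable]) (auto intro!: B_bound simp: scaled_def eps0)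
 moreover have "continuous_on \<Omega>0 (\<lambda>x. \<Sum>l<n. B l (scaled \<epsilon> x))" for n
 proof (intro continuous_on_sum)
  fix l
  have "continuous_on {Y. Y 0 \<in> \<Omega>0} (B l)" using SA by (auto simp: standing_assumptions_def)
  moreover have "continuous_on \<Omega>0 (scaled \<epsilon>)"
   unfolding scaled_def by (intro continuous_on_coordinatewise_then_product continuous_intros)
  ultimately show "continuous_on \<Omega>0 (\<lambda>x. B l (scaled \<epsilon> x))"
   by (rule continuous_on_compose2) (auto simp: scaled_def eps0)
 qed
 ultimately have "continuous_on \<Omega>0 (\<lambda>x. \<Sum>l. B l (scaled \<epsilon> x))"
  by (intro uniform_limit_theorem[of _ "\<lambda>n x. \<Sum>l<n. B l (scaled \<epsilon> x)"]) auto
 then show ?thesis by (rule continuous_on_eq) (simp add: A_eps_sums(2))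
qed

end

section \<open>Slow and fast parts of the modulus\<close>

definition tail_sum :: "(nat => real) => nat => real" where
 "tail_sum \<delta> k = (\<Sum>l. if k <= l then \<delta> l else 0)"

text \<open>The share of the coarse periods \<epsilon> j with j <= k: for them a shift of length s
  is merely short, of relative size s / \<epsilon> j, and slot j occurs in every B_l with l >=
  j.\<close>

definition slow_sum :: "(nat => real) => (nat => real) => nat => real => real" where
 "slow_sum \<delta> \<epsilon> k s = (\<Sum>j\<le>k. s / \<epsilon> j * tail_sum \<delta> j)"

text \<open>The share of the finer periods for a shift obtained by successive rounding: once it is a
  multiple of \<epsilon> j, the later roundings move each coordinate by at most \<epsilon> (Suc
  j).\<close>

definition fast_sum :: "real => (nat => real) => (nat => real) => nat => real" where
 "fast_sum d \<delta> \<epsilon> k = (\<Sum>l. if k < l then \<delta> l * min 2 (d * (\<Sum>j\<in>{k<..l}. \<epsilon> (Suc j) / \<epsilon> j)) else 0)"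

lemma summable_if:
 fixes a b :: "nat => real"
 assumes "summable b" "!!l. 0 <= b l" "!!l. P l ==> 0 <= a l \<and> a l <= b l"
 shows "summable (\<lambda>l. if P l then a l else 0)"
 by (rule summable_comparison_test'[OF assms(1)]) (use assms(2,3) in force)

context
 fixes \<delta> \<epsilon> :: "nat => real"
 assumes d0: "!!l. 0 <= \<delta> l" and sd: "summable \<delta>" and SC: "scales \<epsilon>"
begin

lemma e_pos: "0 < \<epsilon> i" and e_0: "\<epsilon> 0 = 1" and e_dec: "\<epsilon> (Suc i) < \<epsilon> i" and e_lim: "\<epsilon> \<longlonglongrightarrow> 0"
 using SC by (auto simp: scales_def)

lemma summable_tail: "summable (\<lambda>l. if k <= l then \<delta> l else 0)"
 by (rule summable_if[OF sd]) (auto simp: d0)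

lemma tail_sum_nonneg: "0 <= tail_sum \<delta> k"
 unfolding tail_sum_def by (rule suminf_nonneg[OF summable_tail]) (auto simp: d0)

lemma tail_sum_antimono: "antimono (tail_sum \<delta>)"
 by (rule antimonoI) (auto simp: tail_sum_def d0 intro!: suminf_le[OF _ summable_tail summable_tail])

lemma tail_sum_0: "tail_sum \<delta> 0 = delta0 \<delta>"
 by (simp add: tail_sum_def delta0_def)

lemma tail_sum_le: "tail_sum \<delta> k <= delta0 \<delta>"
 using antimonoD[OF tail_sum_antimono, of 0 k] by (simp add: tail_sum_0)

lemma summable_fast: "summable (\<lambda>l. if k < l then \<delta> l * min 2 (d * (\<Sum>j\<in>{k<..l}. \<epsilon> (Suc j) / \<epsilon> j)) else 0)" if "0 <= d"
proof (rule summable_if)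
 show "summable (\<lambda>l. \<delta> l * 2)" using sd by (rule summable_mult2)
 have "0 <= (\<Sum>j\<in>{k<..l}. \<epsilon> (Suc j) / \<epsilon> j)" for l by (intro sum_nonneg divide_nonneg_nonneg less_imp_le[OF e_pos])
 then show "0 <= \<delta> l * min 2 (d * (\<Sum>j\<in>{k<..l}. \<epsilon> (Suc j) / \<epsilon> j)) \<and>
  \<delta> l * min 2 (d * (\<Sum>j\<in>{k<..l}. \<epsilon> (Suc j) / \<epsilon> j)) <= \<delta> l * 2" for l
  using d0[of l] that by (auto intro!: mult_nonneg_nonneg mult_left_mono)
qed (use d0 in auto)

lemma fast_sum_nonneg: "0 <= d ==> 0 <= fast_sum d \<delta> \<epsilon> k"
 unfolding fast_sum_def by (rule suminf_nonneg[OF summable_fast])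
  (auto intro!: mult_nonneg_nonneg d0 sum_nonneg divide_nonneg_nonneg less_imp_le[OF e_pos])

lemma slow_sum_nonneg: "0 <= s ==> 0 <= slow_sum \<delta> \<epsilon> k s"
 unfolding slow_sum_def by (intro sum_nonneg mult_nonneg_nonneg divide_nonneg_nonneg less_imp_le[OF e_pos] tail_sum_nonneg)

lemma slow_sum_mono: "0 <= s ==> s <= s' ==> slow_sum \<delta> \<epsilon> k s <= slow_sum \<delta> \<epsilon> k s'"
 unfolding slow_sum_def by (intro sum_mono mult_right_mono divide_right_mono less_imp_le[OF e_pos] tail_sum_nonneg)

lemma sums_slow: "(\<lambda>l. \<delta> l * (\<Sum>j\<le>min k l. s / \<epsilon> j)) sums slow_sum \<delta> \<epsilon> k s"
proof -
 have "(\<lambda>l. \<Sum>j\<le>k. s / \<epsilon> j * (if j <= l then \<delta> l else 0)) sums (\<Sum>j\<le>k. s / \<epsilon> j * tail_sum \<delta> j)"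
  by (intro sums_sum sums_mult) (use summable_sums[OF summable_tail] in \<open>simp add: tail_sum_def\<close>)
 moreover have "(\<Sum>j\<le>k. s / \<epsilon> j * (if j <= l then \<delta> l else 0)) = \<delta> l * (\<Sum>j\<le>min k l. s / \<epsilon> j)" for l
 proof -
  have "(\<Sum>j\<le>k. s / \<epsilon> j * (if j <= l then \<delta> l else 0)) = (\<Sum>j\<in>{j. j <= k \<and> j <= l}. s / \<epsilon> j * \<delta> l)"
   by (rule sum.mono_neutral_cong_right) auto
  also have "{j. j <= k \<and> j <= l} = {..min k l}" by auto
  finally show ?thesis by (simp add: sum_distrib_left mult.commute)
 qed
 ultimately show ?thesis by (simp add: slow_sum_def)
qed

text \<open>For a general shift the terms with l > k are surrendered to the cap 2, which is the
  origin of the tail.\<close>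

lemma modulus_le_all:
 assumes h: "norm (h :: real^'n::finite) <= s"
 shows "modulus \<delta> \<epsilon> h <= real CARD('n) * slow_sum \<delta> \<epsilon> k s + 2 * tail_sum \<delta> (k + 1)"
proof -
 let ?d = "real CARD('n)"
 have s: "0 <= s" using h norm_ge_zero order_trans by blast
 have S: "(\<lambda>l. ?d * (\<delta> l * (\<Sum>j\<le>min k l. s / \<epsilon> j)) + 2 * (if k + 1 <= l then \<delta> l else 0))
  sums (?d * slow_sum \<delta> \<epsilon> k s + 2 * tail_sum \<delta> (k + 1))"
  by (intro sums_add sums_mult sums_slow) (use summable_sums[OF summable_tail] in \<open>simp add: tail_sum_def\<close>)
 have "modulus \<delta> \<epsilon> h <= (\<Sum>l. ?d * (\<delta> l * (\<Sum>j\<le>min k l. s / \<epsilon> j)) + 2 * (if k + 1 <= l then \<delta> l else 0))"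
  unfolding modulus_def
 proof (rule suminf_le[OF _ summable_modulus[OF sd d0] sums_summable[OF S]])
  fix l
  have o: "osc \<epsilon> j h <= ?d * (s / \<epsilon> j)" for j
   by (rule osc_le) (use h component_le_norm_cart[of h] e_pos e_0 in \<open>auto intro: order_trans\<close>)
  have nn: "0 <= ?d * (\<delta> l * (\<Sum>j\<le>min k l. s / \<epsilon> j))"
   by (intro mult_nonneg_nonneg sum_nonneg divide_nonneg_nonneg d0 s less_imp_le[OF e_pos]) auto
  show "\<delta> l * min 2 (\<Sum>j\<le>l. osc \<epsilon> j h) <= ?d * (\<delta> l * (\<Sum>j\<le>min k l. s / \<epsilon> j)) + 2 * (if k + 1 <= l then \<delta> l else 0)"
  proof (cases "l <= k")
   case True
   have "\<delta> l * min 2 (\<Sum>j\<le>l. osc \<epsilon> j h) <= \<delta> l * (\<Sum>j\<le>l. ?d * (s / \<epsilon> j))"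
    using d0 sum_mono[of "{..l}" "\<lambda>j. osc \<epsilon> j h" "\<lambda>j. ?d * (s / \<epsilon> j)", OF o] by (intro mult_left_mono) auto
   also have "... = ?d * (\<delta> l * (\<Sum>j\<le>min k l. s / \<epsilon> j))"
    using True by (simp add: sum_distrib_left min_absorb2 algebra_simps)
   finally show ?thesis using True by simp
  next
   case False
   have "\<delta> l * min 2 (\<Sum>j\<le>l. osc \<epsilon> j h) <= \<delta> l * 2" using d0 by (intro mult_left_mono) auto
   then show ?thesis using False nn by simp
  qed
 qed
 then show ?thesis using sums_unique[OF S] by simp
qed

lemma eps_halving:
 assumes half: "!!i. \<epsilon> (Suc i) <= \<epsilon> i / 2"
 shows "\<epsilon> (j + i) <= \<epsilon> j / 2 ^ i"
proof (induction i)
 case (Suc i)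
 then show ?case using half[of "j + i"] by simp
qed simp

text \<open>Rounding to multiples of \<open>\<epsilon> (k + 1)\<close>, then of \<open>\<epsilon> (k + 2)\<close>, and so on, yields in the limit a shift near \<open>z\<close> that is
 nearly a multiple of every \<open>\<epsilon> j\<close> with \<open>j > k\<close>.\<close>

primrec rnd_seq :: "nat => real^'n::finite => nat => real^'n" where
 "rnd_seq k z 0 = z"
| "rnd_seq k z (Suc m) = (\<chi> i. \<epsilon> (k + 1 + m) * of_int (round (rnd_seq k z m $ i / \<epsilon> (k + 1 + m))))"

lemma rnd_seq_step: "\<bar>rnd_seq k z (Suc m) $ i - rnd_seq k z m $ i\<bar> <= \<epsilon> (k + 1 + m) / 2"
proof -
 let ?e = "\<epsilon> (k + 1 + m)" and ?x = "rnd_seq k z m $ i"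
 have e: "?e > 0" by (rule e_pos)
 have "rnd_seq k z (Suc m) $ i - ?x = ?e * (of_int (round (?x / ?e)) - ?x / ?e)"
  using e by (simp add: right_diff_distrib)
 then have "\<bar>rnd_seq k z (Suc m) $ i - ?x\<bar> = ?e * \<bar>of_int (round (?x / ?e)) - ?x / ?e\<bar>" using e by (simp add: abs_mult)
 also have "... <= ?e * (1 / 2)" using of_int_round_abs_le[of "?x / ?e"] e by (intro mult_left_mono) auto
 finally show ?thesis by simp
qed

lemma rnd_seq_dist:
 assumes half: "!!i. \<epsilon> (Suc i) <= \<epsilon> i / 2"
 shows "\<bar>rnd_seq k z (m + p) $ i - rnd_seq k z m $ i\<bar> <= \<epsilon> (k + 1 + m) * (1 - 1 / 2 ^ p)"
proof (induction p)
 case (Suc p)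
 have "\<bar>rnd_seq k z (Suc (m + p)) $ i - rnd_seq k z (m + p) $ i\<bar> <= \<epsilon> (k + 1 + (m + p)) / 2" by (rule rnd_seq_step)
 also have "... <= \<epsilon> (k + 1 + m) / 2 ^ p / 2" using eps_halving[OF half, of "k + 1 + m" p] by (simp add: add.assoc)
 finally have "\<bar>rnd_seq k z (m + Suc p) $ i - rnd_seq k z m $ i\<bar> <= \<epsilon> (k + 1 + m) / 2 ^ p / 2 + \<epsilon> (k + 1 + m) * (1 - 1 / 2 ^ p)"
  using Suc by simp
 then show ?case by (simp add: field_simps)
qed simp

text \<open>Three ranges of l: up to k the shift is merely short; from there to k + M each
  coordinate is within \<epsilon> (Suc j) of a multiple of \<epsilon> j; beyond k + M the cap 2 is
  used and the tail is at most \<open>g\<close>. This slack allows stopping after \<open>M\<close>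
  roundings.\<close>

lemma modulus_almost_period:
 assumes half: "!!i. \<epsilon> (Suc i) <= \<epsilon> i / 2" and k: "\<epsilon> (Suc k) <= s" and z: "norm (z :: real^'n::finite) <= s" and g: "g > 0"
 shows "\<exists>h. norm (h - z) <= real CARD('n) * \<epsilon> (Suc k) \<and>
  modulus \<delta> \<epsilon> h <= 2 * real CARD('n) * slow_sum \<delta> \<epsilon> k s + fast_sum (real CARD('n)) \<delta> \<epsilon> k + g"
proof -
 let ?d = "real CARD('n)"
 have s: "0 < s" using k e_pos[of "Suc k"] by linarith
 obtain M where M: "2 * tail_sum \<delta> (k + M + 1) <= g"
 proof -
  have "(\<lambda>n. \<Sum>l. \<delta> (l + n)) \<longlonglongrightarrow> 0" by (rule suminf_exist_split2[OF sd])
  then have "eventually (\<lambda>n. \<bar>\<Sum>l. \<delta> (l + n)\<bar> < g / 2) sequentially"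
   using g by (auto simp: tendsto_iff dist_real_def dest: spec[of _ "g / 2"])
  then obtain n0 where n0: "!!n. n >= n0 ==> \<bar>\<Sum>l. \<delta> (l + n)\<bar> < g / 2" by (auto simp: eventually_sequentially)
  have "tail_sum \<delta> n = (\<Sum>l. \<delta> (l + n))" for n
   unfolding tail_sum_def using suminf_split_initial_segment[OF summable_tail, of n n] by simp
  then have "2 * tail_sum \<delta> (k + n0 + 1) <= g" using n0[of "k + n0 + 1"] by simp
  then show ?thesis using that by blast
 qed
 define h where "h = rnd_seq k z M"
 have close: "\<bar>h $ i - rnd_seq k z m $ i\<bar> <= \<epsilon> (k + 1 + m)" if "m <= M" for m i
 proof -
  have "\<bar>h $ i - rnd_seq k z m $ i\<bar> <= \<epsilon> (k + 1 + m) * (1 - 1 / 2 ^ (M - m))"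
   using rnd_seq_dist[OF half, of k z m "M - m" i] that by (simp add: h_def)
  also have "... <= \<epsilon> (k + 1 + m) * 1" using e_pos[of "k + 1 + m"] by (intro mult_left_mono) auto
  finally show ?thesis by simp
 qed
 have hz: "norm (h - z) <= ?d * \<epsilon> (Suc k)"
 proof -
  have "norm (h - z) <= (\<Sum>i\<in>UNIV. \<bar>(h - z) $ i\<bar>)" by (rule norm_le_l1_cart)
  also have "... <= (\<Sum>i\<in>(UNIV::'n set). \<epsilon> (Suc k))" using close[of 0] by (intro sum_mono) auto
  finally show ?thesis by simp
 qed
 have hs: "\<bar>h $ i\<bar> <= 2 * s" for i using close[of 0 i] component_le_norm_cart[of z i] z k by simp
 have o1: "osc \<epsilon> j h <= ?d * (2 * s / \<epsilon> j)" for j by (rule osc_le[where \<epsilon> = \<epsilon> and j = j, OF e_pos e_0 hs])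
 have o2: "osc \<epsilon> j h <= ?d * (\<epsilon> (Suc j) / \<epsilon> j)" if j: "k < j" "j <= k + M" for j
 proof -
  define m where "m = j - (k + 1)"
  have jm: "j = k + 1 + m" "Suc m <= M" using j by (auto simp: m_def)
  have "frac_dist (h $ i / \<epsilon> j) <= \<epsilon> (Suc j) / \<epsilon> j" for i
  proof -
   define w where "w = round (rnd_seq k z m $ i / \<epsilon> j)"
   have w: "rnd_seq k z (Suc m) $ i = \<epsilon> j * of_int w" by (simp add: w_def jm)
   have "frac_dist (h $ i / \<epsilon> j) <= \<bar>h $ i / \<epsilon> j - of_int w\<bar>" by (rule frac_dist_le_int)
   also have "... = \<bar>h $ i - \<epsilon> j * of_int w\<bar> / \<epsilon> j"
   proof -
    have "h $ i / \<epsilon> j - of_int w = (h $ i - \<epsilon> j * of_int w) / \<epsilon> j" using e_pos[of j] by (simp add: diff_divide_distrib)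
    then show ?thesis using e_pos[of j] by (simp add: abs_divide)
   qed
   also have "... <= \<epsilon> (Suc j) / \<epsilon> j"
    using close[OF jm(2), of i] e_pos[of j] unfolding w by (intro divide_right_mono) (auto simp: jm)
   finally show ?thesis .
  qed
  then show ?thesis using jm sum_bounded_above[of UNIV "\<lambda>i. frac_dist (h $ i / \<epsilon> j)" "\<epsilon> (Suc j) / \<epsilon> j"]
   by (simp add: osc_def)
 qed
 let ?f = "\<lambda>l. if k < l then \<delta> l * min 2 (?d * (\<Sum>j\<in>{k<..l}. \<epsilon> (Suc j) / \<epsilon> j)) else 0"
 let ?u = "\<lambda>l. 2 * ?d * (\<delta> l * (\<Sum>j\<le>min k l. s / \<epsilon> j)) + ?f l + 2 * (if k + M + 1 <= l then \<delta> l else 0)"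
 have S: "?u sums (2 * ?d * slow_sum \<delta> \<epsilon> k s + fast_sum ?d \<delta> \<epsilon> k + 2 * tail_sum \<delta> (k + M + 1))"
  by (intro sums_add sums_mult sums_slow)
   (use summable_sums[OF summable_tail] summable_sums[OF summable_fast] in \<open>simp_all add: tail_sum_def fast_sum_def\<close>)
 have "modulus \<delta> \<epsilon> h <= (\<Sum>l. ?u l)" unfolding modulus_def
 proof (rule suminf_le[OF _ summable_modulus[OF sd d0] sums_summable[OF S]])
  fix l
  have nn1: "0 <= 2 * ?d * (\<delta> l * (\<Sum>j\<le>min k l. s / \<epsilon> j))"
   using s by (intro mult_nonneg_nonneg sum_nonneg divide_nonneg_nonneg d0 less_imp_le[OF e_pos]) auto
  have nn2: "0 <= ?f l" by (auto intro!: mult_nonneg_nonneg d0 sum_nonneg divide_nonneg_nonneg less_imp_le[OF e_pos])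
  have low: "(\<Sum>j\<le>min k l. osc \<epsilon> j h) <= 2 * ?d * (\<Sum>j\<le>min k l. s / \<epsilon> j)"
  proof -
   have "(\<Sum>j\<le>min k l. osc \<epsilon> j h) <= (\<Sum>j\<le>min k l. ?d * (2 * s / \<epsilon> j))" by (intro sum_mono o1)
   then show ?thesis by (simp add: sum_distrib_left algebra_simps)
  qed
  consider "l <= k" | "k < l" "l <= k + M" | "k + M + 1 <= l" by linarith
  then show "\<delta> l * min 2 (\<Sum>j\<le>l. osc \<epsilon> j h) <= ?u l"
  proof cases
   case 1
   have "\<delta> l * min 2 (\<Sum>j\<le>l. osc \<epsilon> j h) <= \<delta> l * (2 * ?d * (\<Sum>j\<le>min k l. s / \<epsilon> j))"
    using d0 low 1 by (intro mult_left_mono) (auto simp: min_absorb2)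
   then show ?thesis using 1 by (simp add: algebra_simps)
  next
   case 2
   have split: "(\<Sum>j\<le>l. osc \<epsilon> j h) = (\<Sum>j\<le>min k l. osc \<epsilon> j h) + (\<Sum>j\<in>{k<..l}. osc \<epsilon> j h)"
   proof -
    have *: "{..l} = {..min k l} \<union> {k<..l}" using 2 by auto
    show ?thesis unfolding * by (rule sum.union_disjoint) auto
   qed
   have "(\<Sum>j\<in>{k<..l}. osc \<epsilon> j h) <= ?d * (\<Sum>j\<in>{k<..l}. \<epsilon> (Suc j) / \<epsilon> j)"
    unfolding sum_distrib_left by (intro sum_mono o2) (use 2 in auto)
   moreover have "0 <= ?d * (\<Sum>j\<in>{k<..l}. \<epsilon> (Suc j) / \<epsilon> j)"
    by (intro mult_nonneg_nonneg sum_nonneg divide_nonneg_nonneg less_imp_le[OF e_pos]) auto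
   moreover have "0 <= (\<Sum>j\<le>min k l. osc \<epsilon> j h)" by (rule sum_osc_nonneg)
   ultimately have "min 2 (\<Sum>j\<le>l. osc \<epsilon> j h) <= 2 * ?d * (\<Sum>j\<le>min k l. s / \<epsilon> j) + min 2 (?d * (\<Sum>j\<in>{k<..l}. \<epsilon> (Suc j) / \<epsilon> j))"
    using low split by linarith
   then have "\<delta> l * min 2 (\<Sum>j\<le>l. osc \<epsilon> j h) <= \<delta> l * (2 * ?d * (\<Sum>j\<le>min k l. s / \<epsilon> j) + min 2 (?d * (\<Sum>j\<in>{k<..l}. \<epsilon> (Suc j) / \<epsilon> j)))"
    by (rule mult_left_mono[OF _ d0])
   then show ?thesis using 2 by (simp add: algebra_simps)
  next
   case 3
   have "\<delta> l * min 2 (\<Sum>j\<le>l. osc \<epsilon> j h) <= \<delta> l * 2" using d0 by (intro mult_left_mono) auto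
   moreover have "(if k + M + 1 <= l then \<delta> l else 0) = \<delta> l" using 3 by simp
   ultimately show ?thesis using nn1 nn2 by linarith
  qed
 qed
 also have "... = 2 * ?d * slow_sum \<delta> \<epsilon> k s + fast_sum ?d \<delta> \<epsilon> k + 2 * tail_sum \<delta> (k + M + 1)"
  by (rule sums_unique[OF S, symmetric])
 finally show ?thesis using hz M by (intro exI[of _ h]) auto
qed

end

section \<open>Summation over separated scales\<close>

lemma sum_powers_half:
 assumes "0 <= (\<theta>::real)" "\<theta> <= 1 / 2"
 shows "(\<Sum>p<m. \<theta> ^ p) <= 2"
proof -
 have "(\<Sum>p<m. \<theta> ^ p) <= (\<Sum>p<m. (1 / 2) ^ p)" using assms by (intro sum_mono power_mono) auto
 also have "... = 2 * (1 - (1 / 2) ^ m)" by (subst sum_gp_strict) auto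
 finally show ?thesis by (rule order_trans) simp
qed

text \<open>Dominated by the full geometric series that starts at the largest radius occurring, the
  one of index \<open>Min A\<close>.\<close>

lemma sum_geometric_below:
 assumes \<theta>: "0 < (\<theta>::real)" "\<theta> <= 1 / 2" and s0: "0 <= s0" and A: "finite A" "!!i. i \<in> A ==> \<theta> ^ i * s0 <= X" and X: "0 <= X"
 shows "(\<Sum>i\<in>A. \<theta> ^ i * s0) <= 2 * X"
proof (cases "A = {}")
 case False
 define a b where "a = Min A" and "b = Suc (Max A)"
 have aA: "a \<in> A" "A \<subseteq> {a..<b}" using A(1) False by (auto simp: a_def b_def less_Suc_eq_le)
 have ab: "a <= b" using aA by force
 have "(\<Sum>i\<in>A. \<theta> ^ i * s0) <= (\<Sum>i\<in>{a..<b}. \<theta> ^ i * s0)" by (rule sum_mono2) (use aA \<theta> s0 in auto)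
 also have "... = (\<Sum>p<b - a. \<theta> ^ (a + p) * s0)"
  using ab by (intro sum.reindex_bij_witness[of _ "\<lambda>p. a + p" "\<lambda>i. i - a"]) auto
 also have "... = (\<theta> ^ a * s0) * (\<Sum>p<b - a. \<theta> ^ p)"
  by (simp add: power_add sum_distrib_left mult.commute mult.left_commute)
 also have "... <= X * 2"
  using A(2)[OF aA(1)] sum_powers_half[of \<theta> "b - a"] \<theta> s0 X by (intro mult_mono) (auto intro!: sum_nonneg)
 finally show ?thesis by simp
qed (use X in auto)

lemma sum_geometric_above:
 assumes \<theta>: "0 < (\<theta>::real)" "\<theta> <= 1 / 2" and s0: "0 < s0" and A: "finite A" "!!i. i \<in> A ==> X <= \<theta> ^ i * s0" and X: "0 < X"
 shows "(\<Sum>i\<in>A. 1 / (\<theta> ^ i * s0)) <= 2 / X"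
proof (cases "A = {}")
 case False
 define b where "b = Max A"
 have bA: "b \<in> A" "A \<subseteq> {..<Suc b}" using A(1) False by (auto simp: b_def less_Suc_eq_le)
 have pos: "0 < \<theta> ^ i * s0" for i using \<theta> s0 by simp
 have "(\<Sum>i\<in>A. 1 / (\<theta> ^ i * s0)) <= (\<Sum>i<Suc b. 1 / (\<theta> ^ i * s0))"
  by (rule sum_mono2) (use bA pos in \<open>auto simp: less_imp_le\<close>)
 also have "... = (\<Sum>p<Suc b. 1 / (\<theta> ^ (b - p) * s0))"
  by (rule sum.reindex_bij_witness[of _ "\<lambda>p. b - p" "\<lambda>i. b - i"]) auto
 also have "... = (\<Sum>p<Suc b. 1 / (\<theta> ^ b * s0) * \<theta> ^ p)"
 proof (rule sum.cong[OF refl])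
  fix p assume "p \<in> {..<Suc b}"
  then have "\<theta> ^ b = \<theta> ^ (b - p) * \<theta> ^ p" by (simp add: power_add[symmetric])
  then show "1 / (\<theta> ^ (b - p) * s0) = 1 / (\<theta> ^ b * s0) * \<theta> ^ p" using \<theta> by simp
 qed
 also have "... = 1 / (\<theta> ^ b * s0) * (\<Sum>p<Suc b. \<theta> ^ p)" by (rule sum_distrib_left[symmetric])
 also have "... <= 1 / X * 2"
 proof (rule mult_mono)
  show "1 / (\<theta> ^ b * s0) <= 1 / X" using A(2)[OF bA(1)] X by (intro divide_left_mono) auto
  show "(\<Sum>p<Suc b. \<theta> ^ p) <= 2" using \<theta> by (intro sum_powers_half) auto
  show "0 <= (\<Sum>p<Suc b. \<theta> ^ p)" using \<theta> by (intro sum_nonneg) auto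
 qed (use X in auto)
 finally show ?thesis by simp
qed (use X in auto)

text \<open>Gives up part of the smallness of x in exchange for an exponent r <= 1. In
  \<open>sum_fast_le\<close> x contains a factor l, and l^r with r <= \<rho> is all that the moment
  of order 1 + \<rho> can pay for.\<close>

lemma min_2_powr:
 assumes "0 <= (x::real)" "0 < r" "r <= 1"
 shows "min 2 x <= 2 * x powr r"
proof (cases "x >= 1")
 case True
 then have "1 <= x powr r" using assms by (simp add: ge_one_powr_ge_zero)
 then show ?thesis by simp
next
 case False
 have "x <= x powr r"
 proof (cases "x = 0")
  case False
  then have "x powr 1 <= x powr r" using \<open>\<not> x >= 1\<close> assms by (intro powr_mono') auto
  then show ?thesis using assms by simp
 qed simp
 then show ?thesis using assms powr_ge_zero[of x r] by linarith
qed

text \<open>The first entry makes consecutive periods differ at least by the factor 2. The second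
  meets the condition of \<open>count_absorbed\<close> for \<eta> = min \<rho> 1 / N: all ratios are
  at most the threshold to the power 1 / N, and the further power \<eta> / 2 must bring this below 1
  / (1 + 4 / \<eta>), whence the exponent 2 N^2 / min \<rho> 1.\<close>

definition sep_threshold :: "real => nat => real" where
 "sep_threshold \<rho> N = min ((1 / 2) ^ N) ((1 / (1 + 4 * real N / min \<rho> 1)) powr (2 * (real N)^2 / min \<rho> 1))"

lemma sep_threshold_pos: "0 < \<rho> ==> sep_threshold \<rho> N > 0"
proof -
 assume r: "0 < \<rho>"
 have "0 <= 4 * real N / min \<rho> 1" using r by simp
 then have "0 < 1 / (1 + 4 * real N / min \<rho> 1)" by (simp add: add_pos_nonneg)
 then show ?thesis unfolding sep_threshold_def by simp
qed

text \<open>The number \<open>c\<close> of dyadic scales between two consecutive periods with ratio \<open>q\<close> is at most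
 \<open>1 + log 2 (1/q)\<close>; below the threshold it is absorbed by a small power of \<open>q\<close>.\<close>

lemma count_absorbed:
 fixes c :: nat and q \<eta> :: real
 assumes q: "0 < q" "q <= (1 / 2) ^ (c - 1)" and \<eta>: "0 < \<eta>" and small: "(1 + 4 / \<eta>) * q powr (\<eta> / 2) <= 1"
 shows "real c * q powr \<eta> <= 1"
proof -
 define m where "m = c - 1"
 have c: "real c <= 1 + real m" by (simp add: m_def)
 have e: "real m * q powr (\<eta> / 2) <= 4 / \<eta>"
 proof -
  have "q powr (\<eta> / 2) <= ((1 / 2) ^ m) powr (\<eta> / 2)" using q \<eta> by (intro powr_mono2) (auto simp: m_def)
  also have "... = (1 / 2) powr (real m * (\<eta> / 2))" by (simp add: powr_realpow[symmetric] powr_powr)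
  also have "... = 1 / exp (real m * (\<eta> / 2) * ln 2)" by (simp add: powr_def ln_div exp_minus inverse_eq_divide)
  finally have 1: "q powr (\<eta> / 2) <= 1 / exp (real m * (\<eta> / 2) * ln 2)" .
  have ln2: "ln 2 >= (1 / 2 :: real)" using ln_one_minus_pos_upper_bound[of "1 / 2"] by (simp add: ln_div)
  have "real m * (\<eta> / 4) <= real m * (\<eta> / 2) * ln 2"
   using ln2 \<eta> mult_left_mono[of "1 / 2" "ln 2" "real m * (\<eta> / 2)"] by simp
  also have "... <= exp (real m * (\<eta> / 2) * ln 2)" using exp_ge_add_one_self[of "real m * (\<eta> / 2) * ln 2"] by linarith
  finally have "real m * (1 / exp (real m * (\<eta> / 2) * ln 2)) <= 4 / \<eta>" using \<eta> by (simp add: field_simps)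
  moreover have "real m * q powr (\<eta> / 2) <= real m * (1 / exp (real m * (\<eta> / 2) * ln 2))" using 1 by (intro mult_left_mono) auto
  ultimately show ?thesis by linarith
 qed
 have q1: "q powr (\<eta> / 2) <= 1"
 proof -
  have "(1 / 2 :: real) ^ (c - 1) <= 1" by (simp add: power_le_one)
  then have "q <= 1" using q(2) by linarith
  then show ?thesis using q \<eta> by (simp add: powr_le1)
 qed
 have "real c * q powr \<eta> = (real c * q powr (\<eta> / 2)) * q powr (\<eta> / 2)" by (simp add: powr_add[symmetric])
 also have "... <= (1 + 4 / \<eta>) * q powr (\<eta> / 2)"
 proof (rule mult_right_mono)
  have "real c * q powr (\<eta> / 2) <= (1 + real m) * q powr (\<eta> / 2)" using c by (intro mult_right_mono) auto
  also have "... = q powr (\<eta> / 2) + real m * q powr (\<eta> / 2)" by (simp add: distrib_right)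
  also have "... <= 1 + 4 / \<eta>" using q1 e by linarith
  finally show "real c * q powr (\<eta> / 2) <= 1 + 4 / \<eta>" .
 qed simp
 finally show ?thesis using small by linarith
qed

context
 fixes \<delta> \<epsilon> :: "nat => real" and \<rho> :: real and N :: nat and \<theta> s0 K0 :: real
 assumes d0: "!!l. 0 <= \<delta> l" and sd: "summable \<delta>" and SC: "scales \<epsilon>"
  and sd\<rho>: "summable (\<lambda>l. real l powr (1 + \<rho>) * \<delta> l)" and \<rho>: "0 < \<rho>" and N: "N >= 1"
  and sep: "!!i k. i < k ==> (\<epsilon> (k + 1) / \<epsilon> k) ^ N <= \<epsilon> (i + 1) / \<epsilon> i"
  and e1: "\<epsilon> 1 <= sep_threshold \<rho> N"
  and \<theta>: "0 < \<theta>" "\<theta> <= 1 / 2" and s0: "0 < s0" "s0 <= 1" and K0: "1 <= K0"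
begin

lemmas ep = e_pos[OF d0 sd SC]

definition ratio :: "nat => real" where "ratio j = \<epsilon> (Suc j) / \<epsilon> j"

lemma ratio_pos: "0 < ratio j" by (simp add: ratio_def ep)

lemma ratio_sep: "i < k ==> ratio k <= ratio i powr (1 / real N)"
proof -
 assume "i < k"
 then have "ratio k ^ N <= ratio i" using sep[of i k] by (simp add: ratio_def)
 then have "(ratio k powr real N) powr (1 / real N) <= ratio i powr (1 / real N)"
  using ratio_pos[of k] N by (intro powr_mono2) (auto simp: powr_realpow)
 then show ?thesis using N ratio_pos[of k] by (simp add: powr_powr)
qed

text \<open>Smallness is assumed of the first ratio, which is \<epsilon> 1; the separation
  hypothesis passes it on to all later ones with exponent 1 / N.\<close>

lemma ratio_small: "ratio j <= sep_threshold \<rho> N powr (1 / real N)"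
proof -
 have t: "0 < sep_threshold \<rho> N" "sep_threshold \<rho> N <= 1"
 proof -
  show "0 < sep_threshold \<rho> N" by (rule sep_threshold_pos[OF \<rho>])
  have "(1 / 2 :: real) ^ N <= 1" by (simp add: power_le_one)
  then show "sep_threshold \<rho> N <= 1" unfolding sep_threshold_def by linarith
 qed
 have q0: "ratio 0 <= sep_threshold \<rho> N" using e1 e_0[OF d0 sd SC] by (simp add: ratio_def)
 show ?thesis
 proof (cases "j = 0")
  case True
  have "sep_threshold \<rho> N powr 1 <= sep_threshold \<rho> N powr (1 / real N)" using t N by (intro powr_mono') auto
  then show ?thesis using q0 t True by simp
 next
  case False
  then have "ratio j <= ratio 0 powr (1 / real N)" by (intro ratio_sep) simp
  also have "... <= sep_threshold \<rho> N powr (1 / real N)" using q0 ratio_pos[of 0] by (intro powr_mono2) auto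
  finally show ?thesis .
 qed
qed

lemma half: "\<epsilon> (Suc i) <= \<epsilon> i / 2"
proof -
 have "ratio i <= sep_threshold \<rho> N powr (1 / real N)" by (rule ratio_small)
 also have "... <= ((1 / 2) ^ N) powr (1 / real N)"
  using sep_threshold_pos[OF \<rho>, of N] by (intro powr_mono2) (auto simp: sep_threshold_def)
 also have "... = 1 / 2" using N by (simp add: powr_realpow[symmetric] powr_powr)
 finally show ?thesis using ep[of i] by (simp add: ratio_def field_simps)
qed

definition rate :: real where "rate = min \<rho> 1 / real N"

lemma rate_pos: "0 < rate" using \<rho> N by (simp add: rate_def)

lemma ratio_rate: "(1 + 4 / rate) * ratio j powr (rate / 2) <= 1"
proof -
 define M where "M = 1 + 4 / rate"
 have M: "M > 0" using rate_pos by (simp add: M_def add_pos_pos)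
 have M': "1 + 4 * real N / min \<rho> 1 = M" by (simp add: M_def rate_def)
 have "ratio j powr (rate / 2) <= (sep_threshold \<rho> N powr (1 / real N)) powr (rate / 2)"
  using ratio_small[of j] ratio_pos[of j] rate_pos by (intro powr_mono2) auto
 also have "... <= (((1 / M) powr (2 * (real N)^2 / min \<rho> 1)) powr (1 / real N)) powr (rate / 2)"
  using sep_threshold_pos[OF \<rho>, of N] rate_pos by (intro powr_mono2) (auto simp: sep_threshold_def M')
 also have "... = (1 / M) powr (2 * (real N)^2 / min \<rho> 1 * (1 / real N) * (rate / 2))" by (simp add: powr_powr)
 also have "2 * (real N)^2 / min \<rho> 1 * (1 / real N) * (rate / 2) = 1" using N \<rho> by (simp add: rate_def power2_eq_square)
 also have "(1 / M) powr 1 = 1 / M" using M by simp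
 finally show ?thesis using M by (simp add: M_def[symmetric] field_simps)
qed

abbreviation radius :: "nat => real" where "radius i \<equiv> \<theta> ^ i * s0"

text \<open>Locates the radius between consecutive periods up to the factor \<open>K0\<close>, which
  leaves room for the spacing of almost periods, a multiple of \<epsilon> (Suc k).\<close>

definition level :: "nat => nat" where "level i = (LEAST k. K0 * \<epsilon> (Suc k) <= radius i)"

lemma radius_pos: "0 < radius i" using \<theta> s0 by simp

lemma radius_le_1: "radius i <= 1"
proof -
 have "\<theta> ^ i <= 1" using \<theta> by (simp add: power_le_one)
 then show ?thesis using s0 \<theta> mult_mono[of "\<theta> ^ i" 1 s0 1] by simp
qed

lemma level_low: "K0 * \<epsilon> (Suc (level i)) <= radius i"
proof -
 have "\<exists>k. K0 * \<epsilon> (Suc k) <= radius i"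
 proof -
  have "(\<lambda>k. K0 * \<epsilon> (Suc k)) \<longlonglongrightarrow> K0 * 0" by (intro tendsto_intros LIMSEQ_Suc e_lim[OF d0 sd SC])
  then have "eventually (\<lambda>k. K0 * \<epsilon> (Suc k) < radius i) sequentially"
   by (rule order_tendstoD(2)) (use radius_pos in simp)
  then show ?thesis by (auto simp: eventually_sequentially intro: less_imp_le)
 qed
 then show ?thesis unfolding level_def by (rule LeastI_ex)
qed

lemma level_high: "j <= level i ==> radius i <= K0 * \<epsilon> j"
proof (cases j)
 case 0
 then show ?thesis using radius_le_1[of i] K0 e_0[OF d0 sd SC] by simp
next
 case (Suc j')
 assume "j <= level i"
 then have "j' < level i" using Suc by simp
 then have "\<not> K0 * \<epsilon> (Suc j') <= radius i" unfolding level_def by (rule not_less_Least)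
 then show ?thesis using Suc by simp
qed

lemma level_mono: "mono level"
proof (rule monoI)
 fix i i' :: nat assume "i <= i'"
 then have "radius i' <= radius i" using \<theta> s0 by (intro mult_right_mono power_decreasing) auto
 then have "K0 * \<epsilon> (Suc (level i')) <= radius i" using level_low[of i'] by linarith
 then show "level i <= level i'" unfolding level_def[of i] by (rule Least_le)
qed

abbreviation tails :: "nat => real" where "tails \<equiv> tail_sum \<delta>"

definition total :: real where "total = delta0 \<delta> + delta_norm (1 + \<rho>) \<delta>"

lemma summable_norm: "summable (\<lambda>l. (if l = 0 then 0 else real l powr (1 + \<rho>)) * \<delta> l)"
 by (rule summable_cong[THEN iffD1, OF _ sd\<rho>]) auto

text \<open>After interchanging the sums each \<delta> l is counted at most l + 1 times, and l <=
  l^(1 + \<rho>) for l >= 1.\<close>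

lemma sum_tails: "(\<Sum>j<M. tails j) <= total"
proof -
 have "(\<lambda>l. \<Sum>j<M. if j <= l then \<delta> l else 0) sums (\<Sum>j<M. tails j)"
  unfolding tail_sum_def by (intro sums_sum summable_sums summable_tail[OF d0 sd SC])
 then have "(\<Sum>j<M. tails j) = (\<Sum>l. \<Sum>j<M. if j <= l then \<delta> l else 0)" by (rule sums_unique)
 also have "... <= (\<Sum>l. \<delta> l + (if l = 0 then 0 else real l powr (1 + \<rho>)) * \<delta> l)"
 proof (rule suminf_le)
  show "summable (\<lambda>l. \<Sum>j<M. if j <= l then \<delta> l else 0)" by (intro summable_sum summable_tail[OF d0 sd SC])
  show "summable (\<lambda>l. \<delta> l + (if l = 0 then 0 else real l powr (1 + \<rho>)) * \<delta> l)" by (intro summable_add sd summable_norm)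
  fix l
  have "(\<Sum>j<M. if j <= l then \<delta> l else 0) = (\<Sum>j\<in>{j. j < M \<and> j <= l}. \<delta> l)" by (rule sum.mono_neutral_cong_right) auto
  also have "... = real (card {j. j < M \<and> j <= l}) * \<delta> l" by simp
  also have "... <= (1 + real l) * \<delta> l"
  proof -
   have "card {j. j < M \<and> j <= l} <= card {..l}" by (rule card_mono) auto
   then show ?thesis using d0 by (intro mult_right_mono) auto
  qed
  also have "... <= \<delta> l + (if l = 0 then 0 else real l powr (1 + \<rho>)) * \<delta> l"
  proof (cases "l = 0")
   case False
   then have "real l powr 1 <= real l powr (1 + \<rho>)" using \<rho> by (intro powr_mono) auto
   then have "real l * \<delta> l <= real l powr (1 + \<rho>) * \<delta> l" using d0 by (intro mult_right_mono) auto
   then show ?thesis using False by (simp add: distrib_right)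
  qed simp
  finally show "(\<Sum>j<M. if j <= l then \<delta> l else 0) <= \<delta> l + (if l = 0 then 0 else real l powr (1 + \<rho>)) * \<delta> l" .
 qed
 also have "... = total" unfolding total_def delta0_def delta_norm_def by (rule suminf_add[OF sd summable_norm, symmetric])
 finally show ?thesis .
qed

lemma tails_nonneg: "0 <= tails j" by (rule tail_sum_nonneg[OF d0 sd SC])

lemma sum_tails_Suc: "(\<Sum>j<M. tails (j + 1)) <= total"
proof -
 have "(\<Sum>j<M. tails (j + 1)) = (\<Sum>j\<in>{1..<Suc M}. tails j)" by (rule sum.reindex_bij_witness[of _ "\<lambda>i. i - 1" Suc]) auto
 also have "... <= (\<Sum>j<Suc M. tails j)" by (intro sum_mono2) (auto simp: tails_nonneg)
 finally show ?thesis using sum_tails[of "Suc M"] by linarith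
qed

lemma regroup:
 fixes h :: "nat => nat => real"
 shows "(\<Sum>i<n. h (level i) i) = (\<Sum>j<Suc (level n). \<Sum>i\<in>{i. i < n \<and> level i = j}. h j i)"
proof -
 have "(\<Sum>j<Suc (level n). \<Sum>i\<in>{i \<in> {..<n}. level i = j}. h (level i) i) = (\<Sum>i<n. h (level i) i)"
  by (rule sum.group) (use monoD[OF level_mono] in \<open>auto simp: less_Suc_eq_le\<close>)
 moreover have "(\<Sum>i\<in>{i \<in> {..<n}. level i = j}. h (level i) i) = (\<Sum>i\<in>{i. i < n \<and> level i = j}. h j i)" for j
  by (rule sum.cong) auto
 ultimately show ?thesis by simp
qed

text \<open>For fixed j the radii with j <= \<open>level i\<close> decrease geometrically from at
  most K0 \<epsilon> j, so together they cost a multiple of the tail at j; the number of scales does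
  not appear.\<close>

lemma sum_slow_le: "(\<Sum>i<n. slow_sum \<delta> \<epsilon> (level i) (radius i)) <= 2 * K0 * total"
proof -
 have "(\<Sum>i<n. slow_sum \<delta> \<epsilon> (level i) (radius i)) = (\<Sum>i<n. \<Sum>j<Suc (level n). if j <= level i then radius i / \<epsilon> j * tails j else 0)"
 proof (rule sum.cong[OF refl])
  fix i assume "i \<in> {..<n}"
  then have "level i <= level n" using monoD[OF level_mono, of i n] by simp
  then have "{j. j < Suc (level n) \<and> j <= level i} = {..level i}" by auto
  moreover have "(\<Sum>j<Suc (level n). if j <= level i then radius i / \<epsilon> j * tails j else 0) = (\<Sum>j\<in>{j. j < Suc (level n) \<and> j <= level i}. radius i / \<epsilon> j * tails j)"
   by (rule sum.mono_neutral_cong_right) auto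
  ultimately show "slow_sum \<delta> \<epsilon> (level i) (radius i) = (\<Sum>j<Suc (level n). if j <= level i then radius i / \<epsilon> j * tails j else 0)"
   by (simp add: slow_sum_def)
 qed
 also have "... = (\<Sum>j<Suc (level n). \<Sum>i<n. if j <= level i then radius i / \<epsilon> j * tails j else 0)" by (rule sum.swap)
 also have "... <= (\<Sum>j<Suc (level n). 2 * K0 * tails j)"
 proof (rule sum_mono)
  fix j
  have "(\<Sum>i<n. if j <= level i then radius i / \<epsilon> j * tails j else 0) = (\<Sum>i\<in>{i. i < n \<and> j <= level i}. radius i / \<epsilon> j * tails j)"
   by (rule sum.mono_neutral_cong_right) auto
  also have "... = tails j / \<epsilon> j * (\<Sum>i\<in>{i. i < n \<and> j <= level i}. radius i)" by (simp add: sum_distrib_left algebra_simps)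
  also have "... <= tails j / \<epsilon> j * (2 * (K0 * \<epsilon> j))"
   using ep[of j] tails_nonneg[of j] s0 K0 \<theta> level_high by (intro mult_left_mono sum_geometric_below) auto
  also have "... = 2 * K0 * tails j" using ep[of j] by simp
  finally show "(\<Sum>i<n. if j <= level i then radius i / \<epsilon> j * tails j else 0) <= 2 * K0 * tails j" .
 qed
 also have "... <= 2 * K0 * total"
  unfolding sum_distrib_left[symmetric] by (rule mult_left_mono[OF sum_tails]) (use K0 in simp)
 finally show ?thesis .
qed

text \<open>Along one level the reciprocal radii grow geometrically up to at most 1 / \<epsilon> (j
  + 1), so a level costs a multiple of its tail, however many scales it contains.\<close>

lemma sum_period_tail_le:
 assumes "0 <= d"
 shows "(\<Sum>i<n. d * \<epsilon> (Suc (level i)) / radius i * tails (level i + 1)) <= 2 * d * total"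
proof -
 have "(\<Sum>i<n. d * \<epsilon> (Suc (level i)) / radius i * tails (level i + 1))
   = (\<Sum>j<Suc (level n). \<Sum>i\<in>{i. i < n \<and> level i = j}. d * \<epsilon> (Suc j) / radius i * tails (j + 1))"
  by (rule regroup[of "\<lambda>j i. d * \<epsilon> (Suc j) / radius i * tails (j + 1)"])
 also have "... <= (\<Sum>j<Suc (level n). 2 * d * tails (j + 1))"
 proof (rule sum_mono)
  fix j
  have "(\<Sum>i\<in>{i. i < n \<and> level i = j}. d * \<epsilon> (Suc j) / radius i * tails (j + 1))
   = d * \<epsilon> (Suc j) * tails (j + 1) * (\<Sum>i\<in>{i. i < n \<and> level i = j}. 1 / radius i)" by (simp add: sum_distrib_left)
  also have "... <= d * \<epsilon> (Suc j) * tails (j + 1) * (2 / \<epsilon> (Suc j))"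
  proof (intro mult_left_mono sum_geometric_above \<theta> s0 ep)
   fix i assume "i \<in> {i. i < n \<and> level i = j}"
   then have "K0 * \<epsilon> (Suc j) <= radius i" using level_low[of i] by simp
   moreover have "1 * \<epsilon> (Suc j) <= K0 * \<epsilon> (Suc j)" using K0 ep[of "Suc j"] by (intro mult_right_mono) auto
   ultimately show "\<epsilon> (Suc j) <= radius i" by linarith
  qed (use assms ep[of "Suc j"] tails_nonneg in auto)
  also have "... = 2 * d * tails (j + 1)" using ep[of "Suc j"] by simp
  finally show "(\<Sum>i\<in>{i. i < n \<and> level i = j}. d * \<epsilon> (Suc j) / radius i * tails (j + 1)) <= 2 * d * tails (j + 1)" .
 qed
 also have "... <= 2 * d * total"
  unfolding sum_distrib_left[symmetric] by (rule mult_left_mono[OF sum_tails_Suc]) (use assms in simp)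
 finally show ?thesis .
qed

text \<open>Along a level the radius is at least halved at each step and falls from at most K0
  \<epsilon> j to no less than K0 \<epsilon> (j + 1), so the number of steps is logarithmic in the
  ratio.\<close>

lemma level_count: "real (card {i. i < n \<and> level i = j}) * ratio j powr rate <= 1"
proof (cases "{i. i < n \<and> level i = j} = {}")
 case True
 show ?thesis unfolding True by simp
next
 case False
 let ?A = "{i. i < n \<and> level i = j}"
 have fin: "finite ?A" by simp
 define a b where "a = Min ?A" and "b = Max ?A"
 have a: "a \<in> ?A" and b: "b \<in> ?A" using Min_in[OF fin False] Max_in[OF fin False] by (auto simp: a_def b_def)
 have sub: "?A \<subseteq> {a..b}" using fin by (auto simp: a_def b_def)
 have ab: "a <= b" using a sub by auto
 have "card ?A <= card {a..b}" by (rule card_mono[OF _ sub]) simp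
 then have cb: "card ?A - 1 <= b - a" by simp
 have "K0 * \<epsilon> (Suc j) <= radius b" using level_low[of b] b by simp
 also have "radius b = \<theta> ^ (b - a) * radius a" using ab by (simp add: power_add[symmetric])
 also have "... <= \<theta> ^ (b - a) * (K0 * \<epsilon> j)" using level_high[of j a] a \<theta> by (intro mult_left_mono) auto
 finally have "K0 * \<epsilon> (Suc j) <= K0 * (\<theta> ^ (b - a) * \<epsilon> j)" by (simp only: mult.left_commute)
 then have "\<epsilon> (Suc j) <= \<theta> ^ (b - a) * \<epsilon> j" using K0 by simp
 then have "ratio j <= \<theta> ^ (b - a)" using ep[of j] by (simp add: ratio_def divide_le_eq)
 also have "... <= (1 / 2) ^ (b - a)" using \<theta> by (intro power_mono) auto
 also have "... <= (1 / 2) ^ (card ?A - 1)" using cb by (intro power_decreasing) auto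
 finally show ?thesis by (intro count_absorbed[OF ratio_pos _ rate_pos ratio_rate])
qed

text \<open>Here each scale of a level counts fully. Later ratios are at most x = (ratio j)^(1 / N),
  so the cap yields (l x)^r up to constants with r = min \<rho> 1. The factor x^r = (ratio j)^rate
  pays for the number of scales in the level, and l^r summed over the levels below l gives l^(1 +
  r), covered by the moment of order 1 + \<rho>. \<open>N\<close> drops out of the bound.\<close>

lemma sum_fast_le:
 assumes d: "1 <= d"
 shows "(\<Sum>i<n. fast_sum d \<delta> \<epsilon> (level i)) <= 2 * d * delta_norm (1 + \<rho>) \<delta>"
proof -
 define r where "r = min \<rho> 1"
 have r: "0 < r" "r <= 1" "r <= \<rho>" using \<rho> by (auto simp: r_def)
 define W where "W j = (\<Sum>l. if j < l then real l powr r * \<delta> l else 0)" for j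
 have sW: "summable (\<lambda>l. if j < l then real l powr r * \<delta> l else 0)" for j
 proof (rule summable_if[OF summable_norm])
  fix l assume l: "j < l"
  have "real l powr r <= real l powr (1 + \<rho>)" using l r by (intro powr_mono) auto
  then show "0 <= real l powr r * \<delta> l \<and> real l powr r * \<delta> l <= (if l = 0 then 0 else real l powr (1 + \<rho>)) * \<delta> l"
   using l d0 by (auto intro!: mult_right_mono)
 qed (auto simp: d0)
 have W0: "0 <= W j" for j unfolding W_def by (rule suminf_nonneg[OF sW]) (auto simp: d0)
 have fast: "fast_sum d \<delta> \<epsilon> j <= (2 * d * ratio j powr rate) * W j" for j
 proof -
  have "fast_sum d \<delta> \<epsilon> j <= (\<Sum>l. (2 * d * ratio j powr rate) * (if j < l then real l powr r * \<delta> l else 0))"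
   unfolding fast_sum_def
  proof (rule suminf_le[OF _ summable_fast[OF d0 sd SC] summable_mult[OF sW]])
   fix l
   show "(if j < l then \<delta> l * min 2 (d * (\<Sum>i\<in>{j<..l}. \<epsilon> (Suc i) / \<epsilon> i)) else 0)
     <= (2 * d * ratio j powr rate) * (if j < l then real l powr r * \<delta> l else 0)"
   proof (cases "j < l")
    case True
    define x where "x = ratio j powr (1 / real N)"
    have x0: "0 <= x" by (simp add: x_def)
    have "(\<Sum>i\<in>{j<..l}. \<epsilon> (Suc i) / \<epsilon> i) <= (\<Sum>i\<in>{j<..l}. x)"
     by (intro sum_mono) (use ratio_sep in \<open>auto simp: x_def ratio_def\<close>)
    also have "... <= real l * x" using x0 by (simp add: mult_right_mono)
    finally have "d * (\<Sum>i\<in>{j<..l}. \<epsilon> (Suc i) / \<epsilon> i) <= d * (real l * x)" using d by (intro mult_left_mono) auto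
    then have "min 2 (d * (\<Sum>i\<in>{j<..l}. \<epsilon> (Suc i) / \<epsilon> i)) <= min 2 (d * (real l * x))" by linarith
    also have "... <= 2 * (d * (real l * x)) powr r" using d x0 r by (intro min_2_powr) auto
    also have "(d * (real l * x)) powr r = d powr r * (real l powr r * x powr r)" using d x0 by (simp add: powr_mult)
    also have "... <= d * (real l powr r * x powr r)"
    proof -
     have "d powr r <= d powr 1" using d r by (intro powr_mono) auto
     then show ?thesis using d by (intro mult_right_mono) auto
    qed
    also have "x powr r = ratio j powr rate" by (simp add: x_def powr_powr rate_def r_def)
    finally have "min 2 (d * (\<Sum>i\<in>{j<..l}. \<epsilon> (Suc i) / \<epsilon> i)) <= 2 * (d * (real l powr r * ratio j powr rate))" by simp
    then have "\<delta> l * min 2 (d * (\<Sum>i\<in>{j<..l}. \<epsilon> (Suc i) / \<epsilon> i)) <= \<delta> l * (2 * (d * (real l powr r * ratio j powr rate)))"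
     by (rule mult_left_mono[OF _ d0])
    then show ?thesis using True by (simp add: algebra_simps)
   qed simp
  qed (use d in simp)
  also have "... = (2 * d * ratio j powr rate) * W j" unfolding W_def by (rule suminf_mult[OF sW])
  finally show ?thesis .
 qed
 have "(\<Sum>i<n. fast_sum d \<delta> \<epsilon> (level i)) = (\<Sum>j<Suc (level n). \<Sum>i\<in>{i. i < n \<and> level i = j}. fast_sum d \<delta> \<epsilon> j)"
  by (rule regroup[of "\<lambda>j i. fast_sum d \<delta> \<epsilon> j"])
 also have "... = (\<Sum>j<Suc (level n). real (card {i. i < n \<and> level i = j}) * fast_sum d \<delta> \<epsilon> j)" by simp
 also have "... <= (\<Sum>j<Suc (level n). 2 * d * W j)"
 proof (rule sum_mono)
  fix j
  let ?c = "real (card {i. i < n \<and> level i = j})"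
  have "?c * fast_sum d \<delta> \<epsilon> j <= ?c * ((2 * d * ratio j powr rate) * W j)" using fast by (intro mult_left_mono) auto
  also have "... = (?c * ratio j powr rate) * (2 * d * W j)" by (simp add: algebra_simps)
  also have "... <= 1 * (2 * d * W j)" using level_count W0 d by (intro mult_right_mono) auto
  finally show "?c * fast_sum d \<delta> \<epsilon> j <= 2 * d * W j" by simp
 qed
 also have "... = 2 * d * (\<Sum>j<Suc (level n). W j)" by (rule sum_distrib_left[symmetric])
 also have "... <= 2 * d * delta_norm (1 + \<rho>) \<delta>"
 proof (rule mult_left_mono)
  have "(\<lambda>l. \<Sum>j<Suc (level n). if j < l then real l powr r * \<delta> l else 0) sums (\<Sum>j<Suc (level n). W j)"
   unfolding W_def by (intro sums_sum summable_sums sW)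
  then have "(\<Sum>j<Suc (level n). W j) = (\<Sum>l. \<Sum>j<Suc (level n). if j < l then real l powr r * \<delta> l else 0)" by (rule sums_unique)
  also have "... <= delta_norm (1 + \<rho>) \<delta>" unfolding delta_norm_def
  proof (rule suminf_le[OF _ summable_sum[OF sW] summable_norm])
   fix l
   have "(\<Sum>j<Suc (level n). if j < l then real l powr r * \<delta> l else 0) = (\<Sum>j\<in>{j. j < Suc (level n) \<and> j < l}. real l powr r * \<delta> l)"
    by (rule sum.mono_neutral_cong_right) auto
   also have "... = real (card {j. j < Suc (level n) \<and> j < l}) * (real l powr r * \<delta> l)" by simp
   also have "... <= real l * (real l powr r * \<delta> l)"
   proof -
    have "card {j. j < Suc (level n) \<and> j < l} <= card {..<l}" by (rule card_mono) auto
    then show ?thesis using d0 by (intro mult_right_mono) auto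
   qed
   also have "... <= (if l = 0 then 0 else real l powr (1 + \<rho>)) * \<delta> l"
   proof (cases "l = 0")
    case False
    have "real l * real l powr r = real l powr (1 + r)" using False by (simp add: powr_add)
    also have "... <= real l powr (1 + \<rho>)" using False r by (intro powr_mono) auto
    finally have "real l * real l powr r * \<delta> l <= real l powr (1 + \<rho>) * \<delta> l" using d0 by (intro mult_right_mono) auto
    then show ?thesis using False by (simp add: mult.assoc)
   qed simp
   finally show "(\<Sum>j<Suc (level n). if j < l then real l powr r * \<delta> l else 0) <= (if l = 0 then 0 else real l powr (1 + \<rho>)) * \<delta> l" .
  qed
  finally show "(\<Sum>j<Suc (level n). W j) <= delta_norm (1 + \<rho>) \<delta>" .
 qed (use d in simp)
 finally show ?thesis .
qed

text \<open>The periods at least halve from one index to the next, so the terms form a geometric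
  series dominated by the last one, where the radius is at most \<open>K0\<close> times the
  period.\<close>

lemma slow_bounded: "slow_sum \<delta> \<epsilon> (level i) (radius i) <= 2 * K0 * delta0 \<delta>"
proof -
 have D0: "0 <= delta0 \<delta>" unfolding delta0_def by (intro suminf_nonneg sd d0)
 have "slow_sum \<delta> \<epsilon> (level i) (radius i) <= (\<Sum>j\<le>level i. K0 * delta0 \<delta> * (1 / 2) ^ (level i - j))" unfolding slow_sum_def
 proof (rule sum_mono)
  fix j assume "j \<in> {..level i}"
  then have j: "j <= level i" by simp
  have "radius i / \<epsilon> j <= K0 * \<epsilon> (level i) / \<epsilon> j" using level_high[of "level i" i] ep[of j] by (intro divide_right_mono) auto
  also have "... <= K0 * (\<epsilon> j / 2 ^ (level i - j)) / \<epsilon> j"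
   using eps_halving[OF d0 sd SC half, of j "level i - j"] j K0 ep[of j] by (intro divide_right_mono mult_left_mono) auto
  also have "... = K0 * (1 / 2) ^ (level i - j)" using ep[of j] by (simp add: power_one_over)
  finally have "radius i / \<epsilon> j * tails j <= K0 * (1 / 2) ^ (level i - j) * delta0 \<delta>"
   using tail_sum_le[OF d0 sd SC, of j] tails_nonneg[of j] K0 by (intro mult_mono) auto
  then show "radius i / \<epsilon> j * tails j <= K0 * delta0 \<delta> * (1 / 2) ^ (level i - j)" by (simp add: algebra_simps)
 qed
 also have "... = K0 * delta0 \<delta> * (\<Sum>j<Suc (level i). (1 / 2) ^ (level i - j))"
  by (simp add: sum_distrib_left lessThan_Suc_atMost)
 also have "(\<Sum>j<Suc (level i). (1 / 2 :: real) ^ (level i - j)) = (\<Sum>p<Suc (level i). (1 / 2) ^ p)"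
  by (rule sum.reindex_bij_witness[of _ "\<lambda>p. level i - p" "\<lambda>p. level i - p"]) auto
 also have "K0 * delta0 \<delta> * (\<Sum>p<Suc (level i). (1 / 2) ^ p) <= K0 * delta0 \<delta> * 2"
  using sum_powers_half[of "1 / 2" "Suc (level i)"] K0 D0 by (intro mult_left_mono) auto
 finally show ?thesis by simp
qed

end

section \<open>Decay for smooth approximate solutions\<close>

lemma sum_power_le:
 assumes "0 <= (x::real)" "x < 1"
 shows "(\<Sum>i<n. x ^ i) <= 1 / (1 - x)"
proof -
 have "(\<Sum>i<n. x ^ i) = (1 - x ^ n) / (1 - x)" using assms by (simp add: sum_gp_strict)
 also have "... <= 1 / (1 - x)" using assms by (intro divide_right_mono) auto
 finally show ?thesis .
qed

definition separated_scales :: "(nat => real) => real => nat => (nat => real) => bool" where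
 "separated_scales \<delta> \<rho> N \<epsilon> \<longleftrightarrow> (\<forall>l. 0 <= \<delta> l) \<and> summable \<delta> \<and> scales \<epsilon> \<and>
   summable (\<lambda>l. real l powr (1 + \<rho>) * \<delta> l) \<and> 0 < \<rho> \<and> N >= 1 \<and>
   (\<forall>i k. i < k --> (\<epsilon> (k + 1) / \<epsilon> k) ^ N <= \<epsilon> (i + 1) / \<epsilon> i) \<and> \<epsilon> 1 <= sep_threshold \<rho> N"

text \<open>The order of the quantifiers is the point: \<open>Kc\<close> may depend on D0 and D1,
  while N, \<rho>, \<epsilon> and \<delta> are quantified inside.\<close>

definition decay_constant :: "'n::finite itself => real => real => real => real => real => real => real => bool" where
 "decay_constant T \<mu> \<Lambda> \<theta> \<alpha> D0 D1 Kc \<longleftrightarrow> (\<forall>(A :: real^'n => real^'n^'n) c r0 v G F f \<delta> \<epsilon> \<rho> N s0 m0 m.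
   approx_solution A \<mu> \<Lambda> c r0 (modulus \<delta> \<epsilon>) v G F f \<and> separated_scales \<delta> \<rho> N \<epsilon> \<and>
   delta0 \<delta> = D0 \<and> delta_norm (1 + \<rho>) \<delta> = D1 \<and>
   0 < s0 \<and> s0 <= 1 \<and> s0 <= r0 \<and> 0 < m0 \<and> ball_energy c (2 * s0) G <= m0 * s0 ^ CARD('n) \<and>
   (\<forall>i<m. ball_energy c (\<theta> ^ i * s0) (\<lambda>x. F x - A x *v G x) + (\<theta> ^ i * s0)^2 * ball_energy c (\<theta> ^ i * s0) f
     <= ((\<theta> powr \<alpha>) ^ i)^2 * m0 * (\<theta> ^ i * s0) ^ CARD('n))
   --> ball_energy c (\<theta> ^ m * s0) G <= Kc * m0 * (\<theta> ^ m * s0) ^ CARD('n))"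

text \<open>\<theta> is fixed before \<alpha>, D0 and D1 because the step parameters come from the
  dimension and the Caccioppoli constant. The other data enter through the exponent
  \<open>Bd\<close>, which collects the bounds fed into \<open>scalar_sum\<close>.\<close>

lemma core_estimate:
 fixes \<mu> \<Lambda> :: real
 assumes \<mu>: "\<mu> > 0"
 shows "\<exists>\<theta>. 0 < \<theta> \<and> \<theta> <= 1 / 2 \<and> (\<forall>\<alpha> D0 D1. 0 < \<alpha> --> 0 <= D0 --> 0 <= D1 -->
  (\<exists>Kc>0. decay_constant TYPE('n::finite) \<mu> \<Lambda> \<theta> \<alpha> D0 D1 Kc))"
proof -
 define d where "d = CARD('n)"
 have d1: "d >= 1" by (simp add: d_def Suc_le_eq)
 define C where "C = cacc_const \<mu> \<Lambda>"
 have C0: "C >= 0" using \<mu> by (simp add: C_def cacc_const_def)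
 obtain a b n M :: nat and \<kappa> \<beta> K L0 :: real where par: "good_params d C a b n M \<kappa> \<beta> K L0" and b1: "b >= 1"
  using good_params_exist[OF C0 d1] by blast
 define \<theta> where "\<theta> = (1 / 2 :: real) ^ b"
 have \<theta>_eq: "\<theta> = 1 / 2 ^ b" by (simp add: \<theta>_def power_one_over)
 have \<theta>: "0 < \<theta>" "\<theta> <= 1 / 2"
 proof -
  show "0 < \<theta>" by (simp add: \<theta>_def)
  have "(1 / 2 :: real) ^ b <= (1 / 2) ^ 1" using b1 by (intro power_decreasing) auto
  then show "\<theta> <= 1 / 2" by (simp add: \<theta>_def)
 qed
 define cG where "cG = (2 * 2 ^ b :: real) ^ d"
 define K7 where "K7 = C * 2304 * 2 ^ (d + 1) * (real M)^2 + (10 * C * (real n + 3)^2 + 1) * cG"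
 define K8 where "K8 = 2 * (real M)^2 * (1 + K7) * (64 * real d * 2 ^ b) ^ d"
 define K9 where "K9 = real d * (64 * real d * 2 ^ b) ^ (d + 1) * (2 ^ (d + 1) * (real M)^2 + cG)"
 have \<beta>: "0 < \<beta>" "\<beta> <= 1" and \<kappa>: "0 < \<kappa>" "(real d + 3) * \<kappa> <= 1 / 64 ^ (d + 1)" and L0: "0 < L0" and K0': "K > 0"
  using par unfolding good_params_def by blast+
 have cG0: "cG >= 1" unfolding cG_def by (rule one_le_power) (use one_le_power[of "2::real" b] in linarith)
 have K70: "K7 >= 0" unfolding K7_def using C0 cG0 by (intro add_nonneg_nonneg mult_nonneg_nonneg) auto
 have K80: "K8 >= 0" unfolding K8_def using K70 by (intro mult_nonneg_nonneg) auto
 have K90: "K9 >= 0" unfolding K9_def using cG0 by (intro mult_nonneg_nonneg add_nonneg_nonneg) auto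
 define K5 where "K5 = sqrt (K * K7 / \<theta> ^ d)"
 have K5: "K5 >= 0" "K5^2 >= K * K7 / \<theta> ^ d"
 proof -
  have "0 <= K * K7 / \<theta> ^ d" using K0' K70 \<theta> by simp
  then show "K5 >= 0" "K5^2 >= K * K7 / \<theta> ^ d" by (simp_all add: K5_def)
 qed
 \<comment> \<open>A radius must be at least \<epsilon> (k + 1) for its level k, at least the
   spacing d \<epsilon> (k + 1) of the almost periods, and at least \<open>L0\<close> times that
   spacing.\<close>
 define K0 where "K0 = 1 + real d + L0 * real d"
 have K0: "1 <= K0" "real d <= K0" "L0 * real d <= K0" using L0 by (auto simp: K0_def)
 \<comment> \<open>At the first radius only the trivial factor 4 per difference is known; 1 /
   \<beta>^d compensates the weights.\<close>
 define Y0 where "Y0 = sqrt (4 ^ d / \<beta> ^ d)"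
 have Y0: "Y0 > 0" "Y0^2 = 4 ^ d / \<beta> ^ d" using \<beta> by (auto simp: Y0_def)
 have kj: "real j * \<kappa> <= 1" if "j <= d" for j
 proof -
  have "real j * \<kappa> <= (real d + 3) * \<kappa>" using that \<kappa> by (intro mult_right_mono) auto
  also have "... <= 1 / 64 ^ (d + 1)" by (rule \<kappa>(2))
  also have "... <= 1" using one_le_power[of "64::real" "d + 1"] by (simp add: divide_le_eq)
  finally show ?thesis .
 qed
 show ?thesis
 proof (rule exI[of _ \<theta>], intro conjI \<theta> allI impI)
  fix \<alpha> D0 D1 :: real assume \<alpha>: "0 < \<alpha>" and D: "0 <= D0" "0 <= D1"
  define t where "t = \<theta> powr \<alpha>"
  have t: "0 < t" "t < 1"
  proof -
   show "0 < t" using \<theta> by (simp add: t_def)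
   have "\<theta> powr \<alpha> < 1 powr \<alpha>" using \<theta> \<alpha> by (intro powr_less_mono2) auto
   then show "t < 1" by (simp add: t_def)
  qed
  define W where "W = D0 + D1"
  define B3 where "B3 = 1 / (1 - t)"
  define Ymax where "Ymax = Y0 + 4 * K5 * (real d * (2 * K0 * D0) + 2 * D0 + 1)"
  define X where "X = 8 * (Y0 + K5 * (real d * (2 * K0 * W) + B3)) + 64 * K5 * W + 8 * K5 * (2 * real d * W + W)"
  define Bd where "Bd = 4 * (Y0 + K5 * (2 * real d * (2 * K0 * W) + 2 * real d * D1 + 2 * B3 + X) + X)
   + 2 * real d * (2 * K0 * W) + 2 * real d * D1 + 2 * B3 + (1 + Ymax) * X"
  define Kc where "Kc = cG * (64 * real d) ^ d * exp ((1 + K8 + K9) * Bd)"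
  have Kc: "Kc > 0" unfolding Kc_def using cG0 d1 by simp
  show "\<exists>Kc>0. decay_constant TYPE('n) \<mu> \<Lambda> \<theta> \<alpha> D0 D1 Kc" unfolding decay_constant_def separated_scales_def
  proof (rule exI[of _ Kc], intro conjI Kc allI impI, elim conjE)
   fix A :: "real^'n => real^'n^'n" and c r0 v G F f \<delta> \<epsilon> \<rho> N s0 m0 m
   assume loc: "approx_solution A \<mu> \<Lambda> c r0 (modulus \<delta> \<epsilon>) v G F f"
    and d0: "\<forall>l. 0 <= \<delta> l" and sd: "summable \<delta>" and SC: "scales \<epsilon>"
    and sd\<rho>: "summable (\<lambda>l. real l powr (1 + \<rho>) * \<delta> l)" and \<rho>: "0 < \<rho>" and N: "(1::nat) <= N"
    and sep: "\<forall>i k. i < k --> (\<epsilon> (k + 1) / \<epsilon> k) ^ N <= \<epsilon> (i + 1) / \<epsilon> i" and e1: "\<epsilon> 1 <= sep_threshold \<rho> N"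
    and DD: "delta0 \<delta> = D0" "delta_norm (1 + \<rho>) \<delta> = D1"
    and s0: "0 < s0" "s0 <= 1" "s0 <= r0" and m0: "0 < m0"
    and init: "ball_energy c (2 * s0) G <= m0 * s0 ^ CARD('n)"
    and err: "\<forall>i<m. ball_energy c (\<theta> ^ i * s0) (\<lambda>x. F x - A x *v G x) + (\<theta> ^ i * s0)^2 * ball_energy c (\<theta> ^ i * s0) f
     <= ((\<theta> powr \<alpha>) ^ i)^2 * m0 * (\<theta> ^ i * s0) ^ CARD('n)"
   interpret approx_solution A \<mu> \<Lambda> c r0 "modulus \<delta> \<epsilon>" v G F f by (rule loc)
   note d0' = d0[rule_format]
   note ctx = d0' sd SC sd\<rho> \<rho> N sep[rule_format] e1 \<theta> s0(1,2) K0(1)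
   define kk where "kk i = level \<epsilon> \<theta> s0 K0 i" for i
   define slow where "slow i = slow_sum \<delta> \<epsilon> (kk i) (\<theta> ^ i * s0)" for i
   define fast where "fast i = fast_sum (real d) \<delta> \<epsilon> (kk i)" for i
   define g where "g i = t ^ i" for i :: nat
   define l where "l i = real d * \<epsilon> (Suc (kk i))" for i
   \<comment> \<open>The slack in the choice of almost periods is set to \<open>g i\<close>, the
     decay rate of source and defect, and is therefore summable.\<close>
   define \<tau> where "\<tau> i = 2 * real d * slow i + fast i + g i" for i
   define \<Omega> where "\<Omega> i = real d * slow i + 2 * tail_sum \<delta> (kk i + 1)" for i
   define same where "same i \<longleftrightarrow> kk (Suc i) = kk i" for i
   \<comment> \<open>The factor is the volume ratio between a ball of radius s0 and the first tent,
     of radius s0 / (64 d).\<close>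
   define m1 where "m1 = (64 * real d) ^ d * m0"
   have ep: "0 < \<epsilon> i" for i by (rule e_pos[OF d0' sd SC])
   have Spos: "0 < \<theta> ^ i * s0" for i using \<theta> s0 by simp
   have klow: "K0 * \<epsilon> (Suc (kk i)) <= \<theta> ^ i * s0" for i unfolding kk_def by (rule level_low[OF ctx])
   have klow1: "\<epsilon> (Suc (kk i)) <= \<theta> ^ i * s0" for i
   proof -
    have "1 * \<epsilon> (Suc (kk i)) <= K0 * \<epsilon> (Suc (kk i))" by (rule mult_right_mono[OF K0(1) less_imp_le[OF ep]])
    then show ?thesis using klow[of i] by linarith
   qed
   have slow0: "0 <= slow i" for i unfolding slow_def by (rule slow_sum_nonneg[OF d0' sd SC]) (use Spos[of i] in simp)
   have fast0: "0 <= fast i" for i unfolding fast_def by (rule fast_sum_nonneg[OF d0' sd SC]) simp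
   have T0: "0 <= tail_sum \<delta> i" for i by (rule tail_sum_nonneg[OF d0' sd SC])
   have g0: "0 < g i" "g i <= 1" for i using t by (auto simp: g_def power_le_one)
   have q0: "0 <= l i / (\<theta> ^ i * s0)" "l i / (\<theta> ^ i * s0) <= 1" for i
   proof -
    show "0 <= l i / (\<theta> ^ i * s0)" using Spos[of i] ep[of "Suc (kk i)"] by (simp add: l_def)
    have "l i <= K0 * \<epsilon> (Suc (kk i))" unfolding l_def using K0(2) ep[of "Suc (kk i)"] by (intro mult_right_mono) auto
    then have "l i <= \<theta> ^ i * s0" using klow[of i] by linarith
    then show "l i / (\<theta> ^ i * s0) <= 1" using Spos[of i] by (simp add: divide_le_eq)
   qed
   have m1: "m0 <= m1"
   proof -
    have "1 <= (64 * real d) ^ d" using d1 by (intro one_le_power) auto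
    then show ?thesis using m0 by (simp add: m1_def)
   qed
   have main: "ball_energy c (\<theta> ^ m * s0) G <= cG * (m1 * exp ((1 + K8 + K9) *
     (\<Sum>i<m. zSeq K5 (ySeq K5 Y0 \<Omega> g) \<tau> (\<lambda>i. l i / (\<theta> ^ i * s0)) g same i
      + \<tau> i + g i + l i / (\<theta> ^ i * s0) * (ySeq K5 Y0 \<Omega> g i + (ySeq K5 Y0 \<Omega> g i)^2)))) * (\<theta> ^ m * s0) ^ d"
    (is "_ <= cG * (m1 * exp (_ * ?sum)) * _")
   proof (rule n_steps[where a = a and b = b and n = n and N = M and \<kappa> = \<kappa> and \<beta> = \<beta> and K = K and ?L0.0 = L0 and ?s0.0 = s0
      and m = m and ?m0.0 = m0 and ?m1.0 = m1 and l = l and \<tau> = \<tau> and \<Omega> = \<Omega> and g = g and same = same and ?Y0.0 = Y0 and ?K5.0 = K5,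
      folded d_def \<theta>_eq, folded cG_def, folded C_def, folded K7_def, folded K8_def K9_def])
    show "good_params d C a b n M \<kappa> \<beta> K L0" by (rule par)
    show "0 <= K5" "K * K7 / \<theta> ^ d <= K5^2" by (fact K5)+
    show "dense_shifts (\<tau> i) (l i) (\<theta> ^ i * s0)" for i unfolding dense_shifts_def
    proof (intro allI impI)
     fix z :: "real^'n" assume "norm z <= \<theta> ^ i * s0"
     from modulus_almost_period[OF d0' sd SC half[OF ctx] klow1 this g0(1)[of i]]
     show "\<exists>h. norm (h - z) <= l i \<and> modulus \<delta> \<epsilon> h <= \<tau> i" by (simp add: \<tau>_def slow_def fast_def l_def d_def)
    qed
    show "0 <= l i" for i using ep[of "Suc (kk i)"] by (simp add: l_def)
    show "L0 * l i <= \<theta> ^ i * s0" for i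
    proof -
     have "L0 * l i = (L0 * real d) * \<epsilon> (Suc (kk i))" by (simp add: l_def)
     also have "... <= K0 * \<epsilon> (Suc (kk i))" using K0(3) ep[of "Suc (kk i)"] by (intro mult_right_mono) auto
     finally show ?thesis using klow[of i] by linarith
    qed
    show "modulus \<delta> \<epsilon> h <= \<Omega> i" if "norm h <= \<theta> ^ i * s0" for i and h :: "real^'n"
     using modulus_le_all[OF d0' sd SC that, of "kk i"] by (simp add: \<Omega>_def slow_def d_def)
    show "0 < g i" for i by (rule g0)
    show "I (\<theta> ^ i * s0) E + (\<theta> ^ i * s0)^2 * I (\<theta> ^ i * s0) f <= (g i)^2 * m0 * (\<theta> ^ i * s0) ^ d" if "i < m" for i
     using err that by (simp add: E_def[abs_def] g_def t_def d_def)
    have I2: "I (2 * s0) G <= m0 * s0 ^ d" using init by (simp add: d_def)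
    have Is: "I r G <= m0 * s0 ^ d" if "r <= 2 * s0" for r using ball_energy_mono[OF contG that, of c] I2 by linarith
    show "I s0 G <= cG * m1 * s0 ^ d"
    proof -
     have "m0 * s0 ^ d <= cG * m1 * s0 ^ d" using cG0 m1 m0 s0 mult_mono[of 1 cG m0 m1] by (intro mult_right_mono) auto
     moreover have "I s0 G <= m0 * s0 ^ d" using Is[of s0] s0 by simp
     ultimately show ?thesis by linarith
    qed
    show "tent_avg c (s0 / (64 * real d)) (\<lambda>x. (norm (G x))^2) <= m1"
    proof -
     define r where "r = s0 / (64 * real d)"
     have r: "r > 0" "real d * r = s0 / 64" using s0 d1 by (auto simp: r_def)
     have "r ^ d * tent_avg c r (\<lambda>x. (norm (G x))^2) <= I (s0 / 64) G"
      unfolding d_def by (rule tent_avg_upper[OF r(1) contG]) (simp only: r(2)[unfolded d_def] order_refl)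
     also have "... <= m0 * s0 ^ d" using Is s0 by simp
     also have "... = r ^ d * m1" using d1 by (simp add: m1_def r_def power_divide)
     finally show ?thesis using r(1) by (simp add: r_def)
    qed
    show "zall (\<kappa> * s0) s0 j (\<beta> ^ j * (Y0^2 * m1 * s0 ^ d))" if j: "1 <= j" "j <= d" for j unfolding zall_def
    proof (intro allI impI)
     fix H :: "(real^'n) list" assume H: "length H = j" "\<forall>h\<in>set H. norm h <= \<kappa> * s0"
     have "len_sum H <= real (length H) * (\<kappa> * s0)" by (rule len_sum_le) (use H in auto)
     also have "... = (real j * \<kappa>) * s0" using H(1) by simp
     also have "... <= 1 * s0" using kj[OF j(2)] s0 by (intro mult_right_mono) auto
     finally have "len_sum H + s0 <= 2 * s0" by simp
     then have "I s0 (diff_ops H G) <= 4 ^ length H * I (2 * s0) G" by (intro ball_energy_diff_ops contG)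
     also have "... <= 4 ^ d * (m1 * s0 ^ d)"
     proof (intro mult_mono power_increasing)
      have "m0 * s0 ^ d <= m1 * s0 ^ d" using m1 s0 by (intro mult_right_mono) auto
      then show "I (2 * s0) G <= m1 * s0 ^ d" using I2 by linarith
     qed (use H(1) j in auto)
     also have "... <= \<beta> ^ j * (Y0^2 * m1 * s0 ^ d)"
     proof -
      have "\<beta> ^ d <= \<beta> ^ j" using \<beta> j by (intro power_decreasing) auto
      then have "1 <= \<beta> ^ j / \<beta> ^ d" using \<beta> by simp
      then have "1 * (4 ^ d * (m1 * s0 ^ d)) <= \<beta> ^ j / \<beta> ^ d * (4 ^ d * (m1 * s0 ^ d))"
       using m1 m0 s0 by (intro mult_right_mono) auto
      then show ?thesis by (simp add: Y0(2))
     qed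
     finally show "I s0 (diff_ops H G) <= \<beta> ^ j * (Y0^2 * m1 * s0 ^ d)" .
    qed
    show "\<tau> (Suc i) <= \<tau> i" if "same i" for i
    proof -
     have "slow (Suc i) <= slow i"
     proof -
      have "\<theta> ^ Suc i * s0 <= \<theta> ^ i * s0" using \<theta> s0 by (intro mult_right_mono power_decreasing) auto
      then show ?thesis unfolding slow_def using that same_def[of i] Spos[of "Suc i"]
       by (simp only:) (rule slow_sum_mono[OF d0' sd SC], auto)
     qed
     moreover have "fast (Suc i) = fast i" using that by (simp add: fast_def same_def)
     moreover have "g (Suc i) <= g i" unfolding g_def using t by (intro power_decreasing) auto
     ultimately show ?thesis unfolding \<tau>_def by (intro add_mono mult_left_mono) auto
    qed
   qed (use s0 m0 m1 Y0 in auto)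
   have Vb: "total \<delta> \<rho> = W" by (simp add: total_def[OF ctx] W_def DD)
   have sum: "?sum <= Bd" unfolding Bd_def X_def
   proof (rule scalar_sum[where k = kk and slow = slow and fast = fast and t = "tail_sum \<delta>"])
    show "antimono (tail_sum \<delta>)" by (rule tail_sum_antimono[OF d0' sd SC])
    show "mono kk" unfolding kk_def by (rule level_mono[OF ctx])
    show "(\<Sum>i<m. slow i) <= 2 * K0 * W" unfolding slow_def kk_def Vb[symmetric] by (rule sum_slow_le[OF ctx])
    show "(\<Sum>i<m. fast i) <= 2 * real d * D1" unfolding fast_def kk_def DD(2)[symmetric]
    proof (rule sum_fast_le[OF ctx])
     show "1 <= real d" by (rule real_of_nat_ge_one_iff[THEN iffD2, OF d1])
    qed
    show "(\<Sum>i<m. g i) <= B3" unfolding g_def B3_def by (rule sum_power_le) (use t in auto)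
    show "(\<Sum>i<m. l i / (\<theta> ^ i * s0) * tail_sum \<delta> (kk i + 1)) <= 2 * real d * W" unfolding l_def kk_def Vb[symmetric]
    proof (rule sum_period_tail_le[OF ctx])
     show "0 <= real d" by simp
    qed
    show "(\<Sum>j<M. tail_sum \<delta> (j + 1)) <= W" for M unfolding Vb[symmetric] by (rule sum_tails_Suc[OF ctx])
    show "ySeq K5 Y0 \<Omega> g i <= Ymax" for i unfolding Ymax_def
    proof (rule ySeq_bound[OF K5(1)])
     fix i
     have "slow i <= 2 * K0 * D0" unfolding slow_def kk_def DD(1)[symmetric] by (rule slow_bounded[OF ctx])
     then have "real d * slow i <= real d * (2 * K0 * D0)" by (intro mult_left_mono) auto
     moreover have "tail_sum \<delta> (kk i + 1) <= D0" unfolding DD(1)[symmetric] by (rule tail_sum_le[OF d0' sd SC])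
     ultimately show "\<Omega> i + g i <= real d * (2 * K0 * D0) + 2 * D0 + 1" using g0(2)[of i] by (simp add: \<Omega>_def)
    qed (use Y0 K0 D in auto)
    show "0 <= Ymax" unfolding Ymax_def using Y0 K5 K0 D by (intro add_nonneg_nonneg mult_nonneg_nonneg) auto
   qed (use K5 Y0 slow0 fast0 g0 q0 T0 in \<open>auto simp: \<Omega>_def \<tau>_def same_def less_imp_le\<close>)
   have "cG * (m1 * exp ((1 + K8 + K9) *
     ?sum)) * (\<theta> ^ m * s0) ^ d
    <= cG * (m1 * exp ((1 + K8 + K9) * Bd)) * (\<theta> ^ m * s0) ^ d"
    using cG0 m1 m0 K80 K90 sum Spos[of m] by (intro mult_right_mono mult_left_mono iffD2[OF exp_le_cancel_iff]) auto
   also have "... = Kc * m0 * (\<theta> ^ m * s0) ^ d" by (simp add: Kc_def m1_def)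
   finally show "ball_energy c (\<theta> ^ m * s0) G <= Kc * m0 * (\<theta> ^ m * s0) ^ CARD('n)" using main by (simp add: d_def)
  qed
 qed
qed

section \<open>Mollification\<close>

text \<open>The functions t^(-m) exp(-1/t), extended by 0. Their derivatives are linear combinations
  of members of the same family, so smoothness of the bump becomes an induction.\<close>

definition psi :: "nat => real => real" where
 "psi m t = (if t <= 0 then 0 else (inverse t) ^ m * exp (- inverse t))"

lemma psi_nonneg: "0 <= psi m t" by (simp add: psi_def)

lemma psi_deriv: "(psi m has_real_derivative (psi (m + 2) t - real m * psi (m + 1) t)) (at t)"
proof -
 consider "t < 0" | "t = 0" | "t > 0" by linarith
 then show ?thesis
 proof cases
  case 1
  have "((\<lambda>t::real. 0) has_real_derivative (psi (m + 2) t - real m * psi (m + 1) t)) (at t)"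
   using 1 by (simp add: psi_def)
  then show ?thesis
   by (rule has_field_derivative_transform_within[where d = "-t"]) (use 1 in \<open>auto simp: dist_real_def psi_def\<close>)
 next
  case 3
  have "((\<lambda>t::real. (inverse t) ^ m * exp (- inverse t)) has_real_derivative (psi (m + 2) t - real m * psi (m + 1) t)) (at t)"
  proof (cases m)
   case 0
   show ?thesis using 3 0 by (auto intro!: derivative_eq_intros simp: psi_def power2_eq_square)
  next
   case (Suc k)
   have "((\<lambda>t::real. (inverse t) ^ Suc k) has_real_derivative (1 + real k) * (- (inverse t * 1 * inverse t) * inverse t ^ k)) (at t)"
    using 3 by (intro DERIV_power_Suc derivative_eq_intros) auto
   moreover have "((\<lambda>t::real. exp (- inverse t)) has_real_derivative exp (- inverse t) * (inverse t * inverse t)) (at t)"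
    using 3 by (auto intro!: derivative_eq_intros)
   ultimately have "((\<lambda>t::real. (inverse t) ^ Suc k * exp (- inverse t)) has_real_derivative
     ((1 + real k) * (- (inverse t * 1 * inverse t) * inverse t ^ k) * exp (- inverse t)
     + exp (- inverse t) * (inverse t * inverse t) * (inverse t) ^ Suc k)) (at t)" by (rule DERIV_mult)
   then show ?thesis using 3 unfolding Suc by (simp add: psi_def algebra_simps)
  qed
  then show ?thesis
   by (rule has_field_derivative_transform_within[where d = t]) (use 3 in \<open>auto simp: dist_real_def psi_def\<close>)
 next
  case 2
  \<comment> \<open>At 0 the substitution x = 1 / h turns the difference quotient into a power times
    exp(-x) at infinity.\<close>
  have "((\<lambda>x::real. x ^ (m + 1) / exp x) \<longlongrightarrow> 0) at_top" by (rule tendsto_power_div_exp_0)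
  then have "((\<lambda>h. (inverse h) ^ (m + 1) / exp (inverse h)) \<longlongrightarrow> 0) (at_right (0::real))"
   by (rule filterlim_compose) (rule filterlim_inverse_at_top_right)
  then have R: "((\<lambda>h. psi m h / h) \<longlongrightarrow> 0) (at_right 0)" by (rule Lim_transform_eventually)
    (auto simp: eventually_at_right_field psi_def exp_minus field_simps intro!: exI[of _ 1])
  have "((\<lambda>h. psi m h / h) \<longlongrightarrow> 0) (at_left 0)" by (rule Lim_transform_eventually[where f = "\<lambda>_. 0"])
    (auto simp: eventually_at_left_field psi_def intro!: exI[of _ "-1"])
  with R have "((\<lambda>h. psi m h / h) \<longlongrightarrow> 0) (at 0)" by (simp add: filterlim_split_at_real)
  then show ?thesis using 2 by (simp add: DERIV_def psi_def)
 qed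
qed

text \<open>A class of functions closed under partial derivatives: \<open>smooth\<close> asks for
  iterated partials of all orders, and closure provides them at once.\<close>

inductive_set bump_alg :: "real^'n::finite => real => (real^'n => real) set" for x a where
 base: "(\<lambda>y. psi m (1 - a\<^sup>2 * (norm (y - x))^2)) \<in> bump_alg x a"
| coord: "f \<in> bump_alg x a ==> (\<lambda>y. y $ k * f y) \<in> bump_alg x a"
| cmul: "f \<in> bump_alg x a ==> (\<lambda>y. r * f y) \<in> bump_alg x a"
| add: "f \<in> bump_alg x a ==> g \<in> bump_alg x a ==> (\<lambda>y. f y + g y) \<in> bump_alg x a"

lemma psi_radial_deriv:
 fixes x :: "'a::euclidean_space"
 shows "((\<lambda>y. psi m (1 - a\<^sup>2 * (norm (y - x))^2)) has_derivative
  (\<lambda>h. ((psi (m + 2) (1 - a\<^sup>2 * (norm (y - x))^2) - real m * psi (m + 1) (1 - a\<^sup>2 * (norm (y - x))^2)) * (- 2 * a^2)) *\<^sub>R (y - x) \<bullet> h)) (at y)"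
proof -
 have 1: "((\<lambda>y. 1 - a\<^sup>2 * (norm (y - x))^2) has_derivative (\<lambda>h. - (a^2 * (2 * ((y - x) \<bullet> h))))) (at y)"
  unfolding power2_norm_eq_inner by (auto intro!: derivative_eq_intros simp: inner_commute)
 have 2: "(psi m has_derivative (\<lambda>h. (psi (m + 2) t - real m * psi (m + 1) t) * h)) (at t)" for t
  using psi_deriv[of m t] by (simp add: has_field_derivative_def)
 from has_derivative_compose[OF 1 2] show ?thesis by (rule has_derivative_eq_rhs) (auto simp: fun_eq_iff)
qed

lemma bump_alg_deriv:
 assumes "f \<in> bump_alg x a"
 shows "\<exists>f'. (\<forall>y. (f has_derivative f' y) (at y)) \<and> (\<forall>k. (\<lambda>y. f' y (axis k 1)) \<in> bump_alg x a)" using assms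
proof induction
 case (base m)
 define q where "q y = 1 - a\<^sup>2 * (norm (y - x))^2" for y
 have q: "(\<lambda>y. psi k (q y)) \<in> bump_alg x a" for k unfolding q_def by (rule bump_alg.base)
 show ?case
 proof (intro exI conjI allI)
  show "((\<lambda>y. psi m (1 - a\<^sup>2 * (norm (y - x))^2)) has_derivative
   (\<lambda>h. ((psi (m + 2) (q y) - real m * psi (m + 1) (q y)) * (- 2 * a^2)) *\<^sub>R (y - x) \<bullet> h)) (at y)" for y
   unfolding q_def by (rule psi_radial_deriv)
  fix k
  define c where "c y = (- 2 * a^2) * (psi (m + 2) (q y) + (- real m) * psi (m + 1) (q y))" for y
  have cA: "c \<in> bump_alg x a" unfolding c_def by (intro bump_alg.cmul bump_alg.add q)
  have "(\<lambda>y. y $ k * c y + (- x $ k) * c y) \<in> bump_alg x a" by (intro bump_alg.add bump_alg.coord bump_alg.cmul cA)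
  moreover have "(\<lambda>y. ((psi (m + 2) (q y) - real m * psi (m + 1) (q y)) * (- 2 * a^2)) *\<^sub>R (y - x) \<bullet> axis k 1)
   = (\<lambda>y. y $ k * c y + (- x $ k) * c y)" by (auto simp: fun_eq_iff c_def inner_axis algebra_simps)
  ultimately show "(\<lambda>y. ((psi (m + 2) (q y) - real m * psi (m + 1) (q y)) * (- 2 * a^2)) *\<^sub>R (y - x) \<bullet> axis k 1) \<in> bump_alg x a"
   by simp
 qed
next
 case (coord f k)
 then obtain f' where f': "!!y. (f has_derivative f' y) (at y)" "!!k. (\<lambda>y. f' y (axis k 1)) \<in> bump_alg x a" by blast
 show ?case
 proof (intro exI conjI allI)
  show "((\<lambda>y. y $ k * f y) has_derivative (\<lambda>h. y $ k * f' y h + h $ k * f y)) (at y)" for y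
   by (rule has_derivative_mult[OF bounded_linear.has_derivative[OF bounded_linear_vec_nth has_derivative_ident] f'(1)])
  show "(\<lambda>y. y $ k * f' y (axis j 1) + axis j 1 $ k * f y) \<in> bump_alg x a" for j
   by (intro bump_alg.add bump_alg.coord bump_alg.cmul f'(2) coord.hyps)
 qed
next
 case (cmul f r)
 then obtain f' where f': "!!y. (f has_derivative f' y) (at y)" "!!k. (\<lambda>y. f' y (axis k 1)) \<in> bump_alg x a" by blast
 show ?case by (rule exI[of _ "\<lambda>y h. r * f' y h"]) (auto intro!: has_derivative_mult_right f' bump_alg.cmul)
next
 case (add f g)
 then obtain f' g' where "!!y. (f has_derivative f' y) (at y)" "!!k. (\<lambda>y. f' y (axis k 1)) \<in> bump_alg x a"
  "!!y. (g has_derivative g' y) (at y)" "!!k. (\<lambda>y. g' y (axis k 1)) \<in> bump_alg x a" by blast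
 then show ?case by (intro exI[of _ "\<lambda>y h. f' y h + g' y h"]) (auto intro!: has_derivative_add bump_alg.add)
qed

lemma pdiff_eq: "(f has_derivative f') (at y) ==> pdiff k f y = f' (axis k 1)"
 unfolding pdiff_def by (metis frechet_derivative_at)

lemma bump_alg_Ck: "f \<in> bump_alg x a ==> Ck n f"
proof (induction n arbitrary: f)
 case 0
 then show ?case using bump_alg_deriv[OF 0] has_derivative_imp_continuous_UNIV by fastforce
next
 case (Suc n)
 obtain f' where f': "!!y. (f has_derivative f' y) (at y)" "!!k. (\<lambda>y. f' y (axis k 1)) \<in> bump_alg x a"
  using bump_alg_deriv[OF Suc.prems] by blast
 have "pdiff k f = (\<lambda>y. f' y (axis k 1))" for k using pdiff_eq[OF f'(1)] by auto
 then show ?case using f' Suc.IH has_derivative_imp_continuous_UNIV[OF f'(1)] by (auto simp: differentiable_def)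
qed

lemma bump_alg_smooth: "f \<in> bump_alg x a ==> smooth f"
 by (simp add: smooth_def bump_alg_Ck)

section \<open>The normalized kernel of radius 1 / a\<close>

definition raw_kernel :: "real => 'a::euclidean_space => real" where
 "raw_kernel a z = psi 0 (1 - a\<^sup>2 * (norm z)^2)"

definition kernel :: "real => 'a::euclidean_space => real" where
 "kernel a z = raw_kernel a z / (\<integral>z. raw_kernel a z \<partial>(lborel :: 'a measure))"

definition kernel_grad :: "real => 'a::euclidean_space => 'a" where
 "kernel_grad a z = ((psi 2 (1 - a\<^sup>2 * (norm z)^2) * (- 2 * a^2)) / (\<integral>z. raw_kernel a z \<partial>(lborel :: 'a measure))) *\<^sub>R z"

lemma continuous_psi: "continuous_on UNIV (psi m)"
 by (rule DERIV_continuous_on) (rule has_field_derivative_at_within, rule psi_deriv)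

lemma continuous_raw_kernel: "continuous_on UNIV (raw_kernel a)"
 unfolding raw_kernel_def by (rule continuous_on_compose2[OF continuous_psi]) (auto intro!: continuous_intros)

lemma raw_kernel_zero:
 assumes "a > 0" "norm z >= 1 / a"
 shows "psi m (1 - a\<^sup>2 * (norm z)^2) = 0"
proof -
 have "1 <= a * norm z" using assms by (simp add: divide_le_eq mult.commute)
 then have "1 <= (a * norm z)^2" using one_le_power by blast
 then show ?thesis by (simp add: psi_def power_mult_distrib)
qed

context
 fixes a :: real
 assumes a: "a > 0"
begin

lemma integrable_compact_support:
 fixes f :: "'a::euclidean_space => 'b::{banach, second_countable_topology}"
 assumes "continuous_on UNIV f" "!!z. norm z >= r ==> f z = 0"
 shows "integrable lborel f"
proof -
 have "set_integrable lborel (cball 0 r) f" by (rule set_integrable_cball[OF assms(1)])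
 moreover have "(\<lambda>x. indicat_real (cball 0 r) x *\<^sub>R f x) = f" using assms(2) by (auto simp: indicator_def fun_eq_iff)
 ultimately show ?thesis by (simp add: set_integrable_def)
qed

lemma raw_kernel_support: "norm z >= 1 / a ==> raw_kernel a z = 0"
 unfolding raw_kernel_def by (rule raw_kernel_zero[OF a])

lemma integrable_raw_kernel: "integrable lborel (raw_kernel a)"
 by (rule integrable_compact_support[OF continuous_raw_kernel raw_kernel_support])

lemma raw_kernel_integral_pos: "0 < (\<integral>z. raw_kernel a z \<partial>(lborel :: 'a::euclidean_space measure))"
proof -
 have nn: "0 <= raw_kernel a z" for z :: 'a by (simp add: raw_kernel_def psi_nonneg)
 have "0 <= (\<integral>z. raw_kernel a z \<partial>(lborel :: 'a measure))" by (intro integral_nonneg_AE AE_I2 nn)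
 moreover have "(\<integral>z. raw_kernel a z \<partial>(lborel :: 'a measure)) \<noteq> 0"
 proof
  assume "(\<integral>z. raw_kernel a z \<partial>(lborel :: 'a measure)) = 0"
  then have "AE z in (lborel :: 'a measure). raw_kernel a z = 0"
   using integral_nonneg_eq_0_iff_AE[OF integrable_raw_kernel] nn by auto
  moreover have meas: "{z :: 'a. raw_kernel a z \<noteq> 0} \<in> sets lborel"
   using open_Collect_neq[OF continuous_raw_kernel[of a] continuous_on_const[of UNIV "0 :: real"]] borel_open by auto
  ultimately have "emeasure lborel {z :: 'a. raw_kernel a z \<noteq> 0} = 0"
   using meas by (subst (asm) AE_iff_measurable[OF _ refl]) auto
  moreover have "ball 0 (1 / a) \<subseteq> {z :: 'a. raw_kernel a z \<noteq> 0}"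
  proof
   fix z :: 'a assume "z \<in> ball 0 (1 / a)"
   then have "a * norm z < 1" using a by (simp add: less_divide_eq mult.commute)
   then have "(a * norm z)^2 < 1" using a by (simp add: power_less_one_iff abs_square_less_1)
   then show "z \<in> {z. raw_kernel a z \<noteq> 0}" by (simp add: raw_kernel_def psi_def power_mult_distrib)
  qed
  ultimately have "emeasure lborel (ball (0::'a) (1 / a)) = 0"
   using meas emeasure_mono[of "ball (0::'a) (1 / a)" "{z :: 'a. raw_kernel a z \<noteq> 0}" lborel] by simp
  then show False using a emeasure_ball[of "1 / a" "0::'a"] unit_ball_vol_pos[of "DIM('a)"] by simp
 qed
 ultimately show ?thesis by linarith
qed

lemma kernel_nonneg: "0 <= kernel a z"
 unfolding kernel_def using raw_kernel_integral_pos by (simp add: raw_kernel_def psi_nonneg)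

lemma kernel_support: "norm z >= 1 / a ==> kernel a z = 0"
 by (simp add: kernel_def raw_kernel_support)

lemma kernel_grad_support: "norm z >= 1 / a ==> kernel_grad a z = 0"
 by (simp add: kernel_grad_def raw_kernel_zero[OF a])

lemma continuous_kernel: "continuous_on UNIV (kernel a)"
 unfolding kernel_def divide_inverse by (intro continuous_intros continuous_raw_kernel)

lemma continuous_kernel_grad: "continuous_on UNIV (kernel_grad a :: 'a::euclidean_space => 'a)"
 unfolding kernel_grad_def divide_inverse by (intro continuous_intros continuous_on_compose2[OF continuous_psi]) auto

lemma kernel_integral: "(\<integral>z. kernel a z \<partial>(lborel :: 'a::euclidean_space measure)) = 1"
 unfolding kernel_def using raw_kernel_integral_pos[where 'a = 'a] by simp

lemma kernel_deriv: "(kernel a has_derivative (\<lambda>h. kernel_grad a z \<bullet> h)) (at (z :: 'a::euclidean_space))"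
proof -
 define I where "I = (\<integral>z. raw_kernel a z \<partial>(lborel :: 'a measure))"
 have "((\<lambda>y. psi 0 (1 - a\<^sup>2 * (norm (y - 0))^2)) has_derivative
  (\<lambda>h. ((psi (0 + 2) (1 - a\<^sup>2 * (norm (z - 0))^2) - real 0 * psi (0 + 1) (1 - a\<^sup>2 * (norm (z - 0))^2)) * (- 2 * a^2)) *\<^sub>R (z - 0) \<bullet> h)) (at z)"
  by (rule psi_radial_deriv)
 then have "((\<lambda>y. psi 0 (1 - a\<^sup>2 * (norm (y - 0))^2) * (1 / I)) has_derivative
  (\<lambda>h. (((psi (0 + 2) (1 - a\<^sup>2 * (norm (z - 0))^2) - real 0 * psi (0 + 1) (1 - a\<^sup>2 * (norm (z - 0))^2)) * (- 2 * a^2)) *\<^sub>R (z - 0) \<bullet> h) * (1 / I))) (at z)"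
  by (rule has_derivative_mult_left)
 moreover have "(\<lambda>y :: 'a. psi 0 (1 - a\<^sup>2 * (norm (y - 0))^2) * (1 / I)) = kernel a"
  by (simp add: fun_eq_iff kernel_def raw_kernel_def[abs_def] I_def)
 moreover have "(\<lambda>h. (((psi (0 + 2) (1 - a\<^sup>2 * (norm (z - 0))^2) - real 0 * psi (0 + 1) (1 - a\<^sup>2 * (norm (z - 0))^2)) * (- 2 * a^2)) *\<^sub>R (z - 0) \<bullet> h) * (1 / I))
   = (\<lambda>h. kernel_grad a z \<bullet> h)" by (auto simp: fun_eq_iff kernel_grad_def I_def numeral_2_eq_2)
 ultimately show ?thesis by simp
qed

end

section \<open>Mollified functions and their averages over balls\<close>

definition moll :: "real => ('a::euclidean_space => 'b::euclidean_space) => 'a => 'b" where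
 "moll a w x = (\<integral>y. kernel a (x - y) *\<^sub>R w y \<partial>lborel)"

definition moll_grad :: "real => ('a::euclidean_space => real) => 'a => 'a" where
 "moll_grad a w x = (\<integral>y. w y *\<^sub>R kernel_grad a (x - y) \<partial>lborel)"

lemma kernel_minus: "kernel a (- z) = kernel a z"
 by (simp add: kernel_def raw_kernel_def)

lemma norm_integral_le_dominated:
 fixes f :: "'a => 'b::{banach, second_countable_topology}"
 assumes "integrable M f" "integrable M g" "!!y. norm (f y) <= g y"
 shows "norm (integral\<^sup>L M f) <= integral\<^sup>L M g"
 by (rule order_trans[OF integral_norm_bound]) (intro integral_mono assms integrable_norm)

lemma compact_support_bounded:
 fixes k :: "'a::euclidean_space => 'b::real_normed_vector"
 assumes "continuous_on UNIV k" "!!z. norm z >= r ==> k z = 0"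
 shows "\<exists>M>0. \<forall>z. norm (k z) <= M"
proof -
 have "compact (k ` cball 0 r)" by (intro compact_continuous_image continuous_on_subset[OF assms(1)]) auto
 then obtain M where M: "M > 0" "!!z. z \<in> cball 0 r ==> norm (k z) <= M"
  using compact_imp_bounded bounded_pos by (metis imageI)
 have "norm (k z) <= M" for z using M assms(2)[of z] by (cases "norm z <= r") auto
 with M(1) show ?thesis by blast
qed

lemma compact_support_uniform:
 fixes k :: "'a::euclidean_space => 'b::real_normed_vector"
 assumes k: "continuous_on UNIV k" "!!z. norm z >= r ==> k z = 0" and e: "e > 0"
 shows "\<exists>d>0. \<forall>z z'. norm (z' - z) < d --> norm (k z' - k z) < e"
proof -
 have "uniformly_continuous_on (cball 0 (r + 2)) k"
  by (intro compact_uniformly_continuous continuous_on_subset[OF k(1)]) auto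
 then obtain d where d: "d > 0"
  "!!z z'. z \<in> cball 0 (r + 2) ==> z' \<in> cball 0 (r + 2) ==> dist z' z < d ==> dist (k z') (k z) < e"
  unfolding uniformly_continuous_on_def using e by metis
 have "norm (k z' - k z) < e" if h: "norm (z' - z) < min d 1" for z z'
 proof (cases "norm z <= r + 1")
  case True
  then have "norm z' <= r + 2" using h norm_triangle_sub[of z' z] by auto
  then show ?thesis using d(2)[of z z'] True h by (simp add: dist_norm)
 next
  case False
  then have "norm z' >= r" using h norm_triangle_sub[of z z'] by (simp add: norm_minus_commute)
  then show ?thesis using False k(2)[of z] k(2)[of z'] e by simp
 qed
 with d(1) show ?thesis by (intro exI[of _ "min d 1"]) auto
qed

lemma integrable_scaled_bounded:
 fixes w :: "'a::euclidean_space => 'b::euclidean_space"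
 assumes w: "integrable lborel w" and k: "k \<in> borel_measurable borel" "!!z. \<bar>k z :: real\<bar> <= M"
 shows "integrable lborel (\<lambda>y. k y *\<^sub>R w y)"
proof (rule Bochner_Integration.integrable_bound[OF integrable_mult_right[OF integrable_norm[OF w], of M]])
 show "(\<lambda>y. k y *\<^sub>R w y) \<in> borel_measurable lborel" using w k(1) by (intro borel_measurable_scaleR) auto
 show "AE y in lborel. norm (k y *\<^sub>R w y) <= norm (M * norm (w y))"
 proof (intro AE_I2)
  fix y
  have "0 <= M" using k(2)[of y] by linarith
  then show "norm (k y *\<^sub>R w y) <= norm (M * norm (w y))" using mult_right_mono[OF k(2) norm_ge_zero, of y "w y"] by simp
 qed
qed

lemma integrable_scaled_compact:
 fixes w :: "'a::euclidean_space => real" and k :: "'a => 'b::euclidean_space"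
 assumes w: "integrable lborel w" and k: "continuous_on UNIV k" "!!z. norm z >= r ==> k z = 0"
 shows "integrable lborel (\<lambda>y. w y *\<^sub>R k (x - y))"
proof -
 obtain M where M: "M > 0" "!!z. norm (k z) <= M" using compact_support_bounded[OF k] by blast
 have "continuous_on UNIV (\<lambda>y. k (x - y))" by (rule continuous_on_compose2[OF k(1)]) (auto intro!: continuous_intros)
 then have m: "(\<lambda>y. k (x - y)) \<in> borel_measurable borel" by (rule borel_measurable_continuous_onI)
 show ?thesis
 proof (rule Bochner_Integration.integrable_bound[OF integrable_mult_right[OF w, of M]])
  show "(\<lambda>y. w y *\<^sub>R k (x - y)) \<in> borel_measurable lborel" using w m by (intro borel_measurable_scaleR) auto
  show "AE y in lborel. norm (w y *\<^sub>R k (x - y)) <= norm (M * w y)"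
   using M mult_left_mono[OF M(2) abs_ge_zero] by (intro AE_I2) (simp add: abs_mult mult.commute)
 qed
qed

context
 fixes a :: real
 assumes a: "a > 0"
begin

lemma kernel_bounded: "\<exists>M>0. \<forall>z :: 'a::euclidean_space. \<bar>kernel a z\<bar> <= M"
 using compact_support_bounded[OF continuous_kernel[OF a] kernel_support[OF a]] by simp

lemma measurable_kernel_diff: "(\<lambda>y. kernel a (x - y)) \<in> borel_measurable borel"
 by (intro borel_measurable_continuous_onI continuous_on_compose2[OF continuous_kernel[OF a]])
   (auto intro!: continuous_intros)

lemma integrable_moll:
 fixes w :: "'a::euclidean_space => 'b::euclidean_space"
 assumes "integrable lborel w"
 shows "integrable lborel (\<lambda>y. kernel a (x - y) *\<^sub>R w y)"
proof -
 obtain M where "!!z :: 'a. \<bar>kernel a z\<bar> <= M" using kernel_bounded by blast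
 then show ?thesis by (intro integrable_scaled_bounded[OF assms measurable_kernel_diff]) auto
qed

lemma kernel_integral_diff: "(\<integral>y. kernel a (x - y) \<partial>lborel) = 1" "integrable lborel (\<lambda>y. kernel a (x - y))"
 for x :: "'a::euclidean_space"
proof -
 have "(\<integral>y. kernel a (x - y) \<partial>lborel) = (\<integral>y. kernel a (y + (- x)) \<partial>lborel)" using kernel_minus[of a "x - _"] by simp
 also have "... = 1" by (subst integral_shift_lborel[OF borel_measurable_continuous_onI[OF continuous_kernel[OF a]]])
   (rule kernel_integral[OF a])
 finally show 1: "(\<integral>y. kernel a (x - y) \<partial>lborel) = 1" .
 then show "integrable lborel (\<lambda>y. kernel a (x - y))" using not_integrable_integral_eq by fastforce
qed

lemma continuous_moll_grad:
 fixes w :: "'a::euclidean_space => real"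
 assumes w: "integrable lborel w"
 shows "continuous_on UNIV (moll_grad a w)" unfolding continuous_on_iff
proof (intro ballI allI impI)
 fix x :: 'a and e :: real assume e: "e > 0"
 define I where "I = (\<integral>y. \<bar>w y\<bar> \<partial>lborel)"
 have I: "0 <= I" unfolding I_def by simp
 define e' where "e' = e / (2 * (I + 1))"
 have e': "e' > 0" using e I by (simp add: e'_def)
 obtain d where d: "d > 0" "!!z z' :: 'a. norm (z' - z) < d ==> norm (kernel_grad a z' - kernel_grad a z) < e'"
  using compact_support_uniform[OF continuous_kernel_grad kernel_grad_support[OF a] e', OF a] by blast
 have int: "integrable lborel (\<lambda>y. w y *\<^sub>R kernel_grad a (x - y))" for x
  by (rule integrable_scaled_compact[OF w continuous_kernel_grad[OF a]]) (rule kernel_grad_support[OF a])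
 show "\<exists>d>0. \<forall>x'\<in>UNIV. dist x' x < d --> dist (moll_grad a w x') (moll_grad a w x) < e"
 proof (rule exI[of _ d], intro conjI ballI impI d(1))
  fix x' assume x': "dist x' x < d"
  have "norm (moll_grad a w x' - moll_grad a w x) = norm (\<integral>y. w y *\<^sub>R (kernel_grad a (x' - y) - kernel_grad a (x - y)) \<partial>lborel)"
   using Bochner_Integration.integral_diff[OF int int, of x' x] by (simp add: moll_grad_def scaleR_diff_right)
  also have "... <= (\<integral>y. \<bar>w y\<bar> * e' \<partial>lborel)"
  proof (rule norm_integral_le_dominated)
   show "integrable lborel (\<lambda>y. w y *\<^sub>R (kernel_grad a (x' - y) - kernel_grad a (x - y)))"
    unfolding scaleR_diff_right by (intro Bochner_Integration.integrable_diff int)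
   show "integrable lborel (\<lambda>y. \<bar>w y\<bar> * e')" using w by (intro integrable_mult_left) auto
   show "norm (w y *\<^sub>R (kernel_grad a (x' - y) - kernel_grad a (x - y))) <= \<bar>w y\<bar> * e'" for y
    using d(2)[of "x' - y" "x - y"] x' by (auto simp: dist_norm intro!: mult_left_mono)
  qed
  also have "... = I * e'" by (simp add: I_def)
  also have "... < e"
  proof -
   have "I * e' <= (I + 1) * e'" using e' by (intro mult_right_mono) auto
   also have "... = e / 2" using I by (simp add: e'_def field_simps)
   finally show ?thesis using e by linarith
  qed
  finally show "dist (moll_grad a w x') (moll_grad a w x) < e" by (simp add: dist_norm)
 qed
qed

text \<open>Uniform continuity of the gradient of the kernel makes its first-order remainder at most
  e' |x' - x|, uniformly in the integration variable; integrating this against |w| gives the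
  derivative.\<close>

lemma moll_deriv:
 fixes w :: "'a::euclidean_space => real"
 assumes w: "integrable lborel w"
 shows "(moll a w has_derivative (\<lambda>h. moll_grad a w x \<bullet> h)) (at x)" unfolding has_derivative_at_alt
proof (intro conjI allI impI)
 show "bounded_linear (\<lambda>h. moll_grad a w x \<bullet> h)" by (rule bounded_linear_inner_right)
 fix e :: real assume e: "e > 0"
 define I where "I = (\<integral>y. \<bar>w y\<bar> \<partial>lborel)"
 have I: "0 <= I" unfolding I_def by simp
 define e' where "e' = e / (I + 1)"
 have e': "e' > 0" using e I by (simp add: e'_def)
 obtain d where d: "d > 0" "!!z z' :: 'a. norm (z' - z) < d ==> norm (kernel_grad a z' - kernel_grad a z) < e'"
  using compact_support_uniform[OF continuous_kernel_grad kernel_grad_support[OF a] e', OF a] by blast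
 have int: "integrable lborel (\<lambda>y. w y *\<^sub>R kernel_grad a (x - y))" for x
  by (rule integrable_scaled_compact[OF w continuous_kernel_grad[OF a]]) (rule kernel_grad_support[OF a])
 note intk = integrable_moll[OF w]
 have lin: "norm (kernel a z' - kernel a z - kernel_grad a z \<bullet> (z' - z)) <= norm (z' - z) * e'"
  if h: "norm (z' - z) < d" for z z' :: 'a
 proof (rule differentiable_bound_linearization[where S = "ball z d" and f' = "\<lambda>x h. kernel_grad a x \<bullet> h"])
  fix t :: real assume t: "t \<in> {0..1}"
  have "t * norm (z' - z) <= norm (z' - z)" using t by (intro mult_left_le_one_le) auto
  then show "z + t *\<^sub>R (z' - z) \<in> ball z d" using t h by (simp add: dist_norm)
 next
  fix x assume x: "x \<in> ball z d"
  show "(kernel a has_derivative (\<bullet>) (kernel_grad a x)) (at x within ball z d)"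
   by (rule has_derivative_at_withinI[OF kernel_deriv[OF a]])
  have "onorm (\<lambda>h. (kernel_grad a x - kernel_grad a z) \<bullet> h) <= e'"
  proof (rule onorm_le)
   fix h
   have "\<bar>(kernel_grad a x - kernel_grad a z) \<bullet> h\<bar> <= norm (kernel_grad a x - kernel_grad a z) * norm h"
    by (rule Cauchy_Schwarz_ineq2)
   also have "... <= e' * norm h" using d(2)[of x z] x by (intro mult_right_mono) (auto simp: dist_norm norm_minus_commute)
   finally show "norm ((kernel_grad a x - kernel_grad a z) \<bullet> h) <= e' * norm h" by simp
  qed
  then show "onorm ((\<bullet>) (kernel_grad a x) - (\<bullet>) (kernel_grad a z)) <= e'" by (simp add: inner_diff_left fun_diff_def)
 qed (use d in auto)
 show "\<exists>d>0. \<forall>x'. norm (x' - x) < d --> norm (moll a w x' - moll a w x - moll_grad a w x \<bullet> (x' - x)) <= e * norm (x' - x)"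
 proof (rule exI[of _ d], intro conjI allI impI d(1))
  fix x' assume x': "norm (x' - x) < d"
  have g: "moll_grad a w x \<bullet> (x' - x) = (\<integral>y. (w y *\<^sub>R kernel_grad a (x - y)) \<bullet> (x' - x) \<partial>lborel)"
   unfolding moll_grad_def by (rule integral_inner_left[OF int, symmetric])
  have gi: "integrable lborel (\<lambda>y. (w y *\<^sub>R kernel_grad a (x - y)) \<bullet> (x' - x))" using int by (rule integrable_inner_left)
  have "moll a w x' - moll a w x - moll_grad a w x \<bullet> (x' - x)
   = (\<integral>y. kernel a (x' - y) *\<^sub>R w y - kernel a (x - y) *\<^sub>R w y - (w y *\<^sub>R kernel_grad a (x - y)) \<bullet> (x' - x) \<partial>lborel)"
   unfolding g moll_def using intk gi by simp
  also have "norm ... <= (\<integral>y. \<bar>w y\<bar> * (norm (x' - x) * e') \<partial>lborel)"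
  proof (rule norm_integral_le_dominated)
   show "integrable lborel (\<lambda>y. kernel a (x' - y) *\<^sub>R w y - kernel a (x - y) *\<^sub>R w y - (w y *\<^sub>R kernel_grad a (x - y)) \<bullet> (x' - x))"
    by (intro Bochner_Integration.integrable_diff intk gi)
   show "integrable lborel (\<lambda>y. \<bar>w y\<bar> * (norm (x' - x) * e'))" using w by (intro integrable_mult_left) auto
   fix y
   have "kernel a (x' - y) *\<^sub>R w y - kernel a (x - y) *\<^sub>R w y - (w y *\<^sub>R kernel_grad a (x - y)) \<bullet> (x' - x)
    = w y * (kernel a (x' - y) - kernel a (x - y) - kernel_grad a (x - y) \<bullet> ((x' - y) - (x - y)))"
    by (simp add: algebra_simps)
   then show "norm (kernel a (x' - y) *\<^sub>R w y - kernel a (x - y) *\<^sub>R w y - (w y *\<^sub>R kernel_grad a (x - y)) \<bullet> (x' - x))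
    <= \<bar>w y\<bar> * (norm (x' - x) * e')" using lin[of "x' - y" "x - y"] x' by (simp add: abs_mult mult_left_mono)
  qed
  also have "... = I * e' * norm (x' - x)" by (simp add: I_def)
  also have "... <= e * norm (x' - x)"
  proof (rule mult_right_mono)
   show "I * e' <= e" using I e by (simp add: e'_def field_simps)
  qed simp
  finally show "norm (moll a w x' - moll a w x - moll_grad a w x \<bullet> (x' - x)) <= e * norm (x' - x)" .
 qed
qed

lemma continuous_moll: "integrable lborel w ==> continuous_on UNIV (moll a w)"
 for w :: "'a::euclidean_space => real" by (rule has_derivative_imp_continuous_UNIV[OF moll_deriv])

text \<open>Jensen's inequality, from the nonnegativity of a variance with respect to the
  probability density \<open>kernel a (x - y)\<close> in y.\<close>

lemma moll_square_le:
 fixes q :: "'a::euclidean_space => real"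
 assumes q: "integrable lborel q" "integrable lborel (\<lambda>y. (q y)^2)"
 shows "(moll a q x)^2 <= moll a (\<lambda>y. (q y)^2) x"
proof -
 define t where "t = moll a q x"
 note i = integrable_moll[OF q(1), of x] integrable_moll[OF q(2), of x] kernel_integral_diff[of x]
 have "0 <= (\<integral>y. kernel a (x - y) * (q y - t)^2 \<partial>lborel)"
  by (intro integral_nonneg_AE AE_I2 mult_nonneg_nonneg kernel_nonneg[OF a]) auto
 also have "(\<lambda>y. kernel a (x - y) * (q y - t)^2) = (\<lambda>y. kernel a (x - y) *\<^sub>R (q y)\<^sup>2 - 2 * t * (kernel a (x - y) *\<^sub>R q y) + t^2 * kernel a (x - y))"
  by (auto simp: fun_eq_iff power2_eq_square algebra_simps)
 also have "(\<integral>y. kernel a (x - y) *\<^sub>R (q y)\<^sup>2 - 2 * t * (kernel a (x - y) *\<^sub>R q y) + t^2 * kernel a (x - y) \<partial>lborel)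
  = moll a (\<lambda>y. (q y)^2) x - 2 * t * moll a q x + t^2 * (\<integral>y. kernel a (x - y) \<partial>lborel)" unfolding moll_def
  by (intro has_bochner_integral_integral_eq has_bochner_integral_add has_bochner_integral_diff
    has_bochner_integral_mult_right has_bochner_integral_integrable i)
 also have "... = moll a (\<lambda>y. (q y)^2) x - t\<^sup>2" using i(3) by (simp add: t_def power2_eq_square)
 finally show ?thesis by (simp add: t_def power2_eq_square)
qed

lemma moll_indicator_bounds:
 fixes y c :: "'a::euclidean_space" and s :: real
 defines "b \<equiv> moll a (indicat_real (cball c s)) y"
 shows "0 <= b" "b <= 1" "dist c y >= s + 1 / a ==> b = 0" "dist c y <= s - 1 / a ==> b = 1"
proof -
 have i: "integrable lborel (\<lambda>x. kernel a (y - x) *\<^sub>R indicat_real (cball c s) x)"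
  using set_integrable_cball[OF continuous_on_const, of c s "1 :: real"]
  by (intro integrable_moll) (simp add: set_integrable_def)
 show "0 <= b" unfolding b_def moll_def by (intro integral_nonneg_AE AE_I2) (auto simp: kernel_nonneg[OF a])
 have "b <= (\<integral>x. kernel a (y - x) \<partial>lborel)" unfolding b_def moll_def
  by (intro integral_mono i kernel_integral_diff) (auto simp: kernel_nonneg[OF a] indicator_def)
 then show "b <= 1" by (simp add: kernel_integral_diff)
 show "b = 0" if d: "dist c y >= s + 1 / a"
 proof -
  have "kernel a (y - x) *\<^sub>R indicat_real (cball c s) x = 0" for x
   using d kernel_support[OF a, of "y - x"] dist_triangle[of c y x]
   by (auto simp: indicator_def dist_norm norm_minus_commute)
  then show ?thesis unfolding b_def moll_def by (simp only: integral_zero)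
 qed
 show "b = 1" if d: "dist c y <= s - 1 / a"
 proof -
  have "kernel a (y - x) *\<^sub>R indicat_real (cball c s) x = kernel a (y - x)" for x
   using d kernel_support[OF a, of "y - x"] dist_triangle[of c x y]
   by (auto simp: indicator_def dist_norm norm_minus_commute)
  then show ?thesis unfolding b_def moll_def by (simp only: kernel_integral_diff)
 qed
qed

text \<open>The kernel is even, so Fubini moves the mollification from \<open>q\<close> to the
  indicator of the ball.\<close>

lemma integral_moll_cball:
 fixes q :: "'a::euclidean_space => real"
 assumes q: "integrable lborel q"
 shows "(LINT x:cball c s|lborel. moll a q x) = (\<integral>y. q y * moll a (indicat_real (cball c s)) y \<partial>lborel)"
  "integrable lborel (\<lambda>y. q y * moll a (indicat_real (cball c s)) y)"
proof -
 have [measurable]: "q \<in> borel_measurable borel" using q by auto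
 have [measurable]: "kernel a \<in> borel_measurable (borel :: 'a measure)"
  by (rule borel_measurable_continuous_onI[OF continuous_kernel[OF a]])
 have [measurable]: "cball c s \<in> sets borel" by simp
 define H where "H x y = indicat_real (cball c s) x * (kernel a (x - y) * q y)" for x y
 have I: "integrable (lborel \<Otimes>\<^sub>M lborel) (\<lambda>(x, y). H x y)"
 proof (rule lborel_pair.Fubini_integrable)
  show "(\<lambda>(x, y). H x y) \<in> borel_measurable (lborel \<Otimes>\<^sub>M lborel)" unfolding H_def
   by (subst measurable_cong_sets[OF sets_pair_measure_cong[OF sets_lborel sets_lborel] refl]) measurable
  have "(\<lambda>x. \<integral>y. norm (case (x, y) of (x, y) => H x y) \<partial>lborel) = (\<lambda>x. indicat_real (cball c s) x *\<^sub>R moll a (\<lambda>y. \<bar>q y\<bar>) x)"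
   by (auto simp: fun_eq_iff H_def moll_def abs_mult kernel_nonneg[OF a])
  then show "integrable lborel (\<lambda>x. \<integral>y. norm (case (x, y) of (x, y) => H x y) \<partial>lborel)"
   using set_integrable_cball[OF continuous_moll[OF integrable_abs[OF q]], of c s] by (simp add: set_integrable_def)
  show "AE x in lborel. integrable lborel (\<lambda>y. case (x, y) of (x, y) => H x y)"
   using integrable_moll[OF q] by (auto simp: H_def)
 qed
 have y: "(\<integral>x. H x y \<partial>lborel) = q y * moll a (indicat_real (cball c s)) y" for y
 proof -
  have "H x y = q y * (kernel a (y - x) *\<^sub>R indicat_real (cball c s) x)" for x
   using kernel_minus[of a "x - y"] by (simp add: H_def)
  then show ?thesis by (simp add: moll_def)
 qed
 have x: "(\<integral>y. H x y \<partial>lborel) = indicat_real (cball c s) x *\<^sub>R moll a q x" for x by (simp add: H_def moll_def)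
 show "(LINT x:cball c s|lborel. moll a q x) = (\<integral>y. q y * moll a (indicat_real (cball c s)) y \<partial>lborel)"
  using lborel_pair.Fubini_integral[OF I] by (simp add: x y set_lebesgue_integral_def)
 show "integrable lborel (\<lambda>y. q y * moll a (indicat_real (cball c s)) y)"
  using lborel_pair.integrable_snd[OF I] by (simp add: y)
qed

lemma integral_moll_cball_le:
 fixes q :: "'a::euclidean_space => real"
 assumes q: "integrable lborel q" "!!y. 0 <= q y" and D: "D \<in> sets borel" "!!y. dist c y < s + 1 / a ==> y \<in> D"
 shows "(LINT x:cball c s|lborel. moll a q x) <= (LINT y:D|lborel. q y)"
 unfolding integral_moll_cball(1)[OF q(1)] unfolding set_lebesgue_integral_def
proof (rule integral_mono[OF integral_moll_cball(2)[OF q(1)]])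
 show "integrable lborel (\<lambda>x. indicat_real D x *\<^sub>R q x)" using integrable_mult_indicator[OF _ q(1), of D] D(1) by simp
 fix y
 show "q y * moll a (indicat_real (cball c s)) y <= indicat_real D y *\<^sub>R q y"
  using moll_indicator_bounds(1-3)[where c = c and s = s and y = y] D(2)[of y] q(2)[of y]
  by (cases "dist c y < s + 1 / a") (auto simp: mult_left_le)
qed

end

text \<open>Once the mollification acts on the indicator, convergence is pointwise off the sphere, a
  null set, and dominated by |q|.\<close>

lemma integral_moll_cball_tendsto:
 fixes q :: "'a::euclidean_space => real"
 assumes q: "integrable lborel q" and s: "s > 0"
 shows "(\<lambda>n. LINT x:cball c s|lborel. moll (real (Suc n)) q x) \<longlonglongrightarrow> (LINT x:cball c s|lborel. q x)"
proof -
 have [measurable]: "q \<in> borel_measurable borel" using q by auto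
 have [measurable]: "cball c s \<in> sets borel" by simp
 have "(\<lambda>n. \<integral>y. q y * moll (real (Suc n)) (indicat_real (cball c s)) y \<partial>lborel) \<longlonglongrightarrow> (\<integral>y. q y * indicat_real (cball c s) y \<partial>lborel)"
 proof (rule integral_dominated_convergence[where w = "\<lambda>y. \<bar>q y\<bar>"])
  show "integrable lborel (\<lambda>y. \<bar>q y\<bar>)" using q by simp
  show "(\<lambda>y. q y * indicat_real (cball c s) y) \<in> borel_measurable lborel" by measurable
  show "(\<lambda>y. q y * moll (real (Suc n)) (indicat_real (cball c s)) y) \<in> borel_measurable lborel" for n
   using integral_moll_cball(2)[OF _ q, of "real (Suc n)" c s] by auto
  show "AE y in lborel. norm (q y * moll (real (Suc n)) (indicat_real (cball c s)) y) <= \<bar>q y\<bar>" for n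
   using moll_indicator_bounds(1,2)[where a = "real (Suc n)" and c = c and s = s]
   by (intro AE_I2) (auto simp: abs_mult abs_of_nonneg intro!: mult_left_le)
  have "sphere c s \<in> null_sets lborel"
   using negligible_sphere[of c s] by (simp add: negligible_iff_null_sets null_sets_def emeasure_completion)
  then have "AE y in lborel. y \<notin> sphere c s" by (rule AE_not_in)
  then show "AE y in lborel. (\<lambda>n. q y * moll (real (Suc n)) (indicat_real (cball c s)) y) \<longlonglongrightarrow> q y * indicat_real (cball c s) y"
  proof eventually_elim
   case (elim y)
   define d where "d = \<bar>dist c y - s\<bar>"
   have d: "d > 0" using elim by (auto simp: d_def)
   have "\<forall>\<^sub>F n in sequentially. 1 / real (Suc n) < d"
    using LIMSEQ_inverse_real_of_nat d by (auto simp: inverse_eq_divide dest: order_tendstoD(2))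
   then have "\<forall>\<^sub>F n in sequentially. moll (real (Suc n)) (indicat_real (cball c s)) y = indicat_real (cball c s) y"
   proof eventually_elim
    case (elim n)
    then show ?case using moll_indicator_bounds(3,4)[where a = "real (Suc n)" and c = c and s = s and y = y]
     by (cases "dist c y <= s") (auto simp: d_def indicator_def)
   qed
   then show ?case by (intro tendsto_mult_left tendsto_eventually)
  qed
 qed
 moreover have "(LINT x:cball c s|lborel. moll (real (Suc n)) q x) = (\<integral>y. q y * moll (real (Suc n)) (indicat_real (cball c s)) y \<partial>lborel)" for n
  by (rule integral_moll_cball(1)[OF _ q]) simp
 ultimately show ?thesis by (simp only: set_lebesgue_integral_def[of lborel "cball c s" q] real_scaleR_def mult.commute[of "indicat_real _ _"])
qed

text \<open>By Vitali's covering theorem almost all of \<open>X\<close> is a countable disjoint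
  union of balls with nonpositive integral.\<close>

lemma integral_le_zero_of_cball_averages:
 fixes k :: "'a::euclidean_space => real"
 assumes k: "integrable lborel k" and X: "open X"
  and avg: "!!c d. c \<in> X ==> d > 0 ==> \<exists>r. 0 < r \<and> r < d \<and> (LINT x:cball c r|lborel. k x) <= 0"
 shows "(LINT x:X|lborel. k x) <= 0"
proof -
 define K where "K = {(c, r). c \<in> X \<and> 0 < r \<and> cball c r \<subseteq> X \<and> (LINT x:cball c r|lborel. k x) <= 0}"
 have "\<exists>i. i \<in> K \<and> x \<in> cball (fst i) (snd i) \<and> snd i < d" if x: "x \<in> X" and d: "0 < d" for x d
 proof -
  obtain e where e: "e > 0" "cball x e \<subseteq> X" using X x open_contains_cball by blast
  obtain r where r: "0 < r" "r < min d e" "(LINT x:cball x r|lborel. k x) <= 0" using avg[OF x, of "min d e"] d e by auto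
  then have "(x, r) \<in> K" using x e by (auto simp: K_def)
  then show ?thesis using r by (intro exI[of _ "(x, r)"]) auto
 qed
 note cov = this
 have "0 < snd i" if "i \<in> K" for i using that by (auto simp: K_def)
 from Vitali_covering_theorem_cballs[of K snd X fst, OF this cov]
 obtain D where D: "countable D" "D \<subseteq> K"
  "pairwise (\<lambda>i j. disjnt (cball (fst i) (snd i)) (cball (fst j) (snd j))) D"
  "negligible (X - (\<Union>i\<in>D. cball (fst i) (snd i)))" by blast
 define b where "b i = cball (fst i) (snd i)" for i :: "'a \<times> real"
 \<comment> \<open>The family may be finite, so indices outside the enumeration receive the empty
   set.\<close>
 define Q where "Q n = (if n \<in> to_nat_on D ` D then b (from_nat_into D n) else {})" for n
 have QD: "\<exists>i\<in>D. n = to_nat_on D i \<and> Q n = b i" if "Q n \<noteq> {}" for n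
 proof -
  have "n \<in> to_nat_on D ` D" using that unfolding Q_def by presburger
  then obtain i where i: "i \<in> D" "n = to_nat_on D i" by blast
  then have "Q n = b i" using D(1) by (simp add: Q_def)
  with i show ?thesis by blast
 qed
 have Qset: "Q n \<in> sets lborel" for n by (auto simp: Q_def b_def)
 have disj: "Q m \<inter> Q n = {}" if "m \<noteq> n" for m n
 proof (cases "Q m = {} \<or> Q n = {}")
  case False
  then obtain i j where ij: "i \<in> D" "m = to_nat_on D i" "Q m = b i" "j \<in> D" "n = to_nat_on D j" "Q n = b j"
   using QD by meson
  then have "i \<noteq> j" using that by auto
  then show ?thesis using D(3) ij by (auto simp: pairwise_def disjnt_def b_def)
 qed auto
 have UQ: "(\<Union>n. Q n) = (\<Union>i\<in>D. b i)"
 proof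
  show "(\<Union>n. Q n) \<subseteq> (\<Union>i\<in>D. b i)" using QD by blast
  show "(\<Union>i\<in>D. b i) \<subseteq> (\<Union>n. Q n)"
  proof (rule UN_least)
   fix i assume i: "i \<in> D"
   then have "Q (to_nat_on D i) = b i" using D(1) by (simp add: Q_def)
   then show "b i \<subseteq> (\<Union>n. Q n)" by blast
  qed
 qed
 have sub: "(\<Union>n. Q n) \<subseteq> X" unfolding UQ using D(2) by (force simp: K_def b_def)
 have neg: "(LINT x:Q n|lborel. k x) <= 0" for n
 proof (cases "Q n = {}")
  case True
  then show ?thesis by (simp add: set_lebesgue_integral_def)
 next
  case False
  then obtain i where "i \<in> D" "Q n = b i" using QD by blast
  then show ?thesis using D(2) by (auto simp: K_def b_def)
 qed
 have Uset: "(\<Union>n. Q n) \<in> sets lborel" using Qset by blast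
 have int: "set_integrable lborel A k" if "A \<in> sets lborel" for A
  unfolding set_integrable_def by (rule integrable_mult_indicator[OF that k])
 have "X - (\<Union>n. Q n) \<in> null_sets lborel"
 proof -
  have "X - (\<Union>n. Q n) \<in> sets lborel" using X Uset by auto
  moreover have "negligible (X - (\<Union>n. Q n))" using D(4) by (simp add: UQ b_def)
  ultimately show ?thesis by (auto simp: negligible_iff_null_sets null_sets_def emeasure_completion)
 qed
 then have ae: "AE x in lborel. x \<notin> X - (\<Union>n. Q n)" by (rule AE_not_in)
 have "(LINT x:X|lborel. k x) = (LINT x:(\<Union>n. Q n)|lborel. k x)" unfolding set_lebesgue_integral_def
 proof (rule integral_cong_AE)
  show "(\<lambda>x. indicat_real X x *\<^sub>R k x) \<in> borel_measurable lborel"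
   "(\<lambda>x. indicat_real (\<Union>n. Q n) x *\<^sub>R k x) \<in> borel_measurable lborel"
   using int[of X] int[OF Uset] X by (auto simp: set_integrable_def)
  show "AE x in lborel. indicat_real X x *\<^sub>R k x = indicat_real (\<Union>n. Q n) x *\<^sub>R k x"
   using ae by eventually_elim (use sub in \<open>auto simp: indicator_def\<close>)
 qed
 also have "... <= 0"
 proof (rule LIMSEQ_le_const2)
  have "(\<lambda>n. LINT x:(\<Union>i<n. Q i)|lborel. k x) \<longlonglongrightarrow> (LINT x:(\<Union>n. \<Union>i<n. Q i)|lborel. k x)"
  proof (rule set_integral_cont_up)
   show "incseq (\<lambda>n. \<Union>i<n. Q i)" by (force simp: incseq_def)
   show "set_integrable lborel (\<Union>n. \<Union>i<n. Q i) k" using Qset by (intro int) blast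
  qed (use Qset in blast)
  moreover have "(\<Union>n. \<Union>i<n. Q i) = (\<Union>n. Q n)" by blast
  ultimately show "(\<lambda>n. LINT x:(\<Union>i<n. Q i)|lborel. k x) \<longlonglongrightarrow> (LINT x:(\<Union>n. Q n)|lborel. k x)" by simp
  have "(LINT x:(\<Union>i<n. Q i)|lborel. k x) <= 0" for n
  proof (induction n)
   case 0
   show ?case by (simp add: set_lebesgue_integral_def)
  next
   case (Suc n)
   have "(LINT x:(Q n \<union> (\<Union>i<n. Q i))|lborel. k x) = (LINT x:Q n|lborel. k x) + (LINT x:(\<Union>i<n. Q i)|lborel. k x)"
   proof (rule set_integral_Un)
    have "Q n \<inter> Q i = {}" if "i < n" for i by (rule disj) (use that in simp)
    then show "Q n \<inter> (\<Union>i<n. Q i) = {}" by blast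
    show "set_integrable lborel (Q n) k" by (rule int[OF Qset])
    have "(\<Union>i<n. Q i) \<in> sets lborel" using Qset by blast
    then show "set_integrable lborel (\<Union>i<n. Q i) k" by (rule int)
   qed
   moreover have "(\<Union>i<Suc n. Q i) = Q n \<union> (\<Union>i<n. Q i)" by (auto simp: lessThan_Suc)
   ultimately show ?case using Suc neg[of n] by simp
  qed
  then show "\<exists>N. \<forall>n\<ge>N. (LINT x:(\<Union>i<n. Q i)|lborel. k x) <= 0" by blast
 qed
 finally show ?thesis .
qed

text \<open>A one-sided Lebesgue differentiation theorem that asks for one good radius below each
  bound. With k = h - C on \<open>W\<close>, every open set has nonpositive k-integral. Hence the
  measure with density |k| gives any open set containing {k > 0} at least twice the mass of {k > 0};
  by outer regularity that mass m satisfies 2 m <= m.\<close>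

lemma AE_le_of_cball_averages:
 fixes h :: "'a::euclidean_space => real"
 assumes h: "integrable lborel h" and W: "open W" "bounded W"
  and avg: "!!c d. c \<in> W ==> d > 0 ==> \<exists>r. 0 < r \<and> r < d \<and> (LINT x:cball c r|lborel. h x) <= C * measure lborel (cball c r)"
 shows "AE x in lborel. x \<in> W --> h x <= C"
proof -
 define k where "k x = indicat_real W x *\<^sub>R (h x - C)" for x
 obtain z r where "W \<subseteq> cball z r" using W(2) unfolding bounded_subset_cball by blast
 then have Wint: "set_integrable lborel W (\<lambda>x. C)"
  using W(1) by (intro set_integrable_subset[OF set_integrable_cball[OF continuous_on_const]]) auto
 have int: "integrable lborel k"
 proof -
  have "set_integrable lborel W (\<lambda>x. h x - C)"
   using Wint integrable_mult_indicator[OF _ h, of W] W by (intro set_integral_diff) (auto simp: set_integrable_def)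
  then show ?thesis by (simp add: set_integrable_def k_def[abs_def])
 qed
 have [measurable]: "k \<in> borel_measurable borel" using int by auto
 have neg: "(LINT x:X|lborel. k x) <= 0" if X: "open X" for X
 proof -
  have "(LINT x:X|lborel. k x) = (LINT x:X \<inter> W|lborel. k x)" unfolding set_lebesgue_integral_def
   by (intro Bochner_Integration.integral_cong refl) (auto simp: k_def indicator_def)
  also have "... <= 0"
  proof (rule integral_le_zero_of_cball_averages[OF int])
   show "open (X \<inter> W)" using X W by auto
   fix c d assume c: "c \<in> X \<inter> W" and d: "(d::real) > 0"
   obtain e where e: "e > 0" "cball c e \<subseteq> W" using W c open_contains_cball by blast
   obtain r where r: "0 < r" "r < min d e" "(LINT x:cball c r|lborel. h x) <= C * measure lborel (cball c r)"
    using avg[of c "min d e"] c d e by auto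
   have sub: "cball c r \<subseteq> W" using r e by auto
   have "(LINT x:cball c r|lborel. k x) = (LINT x:cball c r|lborel. h x - C)" unfolding set_lebesgue_integral_def
    by (intro Bochner_Integration.integral_cong refl) (use sub in \<open>auto simp: k_def indicator_def\<close>)
   also have "... = (LINT x:cball c r|lborel. h x) - (LINT x:cball c r|lborel. C)"
    using integrable_mult_indicator[OF _ h, of "cball c r"]
    by (intro set_integral_diff set_integrable_cball[OF continuous_on_const]) (auto simp: set_integrable_def)
   also have "(LINT x:cball c r|lborel. C) = C * measure lborel (cball c r)"
    by (simp add: set_lebesgue_integral_def mult.commute)
   finally show "\<exists>r. 0 < r \<and> r < d \<and> (LINT x:cball c r|lborel. k x) <= 0" using r by auto
  qed
  finally show ?thesis .
 qed
 define M where "M = density lborel (\<lambda>x. ennreal \<bar>k x\<bar>)"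
 have intA: "integrable lborel (\<lambda>x. indicat_real A x * \<bar>k x\<bar>)" if "A \<in> sets borel" for A
  using integrable_mult_indicator[OF _ integrable_abs[OF int], of A] that by simp
 have em: "emeasure M A = ennreal (\<integral>x. indicat_real A x * \<bar>k x\<bar> \<partial>lborel)" if [measurable]: "A \<in> sets borel" for A
 proof -
  have "emeasure M A = (\<integral>\<^sup>+x. ennreal \<bar>k x\<bar> * indicator A x \<partial>lborel)" unfolding M_def by (rule emeasure_density) auto
  also have "... = (\<integral>\<^sup>+x. ennreal (indicat_real A x * \<bar>k x\<bar>) \<partial>lborel)"
   by (intro nn_integral_cong) (auto simp: indicator_def)
  also have "... = ennreal (\<integral>x. indicat_real A x * \<bar>k x\<bar> \<partial>lborel)"
   by (intro nn_integral_eq_integral intA that AE_I2) auto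
  finally show ?thesis .
 qed
 define Z where "Z = {x. 0 < k x}"
 have Z [measurable]: "Z \<in> sets borel" unfolding Z_def by measurable
 \<comment> \<open>\<open>Z\<close> contains the whole positive part of k, so the integral of k over
   \<open>Y\<close> is twice the mass of \<open>Z\<close> minus the mass of \<open>Y\<close>, and it
   is nonpositive.\<close>
 have "2 * emeasure M Z <= emeasure M Y" if Y: "Y \<in> {Y. Z \<subseteq> Y \<and> open Y}" for Y
 proof -
  have [measurable]: "Y \<in> sets borel" using Y by auto
  have "(\<integral>x. 2 * (indicat_real Z x * \<bar>k x\<bar>) - indicat_real Y x * \<bar>k x\<bar> \<partial>lborel) <= (LINT x:Y|lborel. k x)"
   unfolding set_lebesgue_integral_def
  proof (rule integral_mono)
   show "integrable lborel (\<lambda>x. 2 * (indicat_real Z x * \<bar>k x\<bar>) - indicat_real Y x * \<bar>k x\<bar>)"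
    by (intro Bochner_Integration.integrable_diff integrable_mult_right intA) auto
   show "integrable lborel (\<lambda>x. indicat_real Y x *\<^sub>R k x)" by (rule integrable_mult_indicator[OF _ int]) auto
   show "2 * (indicat_real Z x * \<bar>k x\<bar>) - indicat_real Y x * \<bar>k x\<bar> <= indicat_real Y x *\<^sub>R k x" for x
    using Y by (auto simp: indicator_def Z_def)
  qed
  also have "... <= 0" using neg Y by auto
  finally have "2 * (\<integral>x. indicat_real Z x * \<bar>k x\<bar> \<partial>lborel) <= (\<integral>x. indicat_real Y x * \<bar>k x\<bar> \<partial>lborel)"
   by (subst (asm) Bochner_Integration.integral_diff) (auto intro!: intA)
  then have "ennreal (2 * (\<integral>x. indicat_real Z x * \<bar>k x\<bar> \<partial>lborel)) <= emeasure M Y" by (simp add: em ennreal_leI)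
  then show ?thesis by (simp add: em ennreal_mult)
 qed
 then have "2 * emeasure M Z <= (INF Y\<in>{Y. Z \<subseteq> Y \<and> open Y}. emeasure M Y)" by (intro INF_greatest)
 also have "... = emeasure M Z" by (rule outer_regular[symmetric]) (use em[of UNIV] Z in \<open>auto simp: M_def\<close>)
 finally have "2 * emeasure M Z <= emeasure M Z" .
 moreover have "0 <= (\<integral>x. indicat_real Z x * \<bar>k x\<bar> \<partial>lborel)" by simp
 ultimately have "emeasure M Z = 0" by (simp add: em[OF Z] ennreal_mult[symmetric] flip: ennreal_numeral)
 then have "AE x in lborel. x \<in> Z --> ennreal \<bar>k x\<bar> = 0"
  unfolding M_def by (subst (asm) emeasure_density) (auto simp: nn_integral_0_iff_AE indicator_def)
 then show ?thesis
 proof eventually_elim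
  case (elim x)
  then show ?case by (auto simp: Z_def k_def)
 qed
qed

section \<open>Regularization of weak solutions\<close>

lemma eventually_inverse_Suc_less:
 assumes "0 < d"
 shows "\<forall>\<^sub>F n in sequentially. 1 / real (Suc n) < d"
 using order_tendstoD(2)[OF LIMSEQ_inverse_real_of_nat assms] by (simp only: inverse_eq_divide)

lemma integrable_indicator_of_bound:
 fixes h :: "'a::euclidean_space => 'b::euclidean_space"
 assumes h: "set_borel_measurable lborel (ball x0 R) h" and q: "set_integrable lborel (ball x0 R) q"
  and le: "!!x. x \<in> ball x0 R ==> norm (h x) <= 1 + q x"
 shows "integrable lborel (\<lambda>x. indicat_real (ball x0 R) x *\<^sub>R h x)"
proof (rule Bochner_Integration.integrable_bound)
 show "integrable lborel (\<lambda>x. indicat_real (ball x0 R) x *\<^sub>R 1 + indicat_real (ball x0 R) x *\<^sub>R q x)"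
  using q set_integrable_subset[OF set_integrable_cball[OF continuous_on_const, of x0 R "1 :: real"], of "ball x0 R"]
  by (intro Bochner_Integration.integrable_add) (auto simp: set_integrable_def)
 show "(\<lambda>x. indicat_real (ball x0 R) x *\<^sub>R h x) \<in> borel_measurable lborel"
  using h by (simp add: set_borel_measurable_def)
 show "AE x in lborel. norm (indicat_real (ball x0 R) x *\<^sub>R h x)
   <= norm (indicat_real (ball x0 R) x *\<^sub>R 1 + indicat_real (ball x0 R) x *\<^sub>R q x)"
 proof (intro AE_I2)
  fix x
  show "norm (indicat_real (ball x0 R) x *\<^sub>R h x) <= norm (indicat_real (ball x0 R) x *\<^sub>R 1 + indicat_real (ball x0 R) x *\<^sub>R q x)"
   using le[of x] by (cases "x \<in> ball x0 R") (simp_all add: indicator_def)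
 qed
qed

text \<open>Makes the kernel centred at \<open>x\<close> admissible in the weak formulations and
  thereby links \<open>moll_grad\<close>, where the derivative falls on the kernel, with weak
  derivatives.\<close>

lemma test_fun_kernel:
 fixes x :: "real^'n::finite"
 assumes a: "a > 0" and sub: "cball x (1 / a) \<subseteq> X"
 shows "test_fun X (\<lambda>y. kernel a (x - y))"
  "pdiff k (\<lambda>y. kernel a (x - y)) y = - (kernel_grad a (x - y) $ k)"
proof -
 let ?I = "\<integral>z. raw_kernel a z \<partial>(lborel :: (real^'n) measure)"
 have "(\<lambda>y. (1 / ?I) * psi 0 (1 - a\<^sup>2 * (norm (y - x))^2)) \<in> bump_alg x a" by (intro bump_alg.cmul bump_alg.base)
 also have "(\<lambda>y. (1 / ?I) * psi 0 (1 - a\<^sup>2 * (norm (y - x))^2)) = (\<lambda>y. kernel a (x - y))"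
  by (simp add: fun_eq_iff kernel_def raw_kernel_def[abs_def] norm_minus_commute)
 finally have sm: "smooth (\<lambda>y. kernel a (x - y))" by (rule bump_alg_smooth)
 have "{y. kernel a (x - y) \<noteq> 0} \<subseteq> cball x (1 / a)"
  using kernel_support[OF a, of "x - _"] by (auto simp: dist_norm) (meson linear)
 then have cl: "closure {y. kernel a (x - y) \<noteq> 0} \<subseteq> cball x (1 / a)" by (rule closure_minimal) simp
 then have "compact (closure {y. kernel a (x - y) \<noteq> 0})"
  by (meson bounded_cball bounded_subset closed_closure compact_eq_bounded_closed)
 then show "test_fun X (\<lambda>y. kernel a (x - y))" using sm cl sub by (auto simp: test_fun_def)
 have "((\<lambda>y. x - y) has_derivative (\<lambda>h. - h)) (at y)" by (auto intro!: derivative_eq_intros)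
 from has_derivative_compose[OF this kernel_deriv[OF a]]
 show "pdiff k (\<lambda>y. kernel a (x - y)) y = - (kernel_grad a (x - y) $ k)" by (simp add: pdiff_eq inner_axis)
qed

lemma le_one_plus_square: "t <= 1 + t^2" for t :: real
proof -
 have "0 <= (t - 1 / 2)^2" by simp
 then show ?thesis by (simp add: power2_eq_square algebra_simps)
qed

lemma integrable_vec_nth: "integrable M w ==> integrable M (\<lambda>y. w y $ i)"
 for w :: "'a => real^'m::finite" using integrable_bounded_linear[OF bounded_linear_vec_nth[of i]] by blast

lemma has_derivative_vec_lambda:
 fixes G :: "'a::real_normed_vector => real^'m::finite"
 assumes "!!i. ((\<lambda>x. G x $ i) has_derivative (\<lambda>h. G' h $ i)) (at x)"
 shows "(G has_derivative G') (at x)"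
 using assms by (subst has_derivative_componentwise_within) (auto simp: Basis_vec_def inner_axis)

locale weak_data =
 fixes A :: "real^'n::finite => real^'n^'n" and \<mu> \<Lambda> :: real and x0 :: "real^'n" and R p :: real
  and u f :: "real^'n => real" and g :: "real^'n => real^'n"
 assumes R: "0 < R" and p: "1 < p"
  and contA: "continuous_on (ball x0 R) A"
  and bd: "!!x \<xi>. x \<in> ball x0 R ==> norm (A x *v \<xi>) <= \<Lambda> * norm \<xi>"
  and el: "!!x \<xi>. x \<in> ball x0 R ==> \<mu> * (norm \<xi>)^2 <= \<xi> \<bullet> (A x *v \<xi>)" and \<mu>: "\<mu> > 0"
  and sol: "weak_solution (ball x0 R) A f u g"
  and fm: "set_borel_measurable lborel (ball x0 R) f"
  and fp: "set_integrable lborel (ball x0 R) (\<lambda>x. \<bar>f x\<bar> powr p)"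
begin

definition gt where "gt x = indicat_real (ball x0 R) x *\<^sub>R g x"
definition ut where "ut x = indicat_real (ball x0 R) x *\<^sub>R u x"
definition ft where "ft x = indicat_real (ball x0 R) x *\<^sub>R f x"
definition wt where "wt x = indicat_real (ball x0 R) x *\<^sub>R (A x *v g x)"

definition grad_energy where "grad_energy = (LINT x:ball x0 R|lborel. (norm (g x))^2)"
definition source_energy where "source_energy = (LINT x:ball x0 R|lborel. \<bar>f x\<bar> powr p)"

lemma weak:
 shows "set_borel_measurable lborel (ball x0 R) u" "set_borel_measurable lborel (ball x0 R) g"
  "set_integrable lborel (ball x0 R) (\<lambda>x. (u x)^2)" "set_integrable lborel (ball x0 R) (\<lambda>x. (norm (g x))^2)"
  "!!\<phi> k. test_fun (ball x0 R) \<phi> ==>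
    (LINT x:ball x0 R|lborel. u x * pdiff k \<phi> x) = - (LINT x:ball x0 R|lborel. g x $ k * \<phi> x)"
  "!!\<phi>. test_fun (ball x0 R) \<phi> ==>
    (LINT x:ball x0 R|lborel. (A x *v g x) \<bullet> grad \<phi> x) = (LINT x:ball x0 R|lborel. f x * \<phi> x)"
 using sol by (auto simp: weak_solution_def H1_weak_grad_def)

lemma integrable_ut: "integrable lborel ut"
 unfolding ut_def by (rule integrable_indicator_of_bound[OF weak(1,3)]) (use le_one_plus_square[of "\<bar>_\<bar>"] in auto)

lemma integrable_gt: "integrable lborel gt"
 unfolding gt_def by (rule integrable_indicator_of_bound[OF weak(2,4)]) (rule le_one_plus_square)

lemma integrable_ft: "integrable lborel ft"
 unfolding ft_def
proof (rule integrable_indicator_of_bound[OF fm fp])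
 fix x
 show "norm (f x) <= 1 + \<bar>f x\<bar> powr p"
 proof (cases "\<bar>f x\<bar> <= 1")
  case False
  then have "\<bar>f x\<bar> powr 1 <= \<bar>f x\<bar> powr p" using p by (intro powr_mono) auto
  then show ?thesis using False by simp
 qed (auto intro: add_increasing2)
qed

lemma integrable_wt: "integrable lborel wt"
proof (rule Bochner_Integration.integrable_bound[OF integrable_mult_right[OF integrable_norm[OF integrable_gt], of \<Lambda>]])
 have 1: "(\<lambda>x. indicat_real (ball x0 R) x *\<^sub>R A x) \<in> borel_measurable borel"
  by (rule borel_measurable_continuous_on_indicator[OF _ contA]) simp
 have 2: "gt \<in> borel_measurable borel" using integrable_gt by auto
 have "(\<lambda>x. (indicat_real (ball x0 R) x *\<^sub>R A x) *v gt x) \<in> borel_measurable borel"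
  by (rule borel_measurable_continuous_Pair[OF 1 2])
    (intro continuous_on_mv continuous_intros)
 moreover have "(\<lambda>x. (indicat_real (ball x0 R) x *\<^sub>R A x) *v gt x) = wt"
  by (auto simp: fun_eq_iff wt_def gt_def indicator_def)
 ultimately show "wt \<in> borel_measurable lborel" by simp
 show "AE x in lborel. norm (wt x) <= norm (\<Lambda> * norm (gt x))"
 proof (intro AE_I2)
  fix x
  show "norm (wt x) <= norm (\<Lambda> * norm (gt x))" using bd[of x "g x"] by (auto simp: wt_def gt_def indicator_def)
 qed
qed

lemma gt_square: "(norm (gt x))^2 = indicat_real (ball x0 R) x *\<^sub>R (norm (g x))\<^sup>2"
 by (simp add: gt_def indicator_def)

lemma integrable_gt_square: "integrable lborel (\<lambda>x. (norm (gt x))^2)"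
 using weak(4) by (simp add: gt_square set_integrable_def)

lemma grad_energy_eq: "grad_energy = (\<integral>x. (norm (gt x))^2 \<partial>lborel)"
 by (simp add: grad_energy_def gt_square set_lebesgue_integral_def)

lemma grad_energy_nonneg: "0 <= grad_energy"
 unfolding grad_energy_eq by simp

text \<open>The data for \<open>approx_solution\<close>, mollified from extensions by zero. The
  relations of gradient and divergence hold on the whole space; the identification with the
  mollified \<open>g\<close> and \<open>f\<close> holds where the ball of the kernel lies inside the
  domain.\<close>

definition Ga where "Ga a = moll_grad a ut"
definition Fa where "Fa a x = (\<chi> i. moll a (\<lambda>y. wt y $ i) x)"
definition fa where "fa a x = - (\<Sum>i\<in>UNIV. moll_grad a (\<lambda>y. wt y $ i) x $ i)"

lemma moll_nth:
 fixes w :: "real^'n => real^'m::finite"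
 assumes "a > 0" "integrable lborel w"
 shows "moll a w x $ k = moll a (\<lambda>y. w y $ k) x" unfolding moll_def
 by (subst integral_bounded_linear[OF bounded_linear_vec_nth integrable_moll[OF assms], symmetric]) simp

lemma moll_grad_nth:
 assumes "a > 0" "integrable lborel w"
 shows "moll_grad a w x $ k = (\<integral>y. w y * kernel_grad a (x - y) $ k \<partial>lborel)"
  "integrable lborel (\<lambda>y. w y * kernel_grad a (x - y) $ k)"
proof -
 have i: "integrable lborel (\<lambda>y. w y *\<^sub>R kernel_grad a (x - y))"
  by (rule integrable_scaled_compact[OF assms(2) continuous_kernel_grad[OF assms(1)]]) (rule kernel_grad_support[OF assms(1)])
 show "moll_grad a w x $ k = (\<integral>y. w y * kernel_grad a (x - y) $ k \<partial>lborel)"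
  unfolding moll_grad_def by (subst integral_bounded_linear[OF bounded_linear_vec_nth i, symmetric]) simp
 show "integrable lborel (\<lambda>y. w y * kernel_grad a (x - y) $ k)" using integrable_vec_nth[OF i, of k] by simp
qed

lemma Fa_eq: "a > 0 ==> Fa a x = moll a wt x"
 by (simp add: Fa_def vec_eq_iff moll_nth integrable_wt)

lemma Ga_eq:
 assumes a: "a > 0" and sub: "cball x (1 / a) \<subseteq> ball x0 R"
 shows "Ga a x = moll a gt x" unfolding vec_eq_iff
proof
 fix k
 have "Ga a x $ k = - (LINT y:ball x0 R|lborel. u y * pdiff k (\<lambda>y. kernel a (x - y)) y)"
  by (simp add: Ga_def moll_grad_nth(1)[OF a integrable_ut] test_fun_kernel(2)[OF a sub] set_lebesgue_integral_def ut_def mult.assoc)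
 also have "... = (LINT y:ball x0 R|lborel. g y $ k * kernel a (x - y))"
  by (simp add: weak(5)[OF test_fun_kernel(1)[OF a sub]])
 also have "... = moll a gt x $ k"
  unfolding moll_nth[OF a integrable_gt] by (simp add: moll_def set_lebesgue_integral_def gt_def ac_simps)
 finally show "Ga a x $ k = moll a gt x $ k" .
qed

lemma fa_eq:
 assumes a: "a > 0" and sub: "cball x (1 / a) \<subseteq> ball x0 R"
 shows "fa a x = moll a ft x"
proof -
 have "fa a x = - (\<integral>y. (\<Sum>i\<in>UNIV. wt y $ i * kernel_grad a (x - y) $ i) \<partial>lborel)"
  unfolding fa_def moll_grad_nth(1)[OF a integrable_vec_nth[OF integrable_wt]]
  by (subst Bochner_Integration.integral_sum[OF moll_grad_nth(2)[OF a integrable_vec_nth[OF integrable_wt]]]) simp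
 also have "... = (LINT y:ball x0 R|lborel. (A y *v g y) \<bullet> grad (\<lambda>y. kernel a (x - y)) y)"
  by (simp add: grad_def inner_vec_def test_fun_kernel(2)[OF a sub] set_lebesgue_integral_def wt_def sum_negf sum_distrib_left mult.assoc)
 also have "... = (LINT y:ball x0 R|lborel. f y * kernel a (x - y))" by (rule weak(6)[OF test_fun_kernel(1)[OF a sub]])
 also have "... = moll a ft x" by (simp add: moll_def set_lebesgue_integral_def ft_def ac_simps)
 finally show ?thesis .
qed

lemma grad_pair_moll: "a > 0 ==> grad_pair (moll a ut) (Ga a)"
 unfolding grad_pair_def Ga_def by (auto intro: continuous_moll_grad moll_deriv integrable_ut)

lemma div_pair_moll:
 assumes a: "a > 0"
 shows "div_pair (Fa a) (fa a)" unfolding div_pair_def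
proof (intro exI conjI allI)
 fix x
 show "(Fa a has_derivative (\<lambda>h. \<chi> i. moll_grad a (\<lambda>y. wt y $ i) x \<bullet> h)) (at x)"
  by (rule has_derivative_vec_lambda) (simp add: Fa_def[abs_def] moll_deriv[OF a integrable_vec_nth[OF integrable_wt]])
 show "fa a x = - (\<Sum>i\<in>UNIV. (\<chi> i'. moll_grad a (\<lambda>y. wt y $ i') x \<bullet> axis i 1) $ i)" by (simp add: fa_def inner_axis)
next
 fix i
 show "continuous_on UNIV (\<lambda>x. (\<chi> i'. moll_grad a (\<lambda>y. wt y $ i') x \<bullet> axis i 1) $ i)"
  by (simp add: inner_axis) (intro continuous_intros continuous_moll_grad[OF a integrable_vec_nth[OF integrable_wt]])
qed

lemma norm_moll_le:
 fixes w :: "real^'n => 'b::euclidean_space"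
 assumes "a > 0" "integrable lborel w"
 shows "norm (moll a w x) <= moll a (\<lambda>y. norm (w y)) x" unfolding moll_def
 using assms by (intro norm_integral_le_dominated integrable_moll integrable_norm) (auto simp: kernel_nonneg)

lemma moll_gt_square_le:
 assumes a: "a > 0"
 shows "(moll a (\<lambda>y. norm (gt y)) x)^2 <= moll a (\<lambda>y. (norm (gt y))^2) x"
 by (rule moll_square_le[OF a integrable_norm[OF integrable_gt] integrable_gt_square])

lemma moll_gt_energy_le:
 assumes a: "a > 0"
 shows "(LINT x:cball c s|lborel. moll a (\<lambda>y. (norm (gt y))^2) x) <= grad_energy"
 using integral_moll_cball_le[OF a integrable_gt_square, of UNIV c s]
 by (simp add: grad_energy_eq set_lebesgue_integral_def)

lemma continuous_Ga: "a > 0 ==> continuous_on UNIV (Ga a)"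
 unfolding Ga_def by (intro continuous_moll_grad integrable_ut)

lemma cball_subset_shift:
 fixes c x :: "'a::metric_space"
 assumes "x \<in> cball c s" "cball c (s + t) \<subseteq> X"
 shows "cball x t \<subseteq> X"
proof
 fix y assume "y \<in> cball x t"
 then have "y \<in> cball c (s + t)" using assms(1) dist_triangle[of c y x] by auto
 then show "y \<in> X" using assms(2) by blast
qed

lemma energy_Ga:
 assumes a: "a > 0" and sub: "cball c (s + 1 / a) \<subseteq> ball x0 R"
 shows "ball_energy c s (Ga a) <= grad_energy"
proof -
 have "ball_energy c s (Ga a) <= (LINT x:cball c s|lborel. moll a (\<lambda>y. (norm (gt y))^2) x)"
 proof (rule ball_energy_le_compare[OF continuous_Ga[OF a] continuous_moll[OF a integrable_gt_square]])
  fix x assume x: "x \<in> cball c s"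
  have "norm (Ga a x) <= moll a (\<lambda>y. norm (gt y)) x"
   unfolding Ga_eq[OF a cball_subset_shift[OF x sub]] by (rule norm_moll_le[OF a integrable_gt])
  then have "(norm (Ga a x))^2 <= (moll a (\<lambda>y. norm (gt y)) x)^2" by (intro power_mono) auto
  also have "... <= moll a (\<lambda>y. (norm (gt y))^2) x" by (rule moll_gt_square_le[OF a])
  finally show "(norm (Ga a x))^2 <= moll a (\<lambda>y. (norm (gt y))^2) x" .
 qed
 then show ?thesis using moll_gt_energy_le[OF a] by (rule order_trans)
qed

text \<open>Composition with the nearest-point projection extends \<open>A\<close> from an inner
  ball to the whole space with unchanged bounds, as \<open>approx_solution\<close> demands.\<close>

definition clamped_coeff where "clamped_coeff r x = A (closest_point (cball x0 r) x)"

lemma clamped_coeff: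
 assumes "0 < r" "r < R"
 shows "x \<in> cball x0 r ==> clamped_coeff r x = A x" "continuous_on UNIV (clamped_coeff r)"
  "closest_point (cball x0 r) x \<in> ball x0 R"
proof -
 have in_r: "closest_point (cball x0 r) x \<in> cball x0 r" for x using assms(1) by (intro closest_point_in_set) auto
 show "closest_point (cball x0 r) x \<in> ball x0 R" for x using in_r[of x] assms by auto
 show "x \<in> cball x0 r ==> clamped_coeff r x = A x" by (simp add: clamped_coeff_def closest_point_self)
 have sub: "cball x0 r \<subseteq> ball x0 R" using assms by auto
 show "continuous_on UNIV (clamped_coeff r)" unfolding clamped_coeff_def
  by (rule continuous_on_compose2[OF continuous_on_subset[OF contA sub] continuous_on_closest_point])
    (use in_r assms in auto)
qed

lemma oscillation_small:
 assumes r: "r < R" and e: "e > 0"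
 shows "\<exists>d>0. \<forall>x y. x \<in> cball x0 r --> y \<in> cball x0 r --> dist x y <= d --> (\<forall>\<xi>. norm ((A y - A x) *v \<xi>) <= e * norm \<xi>)"
proof -
 have "uniformly_continuous_on (cball x0 r) A"
  by (intro compact_uniformly_continuous continuous_on_subset[OF contA]) (use r in auto)
 then obtain d where d: "d > 0" "!!x y. x \<in> cball x0 r ==> y \<in> cball x0 r ==> dist y x < d ==> dist (A y) (A x) < e"
  unfolding uniformly_continuous_on_def using e by metis
 show ?thesis
 proof (rule exI[of _ "d / 2"], intro conjI allI impI)
  fix x y and \<xi> :: "real^'n"
  assume "x \<in> cball x0 r" "y \<in> cball x0 r" "dist x y <= d / 2"
  then have "norm (A y - A x) <= e" using d(2)[of x y] d(1) by (simp add: dist_norm norm_minus_commute)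
  then show "norm ((A y - A x) *v \<xi>) <= e * norm \<xi>"
   using norm_matrix_vector_le[of "A y - A x" \<xi>] mult_right_mono[of "norm (A y - A x)" e "norm \<xi>"] by simp
 qed (use d in simp)
qed

text \<open>The defect is the commutator of mollification with multiplication by \<open>A\<close>.
  Inside the inner ball \<open>A\<close> varies by at most \<open>e\<close> over the radius of the
  kernel, so the defect is at most \<open>e\<close> times the mollified |g|.\<close>

lemma energy_defect:
 assumes a: "a > 0" and r: "0 < r" "r < R" and s: "s > 0" and sub: "cball c (s + 1 / a) \<subseteq> cball x0 r"
  and e: "!!x y \<xi>. x \<in> cball x0 r ==> y \<in> cball x0 r ==> dist x y <= 1 / a ==> norm ((A y - A x) *v \<xi>) <= e * norm \<xi>"
   "e > 0"
 shows "ball_energy c s (\<lambda>x. Fa a x - clamped_coeff r x *v Ga a x) <= e^2 * grad_energy"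
proof -
 have sub': "cball x0 r \<subseteq> ball x0 R" using r by auto
 have "ball_energy c s (\<lambda>x. Fa a x - clamped_coeff r x *v Ga a x) <= (LINT x:cball c s|lborel. e^2 * moll a (\<lambda>y. (norm (gt y))^2) x)"
 proof (rule ball_energy_le_compare)
  show "continuous_on UNIV (\<lambda>x. Fa a x - clamped_coeff r x *v Ga a x)" using div_pair_cont[OF div_pair_moll[OF a]]
   by (intro continuous_intros continuous_on_mv continuous_Ga[OF a] clamped_coeff(2)[OF r])
  show "continuous_on UNIV (\<lambda>x. e^2 * moll a (\<lambda>y. (norm (gt y))^2) x)"
   by (intro continuous_intros continuous_moll[OF a integrable_gt_square])
  fix x assume x: "x \<in> cball c s"
  have xs: "cball x (1 / a) \<subseteq> cball x0 r" by (rule cball_subset_shift[OF x sub])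
  then have xr: "x \<in> cball x0 r" using a by (meson centre_in_cball divide_nonneg_pos in_mono less_imp_le zero_le_one)
  have ia: "integrable lborel (\<lambda>y. A x *v gt y)"
   by (rule integrable_bounded_linear[OF matrix_vector_mul_bounded_linear integrable_gt])
  have "Fa a x - clamped_coeff r x *v Ga a x = moll a wt x - A x *v moll a gt x"
   using Ga_eq[OF a order_trans[OF xs sub']] by (simp add: Fa_eq[OF a] clamped_coeff(1)[OF r xr])
  also have "A x *v moll a gt x = moll a (\<lambda>y. A x *v gt y) x" unfolding moll_def
   by (subst integral_bounded_linear[OF matrix_vector_mul_bounded_linear integrable_moll[OF a integrable_gt], symmetric])
     (simp add: matrix_vector_mult_scaleR)
  also have "moll a wt x - moll a (\<lambda>y. A x *v gt y) x = (\<integral>y. kernel a (x - y) *\<^sub>R (wt y - A x *v gt y) \<partial>lborel)"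
   unfolding moll_def scaleR_diff_right
   by (rule Bochner_Integration.integral_diff[symmetric]) (intro integrable_moll[OF a] integrable_wt ia)+
  finally have eq: "Fa a x - clamped_coeff r x *v Ga a x = (\<integral>y. kernel a (x - y) *\<^sub>R (wt y - A x *v gt y) \<partial>lborel)" .
  have "norm (Fa a x - clamped_coeff r x *v Ga a x) <= (\<integral>y. e * (kernel a (x - y) *\<^sub>R norm (gt y)) \<partial>lborel)" unfolding eq
  proof (rule norm_integral_le_dominated)
   show "integrable lborel (\<lambda>y. kernel a (x - y) *\<^sub>R (wt y - A x *v gt y))"
    by (intro integrable_moll[OF a] Bochner_Integration.integrable_diff integrable_wt ia)
   show "integrable lborel (\<lambda>y. e * (kernel a (x - y) *\<^sub>R norm (gt y)))"
    by (intro integrable_mult_right integrable_moll[OF a] integrable_norm integrable_gt)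
   fix y
   show "norm (kernel a (x - y) *\<^sub>R (wt y - A x *v gt y)) <= e * (kernel a (x - y) *\<^sub>R norm (gt y))"
   proof (cases "norm (x - y) >= 1 / a")
    case True
    then show ?thesis using kernel_support[OF a True] by simp
   next
    case False
    then have y: "y \<in> cball x0 r" using xs by (auto simp: dist_norm subset_iff)
    then have "wt y = A y *v gt y" using sub' by (auto simp: wt_def gt_def subset_iff)
    then have "wt y - A x *v gt y = (A y - A x) *v gt y" by (simp add: matrix_vector_mult_diff_rdistrib)
    moreover have "norm ((A y - A x) *v gt y) <= e * norm (gt y)" using False by (intro e(1) xr y) (simp add: dist_norm)
    ultimately show ?thesis
     using mult_left_mono[OF _ kernel_nonneg[OF a], of "norm ((A y - A x) *v gt y)" "e * norm (gt y)" "x - y"] kernel_nonneg[OF a, of "x - y"]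
     by (simp add: mult.left_commute)
   qed
  qed
  also have "... = e * moll a (\<lambda>y. norm (gt y)) x" by (simp add: moll_def)
  finally have "(norm (Fa a x - clamped_coeff r x *v Ga a x))^2 <= (e * moll a (\<lambda>y. norm (gt y)) x)^2"
   by (intro power_mono) auto
  also have "... <= e^2 * moll a (\<lambda>y. (norm (gt y))^2) x"
   using mult_left_mono[OF moll_gt_square_le[OF a], of "e^2" x] by (simp add: power_mult_distrib)
  finally show "(norm (Fa a x - clamped_coeff r x *v Ga a x))^2 <= e^2 * moll a (\<lambda>y. (norm (gt y))^2) x" .
 qed
 also have "... = e^2 * (LINT x:cball c s|lborel. moll a (\<lambda>y. (norm (gt y))^2) x)" by simp
 also have "... <= e^2 * grad_energy" by (intro mult_left_mono moll_gt_energy_le[OF a]) auto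
 finally show ?thesis .
qed

text \<open>A split at height t, used in place of Hoelder's inequality; choosing t according to the
  radius later produces the exponent 1 - d / p.\<close>

lemma square_le_powr:
 fixes y t q :: real
 assumes "2 <= q" "0 < t" "0 <= y"
 shows "y^2 <= t^2 + t powr (2 - q) * y powr q"
proof (cases "y <= t")
 case True
 then have "y^2 <= t^2" using assms by (intro power_mono) auto
 moreover have "0 <= t powr (2 - q) * y powr q" by simp
 ultimately show ?thesis by linarith
next
 case False
 then have y: "y > t" "y > 0" using assms by auto
 have "y^2 = y powr (2 - q) * y powr q" using y by (simp flip: powr_add)
 also have "... <= t powr (2 - q) * y powr q" using assms y by (intro mult_right_mono powr_mono2') auto
 finally show ?thesis by (simp add: add_increasing)
qed

lemma measure_cball_eq: "0 <= r ==> measure lborel (cball c r) = unit_ball_vol (real CARD('n)) * r ^ CARD('n)"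
 for c :: "real^'n" by (simp add: content_cball)

lemma energy_fa:
 assumes a: "a > 0" and sub: "cball c (s + 1 / a) \<subseteq> ball x0 R" and s: "s > 0" and p2: "2 <= p" and t: "0 < t"
 shows "ball_energy c s (fa a) <= t^2 * (unit_ball_vol (real CARD('n)) * (s + 1 / a) ^ CARD('n)) + t powr (2 - p) * source_energy"
proof -
 have i2: "integrable lborel (\<lambda>x. (ft x)^2)"
 proof -
  have "set_integrable lborel (ball x0 R) (\<lambda>x. (f x)^2)" unfolding set_integrable_def
  proof (rule integrable_indicator_of_bound[OF _ fp])
   have "(\<lambda>x. (ft x)^2) \<in> borel_measurable lborel" using integrable_ft by (intro borel_measurable_power) auto
   moreover have "(\<lambda>x. (ft x)^2) = (\<lambda>x. indicat_real (ball x0 R) x *\<^sub>R (f x)\<^sup>2)"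
    by (auto simp: ft_def indicator_def fun_eq_iff)
   ultimately show "set_borel_measurable lborel (ball x0 R) (\<lambda>x. (f x)^2)" by (simp add: set_borel_measurable_def)
   show "norm ((f x)^2) <= 1 + \<bar>f x\<bar> powr p" for x using square_le_powr[OF p2, of 1 "\<bar>f x\<bar>"] by simp
  qed
  moreover have "(\<lambda>x. (ft x)^2) = (\<lambda>x. indicat_real (ball x0 R) x *\<^sub>R (f x)\<^sup>2)"
   by (auto simp: ft_def indicator_def fun_eq_iff)
  ultimately show ?thesis by (simp add: set_integrable_def)
 qed
 have cf: "continuous_on UNIV (fa a)" using div_pair_cont[OF div_pair_moll[OF a]] by simp
 have "ball_energy c s (fa a) <= (LINT x:cball c s|lborel. moll a (\<lambda>y. (ft y)^2) x)"
 proof (rule ball_energy_le_compare[OF cf continuous_moll[OF a i2]])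
  fix x assume x: "x \<in> cball c s"
  show "(norm (fa a x))^2 <= moll a (\<lambda>y. (ft y)^2) x"
   using moll_square_le[OF a integrable_ft i2, of x] by (simp add: fa_eq[OF a cball_subset_shift[OF x sub]])
 qed
 also have "... <= (LINT y:cball c (s + 1 / a)|lborel. (ft y)^2)" by (rule integral_moll_cball_le[OF a i2]) auto
 also have "... <= (\<integral>y. t^2 * indicat_real (cball c (s + 1 / a)) y + t powr (2 - p) * (indicat_real (ball x0 R) y *\<^sub>R \<bar>f y\<bar> powr p) \<partial>lborel)"
  unfolding set_lebesgue_integral_def
 proof (rule integral_mono)
  show "integrable lborel (\<lambda>y. indicat_real (cball c (s + 1 / a)) y *\<^sub>R (ft y)\<^sup>2)"
   by (rule integrable_mult_indicator[OF _ i2]) simp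
  show "integrable lborel (\<lambda>y. t^2 * indicat_real (cball c (s + 1 / a)) y + t powr (2 - p) * (indicat_real (ball x0 R) y *\<^sub>R \<bar>f y\<bar> powr p))"
   using set_integrable_cball[OF continuous_on_const, of c "s + 1 / a" "1 :: real"] fp
   by (intro Bochner_Integration.integrable_add integrable_mult_right) (auto simp: set_integrable_def)
  fix y
  show "indicat_real (cball c (s + 1 / a)) y *\<^sub>R (ft y)\<^sup>2 <= t^2 * indicat_real (cball c (s + 1 / a)) y + t powr (2 - p) * (indicat_real (ball x0 R) y *\<^sub>R \<bar>f y\<bar> powr p)"
   using square_le_powr[OF p2 t, of "\<bar>f y\<bar>"] sub by (auto simp: indicator_def ft_def)
 qed
 also have "... = t^2 * measure lborel (cball c (s + 1 / a)) + t powr (2 - p) * source_energy"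
  using set_integrable_cball[OF continuous_on_const, of c "s + 1 / a" "1 :: real"] fp
  by (subst Bochner_Integration.integral_add) (auto simp: set_integrable_def source_energy_def set_lebesgue_integral_def)
 also have "measure lborel (cball c (s + 1 / a)) = unit_ball_vol (real CARD('n)) * (s + 1 / a) ^ CARD('n)"
  using s a by (intro measure_cball_eq) simp
 finally show ?thesis .
qed

text \<open>Applied to plus and minus each component: by Young's inequality its average over a ball
  is at most K / 2 plus the energy average divided by 2 K, and K^2 = M / \<omega>, with \<omega> the
  volume of the unit ball, makes the two halves equal. Letting the mollification parameter grow,
  \<open>AE_le_of_cball_averages\<close> gives the bound for the component; summing the components
  costs the factor d.\<close>

lemma gradient_bound_of_energy:
 fixes \<theta> s0 M :: real
 assumes \<theta>: "0 < \<theta>" "\<theta> < 1" and s0: "0 < s0" "s0 <= R / 4" and M: "M > 0"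
  and dec: "!!c m. c \<in> ball x0 (R / 2) ==>
   \<forall>\<^sub>F n in sequentially. ball_energy c (\<theta> ^ m * s0) (Ga (real (Suc n))) <= M * (\<theta> ^ m * s0) ^ CARD('n)"
 shows "AE x in lborel. x \<in> ball x0 (R / 2) --> norm (g x) <= real CARD('n) * sqrt (M / unit_ball_vol (real CARD('n)))"
proof -
 define \<omega> where "\<omega> = unit_ball_vol (real CARD('n))"
 have \<omega>: "\<omega> > 0" unfolding \<omega>_def by (rule unit_ball_vol_pos) simp
 define K where "K = sqrt (M / \<omega>)"
 have K: "K > 0" "K^2 * \<omega> = M" using M \<omega> by (auto simp: K_def)
 have comp: "AE x in lborel. x \<in> ball x0 (R / 2) --> \<sigma> * gt x $ k <= K" if \<sigma>: "\<sigma>^2 = 1" for \<sigma> k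
 proof (rule AE_le_of_cball_averages[where h = "\<lambda>x. \<sigma> * gt x $ k"])
  have h: "integrable lborel (\<lambda>x. gt x $ k)" by (rule integrable_vec_nth[OF integrable_gt])
  then show "integrable lborel (\<lambda>x. \<sigma> * gt x $ k)" by simp
  fix c and d :: real assume c: "c \<in> ball x0 (R / 2)" and d: "d > 0"
  have "(\<lambda>m. \<theta> ^ m * s0) \<longlonglongrightarrow> 0 * s0" using \<theta> by (intro tendsto_mult_right LIMSEQ_power_zero) auto
  then obtain m where m: "\<theta> ^ m * s0 < d"
   using order_tendstoD(2)[of _ "0 * s0" sequentially d] d by (auto simp: eventually_sequentially)
  define r where "r = \<theta> ^ m * s0"
  have r: "0 < r" "r < d" using m \<theta> s0 by (auto simp: r_def)
  have "\<theta> ^ m <= 1" using \<theta> by (intro power_le_one) auto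
  then have rR: "r <= R / 4" using mult_right_mono[of "\<theta> ^ m" 1 s0] s0 unfolding r_def by linarith
  have "(\<lambda>n. \<sigma> * (LINT x:cball c r|lborel. moll (real (Suc n)) (\<lambda>x. gt x $ k) x)) \<longlonglongrightarrow> \<sigma> * (LINT x:cball c r|lborel. gt x $ k)"
   by (intro tendsto_mult_left integral_moll_cball_tendsto h r)
  moreover have "\<forall>\<^sub>F n in sequentially. \<sigma> * (LINT x:cball c r|lborel. moll (real (Suc n)) (\<lambda>x. gt x $ k) x) <= K * measure lborel (cball c r)"
  proof -
   have "\<forall>\<^sub>F n in sequentially. 1 / real (Suc n) < R / 4" using R by (intro eventually_inverse_Suc_less) simp
   with dec[OF c, of m] show ?thesis
   proof eventually_elim
    case (elim n)
    define a where "a = real (Suc n)"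
    have a: "a > 0" by (simp add: a_def)
    have sub: "cball c (r + 1 / a) \<subseteq> ball x0 R"
    proof
     fix y assume "y \<in> cball c (r + 1 / a)"
     then show "y \<in> ball x0 R" using c rR elim(2) dist_triangle[of x0 y c] by (simp add: a_def)
    qed
    have "\<sigma> * (LINT x:cball c r|lborel. moll a (\<lambda>x. gt x $ k) x) = (LINT x:cball c r|lborel. \<sigma> * moll a (\<lambda>x. gt x $ k) x)"
     by simp
    also have "... <= (LINT x:cball c r|lborel. 1 / (2 * K) * (norm (Ga a x))^2 + K / 2)"
    proof (rule set_integral_mono)
     show "set_integrable lborel (cball c r) (\<lambda>x. \<sigma> * moll a (\<lambda>x. gt x $ k) x)"
      by (intro set_integrable_cball continuous_intros continuous_moll[OF a h])
     show "set_integrable lborel (cball c r) (\<lambda>x. 1 / (2 * K) * (norm (Ga a x))^2 + K / 2)"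
      by (intro set_integrable_cball continuous_intros continuous_Ga[OF a])
     fix x assume x: "x \<in> cball c r"
     have "moll a (\<lambda>x. gt x $ k) x = Ga a x $ k"
      by (simp add: moll_nth[OF a integrable_gt] Ga_eq[OF a cball_subset_shift[OF x sub]])
     moreover have "\<bar>\<sigma>\<bar> = 1" using \<sigma> by (auto simp: power2_eq_1_iff)
     ultimately have "\<sigma> * moll a (\<lambda>x. gt x $ k) x <= norm (Ga a x)"
      using component_le_norm_cart[of "Ga a x" k] abs_ge_self[of "\<sigma> * Ga a x $ k"] by (simp add: abs_mult)
     also have "... <= 1 / (2 * K) * (norm (Ga a x))^2 + K / 2"
     proof -
      have "(norm (Ga a x) - K)^2 = (norm (Ga a x))^2 + K * K - 2 * K * norm (Ga a x)"
       unfolding power2_eq_square by (simp add: algebra_simps)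
      then have "2 * K * norm (Ga a x) <= (norm (Ga a x))^2 + K * K"
       using zero_le_power2[of "norm (Ga a x) - K"] by linarith
      then show ?thesis using K(1) by (simp add: field_simps)
     qed
     finally show "\<sigma> * moll a (\<lambda>x. gt x $ k) x <= 1 / (2 * K) * (norm (Ga a x))^2 + K / 2" .
    qed
    also have "... = 1 / (2 * K) * ball_energy c r (Ga a) + K / 2 * measure lborel (cball c r)"
     unfolding ball_energy_def
     using K(1) by (subst set_integral_add) (auto intro!: set_integrable_cball continuous_intros continuous_Ga[OF a] simp: set_lebesgue_integral_def)
    also have "... <= 1 / (2 * K) * (M * r ^ CARD('n)) + K / 2 * measure lborel (cball c r)"
     using elim(1) K(1) by (intro add_right_mono mult_left_mono) (auto simp: a_def r_def)
    also have "... = K * measure lborel (cball c r)"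
    proof -
     have "measure lborel (cball c r) = \<omega> * r ^ CARD('n)" using r by (simp add: measure_cball_eq \<omega>_def)
     then show ?thesis using K(1) by (simp add: K(2)[symmetric] field_simps power2_eq_square)
    qed
    finally show ?case by (simp add: a_def)
   qed
  qed
  ultimately have "\<sigma> * (LINT x:cball c r|lborel. gt x $ k) <= K * measure lborel (cball c r)"
   by (intro tendsto_upperbound) auto
  then show "\<exists>r>0. r < d \<and> (LINT x:cball c r|lborel. \<sigma> * gt x $ k) <= K * measure lborel (cball c r)"
   using r by (intro exI[of _ r]) simp
 qed auto
 have "AE x in lborel. \<forall>k. x \<in> ball x0 (R / 2) --> 1 * gt x $ k <= K"
  "AE x in lborel. \<forall>k. x \<in> ball x0 (R / 2) --> (-1) * gt x $ k <= K" unfolding AE_all_countable by (intro allI comp, simp)+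
 then show ?thesis
 proof eventually_elim
  case (elim x)
  show ?case
  proof
   assume x: "x \<in> ball x0 (R / 2)"
   then have "gt x = g x" using R by (simp add: gt_def)
   have "\<bar>g x $ k\<bar> <= K" for k
    using elim(1)[rule_format, OF x, of k] elim(2)[rule_format, OF x, of k] \<open>gt x = g x\<close> by (simp add: abs_le_iff)
   then have "norm (g x) <= (\<Sum>k\<in>(UNIV :: 'n set). K)"
    using norm_le_l1_cart[of "g x"] sum_mono[of UNIV "\<lambda>k. \<bar>g x $ k\<bar>" "\<lambda>k. K"] by (simp add: order_trans)
   then show "norm (g x) <= real CARD('n) * sqrt (M / unit_ball_vol (real CARD('n)))" by (simp add: K_def \<omega>_def)
  qed
 qed
qed

end

section \<open>Pointwise bounds from energy decay\<close>

context weak_data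
begin

lemma vol_pos: "0 < unit_ball_vol (real CARD('n))" by (rule unit_ball_vol_pos) simp

lemma measure_ball_eq: "measure lborel (ball x0 R) = unit_ball_vol (real CARD('n)) * R ^ CARD('n)"
 using R by (simp add: content_ball)

lemma avg_grad: "avg (ball x0 R) (\<lambda>x. (norm (g x))^2) = grad_energy / (unit_ball_vol (real CARD('n)) * R ^ CARD('n))"
 by (simp add: avg_def grad_energy_def measure_ball_eq)

lemma avg_source: "avg (ball x0 R) (\<lambda>x. \<bar>f x\<bar> powr p) = source_energy / (unit_ball_vol (real CARD('n)) * R ^ CARD('n))"
 by (simp add: avg_def source_energy_def measure_ball_eq)

lemma source_energy_nonneg: "0 <= source_energy"
 unfolding source_energy_def set_lebesgue_integral_def by (intro integral_nonneg_AE AE_I2) auto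

text \<open>\<open>t\<close> stands for the normalized L^p size of the source and must be positive
  even if that vanishes. So it is taken too large by 1 / (n + 1), and the excess is removed through
  a countable intersection of almost-everywhere statements.\<close>

lemma gradient_bound_of_decay:
 fixes \<theta> K :: real
 defines "avgG \<equiv> grad_energy / (unit_ball_vol (real CARD('n)) * R ^ CARD('n))" and "avgF \<equiv> source_energy / (unit_ball_vol (real CARD('n)) * R ^ CARD('n))"
 assumes K: "0 < K" and \<theta>: "0 < \<theta>" "\<theta> < 1"
  and dec: "!!t c m. 0 < t ==> source_energy <= unit_ball_vol (real CARD('n)) * R ^ CARD('n) * t powr p ==> c \<in> ball x0 (R / 2) ==>
   \<forall>\<^sub>F n in sequentially. ball_energy c (\<theta> ^ m * (R / 8)) (Ga (real (Suc n)))
    <= K * (avgG + (R * t)^2) * (\<theta> ^ m * (R / 8)) ^ CARD('n)"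
 shows "AE x in lborel. x \<in> ball x0 (R / 2) -->
  norm (g x) <= real CARD('n) * sqrt (K / unit_ball_vol (real CARD('n))) * (sqrt avgG + R * avgF powr (1 / p))"
proof -
 define T0 where "T0 = avgF powr (1 / p)"
 have V: "0 < unit_ball_vol (real CARD('n)) * R ^ CARD('n)" using vol_pos R by simp
 have avgG: "0 <= avgG" using grad_energy_nonneg V by (simp add: avgG_def)
 have avgF: "0 <= avgF" using source_energy_nonneg V by (simp add: avgF_def)
 have T0: "0 <= T0" "T0 powr p = avgF" using p avgF by (auto simp: T0_def powr_powr)
 define D where "D = real CARD('n) * sqrt (K / unit_ball_vol (real CARD('n)))"
 have D: "0 <= D" using K vol_pos by (simp add: D_def)
 have "AE x in lborel. x \<in> ball x0 (R / 2) --> norm (g x) <= D * (sqrt avgG + R * (T0 + 1 / real (Suc n)))" for n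
 proof -
  define t where "t = T0 + 1 / real (Suc n)"
  have t: "0 < t" using T0 by (simp add: t_def add_nonneg_pos)
  have "avgF <= t powr p" unfolding T0(2)[symmetric] using T0(1) p by (intro powr_mono2) (auto simp: t_def)
  then have "source_energy <= unit_ball_vol (real CARD('n)) * R ^ CARD('n) * t powr p"
   using V by (simp add: avgF_def divide_le_eq mult.commute)
  note d = dec[OF t this]
  define M where "M = K * (avgG + (R * t)^2)"
  have M: "0 < M" unfolding M_def using K avgG R t by (intro mult_pos_pos add_nonneg_pos) auto
  have "AE x in lborel. x \<in> ball x0 (R / 2) --> norm (g x) <= real CARD('n) * sqrt (M / unit_ball_vol (real CARD('n)))"
   by (rule gradient_bound_of_energy[OF \<theta> _ _ M d[folded M_def]]) (use R in auto)
  moreover have "sqrt (M / unit_ball_vol (real CARD('n))) <= sqrt (K / unit_ball_vol (real CARD('n))) * (sqrt avgG + R * t)"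
  proof -
   have "M / unit_ball_vol (real CARD('n)) = K / unit_ball_vol (real CARD('n)) * (avgG + (R * t)^2)" by (simp add: M_def)
   then have "sqrt (M / unit_ball_vol (real CARD('n))) = sqrt (K / unit_ball_vol (real CARD('n))) * sqrt (avgG + (R * t)^2)" by (simp only: real_sqrt_mult)
   also have "... <= sqrt (K / unit_ball_vol (real CARD('n))) * (sqrt avgG + sqrt ((R * t)^2))"
    using K vol_pos avgG by (intro mult_left_mono sqrt_add_le_add_sqrt) auto
   finally show ?thesis using R t by simp
  qed
  then have "real CARD('n) * sqrt (M / unit_ball_vol (real CARD('n))) <= D * (sqrt avgG + R * t)"
   unfolding D_def mult.assoc by (rule mult_left_mono) simp
  ultimately show ?thesis unfolding t_def[symmetric] by (auto elim!: eventually_mono)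
 qed
 then have "AE x in lborel. \<forall>n. x \<in> ball x0 (R / 2) --> norm (g x) <= D * (sqrt avgG + R * (T0 + 1 / real (Suc n)))"
  by (subst AE_all_countable) blast
 then show ?thesis
 proof eventually_elim
  case (elim x)
  show ?case
  proof
   assume x: "x \<in> ball x0 (R / 2)"
   have "(\<lambda>n. D * (sqrt avgG + R * (T0 + 1 / real (Suc n)))) \<longlonglongrightarrow> D * (sqrt avgG + R * (T0 + 0))"
    using LIMSEQ_inverse_real_of_nat by (intro tendsto_intros) (simp only: inverse_eq_divide)
   then have "norm (g x) <= D * (sqrt avgG + R * (T0 + 0))" by (rule LIMSEQ_le_const) (use elim x in auto)
   then show "norm (g x) <= real CARD('n) * sqrt (K / unit_ball_vol (real CARD('n))) * (sqrt avgG + R * avgF powr (1 / p))"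
    by (simp add: D_def T0_def)
  qed
 qed
qed

lemma eventually_defect_small:
 assumes c: "c \<in> ball x0 (R / 2)" and s: "0 < s" "s <= R / 4" and e: "0 < e"
 shows "\<forall>\<^sub>F n in sequentially. ball_energy c s (\<lambda>x. Fa (real (Suc n)) x - clamped_coeff (7 * R / 8) x *v Ga (real (Suc n)) x) <= e"
proof -
 \<comment> \<open>\<open>grad_energy\<close> may vanish, hence the added 1.\<close>
 define e' where "e' = sqrt (e / (grad_energy + 1))"
 have gp: "0 < grad_energy + 1" using grad_energy_nonneg by linarith
 then have e': "e' > 0" "e'^2 * (grad_energy + 1) = e" using e by (auto simp: e'_def)
 obtain d where d: "d > 0" "!!x y \<xi>. x \<in> cball x0 (7 * R / 8) ==> y \<in> cball x0 (7 * R / 8) ==> dist x y <= d ==> norm ((A y - A x) *v \<xi>) <= e' * norm \<xi>"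
  using oscillation_small[of "7 * R / 8" e'] e' R by auto
 have "\<forall>\<^sub>F n in sequentially. 1 / real (Suc n) < min d (R / 16)" using d R by (intro eventually_inverse_Suc_less) simp
 then show ?thesis
 proof eventually_elim
  case (elim n)
  define a where "a = real (Suc n)"
  have a: "a > 0" "1 / a < d" "1 / a < R / 16" using elim by (auto simp: a_def)
  have "ball_energy c s (\<lambda>x. Fa a x - clamped_coeff (7 * R / 8) x *v Ga a x) <= e'^2 * grad_energy"
  proof (rule energy_defect[OF a(1) _ _ s(1)])
   show "cball c (s + 1 / a) \<subseteq> cball x0 (7 * R / 8)"
   proof
    fix y assume "y \<in> cball c (s + 1 / a)"
    then show "y \<in> cball x0 (7 * R / 8)" using c s a dist_triangle[of x0 y c] by simp
   qed
   show "norm ((A y - A x) *v \<xi>) <= e' * norm \<xi>" if "x \<in> cball x0 (7 * R / 8)" "y \<in> cball x0 (7 * R / 8)" "dist x y <= 1 / a" for x y \<xi>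
    using d(2)[OF that(1,2)] that(3) a by simp
  qed (use R e' in auto)
  also have "... <= e'^2 * (grad_energy + 1)" by (intro mult_left_mono) auto
  finally show ?case by (simp add: e' a_def)
 qed
qed

lemma eventually_cball_inside:
 assumes c: "c \<in> ball x0 (R / 2)" and s: "s <= R / 4"
 shows "\<forall>\<^sub>F n in sequentially. cball c (s + 1 / real (Suc n)) \<subseteq> ball x0 R"
proof -
 have "\<forall>\<^sub>F n in sequentially. 1 / real (Suc n) < R / 16" using R by (intro eventually_inverse_Suc_less) simp
 then show ?thesis
 proof eventually_elim
  case (elim n)
  show ?case
  proof
   fix y assume "y \<in> cball c (s + 1 / real (Suc n))"
   then show "y \<in> ball x0 R" using c s elim dist_triangle[of x0 y c] R by simp
  qed
 qed
qed

text \<open>The height w = t (s / R)^(- d / p) balances the two terms of \<open>energy_fa\<close>.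
  Then s w equals R t (s / R)^(1 - d / p), which decays with s when p > d.\<close>

lemma source_decay:
 fixes s t :: real
 defines "d \<equiv> CARD('n)"
 assumes p2: "2 <= p" and t: "0 < t" "source_energy <= unit_ball_vol (real CARD('n)) * R ^ d * t powr p"
  and s: "0 < s" and a: "a > 0" "1 / a <= s" and sub: "cball c (s + 1 / a) \<subseteq> ball x0 R"
 shows "s^2 * ball_energy c s (fa a) <= unit_ball_vol (real CARD('n)) * (2 ^ d + 1) * (R * t)^2 * ((s / R) powr (1 - real d / p))^2 * s ^ d"
proof -
 define z where "z = s / R"
 have z: "0 < z" using s R by (simp add: z_def)
 define w where "w = t * z powr (- (real d / p))"
 have w: "0 < w" using t z by (simp add: w_def)
 have w2: "w^2 = t^2 * (z powr (- (real d / p)))^2" by (simp add: w_def power_mult_distrib)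
 have "ball_energy c s (fa a) <= w^2 * (unit_ball_vol (real CARD('n)) * (s + 1 / a) ^ d) + w powr (2 - p) * source_energy"
  unfolding d_def by (rule energy_fa[OF a(1) sub s p2 w])
 also have "... <= w^2 * (unit_ball_vol (real CARD('n)) * (2 * s) ^ d) + w powr (2 - p) * (unit_ball_vol (real CARD('n)) * R ^ d * t powr p)"
  using a s vol_pos t by (intro add_mono mult_left_mono power_mono) auto
 also have "w powr (2 - p) * (unit_ball_vol (real CARD('n)) * R ^ d * t powr p) = unit_ball_vol (real CARD('n)) * w^2 * s ^ d"
 proof -
  have "w powr (2 - p) = w^2 / w powr p" using w by (simp add: powr_diff)
  moreover have "w powr p = t powr p / z ^ d"
  proof -
   have "w powr p = t powr p * (z powr (- (real d / p))) powr p" using t z by (simp add: w_def powr_mult)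
   also have "(z powr (- (real d / p))) powr p = z powr (- real d)" using p by (simp add: powr_powr)
   also have "... = 1 / z ^ d" using z by (simp add: powr_minus powr_realpow inverse_eq_divide)
   finally show ?thesis by simp
  qed
  moreover have "z ^ d * R ^ d = s ^ d" using R by (simp add: z_def power_divide)
  ultimately show ?thesis using t z by (simp add: field_simps)
 qed
 also have "w^2 * (unit_ball_vol (real CARD('n)) * (2 * s) ^ d) + unit_ball_vol (real CARD('n)) * w^2 * s ^ d = unit_ball_vol (real CARD('n)) * (2 ^ d + 1) * w^2 * s ^ d"
  by (simp add: power_mult_distrib algebra_simps)
 finally have "s^2 * ball_energy c s (fa a) <= s^2 * (unit_ball_vol (real CARD('n)) * (2 ^ d + 1) * w^2 * s ^ d)"
  by (rule mult_left_mono) simp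
 also have "s^2 * (unit_ball_vol (real CARD('n)) * (2 ^ d + 1) * w^2 * s ^ d) = unit_ball_vol (real CARD('n)) * (2 ^ d + 1) * (R * t)^2 * (z powr (1 - real d / p))^2 * s ^ d"
 proof -
  have "z powr (1 - real d / p) = z * z powr (- (real d / p))" using z by (simp add: powr_diff powr_minus divide_inverse)
  moreover have "s = R * z" using R by (simp add: z_def)
  ultimately show ?thesis by (simp add: w2 power_mult_distrib algebra_simps)
 qed
 finally show ?thesis unfolding z_def .
qed

end

section \<open>The one-dimensional case\<close>

lemma lborel_line:
 assumes U: "UNIV = {k :: 'n::finite}"
 shows "lborel = distr lborel borel (\<lambda>t::real. t *\<^sub>R (axis k 1 :: real^'n))"
proof (rule lborel_eqI)
 fix l u :: "real^'n" assume le: "!!b. b \<in> Basis ==> l \<bullet> b <= u \<bullet> b"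
 have B: "(Basis :: (real^'n) set) = {axis k 1}" using U by (auto simp: Basis_vec_def)
 have m: "(\<lambda>t::real. t *\<^sub>R (axis k 1 :: real^'n)) \<in> borel_measurable borel"
  by (intro borel_measurable_continuous_onI continuous_intros)
 have "(\<lambda>t::real. t *\<^sub>R (axis k 1 :: real^'n)) -` box l u = {l $ k<..<u $ k}" by (auto simp: box_def B inner_axis)
 then have "emeasure (distr lborel borel (\<lambda>t::real. t *\<^sub>R (axis k 1 :: real^'n))) (box l u) = emeasure lborel {l $ k<..<u $ k}"
  using m by (subst emeasure_distr) auto
 also have "... = ennreal (u $ k - l $ k)" using le[of "axis k 1"] by (simp add: B inner_axis)
 also have "... = (\<Prod>b\<in>Basis. (u - l) \<bullet> b)" by (simp add: B inner_axis)
 finally show "emeasure (distr lborel borel (\<lambda>t::real. t *\<^sub>R (axis k 1 :: real^'n))) (box l u) = (\<Prod>b\<in>Basis. (u - l) \<bullet> b)" .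
qed simp

lemma one_dim_variation:
 fixes F :: "real^'n::finite => real^'n"
 assumes U: "UNIV = {k :: 'n}" and F: "div_pair F f" and x: "x \<in> cball c r" "y \<in> cball c r"
 shows "norm (F x - F y) <= (LINT z:cball c r|lborel. \<bar>f z\<bar>)"
proof -
 obtain F' where F': "!!x. (F has_derivative F' x) (at x)"
  "!!i. continuous_on UNIV (\<lambda>x. F' x (axis i 1) $ i)" "!!x. f x = - (\<Sum>i\<in>UNIV. F' x (axis i 1) $ i)"
  using F unfolding div_pair_def by blast
 have f: "f z = - (F' z (axis k 1) $ k)" for z by (simp add: F'(3) U)
 have cf: "continuous_on UNIV f" unfolding f by (intro continuous_intros F'(2))
 define e :: "real^'n" where "e = axis k 1"
 have vec: "v = (v $ k) *\<^sub>R e" for v :: "real^'n"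
  unfolding vec_eq_iff e_def using U by (metis (full_types) UNIV_I axis_nth mult.right_neutral real_scaleR_def singletonD vector_scaleR_component)
 have nrm: "norm v = \<bar>v $ k\<bar>" for v :: "real^'n" by (subst vec) (simp add: e_def norm_axis_1)
 have cball: "t *\<^sub>R e \<in> cball c r \<longleftrightarrow> t \<in> {c $ k - r .. c $ k + r}" for t
  by (simp add: dist_norm nrm e_def) (auto simp: abs_le_iff)
 have der: "((\<lambda>t. F (t *\<^sub>R e) $ k) has_real_derivative - f (t *\<^sub>R e)) (at t)" for t
 proof -
  have "((\<lambda>t. t *\<^sub>R e) has_derivative (\<lambda>h. h *\<^sub>R e)) (at t)" by (auto intro!: derivative_eq_intros)
  from has_derivative_compose[OF this F'(1)]
  have "((\<lambda>t. F (t *\<^sub>R e)) has_derivative (\<lambda>h. F' (t *\<^sub>R e) (h *\<^sub>R e))) (at t)" .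
  from bounded_linear.has_derivative[OF bounded_linear_vec_nth this, of k]
  have "((\<lambda>t. F (t *\<^sub>R e) $ k) has_derivative (\<lambda>h. F' (t *\<^sub>R e) (h *\<^sub>R e) $ k)) (at t)" .
  moreover have "F' (t *\<^sub>R e) (h *\<^sub>R e) $ k = - f (t *\<^sub>R e) * h" for h
   using linear_scale[OF has_derivative_linear[OF F'(1)]] by (simp add: f e_def)
  then have "(\<lambda>h. F' (t *\<^sub>R e) (h *\<^sub>R e) $ k) = (*) (- f (t *\<^sub>R e))" by (intro ext)
  ultimately show ?thesis by (simp only: has_field_derivative_def)
 qed
 have cfe: "continuous_on UNIV (\<lambda>t. f (t *\<^sub>R e))"
  by (rule continuous_on_compose2[OF cf]) (auto intro!: continuous_intros)
 have main: "\<bar>F (t *\<^sub>R e) $ k - F (s *\<^sub>R e) $ k\<bar> <= (LINT z:cball c r|lborel. \<bar>f z\<bar>)"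
  if st: "s <= t" "s *\<^sub>R e \<in> cball c r" "t *\<^sub>R e \<in> cball c r" for s t
 proof -
  have "(\<integral>z. - f (z *\<^sub>R e) * indicator {s .. t} z \<partial>lborel) = F (t *\<^sub>R e) $ k - F (s *\<^sub>R e) $ k"
   by (rule integral_FTC_Icc_real[OF st(1) der])
     (use cfe in \<open>auto simp: continuous_on_eq_continuous_at intro!: continuous_intros\<close>)
  then have "\<bar>F (t *\<^sub>R e) $ k - F (s *\<^sub>R e) $ k\<bar> = norm (\<integral>z. - f (z *\<^sub>R e) * indicator {s .. t} z \<partial>lborel)" by simp
  also have "... <= (\<integral>z. indicat_real (cball c r) (z *\<^sub>R e) * \<bar>f (z *\<^sub>R e)\<bar> \<partial>lborel)"
  proof (rule norm_integral_le_dominated)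
   have "set_integrable lborel {s .. t} (\<lambda>z. - f (z *\<^sub>R e))"
    by (intro borel_integrable_atLeastAtMost' continuous_intros continuous_on_subset[OF cfe]) auto
   then show "integrable lborel (\<lambda>z. - f (z *\<^sub>R e) * indicator {s .. t} z)"
    by (simp add: set_integrable_def mult.commute)
   have "set_integrable lborel {c $ k - r .. c $ k + r} (\<lambda>z. \<bar>f (z *\<^sub>R e)\<bar>)"
    by (intro borel_integrable_atLeastAtMost' continuous_intros continuous_on_subset[OF cfe]) auto
   moreover have "indicat_real (cball c r) (z *\<^sub>R e) = indicator {c $ k - r .. c $ k + r} z" for z
    using cball[of z] by (simp add: indicator_def)
   ultimately show "integrable lborel (\<lambda>z. indicat_real (cball c r) (z *\<^sub>R e) * \<bar>f (z *\<^sub>R e)\<bar>)"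
    by (simp add: set_integrable_def)
   show "norm (- f (z *\<^sub>R e) * indicator {s .. t} z) <= indicat_real (cball c r) (z *\<^sub>R e) * \<bar>f (z *\<^sub>R e)\<bar>" for z
    using cball[of z] cball[of s] cball[of t] st by (auto simp: indicator_def)
  qed
  also have "... = (LINT z:cball c r|lborel. \<bar>f z\<bar>)"
  proof -
   have 1: "(\<lambda>t. t *\<^sub>R e) \<in> borel_measurable borel" by (intro borel_measurable_continuous_onI continuous_intros)
   have 2: "(\<lambda>z. indicat_real (cball c r) z *\<^sub>R \<bar>f z\<bar>) \<in> borel_measurable borel"
    by (intro borel_measurable_scaleR borel_measurable_indicator borel_measurable_continuous_onI continuous_intros cf) auto
   have "(\<integral>z. indicat_real (cball c r) z *\<^sub>R \<bar>f z\<bar> \<partial>lborel) = (\<integral>z. indicat_real (cball c r) z *\<^sub>R \<bar>f z\<bar> \<partial>distr lborel borel (\<lambda>t. t *\<^sub>R e))"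
    unfolding e_def by (rule arg_cong[OF lborel_line[OF U]])
   also have "... = (\<integral>t. indicat_real (cball c r) (t *\<^sub>R e) *\<^sub>R \<bar>f (t *\<^sub>R e)\<bar> \<partial>lborel)"
    by (rule integral_distr) (use 1 2 in auto)
   finally show ?thesis by (simp add: set_lebesgue_integral_def)
  qed
  finally show ?thesis .
 qed
 have "\<bar>F ((x $ k) *\<^sub>R e) $ k - F ((y $ k) *\<^sub>R e) $ k\<bar> <= (LINT z:cball c r|lborel. \<bar>f z\<bar>)"
  using main[of "x $ k" "y $ k"] main[of "y $ k" "x $ k"] x vec[of x] vec[of y]
  by (cases "x $ k <= y $ k") (simp_all add: abs_minus_commute)
 then show ?thesis by (simp add: nrm flip: vec)
qed

context weak_data
begin

lemma clamped_coeff_bounds: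
 assumes "0 < r" "r < R"
 shows "norm (clamped_coeff r x *v \<xi>) <= \<Lambda> * norm \<xi>" "\<mu> * (norm \<xi>)^2 <= \<xi> \<bullet> (clamped_coeff r x *v \<xi>)"
 using bd[OF clamped_coeff(3)[OF assms]] el[OF clamped_coeff(3)[OF assms]] by (auto simp: clamped_coeff_def)

lemma integral_source_le:
 assumes t: "0 < t" "source_energy <= unit_ball_vol (real CARD('n)) * R ^ CARD('n) * t powr p"
 shows "(\<integral>y. \<bar>ft y\<bar> \<partial>lborel) <= 2 * (unit_ball_vol (real CARD('n)) * R ^ CARD('n) * t)"
proof -
 have pt: "y <= t + t powr (1 - p) * y powr p" if "0 <= y" for y
 proof (cases "y <= t")
  case False
  then have y: "y > t" "y > 0" using t by auto
  have "y powr 1 = y powr (1 - p) * y powr p" by (simp only: powr_add[symmetric] diff_add_cancel)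
  also have "... <= t powr (1 - p) * y powr p" using p t y by (intro mult_right_mono powr_mono2') auto
  finally show ?thesis using t y by simp
 qed (simp add: add_increasing2)
 have ib: "integrable lborel (\<lambda>y. indicat_real (ball x0 R) y *\<^sub>R (1 :: real))"
  using set_integrable_subset[OF set_integrable_cball[OF continuous_on_const, of x0 R "1 :: real"], of "ball x0 R"]
  by (auto simp: set_integrable_def)
 have "(\<integral>y. \<bar>ft y\<bar> \<partial>lborel) <= (\<integral>y. t * (indicat_real (ball x0 R) y *\<^sub>R 1) + t powr (1 - p) * (indicat_real (ball x0 R) y *\<^sub>R \<bar>f y\<bar> powr p) \<partial>lborel)"
 proof (rule integral_mono)
  show "integrable lborel (\<lambda>y. \<bar>ft y\<bar>)" using integrable_ft by simp
  show "integrable lborel (\<lambda>y. t * (indicat_real (ball x0 R) y *\<^sub>R 1) + t powr (1 - p) * (indicat_real (ball x0 R) y *\<^sub>R \<bar>f y\<bar> powr p))"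
   using ib fp by (intro Bochner_Integration.integrable_add integrable_mult_right) (auto simp: set_integrable_def)
  show "\<bar>ft y\<bar> <= t * (indicat_real (ball x0 R) y *\<^sub>R 1) + t powr (1 - p) * (indicat_real (ball x0 R) y *\<^sub>R \<bar>f y\<bar> powr p)" for y
   using pt[of "\<bar>f y\<bar>"] by (auto simp: indicator_def ft_def)
 qed
 also have "... = t * measure lborel (ball x0 R) + t powr (1 - p) * source_energy"
  using ib fp by (subst Bochner_Integration.integral_add) (auto simp: set_integrable_def source_energy_def set_lebesgue_integral_def)
 also have "... <= t * measure lborel (ball x0 R) + t powr (1 - p) * (unit_ball_vol (real CARD('n)) * R ^ CARD('n) * t powr p)"
  by (intro add_left_mono mult_left_mono t(2)) simp
 also have "t powr (1 - p) * (unit_ball_vol (real CARD('n)) * R ^ CARD('n) * t powr p) = unit_ball_vol (real CARD('n)) * R ^ CARD('n) * t"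
  using t by (simp add: powr_diff)
 finally show ?thesis by (simp add: measure_ball_eq mult.commute)
qed

text \<open>No iteration over scales: the flux is bounded pointwise by its mean square over the ball
  of radius R / 8 and its variation, and ellipticity bounds the gradient by flux and defect. The
  shape is that required by \<open>gradient_bound_of_decay\<close> with \<theta> = 1/2.\<close>

lemma one_dim_decay:
 fixes t :: real and m :: nat
 defines "W \<equiv> unit_ball_vol (real CARD('n))"
 assumes U: "UNIV = {k :: 'n}" and t: "0 < t" "source_energy <= W * R ^ CARD('n) * t powr p"
  and c: "c \<in> ball x0 (R / 2)"
 shows "\<forall>\<^sub>F n in sequentially. ball_energy c ((1 / 2) ^ m * (R / 8)) (Ga (real (Suc n)))
  <= 2 * W / \<mu>^2 * (32 * \<Lambda>^2 + 5 + 8 * W^2) * (grad_energy / (W * R ^ CARD('n)) + (R * t)^2) * ((1 / 2) ^ m * (R / 8)) ^ CARD('n)"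
proof -
 have d1: "CARD('n) = 1" using U by (metis is_singletonI is_singleton_altdef)
 have W: "0 < W" unfolding W_def by (rule vol_pos)
 define r where "r = (1 / 2) ^ m * (R / 8)"
 have "(1 / 2 :: real) ^ m <= 1" by (rule power_le_one) auto
 then have r: "0 < r" "r <= R / 8" using R mult_right_mono[of "(1 / 2) ^ m" 1 "R / 8"] by (auto simp: r_def)
 define e1 where "e1 = (R * t)^2 * W * r"
 have e1: "0 < e1" using R t W r by (simp add: e1_def)
 define avgG where "avgG = grad_energy / (W * R)"
 have avgG: "0 <= avgG" using grad_energy_nonneg W R by (simp add: avgG_def)
 have rr: "0 < 7 * R / 8" "7 * R / 8 < R" using R by auto
 have mc: "measure lborel (cball c s) = W * s" if "0 <= s" for s
  using measure_cball_eq[OF that, of c] by (simp add: W_def d1)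
 have "\<forall>\<^sub>F n in sequentially. ball_energy c (R / 8) (\<lambda>x. Fa (real (Suc n)) x - clamped_coeff (7 * R / 8) x *v Ga (real (Suc n)) x) <= e1"
  using R by (intro eventually_defect_small c e1) auto
 moreover have "\<forall>\<^sub>F n in sequentially. cball c (R / 8 + 1 / real (Suc n)) \<subseteq> ball x0 R"
  using R by (intro eventually_cball_inside c) auto
 ultimately have "\<forall>\<^sub>F n in sequentially. ball_energy c r (Ga (real (Suc n)))
  <= 2 * W / \<mu>^2 * (32 * \<Lambda>^2 + 5 + 8 * W^2) * (avgG + (R * t)^2) * r"
 proof eventually_elim
  case (elim n)
  define a where "a = real (Suc n)"
  have a: "a > 0" by (simp add: a_def)
  have sub: "cball c (R / 8 + 1 / a) \<subseteq> ball x0 R" using elim by (simp add: a_def)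
  define M where "M = clamped_coeff (7 * R / 8)"
  define E where "E x = Fa a x - M x *v Ga a x" for x
  note dp = div_pair_moll[OF a]
  have cF: "continuous_on UNIV (Fa a)" and cf: "continuous_on UNIV (fa a)" using div_pair_cont[OF dp] by auto
  note cG = continuous_Ga[OF a]
  have cM: "continuous_on UNIV (\<lambda>x. M x *v Ga a x)"
   unfolding M_def by (intro continuous_on_mv clamped_coeff(2)[OF rr] cG)
  have cE: "continuous_on UNIV E" unfolding E_def by (intro continuous_intros cF cM)
  have eE: "ball_energy c (R / 8) E <= e1" using elim by (simp add: E_def[abs_def] M_def a_def)
  define J where "J = (LINT z:cball c (R / 8)|lborel. \<bar>fa a z\<bar>)"
  have "J <= (LINT z:cball c (R / 8)|lborel. moll a (\<lambda>y. norm (ft y)) z)" unfolding J_def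
  proof (rule set_integral_mono)
   show "set_integrable lborel (cball c (R / 8)) (\<lambda>z. \<bar>fa a z\<bar>)" by (intro set_integrable_cball continuous_intros cf)
   show "set_integrable lborel (cball c (R / 8)) (moll a (\<lambda>y. norm (ft y)))"
    by (intro set_integrable_cball continuous_moll[OF a] integrable_norm integrable_ft)
   show "\<bar>fa a z\<bar> <= moll a (\<lambda>y. norm (ft y)) z" if "z \<in> cball c (R / 8)" for z
    using norm_moll_le[OF a integrable_ft, of z] by (simp add: fa_eq[OF a cball_subset_shift[OF that sub]])
  qed
  also have "... <= (LINT z:UNIV|lborel. norm (ft z))"
   by (rule integral_moll_cball_le[OF a integrable_norm[OF integrable_ft]]) auto
  also have "... <= 2 * (W * R * t)"
   using integral_source_le[OF t[unfolded W_def]] by (simp add: set_lebesgue_integral_def d1 W_def)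
  finally have J: "J <= 2 * (W * R * t)" .
  have J0: "0 <= J" unfolding J_def set_lebesgue_integral_def by (intro integral_nonneg_AE AE_I2) auto
  have IF: "ball_energy c (R / 8) (Fa a) <= 2 * (\<Lambda>^2 * grad_energy) + 2 * e1"
  proof -
   have "ball_energy c (R / 8) (Fa a) = ball_energy c (R / 8) (\<lambda>x. M x *v Ga a x + E x)" by (simp add: E_def)
   also have "... <= 2 * ball_energy c (R / 8) (\<lambda>x. M x *v Ga a x) + 2 * ball_energy c (R / 8) E"
    by (rule ball_energy_add[OF cM cE])
   also have "ball_energy c (R / 8) (\<lambda>x. M x *v Ga a x) <= ball_energy c (R / 8) (\<lambda>x. \<Lambda> *\<^sub>R Ga a x)"
    using clamped_coeff_bounds(1)[OF rr]
    by (intro ball_energy_mono_fun cM continuous_intros cG) (auto simp: M_def intro: order_trans[OF _ mult_right_mono[OF abs_ge_self norm_ge_zero]])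
   also have "... <= \<Lambda>^2 * grad_energy" unfolding ball_energy_cmul by (intro mult_left_mono energy_Ga[OF a sub]) simp
   finally show ?thesis using eE by simp
  qed
  \<comment> \<open>Twice the mean of |F|^2 over the ball plus twice the squared variation.\<close>
  define Q where "Q = 2 * (2 * (\<Lambda>^2 * grad_energy) + 2 * e1) / (W * (R / 8)) + 2 * J^2"
  have Fx: "(norm (Fa a x))^2 <= Q" if x: "x \<in> cball c (R / 8)" for x
  proof -
   have "(LINT y:cball c (R / 8)|lborel. (norm (Fa a x))^2) <= (LINT y:cball c (R / 8)|lborel. 2 * (norm (Fa a y))^2 + 2 * J^2)"
   proof (rule set_integral_mono)
    show "set_integrable lborel (cball c (R / 8)) (\<lambda>y. (norm (Fa a x))^2)"
     "set_integrable lborel (cball c (R / 8)) (\<lambda>y. 2 * (norm (Fa a y))^2 + 2 * J^2)"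
     by (intro set_integrable_cball continuous_intros cF)+
    fix y assume y: "y \<in> cball c (R / 8)"
    have "norm (Fa a x) <= norm (Fa a y) + J"
     using one_dim_variation[OF U dp x y] norm_triangle_sub[of "Fa a x" "Fa a y"] by (simp add: J_def)
    then have "(norm (Fa a x))^2 <= (norm (Fa a y) + J)^2" by (intro power_mono) auto
    also have "... <= 2 * (norm (Fa a y))^2 + 2 * J^2"
    proof -
     have "2 * (norm (Fa a y))^2 + 2 * J^2 - (norm (Fa a y) + J)\<^sup>2 = (norm (Fa a y) - J)^2"
      unfolding power2_eq_square by (simp add: algebra_simps)
     then show ?thesis using zero_le_power2[of "norm (Fa a y) - J"] by linarith
    qed
    finally show "(norm (Fa a x))^2 <= 2 * (norm (Fa a y))^2 + 2 * J^2" .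
   qed
   also have "... = 2 * ball_energy c (R / 8) (Fa a) + 2 * J^2 * (W * (R / 8))" unfolding ball_energy_def
    by (subst set_integral_add) (use mc[of "R / 8"] R in \<open>auto intro!: set_integrable_cball continuous_intros cF simp: set_lebesgue_integral_def algebra_simps\<close>)
   also have "(LINT y:cball c (R / 8)|lborel. (norm (Fa a x))^2) = (norm (Fa a x))^2 * (W * (R / 8))"
    using mc[of "R / 8"] R by (simp add: set_lebesgue_integral_def)
   finally have "(norm (Fa a x))^2 * (W * (R / 8)) <= 2 * ball_energy c (R / 8) (Fa a) + 2 * J^2 * (W * (R / 8))" .
   also have "... <= 2 * (2 * (\<Lambda>^2 * grad_energy) + 2 * e1) + 2 * J^2 * (W * (R / 8))"
    by (intro add_right_mono mult_left_mono IF) simp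
   finally have "(norm (Fa a x))^2 * (W * (R / 8)) <= 2 * (2 * (\<Lambda>^2 * grad_energy) + 2 * e1) + 2 * J^2 * (W * (R / 8))" .
   then show ?thesis unfolding Q_def using W R by (simp add: field_simps)
  qed
  have "ball_energy c r (Ga a) <= (LINT x:cball c r|lborel. 2 / \<mu>^2 * (Q + (norm (E x))^2))"
  proof (rule ball_energy_le_compare[OF cG])
   show "continuous_on UNIV (\<lambda>x. 2 / \<mu>^2 * (Q + (norm (E x))^2))" by (intro continuous_intros cE)
   fix x assume "x \<in> cball c r"
   then have x: "x \<in> cball c (R / 8)" using r by auto
   have "\<mu> * (norm (Ga a x))^2 <= norm (Ga a x) * norm (M x *v Ga a x)"
    using clamped_coeff_bounds(2)[OF rr, of "Ga a x" x] norm_cauchy_schwarz[of "Ga a x" "M x *v Ga a x"] by (simp add: M_def)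
   then have mG: "\<mu> * norm (Ga a x) <= norm (M x *v Ga a x)"
    by (cases "norm (Ga a x) = 0") (auto simp: power2_eq_square mult.left_commute)
   also have "... <= norm (Fa a x) + norm (E x)" using norm_triangle_ineq4[of "Fa a x" "E x"] by (simp add: E_def)
   finally have "(\<mu> * norm (Ga a x))^2 <= (norm (Fa a x) + norm (E x))^2" using \<mu> by (intro power_mono) auto
   also have "... <= 2 * ((norm (Fa a x))^2 + (norm (E x))^2)"
   proof -
    have "2 * ((norm (Fa a x))^2 + (norm (E x))^2) - (norm (Fa a x) + norm (E x))\<^sup>2 = (norm (Fa a x) - norm (E x))^2"
     unfolding power2_eq_square by (simp add: algebra_simps)
    then show ?thesis using zero_le_power2[of "norm (Fa a x) - norm (E x)"] by linarith
   qed
   also have "... <= 2 * (Q + (norm (E x))^2)" using Fx[OF x] by simp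
   finally have "\<mu>^2 * (norm (Ga a x))^2 <= 2 * (Q + (norm (E x))^2)" by (simp add: power_mult_distrib)
   then show "(norm (Ga a x))^2 <= 2 / \<mu>^2 * (Q + (norm (E x))^2)" using \<mu> by (simp add: pos_le_divide_eq mult.commute)
  qed
  also have "... = 2 / \<mu>^2 * (Q * (W * r) + ball_energy c r E)"
  proof -
   have "(LINT x:cball c r|lborel. Q + (norm (E x))^2) = Q * (W * r) + ball_energy c r E" unfolding ball_energy_def
    by (subst set_integral_add) (use mc[of r] r in \<open>auto intro!: set_integrable_cball continuous_intros cE simp: set_lebesgue_integral_def\<close>)
   then show ?thesis by (simp only: set_integral_mult_right)
  qed
  also have "... <= 2 / \<mu>^2 * (W * r * (32 * \<Lambda>^2 * avgG + (5 + 8 * W^2) * (R * t)^2))"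
  proof (rule mult_left_mono)
   have "ball_energy c r E <= e1" using ball_energy_mono[OF cE r(2), of c] eE by linarith
   moreover have "Q <= 32 * \<Lambda>^2 * avgG + (4 + 8 * W^2) * (R * t)^2"
   proof -
    have "2 * (2 * (\<Lambda>^2 * grad_energy) + 2 * e1) / (W * (R / 8)) = 32 * \<Lambda>^2 * avgG + 32 * (R * t)^2 * (r / R)"
     using W R by (simp add: avgG_def e1_def field_simps)
    also have "32 * (R * t)^2 * (r / R) <= 32 * (R * t)^2 * (1 / 8)"
     using r R by (intro mult_left_mono) (auto simp: field_simps)
    finally have "2 * (2 * (\<Lambda>^2 * grad_energy) + 2 * e1) / (W * (R / 8)) <= 32 * \<Lambda>^2 * avgG + 4 * (R * t)^2" by simp
    moreover have "J^2 <= (2 * (W * R * t))^2" by (rule power_mono[OF J J0])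
    moreover have "(2 * (W * R * t))^2 = 4 * (W^2 * (R * t)^2)" by (simp add: power_mult_distrib)
    ultimately show ?thesis unfolding Q_def by (simp add: algebra_simps)
   qed
   then have "Q * (W * r) <= (32 * \<Lambda>^2 * avgG + (4 + 8 * W^2) * (R * t)^2) * (W * r)"
    using W r by (intro mult_right_mono) auto
   ultimately show "Q * (W * r) + ball_energy c r E <= W * r * (32 * \<Lambda>^2 * avgG + (5 + 8 * W^2) * (R * t)^2)"
    unfolding e1_def by (simp add: algebra_simps)
  qed simp
  also have "... <= 2 / \<mu>^2 * (W * r * ((32 * \<Lambda>^2 + 5 + 8 * W^2) * (avgG + (R * t)^2)))"
  proof (intro mult_left_mono)
   have "0 <= (5 + 8 * W^2) * avgG" "0 <= 32 * \<Lambda>^2 * (R * t)^2" using avgG by auto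
   then show "32 * \<Lambda>^2 * avgG + (5 + 8 * W^2) * (R * t)^2 <= (32 * \<Lambda>^2 + 5 + 8 * W^2) * (avgG + (R * t)^2)"
    unfolding distrib_right distrib_left by linarith
  qed (use W r in auto)
  finally show ?case by (simp add: a_def ac_simps)
 qed
 then show ?thesis by (simp add: d1 avgG_def r_def)
qed

end

text \<open>Starts the energy decay at s0 = R / 8. For a fixed number \<open>m\<close> of scales the
  finitely many defect bounds hold together once the mollification is fine enough, and the kernel
  must also be smaller than the last radius; hence \<open>m\<close> is fixed before n tends to
  infinity.\<close>

lemma (in weak_data) multi_dim_decay:
 fixes \<theta> Kc D0 D1 t :: real and \<delta> \<epsilon> :: "nat => real" and m :: nat
 defines "d \<equiv> CARD('n)"
 defines "W \<equiv> unit_ball_vol (real d)" and "\<alpha> \<equiv> 1 - real d / p"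
 assumes p2: "2 <= p" and \<theta>: "0 < \<theta>" "\<theta> <= 1 / 2" and \<alpha>: "0 < \<alpha>" and R1: "R <= 1"
  and est: "!!(A :: real^'n => real^'n^'n) c r0 v G F f s0 m0 m.
   approx_solution A \<mu> \<Lambda> c r0 \<omega> v G F f ==> 0 < s0 ==> s0 <= 1 ==> s0 <= r0 ==> 0 < m0 ==>
   ball_energy c (2 * s0) G <= m0 * s0 ^ d ==>
   (!!i. i < m ==> ball_energy c (\<theta> ^ i * s0) (\<lambda>x. F x - A x *v G x) + (\<theta> ^ i * s0)^2 * ball_energy c (\<theta> ^ i * s0) f
     <= ((\<theta> powr \<alpha>) ^ i)^2 * m0 * (\<theta> ^ i * s0) ^ d) ==>
   ball_energy c (\<theta> ^ m * s0) G <= Kc * m0 * (\<theta> ^ m * s0) ^ d"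
  and \<omega>: "!!h. 0 <= \<omega> h" "!!h k. \<omega> (h + k) <= \<omega> h + \<omega> k" "!!h. \<omega> (- h) = \<omega> h" "\<omega> 0 = 0"
   "!!x h \<xi>. closed_segment x (x + h) \<subseteq> ball x0 R ==> norm ((A (x + h) - A x) *v \<xi>) <= \<omega> h * norm \<xi>"
  and t: "0 < t" "source_energy <= W * R ^ d * t powr p" and c: "c \<in> ball x0 (R / 2)"
 shows "\<forall>\<^sub>F n in sequentially. ball_energy c (\<theta> ^ m * (R / 8)) (Ga (real (Suc n)))
  <= Kc * (W * (8 ^ d + 2 ^ d + 2)) * (grad_energy / (W * R ^ d) + (R * t)^2) * (\<theta> ^ m * (R / 8)) ^ d"
proof -
 have W: "0 < W" unfolding W_def d_def by (rule vol_pos)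
 define avgG where "avgG = grad_energy / (W * R ^ d)"
 have avgG: "0 <= avgG" using grad_energy_nonneg W R by (simp add: avgG_def)
 \<comment> \<open>8^d converts R^d into s0^d, 2^d + 1 is the constant of
   \<open>source_decay\<close>, and the remaining 1 is reserved for the defect.\<close>
 define s0 m0 where "s0 = R / 8" and "m0 = W * (8 ^ d + 2 ^ d + 2) * (avgG + (R * t)^2)"
 have s0: "0 < s0" "s0 <= 1" using R R1 by (auto simp: s0_def)
 have Rt: "0 < (R * t)^2" using R t by simp
 have m0: "0 < m0" unfolding m0_def using W avgG Rt by (intro mult_pos_pos add_nonneg_pos add_pos_nonneg) auto
 define s where "s i = \<theta> ^ i * s0" for i
 have s: "0 < s i" "s i <= s0" for i
 proof -
  show "0 < s i" using \<theta> s0 by (simp add: s_def)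
  have "\<theta> ^ i <= 1" using \<theta> by (intro power_le_one) auto
  then show "s i <= s0" using s0 mult_right_mono[of "\<theta> ^ i" 1 s0] by (simp add: s_def)
 qed
 have rr: "0 < 7 * R / 8" "7 * R / 8 < R" using R by auto
 define e where "e i = W * (R * t)^2 * ((\<theta> powr \<alpha>) ^ i)^2 * s i ^ d" for i
 have e: "0 < e i" for i unfolding e_def using W Rt \<theta> s[of i] by (intro mult_pos_pos) auto
 have "\<forall>\<^sub>F n in sequentially. ball_energy c (s i) (\<lambda>x. Fa (real (Suc n)) x - clamped_coeff (7 * R / 8) x *v Ga (real (Suc n)) x) <= e i" for i
  by (rule eventually_defect_small[OF c s(1) _ e]) (use s(2)[of i] R in \<open>simp add: s0_def\<close>)
 then have "\<forall>\<^sub>F n in sequentially. \<forall>i\<in>{..<m}. ball_energy c (s i) (\<lambda>x. Fa (real (Suc n)) x - clamped_coeff (7 * R / 8) x *v Ga (real (Suc n)) x) <= e i"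
  by (intro eventually_ball_finite ballI) auto
 moreover have "\<forall>\<^sub>F n in sequentially. cball c (R / 4 + 1 / real (Suc n)) \<subseteq> ball x0 R"
  by (intro eventually_cball_inside c) auto
 moreover have "\<forall>\<^sub>F n in sequentially. 1 / real (Suc n) < s m" by (intro eventually_inverse_Suc_less s)
 ultimately have "\<forall>\<^sub>F n in sequentially. ball_energy c (s m) (Ga (real (Suc n))) <= Kc * m0 * s m ^ d"
 proof eventually_elim
  case (elim n)
  define a where "a = real (Suc n)"
  have a: "a > 0" by (simp add: a_def)
  have sub: "cball c (R / 4 + 1 / a) \<subseteq> ball x0 R" using elim by (simp add: a_def)
  have inner: "cball c (R / 4) \<subseteq> cball x0 (7 * R / 8)"
  proof
   fix y assume "y \<in> cball c (R / 4)"
   then show "y \<in> cball x0 (7 * R / 8)" using c R dist_triangle[of x0 y c] by simp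
  qed
  \<comment> \<open>The ball of radius R / 4 about \<open>c\<close> lies in the inner ball, where
    the clamped coefficient coincides with \<open>A\<close>; the modulus is needed only
    there.\<close>
  have sol: "approx_solution (clamped_coeff (7 * R / 8)) \<mu> \<Lambda> c (R / 4) \<omega> (moll a ut) (Ga a) (Fa a) (fa a)"
  proof
   fix x h \<xi> assume x: "x \<in> cball c (R / 4)" "x + h \<in> cball c (R / 4)"
   have "closed_segment x (x + h) \<subseteq> cball c (R / 4)" using x by (intro closed_segment_subset) auto
   also have "... \<subseteq> ball x0 R" using inner rr by auto
   finally have "norm ((A (x + h) - A x) *v \<xi>) <= \<omega> h * norm \<xi>" by (rule \<omega>(5))
   then show "norm ((clamped_coeff (7 * R / 8) (x + h) - clamped_coeff (7 * R / 8) x) *v \<xi>) <= \<omega> h * norm \<xi>"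
    using x inner by (simp add: clamped_coeff(1)[OF rr] subset_iff)
  qed (use \<omega> \<mu> clamped_coeff_bounds[OF rr] clamped_coeff(2)[OF rr] grad_pair_moll[OF a] div_pair_moll[OF a] in auto)
  have "ball_energy c (\<theta> ^ m * s0) (Ga a) <= Kc * m0 * (\<theta> ^ m * s0) ^ d"
  proof (rule est[OF sol s0 _ m0])
   show "s0 <= R / 4" using R by (simp add: s0_def)
   have "ball_energy c (2 * s0) (Ga a) <= grad_energy" using energy_Ga[OF a sub] by (simp add: s0_def)
   also have "... = W * 8 ^ d * avgG * s0 ^ d" using W R by (simp add: avgG_def s0_def power_divide)
   also have "... <= m0 * s0 ^ d"
   proof (rule mult_right_mono)
    have "W * 8 ^ d * avgG <= W * (8 ^ d + 2 ^ d + 2) * avgG" using W avgG by (intro mult_left_mono mult_right_mono) auto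
    also have "... <= m0" unfolding m0_def using W Rt by (intro mult_left_mono) (auto intro: add_nonneg_nonneg)
    finally show "W * 8 ^ d * avgG <= m0" .
   qed (use s0 in simp)
   finally show "ball_energy c (2 * s0) (Ga a) <= m0 * s0 ^ d" .
   fix i assume i: "i < m"
   define q where "q = ((\<theta> powr \<alpha>) ^ i)^2"
   have q: "0 <= q" by (simp add: q_def)
   have sm: "s m <= s i" unfolding s_def using \<theta> s0 i by (intro mult_right_mono power_decreasing) auto
   have "(s i)^2 * ball_energy c (s i) (fa a) <= W * (2 ^ d + 1) * (R * t)^2 * ((s i / R) powr \<alpha>)^2 * s i ^ d"
    unfolding W_def \<alpha>_def d_def
   proof (rule source_decay[OF p2 t[unfolded W_def d_def] s(1) a])
    show "1 / a <= s i" using elim sm by (simp add: a_def)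
    have "s i + 1 / a <= R / 4 + 1 / a" using s(2)[of i] R by (simp add: s0_def)
    then have "cball c (s i + 1 / a) \<subseteq> cball c (R / 4 + 1 / a)" by (rule subset_cball)
    then show "cball c (s i + 1 / a) \<subseteq> ball x0 R" using sub by blast
   qed
   also have "... <= W * (2 ^ d + 1) * (R * t)^2 * q * s i ^ d"
   proof (intro mult_right_mono mult_left_mono)
    have "s i / R <= \<theta> ^ i" using R \<theta> by (simp add: s_def s0_def field_simps)
    then have "(s i / R) powr \<alpha> <= (\<theta> ^ i) powr \<alpha>" using s[of i] R \<alpha> by (intro powr_mono2) auto
    also have "(\<theta> ^ i) powr \<alpha> = (\<theta> powr \<alpha>) ^ i" using \<theta> by (simp add: powr_realpow[symmetric] powr_powr mult.commute)
    finally show "((s i / R) powr \<alpha>)^2 <= q" unfolding q_def by (intro power_mono) auto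
   qed (use W s[of i] in \<open>auto simp: less_imp_le\<close>)
   finally have f: "(s i)^2 * ball_energy c (s i) (fa a) <= W * (2 ^ d + 1) * (R * t)^2 * q * s i ^ d" .
   have "ball_energy c (s i) (\<lambda>x. Fa a x - clamped_coeff (7 * R / 8) x *v Ga a x) <= W * (R * t)^2 * q * s i ^ d"
    using elim i by (simp add: e_def q_def a_def)
   with f have "ball_energy c (s i) (\<lambda>x. Fa a x - clamped_coeff (7 * R / 8) x *v Ga a x) + (s i)^2 * ball_energy c (s i) (fa a)
    <= (W * (2 ^ d + 2) * (R * t)^2) * (q * s i ^ d)" by (simp add: algebra_simps)
   also have "... <= m0 * (q * s i ^ d)"
   proof (rule mult_right_mono)
    have "W * (2 ^ d + 2) * (R * t)^2 <= W * (8 ^ d + 2 ^ d + 2) * (R * t)^2" using W by (intro mult_left_mono mult_right_mono) auto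
    also have "... <= m0" unfolding m0_def using W avgG by (intro mult_left_mono) (auto intro: add_nonneg_nonneg)
    finally show "W * (2 ^ d + 2) * (R * t)^2 <= m0" .
   qed (use q s[of i] in simp)
   finally show "ball_energy c (\<theta> ^ i * s0) (\<lambda>x. Fa a x - clamped_coeff (7 * R / 8) x *v Ga a x) + (\<theta> ^ i * s0)^2 * ball_energy c (\<theta> ^ i * s0) (fa a)
    <= ((\<theta> powr \<alpha>) ^ i)^2 * m0 * (\<theta> ^ i * s0) ^ d" by (simp add: s_def q_def ac_simps)
  qed
  then show ?case by (simp add: s_def a_def)
 qed
 then show ?thesis by (simp add: s_def s0_def m0_def avgG_def mult.assoc)
qed

section \<open>Choice of the constants\<close>

definition gradient_bound ::
 "real => real^'n::finite => real => real => (real^'n => real) => (real^'n => real^'n) => bool" where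
 "gradient_bound C x0 R p f g \<longleftrightarrow> (AE x in lborel. x \<in> ball x0 (R/2) -->
      norm (g x) <= C *
       (sqrt (avg (ball x0 R) (\<lambda>x. (norm (g x))^2))
       + R * avg (ball x0 R) (\<lambda>x. \<bar>f x\<bar> powr p) powr (1 / p)))"

definition admissible ::
 "(real^'n::finite) set => (nat => (nat => real^'n) => real^'n^'n) => real => (nat => real) => real => real
  => nat => (nat => real) => real^'n => real => (real^'n => real) => (real^'n => real) => (real^'n => real^'n) => bool" where
 "admissible \<Omega>0 B \<mu> \<delta> \<rho> p N \<epsilon> x0 R f u g \<longleftrightarrow>
    standing_assumptions \<Omega>0 B \<mu> \<and> condition_B \<Omega>0 B \<delta> \<and>
    0 < R \<and> R <= 1 \<and> ball x0 R \<subseteq> \<Omega>0 \<and>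
    \<rho> > 0 \<and> summable (\<lambda>l. real l powr (1 + \<rho>) * \<delta> l) \<and>
    scales \<epsilon> \<and>
    p > real CARD('n) \<and> set_borel_measurable lborel (ball x0 R) f \<and>
    set_integrable lborel (ball x0 R) (\<lambda>x. \<bar>f x\<bar> powr p) \<and>
    weak_solution (ball x0 R) (A_eps B \<epsilon>) f u g \<and>
    N >= 1 \<and> (\<forall>i k. i < k --> (\<epsilon> (k+1) / \<epsilon> k) ^ N <= \<epsilon> (i+1) / \<epsilon> i) \<and>
    \<epsilon> 1 <= sep_threshold \<rho> N"

lemma choice_five:
 "(!!a b c d e. \<exists>x. P a b c d e x) ==> \<exists>h. \<forall>a b c d e. P a b c d e (h a b c d e)" by metis

text \<open>The five numbers \<mu>, p, D0, \<rho> and D1 are fixed before all other data, so that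
  choice turns the constant into a function of them. If they are incompatible with the hypotheses
  the claim is vacuous; otherwise D0 also serves as the bound \<Lambda> of the coefficient.\<close>

lemma lipschitz_constant_exists:
 fixes \<mu> p D0 \<rho> D1 :: real
 shows "\<exists>C. \<forall>(\<Omega>0 :: (real^'n::finite) set) B \<delta> N (\<epsilon> :: nat => real) (x0 :: real^'n) R
    (f :: real^'n => real) (u :: real^'n => real) (g :: real^'n => real^'n).
    admissible \<Omega>0 B \<mu> \<delta> \<rho> p N \<epsilon> x0 R f u g \<and> delta0 \<delta> = D0 \<and> delta_norm (1 + \<rho>) \<delta> = D1
   -->
    gradient_bound C x0 R p f g"
  (is "\<exists>C. \<forall>\<Omega>0 B \<delta> N \<epsilon> x0 R f u g. ?hyp \<Omega>0 B \<delta> N \<epsilon> x0 R f u g --> ?concl C x0 R f g")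
proof (cases "\<mu> > 0 \<and> p > real CARD('n) \<and> 0 <= D0 \<and> 0 <= D1")
 case False
 note admissible_def [simp]
 have "\<not> ?hyp \<Omega>0 B \<delta> N \<epsilon> x0 R f u g" for \<Omega>0 B \<delta> N \<epsilon> x0 R f u g
 proof
  assume h: "?hyp \<Omega>0 B \<delta> N \<epsilon> x0 R f u g"
  then have \<delta>: "!!l. 0 <= \<delta> l" "summable \<delta>" by (auto simp: condition_B_def)
  have "0 <= delta0 \<delta>" unfolding delta0_def by (intro suminf_nonneg \<delta>)
  moreover have "0 <= delta_norm (1 + \<rho>) \<delta>"
  proof -
   have "(\<lambda>l. (if l = 0 then 0 else real l powr (1 + \<rho>)) * \<delta> l) = (\<lambda>l. real l powr (1 + \<rho>) * \<delta> l)" by auto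
   then show ?thesis unfolding delta_norm_def using h \<delta> by (intro suminf_nonneg) auto
  qed
  ultimately show False using h False by (auto simp: standing_assumptions_def)
 qed
 then show ?thesis by blast
next
 case True
 note admissible_def [simp]
 from True have \<mu>: "\<mu> > 0" and p: "p > real CARD('n)" and D: "0 <= D0" "0 <= D1" by auto
 have card: "0 < CARD('n)" by simp
 have p1: "1 < p" using p card by (metis One_nat_def Suc_leI of_nat_1 of_nat_le_iff order_le_less_trans)
 define W where "W = unit_ball_vol (real CARD('n))"
 have W: "0 < W" unfolding W_def by (rule unit_ball_vol_pos) simp
 have data: "weak_data (A_eps B \<epsilon>) \<mu> D0 x0 R p u f g"
  "!!h :: real^'n. 0 <= modulus \<delta> \<epsilon> h" "!!h k :: real^'n. modulus \<delta> \<epsilon> (h + k) <= modulus \<delta> \<epsilon> h + modulus \<delta> \<epsilon> k"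
  "!!x h \<xi>. closed_segment x (x + h) \<subseteq> ball x0 R ==> norm ((A_eps B \<epsilon> (x + h) - A_eps B \<epsilon> x) *v \<xi>) <= modulus \<delta> \<epsilon> h * norm \<xi>"
  if h: "?hyp \<Omega>0 B \<delta> N \<epsilon> x0 R f u g" for \<Omega>0 B \<delta> N \<epsilon> x0 R f u g
 proof -
  have SA: "standing_assumptions \<Omega>0 B \<mu>" and CB: "condition_B \<Omega>0 B \<delta>" and SC: "scales \<epsilon>"
   and sub: "ball x0 R \<subseteq> \<Omega>0" using h by auto
  note ctx = SA CB SC
  show "weak_data (A_eps B \<epsilon>) \<mu> D0 x0 R p u f g"
  proof
   show "continuous_on (ball x0 R) (A_eps B \<epsilon>)" by (rule continuous_on_subset[OF A_eps_continuous[OF ctx] sub])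
   show "norm (A_eps B \<epsilon> x *v \<xi>) <= D0 * norm \<xi>" if "x \<in> ball x0 R" for x \<xi>
   proof -
    have "norm (A_eps B \<epsilon> x) <= D0" using A_eps_bound[OF ctx, of x] that sub h by auto
    then show ?thesis using norm_matrix_vector_le[of "A_eps B \<epsilon> x" \<xi>] mult_right_mono[OF _ norm_ge_zero, of "norm (A_eps B \<epsilon> x)" D0 \<xi>] by linarith
   qed
   show "\<mu> * (norm \<xi>)^2 <= \<xi> \<bullet> (A_eps B \<epsilon> x *v \<xi>)" if "x \<in> ball x0 R" for x \<xi>
    by (rule A_eps_elliptic[OF ctx]) (use that sub in auto)
  qed (use h p1 \<mu> in auto)
  have \<delta>: "!!l. 0 <= \<delta> l" "summable \<delta>" using CB by (auto simp: condition_B_def)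
  show "0 <= modulus \<delta> \<epsilon> h" for h :: "real^'n" by (rule modulus_nonneg[OF \<delta>(2,1)])
  show "modulus \<delta> \<epsilon> (h + k) <= modulus \<delta> \<epsilon> h + modulus \<delta> \<epsilon> k" for h k :: "real^'n" by (rule modulus_add[OF \<delta>(2,1)])
  show "norm ((A_eps B \<epsilon> (x + h) - A_eps B \<epsilon> x) *v \<xi>) <= modulus \<delta> \<epsilon> h * norm \<xi>"
   if "closed_segment x (x + h) \<subseteq> ball x0 R" for x h \<xi>
  proof -
   have "norm (A_eps B \<epsilon> (x + h) - A_eps B \<epsilon> x) <= modulus \<delta> \<epsilon> h"
    by (rule A_eps_difference[OF ctx]) (use that sub in auto)
   then show ?thesis using norm_matrix_vector_le[of "A_eps B \<epsilon> (x + h) - A_eps B \<epsilon> x" \<xi>]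
     mult_right_mono[OF _ norm_ge_zero, of "norm (A_eps B \<epsilon> (x + h) - A_eps B \<epsilon> x)" "modulus \<delta> \<epsilon> h" \<xi>] by linarith
  qed
 qed
 show ?thesis
 proof (cases "CARD('n) = 1")
  case True
  then obtain k :: 'n where U: "UNIV = {k}" using card_1_singletonE by blast
  define K where "K = 2 * W / \<mu>^2 * (32 * D0^2 + 5 + 8 * W^2)"
  have K: "0 < K" unfolding K_def using W \<mu> by (intro mult_pos_pos divide_pos_pos add_pos_nonneg add_nonneg_pos) auto
  show ?thesis
  proof (rule exI[of _ "real CARD('n) * sqrt (K / W)"], intro allI impI)
   fix \<Omega>0 B \<delta> N \<epsilon> x0 R f u g
   assume h: "?hyp \<Omega>0 B \<delta> N \<epsilon> x0 R f u g"
   interpret weak_data "A_eps B \<epsilon>" \<mu> D0 x0 R p u f g by (rule data(1)[OF h])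
   show "?concl (real CARD('n) * sqrt (K / W)) x0 R f g" unfolding gradient_bound_def avg_grad avg_source W_def
    by (rule gradient_bound_of_decay[OF K, of "1 / 2"])
      (use one_dim_decay[OF U] in \<open>auto simp: K_def W_def\<close>)
  qed
 next
  case False
  then have p2: "2 <= p" using p card by linarith
  define \<alpha> where "\<alpha> = 1 - real CARD('n) / p"
  have \<alpha>: "0 < \<alpha>" using p p1 by (simp add: \<alpha>_def)
  obtain \<theta> Kc where \<theta>: "0 < \<theta>" "\<theta> <= 1 / 2" and Kc: "Kc > 0" and est: "decay_constant TYPE('n) \<mu> D0 \<theta> \<alpha> D0 D1 Kc"
   using core_estimate[where 'n = 'n and \<mu> = \<mu> and \<Lambda> = D0, OF \<mu>] \<alpha> D by blast
  define K where "K = Kc * (W * (8 ^ CARD('n) + 2 ^ CARD('n) + 2))"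
  have K: "0 < K" unfolding K_def using Kc W by (intro mult_pos_pos add_pos_pos) auto
  show ?thesis
  proof (rule exI[of _ "real CARD('n) * sqrt (K / W)"], intro allI impI)
   fix \<Omega>0 B \<delta> N \<epsilon> x0 R f u g
   assume h: "?hyp \<Omega>0 B \<delta> N \<epsilon> x0 R f u g"
   interpret weak_data "A_eps B \<epsilon>" \<mu> D0 x0 R p u f g by (rule data(1)[OF h])
   have \<delta>: "\<forall>l. 0 <= \<delta> l" "summable \<delta>" using h by (auto simp: condition_B_def)
   show "?concl (real CARD('n) * sqrt (K / W)) x0 R f g" unfolding gradient_bound_def avg_grad avg_source W_def
   proof (rule gradient_bound_of_decay[OF K \<theta>(1)])
    fix t c m assume t: "0 < t" "source_energy <= unit_ball_vol (real CARD('n)) * R ^ CARD('n) * t powr p"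
     and c: "c \<in> ball x0 (R / 2)"
    show "\<forall>\<^sub>F n in sequentially. ball_energy c (\<theta> ^ m * (R / 8)) (Ga (real (Suc n)))
     <= K * (grad_energy / (unit_ball_vol (real CARD('n)) * R ^ CARD('n)) + (R * t)^2) * (\<theta> ^ m * (R / 8)) ^ CARD('n)"
     unfolding K_def W_def
    proof (rule multi_dim_decay[OF p2 \<theta> \<alpha>[unfolded \<alpha>_def] _ _ data(2,3)[OF h] modulus_minus modulus_zero data(4)[OF h] t c])
     show "R <= 1" using h by auto
     fix A' :: "real^'n => real^'n^'n" and c' r0 v G F f' s0 m0 m'
     assume "approx_solution A' \<mu> D0 c' r0 (modulus \<delta> \<epsilon>) v G F f'" "0 < s0" "s0 <= 1" "s0 <= r0" "0 < m0"
      "ball_energy c' (2 * s0) G <= m0 * s0 ^ CARD('n)"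
      "!!i. i < m' ==> ball_energy c' (\<theta> ^ i * s0) (\<lambda>x. F x - A' x *v G x) + (\<theta> ^ i * s0)^2 * ball_energy c' (\<theta> ^ i * s0) f'
       <= ((\<theta> powr (1 - real CARD('n) / p)) ^ i)^2 * m0 * (\<theta> ^ i * s0) ^ CARD('n)"
     then show "ball_energy c' (\<theta> ^ m' * s0) G <= Kc * m0 * (\<theta> ^ m' * s0) ^ CARD('n)"
      using h \<delta> by (intro est[unfolded decay_constant_def, rule_format, of A' c' r0 \<delta> \<epsilon> v G F f' \<rho> N s0 m0 m']) (simp add: \<alpha>_def separated_scales_def)
    qed
   qed (use \<theta> in auto)
  qed
 qed
qed

theorem theorem1p3:
  shows "\<exists>(\<nu> :: real \<Rightarrow> real \<Rightarrow> real \<Rightarrow> nat \<Rightarrow> real \<Rightarrow> real \<Rightarrow> real)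
          (C :: real \<Rightarrow> real \<Rightarrow> real \<Rightarrow> real \<Rightarrow> real \<Rightarrow> real).
     (\<forall>\<mu> p \<rho> N s0 s1. \<nu> \<mu> p \<rho> N s0 s1 > 0) \<and>
     (\<forall>(\<Omega>0 :: (real^'n::finite) set) B \<mu> \<delta> \<rho> p N (\<epsilon> :: nat \<Rightarrow> real) (x0 :: real^'n) R
        (f :: real^'n \<Rightarrow> real) (u :: real^'n \<Rightarrow> real) (g :: real^'n \<Rightarrow> real^'n).
        standing_assumptions \<Omega>0 B \<mu> \<and> condition_B \<Omega>0 B \<delta> \<and>
        0 < R \<and> R \<le> 1 \<and> ball x0 R \<subseteq> \<Omega>0 \<and>
        summable (\<lambda>l. real l * \<delta> l) \<and> \<rho> > 0 \<and> summable (\<lambda>l. real l powr (1 + \<rho>) * \<delta> l) \<and>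
        scales \<epsilon> \<and>
        p > real CARD('n) \<and> set_borel_measurable lborel (ball x0 R) f \<and>
        set_integrable lborel (ball x0 R) (\<lambda>x. \<bar>f x\<bar> powr p) \<and>
        weak_solution (ball x0 R) (A_eps B \<epsilon>) f u g \<and>
        N \<ge> 1 \<and> (\<forall>i k. i < k \<longrightarrow> (\<epsilon> (k+1) / \<epsilon> k) ^ N \<le> \<epsilon> (i+1) / \<epsilon> i) \<and>
        \<epsilon> 1 \<le> \<nu> \<mu> p \<rho> N (delta0 \<delta>) (delta_norm 1 \<delta>)
      \<longrightarrow>
        (AE x in lborel. x \<in> ball x0 (R/2) \<longrightarrow>
           norm (g x) \<le> C \<mu> p (delta0 \<delta>) \<rho> (delta_norm (1 + \<rho>) \<delta>) *
             (sqrt (avg (ball x0 R) (\<lambda>x. (norm (g x))\<^sup>2))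
              + R * avg (ball x0 R) (\<lambda>x. \<bar>f x\<bar> powr p) powr (1 / p))))"
proof -
 \<comment> \<open>The value 1 for \<rho> <= 0 keeps \<nu> positive for all arguments.\<close>
 define \<nu> :: "real => real => real => nat => real => real => real"
  where "\<nu> \<mu> p \<rho> N s0 s1 = (if 0 < \<rho> then sep_threshold \<rho> N else 1)" for \<mu> p \<rho> N s0 s1
 from choice_five[OF lipschitz_constant_exists[where 'n = 'n]]
 obtain C :: "real => real => real => real => real => real" where C:
  "\<forall>\<mu> p D0 \<rho> D1. \<forall>(\<Omega>0 :: (real^'n::finite) set) B \<delta> N (\<epsilon> :: nat => real) (x0 :: real^'n) R
    (f :: real^'n => real) (u :: real^'n => real) (g :: real^'n => real^'n).
    admissible \<Omega>0 B \<mu> \<delta> \<rho> p N \<epsilon> x0 R f u g \<and> delta0 \<delta> = D0 \<and> delta_norm (1 + \<rho>) \<delta> = D1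
   -->
    gradient_bound (C \<mu> p D0 \<rho> D1) x0 R p f g" ..
 show ?thesis
 proof (rule exI[of _ \<nu>], rule exI[of _ C], intro conjI allI impI, goal_cases)
  case 1
  show ?case by (simp add: \<nu>_def sep_threshold_pos)
 next
  case (2 \<Omega>0 B \<mu> \<delta> \<rho> p N \<epsilon> x0 R f u g)
  moreover from 2 have "\<nu> \<mu> p \<rho> N (delta0 \<delta>) (delta_norm 1 \<delta>) = sep_threshold \<rho> N" by (simp add: \<nu>_def)
  ultimately have "admissible \<Omega>0 B \<mu> \<delta> \<rho> p N \<epsilon> x0 R f u g" by (simp add: admissible_def)
  then show ?case by (rule C[rule_format, OF conjI[OF _ conjI[OF refl refl]], unfolded gradient_bound_def])
 qed
qed

end
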